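(* Let $\mathbf k$ be an algebraically closed field of characteristic $p>0$, let $X$ be a smooth irreducible algebraic variety over $\mathbf k$, let $V$ be a finite dimensional $\mathbf k$-vector space, and let $\nabla(\mathbf s)=d-\sum_{j=1}^n s_jB_j$, $\mathbf s=(s_1,\dots,s_n)$, be a periodic pencil of flat connections on $X$ with values in $V$. In local coordinates $x_1,\dots,x_r$ on a dense open subset of $X$ write $B_j=\sum_{i=1}^r B_{ij}dx_i$. Then for all $\mathbf s\in \mathbf k^n$ the pencil of commuting endomorphisms given by the $p$-curvature $$C(\nabla(\mathbf s))=\sum_{i=1}^r C_i(\nabla(\mathbf s))\,dx_i^{(1)}$$ is isospectral to the pencil of commuting endomorphisms $$\mathbf B(\nabla(\mathbf s))=\sum_{j=1}^n (s_j-s_j^p)B_j^{(1)}=\sum_{i=1}^r\sum_{j=1}^n (s_j-s_j^p)B_{ij}^{(1)}\,dx_i^{(1)}.$$ In particular, if $s_j\in\mathbb F_p$ for all $j$, then the endomorphisms $C_i(\nabla(\mathbf s))$ are nilpotent. Moreover, if for some $\mathbf s$ the pencil $\mathbf B(\nabla(\mathbf s))$ has simple spectrum (in the sense that $\mathbf B(\nabla(\mathbf s))(\mathbf x)$ has simple spectrum for generic $\mathbf x\in X$), then $C(\nabla(\mathbf s))$ and $\mathbf B(\nabla(\mathbf s))$ are conjugate.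
   Context: Pencil: a family of flat connections $\nabla(\mathbf s)=d-\sum_{j=1}^n s_jB_j$ on the trivial bundle $X\times V\to X$, with $B_j\in\Omega^1(X)\otimes \mathrm{End}\,V$ independent of $\mathbf s$, flat for all $\mathbf s$ (equivalently $dB_j=0$ and $[B_j,B_k]=0$ for all $j,k$). Periodic: there exist shift operators $A_j\in GL(V)(\mathbf k(\mathbf s)[X])$, $1\le j\le n$ (regular on $X$, rational in $\mathbf s$, invertible), such that $\nabla(\mathbf s+\mathbf e_j)\circ A_j(\mathbf s)=A_j(\mathbf s)\circ\nabla(\mathbf s)$, where $\{\mathbf e_j\}$ is the standard basis of $\mathbf k^n$. $p$-curvature: $C_i(\nabla)=\nabla_i^p$, where $\nabla_i$ is the covariant derivative along $\partial/\partial x_i$; the $C_i$ are commuting and linear over functions. Here $x_i^{(1)}:=x_i^p$ are the coordinates on the Frobenius twist $X^{(1)}$, and $dx_i^{(1)}$ are the corresponding formal basis elements recording the $i$-th component. Frobenius twist: for a matrix-valued function $B$ (in a basis of $V$), $B^{(1)}$ is the matrix-valued function (endomorphism of the Frobenius twist $V^{(1)}$, viewed on $X$ via the Frobenius morphism $X\to X^{(1)}$) whose entries are the $p$-th powers of the entries of $B$. A pencil of commuting endomorphisms is a tuple $(L_1,\dots,L_r)$ of commuting operators on a finite dimensional space (equivalently the linear map $\mathbf u\mapsto\sum u_iL_i$). Two pencils $(L_i)$ on $V$ and $(M_i)$ on $W$ are isospectral if their joint (generalized) eigenvalues coincide counted with multiplicity; equivalently, $\sum u_iL_i$ and $\sum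 u_iM_i$ have equal characteristic polynomials for every $\mathbf u\in\mathbf k^r$. For pencils depending on $\mathbf x\in X$ this is required at every point $\mathbf x$ where the coordinates are defined. Simple spectrum means that all joint eigenvalues have multiplicity $1$. Conjugate means conjugate by an invertible matrix over $\mathbf k(X)$. *)

theory Defs
  imports
    "HOL-Analysis.Abstract_Topology"
    "HOL-Computational_Algebra.Computational_Algebra"
    "Jordan_Normal_Form.Matrix_Kernel"
begin

section \<open>Varieties\<close>

text \<open>
  Varieties over an algebraically closed field are treated classically, as topological spaces
  with a sheaf of \<open>'k\<close>-valued functions.  Affine \<open>m\<close>-space is \<open>carrier_vec m\<close>.
\<close>

inductive_set poly_fun :: "nat \<Rightarrow> ('k::comm_ring_1 vec \<Rightarrow> 'k) set" for m where
  const: "(\<lambda>_. c) \<in> poly_fun m"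
| coord: "i < m \<Longrightarrow> (\<lambda>z. z $ i) \<in> poly_fun m"
| add: "f \<in> poly_fun m \<Longrightarrow> g \<in> poly_fun m \<Longrightarrow> (\<lambda>z. f z + g z) \<in> poly_fun m"
| mult: "f \<in> poly_fun m \<Longrightarrow> g \<in> poly_fun m \<Longrightarrow> (\<lambda>z. f z * g z) \<in> poly_fun m"

definition zariski_closed :: "nat \<Rightarrow> 'k::comm_ring_1 vec set \<Rightarrow> bool" where
  "zariski_closed m Z \<longleftrightarrow> (\<exists>S \<subseteq> poly_fun m. Z = {z \<in> carrier_vec m. \<forall>f\<in>S. f z = 0})"

definition zariski_open_in :: "nat \<Rightarrow> 'k::comm_ring_1 vec set \<Rightarrow> 'k vec set \<Rightarrow> bool" where
  "zariski_open_in m Z W \<longleftrightarrow> (\<exists>C. zariski_closed m C \<and> W = Z - C)"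

text \<open>Regular functions on an open subset \<open>W\<close> of an algebraic set \<open>Z\<close>: locally quotients of polynomials.\<close>

definition affine_regular ::
  "nat \<Rightarrow> 'k::field vec set \<Rightarrow> 'k vec set \<Rightarrow> ('k vec \<Rightarrow> 'k) \<Rightarrow> bool" where
  "affine_regular m Z W g \<longleftrightarrow>
     (\<forall>z\<in>W. \<exists>W' a b. zariski_open_in m Z W' \<and> z \<in> W' \<and> W' \<subseteq> W \<and>
        a \<in> poly_fun m \<and> b \<in> poly_fun m \<and> (\<forall>w\<in>W'. b w \<noteq> 0 \<and> g w = a w / b w))"

text \<open>
  In \<open>reg X W\<close> only open \<open>W\<close> matter, and only the restrictions to \<open>W\<close> of its members: the conditions
  below force \<open>reg X W\<close> to be closed under changing a function outside \<open>W\<close>.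
\<close>

record ('x, 'k) space_with_functions =
  topo :: "'x topology"
  reg :: "'x set \<Rightarrow> ('x \<Rightarrow> 'k) set"

abbreviation points :: "('x, 'k) space_with_functions \<Rightarrow> 'x set" where
  "points X \<equiv> topspace (topo X)"

definition affine_chart ::
  "('x, 'k::field) space_with_functions \<Rightarrow> 'x set \<Rightarrow> nat \<Rightarrow> ('x \<Rightarrow> 'k vec) \<Rightarrow> bool" where
  "affine_chart X U m \<phi> \<longleftrightarrow>
     openin (topo X) U \<and>
     (\<exists>Z. zariski_closed m Z \<and> bij_betw \<phi> U Z \<and>
        (\<forall>W\<subseteq>U. openin (topo X) W \<longleftrightarrow> zariski_open_in m Z (\<phi> ` W)) \<and>
        (\<forall>W f. openin (topo X) W \<and> W \<subseteq> U \<longrightarrow>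
           (f \<in> reg X W \<longleftrightarrow> (\<exists>g. affine_regular m Z (\<phi> ` W) g \<and> (\<forall>x\<in>W. f x = g (\<phi> x))))))"

text \<open>Separatedness is the closedness of the diagonal in the products of pairs of affine charts.\<close>

definition variety :: "('x, 'k::field) space_with_functions \<Rightarrow> bool" where
  "variety X \<longleftrightarrow>
     (\<forall>W f. openin (topo X) W \<longrightarrow>
        (f \<in> reg X W \<longleftrightarrow>
          (\<forall>x\<in>W. \<exists>W'. openin (topo X) W' \<and> x \<in> W' \<and> W' \<subseteq> W \<and> f \<in> reg X W'))) \<and>
     (\<exists>\<U>. finite \<U> \<and> \<Union>\<U> = points X \<and> (\<forall>U\<in>\<U>. \<exists>m \<phi>. affine_chart X U m \<phi>)) \<and>
     (\<forall>U m \<phi> U' m' \<phi>'. affine_chart X U m \<phi> \<and> affine_chart X U' m' \<phi>' \<longrightarrow>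
        zariski_closed (m + m') ((\<lambda>x. \<phi> x @\<^sub>v \<phi>' x) ` (U \<inter> U')))"

definition irreducible_in :: "'x topology \<Rightarrow> 'x set \<Rightarrow> bool" where
  "irreducible_in T S \<longleftrightarrow> S \<noteq> {} \<and> S \<subseteq> topspace T \<and>
     (\<forall>C D. closedin T C \<and> closedin T D \<and> S \<subseteq> C \<union> D \<longrightarrow> S \<subseteq> C \<or> S \<subseteq> D)"

definition irreducible_chain :: "'x topology \<Rightarrow> nat \<Rightarrow> bool" where
  "irreducible_chain T d \<longleftrightarrow>
     (\<exists>Z :: nat \<Rightarrow> 'x set. (\<forall>i\<le>d. closedin T (Z i) \<and> irreducible_in T (Z i)) \<and>
        (\<forall>i<d. Z i \<subset> Z (Suc i)))"

definition has_krull_dim :: "'x topology \<Rightarrow> nat \<Rightarrow> bool" where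
  "has_krull_dim T d \<longleftrightarrow> irreducible_chain T d \<and> \<not> irreducible_chain T (Suc d)"

definition regular_at :: "('x, 'k) space_with_functions \<Rightarrow> 'x \<Rightarrow> ('x \<Rightarrow> 'k) \<Rightarrow> bool" where
  "regular_at X x f \<longleftrightarrow> (\<exists>W. openin (topo X) W \<and> x \<in> W \<and> f \<in> reg X W)"

text \<open>
  Tangent vectors at \<open>x\<close> are the derivations of the local ring at \<open>x\<close>, as functionals on functions
  that are regular near \<open>x\<close>.  They are set to 0 on all other functions, so that they
  are determined by their values on germs.
\<close>

definition tangent_space ::
  "('x, 'k::field) space_with_functions \<Rightarrow> 'x \<Rightarrow> (('x \<Rightarrow> 'k) \<Rightarrow> 'k) set" where
  "tangent_space X x = {v.
     (\<forall>f g. regular_at X x f \<and> regular_at X x g \<longrightarrow>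
        v (\<lambda>y. f y + g y) = v f + v g \<and>
        v (\<lambda>y. f y * g y) = f x * v g + g x * v f) \<and>
     (\<forall>c f. regular_at X x f \<longrightarrow> v (\<lambda>y. c * f y) = c * v f) \<and>
     (\<forall>f g W. openin (topo X) W \<and> x \<in> W \<and> f \<in> reg X W \<and> g \<in> reg X W \<and> (\<forall>y\<in>W. f y = g y)
        \<longrightarrow> v f = v g) \<and>
     (\<forall>f. \<not> regular_at X x f \<longrightarrow> v f = 0)}"

definition tangent_space_dim :: "('x, 'k::field) space_with_functions \<Rightarrow> 'x \<Rightarrow> nat \<Rightarrow> bool" where
  "tangent_space_dim X x d \<longleftrightarrow>
     (\<exists>e :: nat \<Rightarrow> ('x \<Rightarrow> 'k) \<Rightarrow> 'k. (\<forall>l<d. e l \<in> tangent_space X x) \<and>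
        (\<forall>v\<in>tangent_space X x. \<exists>!c. c \<in> carrier_vec d \<and> v = (\<lambda>f. \<Sum>l<d. c $ l * e l f)))"

definition smooth_irreducible_variety :: "('x, 'k::field) space_with_functions \<Rightarrow> bool" where
  "smooth_irreducible_variety X \<longleftrightarrow>
     variety X \<and> irreducible_in (topo X) (points X) \<and>
     (\<exists>d. has_krull_dim (topo X) d \<and> (\<forall>x\<in>points X. tangent_space_dim X x d))"


section \<open>Differential forms, vector fields, local coordinates\<close>

text \<open>
  A 1-form assigns to each point a functional on the tangent space; it is regular if it is
  locally \<open>\<Sum> f\<^sub>l dg\<^sub>l\<close> with \<open>f\<^sub>l, g\<^sub>l\<close> regular.  On a smooth variety these are the
  sections of the locally free sheaf of Kaehler differentials.
\<close>

type_synonym ('x, 'k) tangent = "('x \<Rightarrow> 'k) \<Rightarrow> 'k"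

definition one_form_on ::
  "('x, 'k::field) space_with_functions \<Rightarrow> 'x set \<Rightarrow> ('x \<Rightarrow> ('x, 'k) tangent \<Rightarrow> 'k) \<Rightarrow> bool" where
  "one_form_on X W \<omega> \<longleftrightarrow>
     (\<forall>x\<in>W. \<exists>W' (m::nat) f g. openin (topo X) W' \<and> x \<in> W' \<and> W' \<subseteq> W \<and>
        (\<forall>l<m. f l \<in> reg X W' \<and> g l \<in> reg X W') \<and>
        (\<forall>y\<in>W'. \<forall>v\<in>tangent_space X y. \<omega> y v = (\<Sum>l<m. f l y * v (g l))))"

definition vector_field_on ::
  "('x, 'k::field) space_with_functions \<Rightarrow> 'x set \<Rightarrow> ('x \<Rightarrow> ('x, 'k) tangent) \<Rightarrow> bool" where
  "vector_field_on X W \<xi> \<longleftrightarrow>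
     (\<forall>y\<in>W. \<xi> y \<in> tangent_space X y) \<and>
     (\<forall>W' f. openin (topo X) W' \<and> W' \<subseteq> W \<and> f \<in> reg X W' \<longrightarrow> (\<lambda>y. \<xi> y f) \<in> reg X W')"

definition lie_bracket ::
  "('x, 'k::field) space_with_functions \<Rightarrow> ('x \<Rightarrow> ('x, 'k) tangent) \<Rightarrow> ('x \<Rightarrow> ('x, 'k) tangent) \<Rightarrow>
   'x \<Rightarrow> ('x, 'k) tangent" where
  "lie_bracket X \<xi> \<eta> y f =
     (if regular_at X y f then \<xi> y (\<lambda>z. \<eta> z f) - \<eta> y (\<lambda>z. \<xi> z f) else 0)"

text \<open>
  \<open>x\<^sub>0, \<dots>, x\<^bsub>r-1\<^esub>\<close> are local (etale) coordinates on \<open>U\<close> if the \<open>dx\<^sub>i\<close> freely generate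
  the sheaf of 1-forms over the regular functions on \<open>U\<close>.
\<close>

definition local_coordinates ::
  "('x, 'k::field) space_with_functions \<Rightarrow> 'x set \<Rightarrow> nat \<Rightarrow> (nat \<Rightarrow> 'x \<Rightarrow> 'k) \<Rightarrow> bool" where
  "local_coordinates X U r x \<longleftrightarrow>
     openin (topo X) U \<and> (\<forall>i<r. x i \<in> reg X U) \<and>
     (\<forall>W\<subseteq>U. openin (topo X) W \<longrightarrow>
        (\<forall>\<omega>. one_form_on X W \<omega> \<longrightarrow>
           (\<exists>f. (\<forall>i<r. f i \<in> reg X W) \<and>
              (\<forall>y\<in>W. \<forall>v\<in>tangent_space X y. \<omega> y v = (\<Sum>i<r. f i y * v (x i))))) \<and>
        (\<forall>f. (\<forall>i<r. f i \<in> reg X W) \<and>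
             (\<forall>y\<in>W. \<forall>v\<in>tangent_space X y. (\<Sum>i<r. f i y * v (x i)) = 0)
           \<longrightarrow> (\<forall>i<r. \<forall>y\<in>W. f i y = 0)))"

text \<open>The coordinate vector field \<open>\<partial>/\<partial>x\<^sub>i\<close>, meaningful on the domain of the coordinates.\<close>

definition coord_field ::
  "('x, 'k::field) space_with_functions \<Rightarrow> nat \<Rightarrow> (nat \<Rightarrow> 'x \<Rightarrow> 'k) \<Rightarrow> nat \<Rightarrow> 'x \<Rightarrow> ('x, 'k) tangent"
  where
  "coord_field X r x i y =
     (THE v. v \<in> tangent_space X y \<and> (\<forall>l<r. v (x l) = (if l = i then 1 else 0)))"


section \<open>Connections on the trivial bundle with fibre \<open>V = 'k\<^sup>N\<close>\<close>

definition section_on ::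
  "('x, 'k) space_with_functions \<Rightarrow> nat \<Rightarrow> 'x set \<Rightarrow> ('x \<Rightarrow> 'k vec) \<Rightarrow> bool" where
  "section_on X N W F \<longleftrightarrow>
     (\<forall>y\<in>W. F y \<in> carrier_vec N) \<and> (\<forall>a<N. (\<lambda>y. F y $ a) \<in> reg X W)"

definition matrix_function_on ::
  "('x, 'k) space_with_functions \<Rightarrow> nat \<Rightarrow> 'x set \<Rightarrow> ('x \<Rightarrow> 'k mat) \<Rightarrow> bool" where
  "matrix_function_on X N W M \<longleftrightarrow>
     (\<forall>y\<in>W. M y \<in> carrier_mat N N) \<and> (\<forall>a<N. \<forall>b<N. (\<lambda>y. M y $$ (a, b)) \<in> reg X W)"

type_synonym ('x, 'k) matrix_form = "'x \<Rightarrow> ('x, 'k) tangent \<Rightarrow> 'k mat"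

definition matrix_form_on ::
  "('x, 'k::field) space_with_functions \<Rightarrow> nat \<Rightarrow> 'x set \<Rightarrow> ('x, 'k) matrix_form \<Rightarrow> bool" where
  "matrix_form_on X N W A \<longleftrightarrow>
     (\<forall>y\<in>W. \<forall>v\<in>tangent_space X y. A y v \<in> carrier_mat N N) \<and>
     (\<forall>a<N. \<forall>b<N. one_form_on X W (\<lambda>y v. A y v $$ (a, b)))"

text \<open>\<open>mat_lincomb N m c M = \<Sum>\<^bsub>j<m\<^esub> c\<^sub>j M\<^sub>j\<close> for \<open>N \<times> N\<close> matrices.\<close>

definition mat_lincomb :: "nat \<Rightarrow> nat \<Rightarrow> (nat \<Rightarrow> 'k::comm_ring_1) \<Rightarrow> (nat \<Rightarrow> 'k mat) \<Rightarrow> 'k mat" where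
  "mat_lincomb N m c M = mat N N (\<lambda>(a, b). \<Sum>j<m. c j * M j $$ (a, b))"

text \<open>The connection \<open>\<nabla> = d - A\<close>, sending a section to a vector-valued 1-form.\<close>

definition nabla :: "nat \<Rightarrow> ('x, 'k::field) matrix_form \<Rightarrow> ('x \<Rightarrow> 'k vec) \<Rightarrow>
    'x \<Rightarrow> ('x, 'k) tangent \<Rightarrow> 'k vec" where
  "nabla N A F y v = vec N (\<lambda>a. v (\<lambda>z. F z $ a)) - A y v *\<^sub>v F y"

definition covariant_derivative :: "nat \<Rightarrow> ('x, 'k::field) matrix_form \<Rightarrow> ('x \<Rightarrow> ('x, 'k) tangent) \<Rightarrow>
    ('x \<Rightarrow> 'k vec) \<Rightarrow> 'x \<Rightarrow> 'k vec" where
  "covariant_derivative N A \<xi> F y = nabla N A F y (\<xi> y)"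

definition flat ::
  "('x, 'k::field) space_with_functions \<Rightarrow> nat \<Rightarrow> ('x, 'k) matrix_form \<Rightarrow> bool" where
  "flat X N A \<longleftrightarrow>
     (\<forall>W \<xi> \<eta> F. openin (topo X) W \<and> vector_field_on X W \<xi> \<and> vector_field_on X W \<eta> \<and>
        section_on X N W F \<longrightarrow>
        (\<forall>y\<in>W. covariant_derivative N A \<xi> (covariant_derivative N A \<eta> F) y
               - covariant_derivative N A \<eta> (covariant_derivative N A \<xi> F) y
             = covariant_derivative N A (lie_bracket X \<xi> \<eta>) F y))"

text \<open>The connection form \<open>\<Sum>\<^sub>j s\<^sub>j B\<^sub>j\<close> of \<open>\<nabla>(s)\<close>, for \<open>s \<in> carrier_vec n\<close>.\<close>

definition pencil_form ::
  "nat \<Rightarrow> nat \<Rightarrow> (nat \<Rightarrow> ('x, 'k::field) matrix_form) \<Rightarrow> 'k vec \<Rightarrow> ('x, 'k) matrix_form" where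
  "pencil_form N n B s y v = mat_lincomb N n (\<lambda>j. s $ j) (\<lambda>j. B j y v)"

definition flat_pencil :: "('x, 'k::field) space_with_functions \<Rightarrow> nat \<Rightarrow> nat \<Rightarrow>
    (nat \<Rightarrow> ('x, 'k) matrix_form) \<Rightarrow> bool" where
  "flat_pencil X N n B \<longleftrightarrow>
     (\<forall>j<n. matrix_form_on X N (points X) (B j)) \<and>
     (\<forall>s\<in>carrier_vec n. flat X N (pencil_form N n B s))"

text \<open>
  Over the infinite field \<open>'k\<close>, an element of \<open>'k(s)[X]\<close> (the tensor product of \<open>'k(s)\<close> with the global
  regular functions) with denominator \<open>q\<close> is given by its values at all \<open>s\<close> with \<open>q(s) \<noteq> 0\<close>.
\<close>

definition rational_family :: "('x, 'k::field) space_with_functions \<Rightarrow> nat \<Rightarrow> ('k vec \<Rightarrow> 'k) \<Rightarrow>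
    ('k vec \<Rightarrow> 'x \<Rightarrow> 'k) \<Rightarrow> bool" where
  "rational_family X n q a \<longleftrightarrow>
     (\<exists>(m::nat) g f. (\<forall>l<m. g l \<in> poly_fun n \<and> f l \<in> reg X (points X)) \<and>
        (\<forall>s\<in>carrier_vec n. q s \<noteq> 0 \<longrightarrow>
           (\<forall>x\<in>points X. a s x = (\<Sum>l<m. g l s / q s * f l x))))"

definition rational_matrix_family :: "('x, 'k::field) space_with_functions \<Rightarrow> nat \<Rightarrow> nat \<Rightarrow>
    ('k vec \<Rightarrow> 'k) \<Rightarrow> ('k vec \<Rightarrow> 'x \<Rightarrow> 'k mat) \<Rightarrow> bool" where
  "rational_matrix_family X N n q A \<longleftrightarrow>
     (\<forall>s\<in>carrier_vec n. q s \<noteq> 0 \<longrightarrow> (\<forall>x\<in>points X. A s x \<in> carrier_mat N N)) \<and>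
     (\<forall>a<N. \<forall>b<N. rational_family X n q (\<lambda>s x. A s x $$ (a, b)))"

text \<open>
  \<open>A\<close> represents a shift operator in direction \<open>j\<close>: it lies in \<open>GL\<^sub>N\<close> of \<open>'k(s)[X]\<close>, with inverse \<open>A'\<close>
  (\<open>q\<close> being a common denominator of all entries of both), and
  \<open>\<nabla>(s + e\<^sub>j) \<circ> A(s) = A(s) \<circ> \<nabla>(s)\<close>.
\<close>

definition shift_operator :: "('x, 'k::field) space_with_functions \<Rightarrow> nat \<Rightarrow> nat \<Rightarrow>
    (nat \<Rightarrow> ('x, 'k) matrix_form) \<Rightarrow> nat \<Rightarrow> ('k vec \<Rightarrow> 'x \<Rightarrow> 'k mat) \<Rightarrow> bool" where
  "shift_operator X N n B j A \<longleftrightarrow>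
     (\<exists>q A'. q \<in> poly_fun n \<and> (\<exists>s\<in>carrier_vec n. q s \<noteq> 0) \<and>
        rational_matrix_family X N n q A \<and> rational_matrix_family X N n q A' \<and>
        (\<forall>s\<in>carrier_vec n. q s \<noteq> 0 \<longrightarrow>
           (\<forall>x\<in>points X. A s x * A' s x = 1\<^sub>m N \<and> A' s x * A s x = 1\<^sub>m N) \<and>
           (\<forall>W F. openin (topo X) W \<and> section_on X N W F \<longrightarrow>
              (\<forall>x\<in>W. \<forall>v\<in>tangent_space X x.
                 nabla N (pencil_form N n B (s + unit_vec n j)) (\<lambda>y. A s y *\<^sub>v F y) x v
                 = A s x *\<^sub>v nabla N (pencil_form N n B s) F x v))))"

definition periodic_pencil :: "('x, 'k::field) space_with_functions \<Rightarrow> nat \<Rightarrow> nat \<Rightarrow>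
    (nat \<Rightarrow> ('x, 'k) matrix_form) \<Rightarrow> bool" where
  "periodic_pencil X N n B \<longleftrightarrow>
     flat_pencil X N n B \<and> (\<forall>j<n. \<exists>A. shift_operator X N n B j A)"

text \<open>\<open>B\<^sub>j = \<Sum>\<^sub>i B\<^bsub>ij\<^esub> dx\<^sub>i\<close> on \<open>U\<close>, with \<open>Bc i j\<close> standing for \<open>B\<^bsub>ij\<^esub>\<close>.\<close>

definition coordinate_expansion :: "('x, 'k::field) space_with_functions \<Rightarrow> nat \<Rightarrow> 'x set \<Rightarrow> nat \<Rightarrow>
    (nat \<Rightarrow> 'x \<Rightarrow> 'k) \<Rightarrow> nat \<Rightarrow> (nat \<Rightarrow> ('x, 'k) matrix_form) \<Rightarrow>
    (nat \<Rightarrow> nat \<Rightarrow> 'x \<Rightarrow> 'k mat) \<Rightarrow> bool" where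
  "coordinate_expansion X N U r x n B Bc \<longleftrightarrow>
     (\<forall>i<r. \<forall>j<n. matrix_function_on X N U (Bc i j)) \<and>
     (\<forall>j<n. \<forall>y\<in>U. \<forall>v\<in>tangent_space X y.
        B j y v = mat_lincomb N r (\<lambda>i. v (x i)) (\<lambda>i. Bc i j y))"

text \<open>
  \<open>C\<^sub>i = \<nabla>\<^sub>i\<^sup>p\<close>.  This operator is linear over functions, hence is an endomorphism of the bundle, given
  by its matrix with respect to the constant sections \<open>e\<^sub>b\<close>: the \<open>b\<close>-th column at \<open>y\<close> is
  \<open>(\<nabla>\<^sub>i\<^sup>p e\<^sub>b)(y)\<close>.
\<close>

definition p_curvature :: "('x, 'k::field) space_with_functions \<Rightarrow> nat \<Rightarrow> nat \<Rightarrow>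
    (nat \<Rightarrow> 'x \<Rightarrow> 'k) \<Rightarrow> ('x, 'k) matrix_form \<Rightarrow> nat \<Rightarrow> 'x \<Rightarrow> 'k mat" where
  "p_curvature X N r x A i y =
     mat N N (\<lambda>(a, b).
       ((covariant_derivative N A (coord_field X r x i) ^^ CHAR('k)) (\<lambda>_. unit_vec N b)) y $ a)"

definition frobenius_twist :: "'k::comm_ring_1 mat \<Rightarrow> 'k mat" where
  "frobenius_twist M = map_mat (\<lambda>c. c ^ CHAR('k)) M"

text \<open>The \<open>dx\<^sub>i\<^sup>(\<^sup>1\<^sup>)\<close>-component of the pencil \<open>\<Sum>\<^sub>j (s\<^sub>j - s\<^sub>j\<^sup>p) B\<^sub>j\<^sup>(\<^sup>1\<^sup>)\<close>.\<close>

definition twisted_pencil :: "nat \<Rightarrow> nat \<Rightarrow> (nat \<Rightarrow> nat \<Rightarrow> 'x \<Rightarrow> 'k::comm_ring_1 mat) \<Rightarrow> 'k vec \<Rightarrow>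
    nat \<Rightarrow> 'x \<Rightarrow> 'k mat" where
  "twisted_pencil N n Bc s i y =
     mat_lincomb N n (\<lambda>j. s $ j - (s $ j) ^ CHAR('k)) (\<lambda>j. frobenius_twist (Bc i j y))"


section \<open>Pencils of commuting endomorphisms\<close>

definition commuting_pencil :: "nat \<Rightarrow> nat \<Rightarrow> (nat \<Rightarrow> 'k::field mat) \<Rightarrow> bool" where
  "commuting_pencil N r L \<longleftrightarrow>
     (\<forall>i<r. L i \<in> carrier_mat N N) \<and> (\<forall>i<r. \<forall>l<r. L i * L l = L l * L i)"

definition joint_gen_eigenspace ::
  "nat \<Rightarrow> nat \<Rightarrow> (nat \<Rightarrow> 'k::field mat) \<Rightarrow> (nat \<Rightarrow> 'k) \<Rightarrow> 'k vec set" where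
  "joint_gen_eigenspace N r L \<chi> =
     {w \<in> carrier_vec N. \<forall>i<r. ((L i - \<chi> i \<cdot>\<^sub>m 1\<^sub>m N) ^\<^sub>m N) *\<^sub>v w = 0\<^sub>v N}"

text \<open>The multiplicity of \<open>\<chi>\<close>; it is 0 if \<open>\<chi>\<close> is not a joint eigenvalue.\<close>

definition joint_multiplicity ::
  "nat \<Rightarrow> nat \<Rightarrow> (nat \<Rightarrow> 'k::field mat) \<Rightarrow> (nat \<Rightarrow> 'k) \<Rightarrow> nat" where
  "joint_multiplicity N r L \<chi> =
     vectorspace.dim class_ring
       ((module_vec TYPE('k) N)\<lparr>carrier := joint_gen_eigenspace N r L \<chi>\<rparr>)"

definition isospectral ::
  "nat \<Rightarrow> nat \<Rightarrow> (nat \<Rightarrow> 'k::field mat) \<Rightarrow> (nat \<Rightarrow> 'k mat) \<Rightarrow> bool" where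
  "isospectral N r L M \<longleftrightarrow>
     commuting_pencil N r L \<and> commuting_pencil N r M \<and>
     (\<forall>\<chi>. joint_multiplicity N r L \<chi> = joint_multiplicity N r M \<chi>)"

definition simple_spectrum :: "nat \<Rightarrow> nat \<Rightarrow> (nat \<Rightarrow> 'k::field mat) \<Rightarrow> bool" where
  "simple_spectrum N r L \<longleftrightarrow>
     commuting_pencil N r L \<and>
     (\<forall>\<chi>. joint_multiplicity N r L \<chi> \<noteq> 0 \<longrightarrow> joint_multiplicity N r L \<chi> = 1)"

definition generically_simple_spectrum :: "('x, 'k::field) space_with_functions \<Rightarrow> nat \<Rightarrow> 'x set \<Rightarrow>
    nat \<Rightarrow> (nat \<Rightarrow> 'x \<Rightarrow> 'k mat) \<Rightarrow> bool" where
  "generically_simple_spectrum X N U r L \<longleftrightarrow>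
     (\<exists>W\<subseteq>U. openin (topo X) W \<and> W \<noteq> {} \<and> (\<forall>y\<in>W. simple_spectrum N r (\<lambda>i. L i y)))"

text \<open>
  On an irreducible variety, an element of \<open>GL\<^sub>N('k(X))\<close> is a matrix \<open>G\<close> of regular functions on some
  nonempty open set \<open>W\<close> with an inverse \<open>H\<close> of the same kind.
\<close>

definition conjugate_over_function_field :: "('x, 'k::field) space_with_functions \<Rightarrow> nat \<Rightarrow> 'x set \<Rightarrow>
    nat \<Rightarrow> (nat \<Rightarrow> 'x \<Rightarrow> 'k mat) \<Rightarrow> (nat \<Rightarrow> 'x \<Rightarrow> 'k mat) \<Rightarrow> bool" where
  "conjugate_over_function_field X N U r L M \<longleftrightarrow>
     (\<exists>W G H. W \<subseteq> U \<and> openin (topo X) W \<and> W \<noteq> {} \<and>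
        matrix_function_on X N W G \<and> matrix_function_on X N W H \<and>
        (\<forall>y\<in>W. G y * H y = 1\<^sub>m N \<and> H y * G y = 1\<^sub>m N \<and>
           (\<forall>i<r. L i y = G y * M i y * H y)))"

end

theory Submission
  imports
    Defs
    "HOL-Number_Theory.Cong"
    "Jordan_Normal_Form.Jordan_Normal_Form_Uniqueness"
begin

text \<open>
  Fix \<open>s\<close>, a point \<open>y\<close> and \<open>u\<^sub>0, u\<^sub>1, \<dots>\<close>.  Isospectrality amounts to an equality of
  characteristic polynomials,
    \<open>det (z - \<Sum>\<^sub>i u\<^sub>i C\<^sub>i(s)) = det (z - \<Sum>\<^sub>i u\<^sub>i \<Sum>\<^sub>j (s\<^sub>j - s\<^sub>j\<^sup>p) B\<^sub>i\<^sub>j\<^sup>(\<^sup>1\<^sup>))\<close>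
  for all \<open>z\<close> and \<open>u\<close> (\<open>isospectral_if_char_poly_eq\<close>, which passes to joint multiplicities by a linear
  functional that separates the joint eigenvalues).  Write \<open>z = \<zeta> - \<zeta>\<^sup>p\<close> and treat \<open>\<zeta>\<close> as one more
  variable beside \<open>s\<close>.  Both sides are then polynomials in \<open>(s, \<zeta>)\<close> with three properties in common.

  \<^item> They are invariant under adding 1 to any variable.  For the right side this is Frobenius; for the
    left side the shift operators conjugate \<open>C\<^sub>i(s)\<close> to \<open>C\<^sub>i(s + e\<^sub>j)\<close> for generic \<open>s\<close>.
  \<^item> Their homogeneous parts have degrees between \<open>N\<close> and \<open>pN\<close>: the entries of \<open>C\<^sub>i(s) = \<nabla>\<^sub>i(s)\<^sup>p\<close> have
    parts of degrees \<open>1, \<dots>, p\<close> only, as the derivatives of constant sections are 0.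
  \<^item> Their parts of degree \<open>pN\<close> agree.  With \<open>w\<^sub>i\<^sup>p = u\<^sub>i\<close> and \<open>P = \<zeta> - \<Sum>\<^sub>i w\<^sub>i \<Sum>\<^sub>j s\<^sub>j B\<^sub>i\<^sub>j\<close>, one is the
    determinant of \<open>-P\<^sup>p\<close> (the matrices in \<open>P\<close> commute by flatness), the other that of the matrix \<open>-P\<^sup>(\<^sup>1\<^sup>)\<close>
    of \<open>p\<close>-th powers, and both are equal to \<open>\<plusminus> det(P)\<^sup>p\<close>.

  The difference is therefore a periodic polynomial with degrees in \<open>[N, pN)\<close>, and such a polynomial
  is 0: it is divisible by \<open>x - x\<^sup>p\<close> for its last variable \<open>x\<close>, by induction on the number of
  variables, and the quotient has degrees in \<open>[N - 1, p(N - 1))\<close> (\<open>periodic_pfun_eq_zero\<close>).  For \<open>s\<close> in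
  the prime field the right side is \<open>z\<^sup>N\<close>, so the \<open>C\<^sub>i\<close> are nilpotent.

  For the conjugacy, let \<open>L\<close> and \<open>M\<close> be isospectral pencils, \<open>M\<close> with simple spectrum.  The Krylov
  matrix with rows \<open>w\<^sup>T A\<^sup>k\<close> maps an eigenvector of \<open>A\<close> to a multiple of the vector of powers of its
  eigenvalue.  If \<open>K\<close> and \<open>K'\<close> are Krylov matrices of \<open>\<Sum>\<^sub>i u\<^sub>i L\<^sub>i\<close> and \<open>\<Sum>\<^sub>i u\<^sub>i M\<^sub>i\<close>, then \<open>K\<^sup>-\<^sup>1 K'\<close> takes
  joint eigenvectors of \<open>M\<close> to joint eigenvectors of \<open>L\<close> with the same eigenvalues and conjugates the
  pencils (\<open>krylov_matrices_intertwine\<close>).  Its entries are regular where \<open>det K\<close> and \<open>det K'\<close> do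
  not vanish, and this happens near a suitable point for suitable constants \<open>u\<close>, \<open>w\<close>, \<open>w'\<close>.

  The geometric input is that \<open>\<partial>\<^sub>0, \<dots>, \<partial>\<^bsub>r-1\<^esub>\<close> exist, commute and have \<open>p\<close>-th power 0: a derivation that
  kills the coordinates is 0, because the \<open>dx\<^sub>i\<close> generate the 1-forms.  It relies on the fact that
  regular functions remain regular on smaller open sets.  Gluing alone does not give it; it follows
  from the existence of nonzero tangent vectors at all points (\<open>reg_restrict\<close>), which holds as soon as
  there is at least one coordinate.  Without coordinates the claims are trivial.
\<close>

section \<open>Polynomial functions in finitely many variables\<close>

text \<open>
  Over a finite field, the product of all \<open>x - a\<close>, plus 1, has no root.
\<close>

lemma infinite_alg_closed: "infinite (UNIV :: 'k::alg_closed_field set)"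
proof
  assume fin: "finite (UNIV :: 'k set)"
  define q :: "'k poly" where "q = (\<Prod>a\<in>UNIV. [:- a, 1:]) + 1"
  have deg: "degree (\<Prod>a\<in>(UNIV::'k set). [:- a, 1:]) = card (UNIV::'k set)"
    by (subst degree_prod_eq_sum_degree) auto
  have "card (UNIV::'k set) > 0" using fin by (simp add: card_gt_0_iff)
  then have "degree q > 0" unfolding q_def using deg by (subst degree_add_eq_left) auto
  then obtain x where "poly q x = 0" using alg_closed_imp_poly_has_root by blast
  moreover have "poly q x = 1" unfolding q_def using fin by (simp add: poly_prod prod_zero_iff)
  ultimately show False by simp
qed

lemma poly_eq_if_eval_eq:
  fixes q q' :: "'k::alg_closed_field poly"
  assumes "\<And>t. poly q t = poly q' t"
  shows "q = q'"
proof -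
  have "{t. poly (q - q') t = 0} = UNIV" using assms by simp
  then show ?thesis using poly_roots_finite[of "q - q'"] infinite_alg_closed by fastforce
qed

text \<open>
  Polynomial functions in \<open>s\<^sub>0, \<dots>, s\<^bsub>n-1\<^esub>\<close> are functions of a whole sequence \<open>s\<close>, so that the
  sets for different \<open>n\<close> are nested and inductions on \<open>n\<close> stay within one type.
\<close>

inductive_set pfun :: "nat \<Rightarrow> ((nat \<Rightarrow> 'k::comm_ring_1) \<Rightarrow> 'k) set" for n where
  const: "(\<lambda>_. c) \<in> pfun n"
| coord: "i < n \<Longrightarrow> (\<lambda>s. s i) \<in> pfun n"
| add: "f \<in> pfun n \<Longrightarrow> g \<in> pfun n \<Longrightarrow> (\<lambda>s. f s + g s) \<in> pfun n"
| mult: "f \<in> pfun n \<Longrightarrow> g \<in> pfun n \<Longrightarrow> (\<lambda>s. f s * g s) \<in> pfun n"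

lemma pfun_sum: "(\<And>a. a \<in> A \<Longrightarrow> f a \<in> pfun n) \<Longrightarrow> (\<lambda>s. \<Sum>a\<in>A. f a s) \<in> pfun n"
  by (induction A rule: infinite_finite_induct) (auto intro: pfun.intros)

lemma pfun_prod: "(\<And>a. a \<in> A \<Longrightarrow> f a \<in> pfun n) \<Longrightarrow> (\<lambda>s. \<Prod>a\<in>A. f a s) \<in> pfun n"
  by (induction A rule: infinite_finite_induct) (auto intro: pfun.intros)

lemma pfun_power: "f \<in> pfun n \<Longrightarrow> (\<lambda>s. f s ^ k) \<in> pfun n"
  by (induction k) (auto intro: pfun.intros)

lemma pfun_uminus: "f \<in> pfun n \<Longrightarrow> (\<lambda>s. - f s) \<in> pfun n"
  using pfun.mult[OF pfun.const[of "-1"]] by fastforce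

lemma pfun_diff: "f \<in> pfun n \<Longrightarrow> g \<in> pfun n \<Longrightarrow> (\<lambda>s. f s - g s) \<in> pfun n"
  using pfun.add[OF _ pfun_uminus] by fastforce

lemmas pfun_intros = pfun.intros pfun_sum pfun_prod pfun_power pfun_uminus pfun_diff

lemma pfun_mono: "f \<in> pfun n \<Longrightarrow> n \<le> n' \<Longrightarrow> f \<in> pfun n'"
  by (induction rule: pfun.induct) (auto intro: pfun.intros)

lemma pfun_cong: "f \<in> pfun n \<Longrightarrow> (\<And>i. i < n \<Longrightarrow> s i = s' i) \<Longrightarrow> f s = f s'"
  by (induction rule: pfun.induct) auto

lemma pfun_subst:
  "f \<in> pfun n \<Longrightarrow> (\<And>i. i < n \<Longrightarrow> (\<lambda>s. \<sigma> s i) \<in> pfun n') \<Longrightarrow> (\<lambda>s. f (\<sigma> s)) \<in> pfun n'"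
  by (induction rule: pfun.induct) (auto intro: pfun.intros)

lemma pfun_line:
  assumes "f \<in> pfun n"
  shows "\<exists>q. \<forall>t. f (\<lambda>i. s i + t * v i) = poly q t"
  using assms
proof (induction rule: pfun.induct)
  case (const c)
  show ?case by (rule exI[of _ "[:c:]"]) simp
next
  case (coord i)
  show ?case by (rule exI[of _ "[:s i, v i:]"]) simp
next
  case (add f g)
  then show ?case by (metis poly_add)
next
  case (mult f g)
  then show ?case by (metis poly_mult)
qed

text \<open>
  On the line through \<open>s0\<close> and \<open>s\<close> the function \<open>g\<close> is a nonzero polynomial in one variable, and its
  product with the restriction of \<open>f\<close> vanishes.
\<close>

lemma pfun_cancel:
  fixes f g :: "(nat \<Rightarrow> 'k::alg_closed_field) \<Rightarrow> 'k"
  assumes f: "f \<in> pfun n" and g: "g \<in> pfun n" and nz: "g s0 \<noteq> 0"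
    and fg: "\<And>s. g s \<noteq> 0 \<Longrightarrow> f s = 0"
  shows "f s = 0"
proof -
  obtain qf where qf: "\<And>t. f (\<lambda>i. s0 i + t * (s i - s0 i)) = poly qf t"
    using pfun_line[OF f, of s0 "\<lambda>i. s i - s0 i"] by blast
  obtain qg where qg: "\<And>t. g (\<lambda>i. s0 i + t * (s i - s0 i)) = poly qg t"
    using pfun_line[OF g, of s0 "\<lambda>i. s i - s0 i"] by blast
  have "poly (qf * qg) t = poly 0 t" for t
    using fg qf qg by (metis mult_eq_0_iff poly_0 poly_mult)
  then have "qf * qg = 0" by (rule poly_eq_if_eval_eq)
  moreover have "qg \<noteq> 0" using qg[of 0] nz by auto
  ultimately have "qf = 0" by auto
  then show ?thesis using qf[of 1] by simp
qed

lemma pfun_eq_cancel: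
  fixes f g h :: "(nat \<Rightarrow> 'k::alg_closed_field) \<Rightarrow> 'k"
  assumes "f \<in> pfun n" "h \<in> pfun n" "g \<in> pfun n" and "g s0 \<noteq> 0"
    and "\<And>s. g s \<noteq> 0 \<Longrightarrow> f s = h s"
  shows "f s = h s"
  using pfun_cancel[OF pfun_diff[OF assms(1,2)] assms(3,4)] assms(5) by fastforce

text \<open>
  \<open>f\<close> is a polynomial in \<open>\<psi> P\<close> whose coefficients are polynomial functions of \<open>\<pi> P\<close>.  The parameter \<open>P\<close>
  ranges over pairs \<open>(t, s)\<close> in the expansion along rays \<open>t s\<close>, and over points \<open>s\<close> in the expansion by
  powers of the last variable.
\<close>

definition pfun_expansion ::
  "nat \<Rightarrow> ('p \<Rightarrow> nat \<Rightarrow> 'k::comm_ring_1) \<Rightarrow> ('p \<Rightarrow> 'k) \<Rightarrow> ('p \<Rightarrow> 'k) \<Rightarrow> bool" where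
  "pfun_expansion n \<pi> \<psi> f \<longleftrightarrow>
     (\<exists>K c. (\<forall>i. c i \<in> pfun n) \<and> (\<forall>P. f P = (\<Sum>i<K::nat. c i (\<pi> P) * \<psi> P ^ i)))"

lemma pfun_expansion_coeff: "c \<in> pfun n \<Longrightarrow> pfun_expansion n \<pi> \<psi> (\<lambda>P. c (\<pi> P))"
  unfolding pfun_expansion_def by (rule exI[of _ 1], rule exI[of _ "\<lambda>_. c"]) auto

lemma pfun_expansion_base: "pfun_expansion n \<pi> \<psi> \<psi>"
  unfolding pfun_expansion_def
  by (rule exI[of _ 2], rule exI[of _ "\<lambda>i _. if i = 1 then 1 else 0"])
    (auto simp: numeral_2_eq_2 intro: pfun.const)

lemma pfun_expansion_add:
  assumes "pfun_expansion n \<pi> \<psi> f" "pfun_expansion n \<pi> \<psi> g"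
  shows "pfun_expansion n \<pi> \<psi> (\<lambda>P. f P + g P)"
proof -
  obtain K c K' c' where
    1: "\<forall>i. c i \<in> pfun n" "\<forall>P. f P = (\<Sum>i<K::nat. c i (\<pi> P) * \<psi> P ^ i)" and
    2: "\<forall>i. c' i \<in> pfun n" "\<forall>P. g P = (\<Sum>i<K'::nat. c' i (\<pi> P) * \<psi> P ^ i)"
    using assms unfolding pfun_expansion_def by blast
  let ?c = "\<lambda>i s. (if i < K then c i s else 0) + (if i < K' then c' i s else 0)"
  show ?thesis unfolding pfun_expansion_def
  proof (intro exI conjI allI)
    fix i show "?c i \<in> pfun n"
      using 1(1) 2(1) by (cases "i < K"; cases "i < K'") (simp_all add: pfun.intros)
  next
    fix P
    have "(\<Sum>i<K. c i (\<pi> P) * \<psi> P ^ i) = (\<Sum>i<K+K'. (if i < K then c i (\<pi> P) else 0) * \<psi> P ^ i)"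
      by (rule sum.mono_neutral_cong_left) auto
    moreover have "(\<Sum>i<K'. c' i (\<pi> P) * \<psi> P ^ i) = (\<Sum>i<K+K'. (if i < K' then c' i (\<pi> P) else 0) * \<psi> P ^ i)"
      by (rule sum.mono_neutral_cong_left) auto
    ultimately show "f P + g P = (\<Sum>i<K+K'. ?c i (\<pi> P) * \<psi> P ^ i)"
      using 1(2) 2(2) by (simp add: distrib_right sum.distrib)
  qed
qed

lemma pfun_expansion_mult:
  assumes "pfun_expansion n \<pi> \<psi> f" "pfun_expansion n \<pi> \<psi> g"
  shows "pfun_expansion n \<pi> \<psi> (\<lambda>P. f P * g P)"
proof -
  obtain K c K' c' where
    1: "\<forall>i. c i \<in> pfun n" "\<forall>P. f P = (\<Sum>i<K::nat. c i (\<pi> P) * \<psi> P ^ i)" and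
    2: "\<forall>i. c' i \<in> pfun n" "\<forall>P. g P = (\<Sum>i<K'::nat. c' i (\<pi> P) * \<psi> P ^ i)"
    using assms unfolding pfun_expansion_def by blast
  let ?S = "{..<K} \<times> {..<K'}"
  let ?c = "\<lambda>k s. \<Sum>x | x \<in> ?S \<and> fst x + snd x = k. c (fst x) s * c' (snd x) s"
  show ?thesis unfolding pfun_expansion_def
  proof (intro exI conjI allI)
    fix k show "?c k \<in> pfun n" by (intro pfun_sum pfun.mult 1(1)[rule_format] 2(1)[rule_format])
  next
    fix P
    let ?g = "\<lambda>x. c (fst x) (\<pi> P) * c' (snd x) (\<pi> P) * \<psi> P ^ (fst x + snd x)"
    have "f P * g P = (\<Sum>x\<in>?S. ?g x)"
      unfolding 1(2)[rule_format] 2(2)[rule_format] sum_product sum.cartesian_product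
      by (intro sum.cong refl) (auto simp: power_add mult_ac)
    also have "\<dots> = (\<Sum>k<K+K'. \<Sum>x | x \<in> ?S \<and> fst x + snd x = k. ?g x)"
      by (rule sum.group[symmetric]) auto
    also have "\<dots> = (\<Sum>k<K+K'. ?c k (\<pi> P) * \<psi> P ^ k)"
      by (intro sum.cong refl) (auto simp: sum_distrib_right intro!: sum.cong)
    finally show "f P * g P = (\<Sum>k<K+K'. ?c k (\<pi> P) * \<psi> P ^ k)" .
  qed
qed

lemma pfun_scaling:
  assumes "f \<in> pfun n"
  shows "\<exists>K c. (\<forall>i. c i \<in> pfun n) \<and> (\<forall>s t. f (\<lambda>i. t * s i) = (\<Sum>i<K::nat. c i s * t ^ i))"
proof -
  have "pfun_expansion n snd fst (\<lambda>P. f (\<lambda>i. fst P * snd P i))"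
    using assms
  proof (induction rule: pfun.induct)
    case (const c)
    show ?case using pfun_expansion_coeff[OF pfun.const] .
  next
    case (coord i)
    show ?case
      by (rule pfun_expansion_mult[OF pfun_expansion_base pfun_expansion_coeff[OF pfun.coord[OF coord]]])
  qed (auto intro: pfun_expansion_add pfun_expansion_mult)
  then obtain K c where "\<forall>i. c i \<in> pfun n"
    "\<forall>P. f (\<lambda>i. fst P * snd P i) = (\<Sum>i<K::nat. c i (snd P) * fst P ^ i)"
    unfolding pfun_expansion_def by blast
  then show ?thesis by (intro exI[of _ K] exI[of _ c]) auto
qed

lemma pfun_last_expansion:
  assumes "f \<in> pfun (Suc n)"
  shows "\<exists>K c. (\<forall>i. c i \<in> pfun n) \<and> (\<forall>s. f s = (\<Sum>i<K::nat. c i s * s n ^ i))"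
proof -
  have "pfun_expansion n (\<lambda>s. s) (\<lambda>s. s n) f"
    using assms
  proof (induction rule: pfun.induct)
    case (const c)
    show ?case using pfun_expansion_coeff[OF pfun.const] .
  next
    case (coord i)
    show ?case
    proof (cases "i = n")
      case True
      show ?thesis unfolding True by (rule pfun_expansion_base)
    next
      case False
      then have "(\<lambda>s. s i) \<in> pfun n" using coord by (intro pfun.coord) auto
      then show ?thesis by (rule pfun_expansion_coeff[where \<pi> = "\<lambda>s. s"])
    qed
  qed (auto intro: pfun_expansion_add pfun_expansion_mult)
  then show ?thesis unfolding pfun_expansion_def by auto
qed

section \<open>Periodic polynomial functions\<close>

text \<open>
  The elements of the prime field are \<open>p\<close> distinct roots of \<open>x - x\<^sup>p\<close>, hence also of the remainder, whose
  degree is less than \<open>p\<close>.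
\<close>

lemma poly_dvd_of_prime_field_roots:
  fixes q :: "'k::alg_closed_field poly"
  assumes p: "prime CHAR('k)" and roots: "\<And>m. poly q (of_nat m) = 0"
  shows "[:0, 1:] - monom 1 CHAR('k) dvd q"
proof -
  let ?p = "CHAR('k)"
  let ?T = "[:0, 1:] - monom 1 ?p :: 'k poly"
  have p2: "?p \<ge> 2" using p prime_ge_2_nat by blast
  have degT: "degree ?T = ?p"
    proof -
    have "?T = - monom 1 ?p + [:0, 1:]" by simp
    also have "degree \<dots> = ?p"
      using p2 by (subst degree_add_eq_left) (auto simp: degree_monom_eq)
    finally show ?thesis .
  qed
  have T0: "?T \<noteq> 0" using degT p2 by auto
  have frob: "(of_nat m :: 'k) ^ ?p = of_nat m" for m
  proof (induction m)
    case 0 then show ?case using p2 by simp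
  next
    case (Suc m)
    have "(1 + of_nat m :: 'k) ^ ?p = 1 ^ ?p + of_nat m ^ ?p" by (rule freshmans_dream) (use p in auto)
    then show ?case using Suc by simp
  qed
  have Troot: "poly ?T (of_nat m) = 0" for m by (simp add: poly_monom frob)
  have mod0: "poly (q mod ?T) (of_nat m) = 0" for m
  proof -
    have "poly q (of_nat m) = poly (q div ?T) (of_nat m) * poly ?T (of_nat m) + poly (q mod ?T) (of_nat m)"
      by (metis div_mult_mod_eq poly_add poly_mult)
    then show ?thesis using roots Troot by simp
  qed
  have inj: "inj_on (of_nat :: nat \<Rightarrow> 'k) {..<?p}"
    by (auto intro!: inj_onI simp: of_nat_eq_iff_cong_CHAR cong_less_modulus_unique_nat)
  have "q mod ?T = 0"
  proof (rule ccontr)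
    assume nz: "q mod ?T \<noteq> 0"
    have "card (of_nat ` {..<?p} :: 'k set) \<le> card {t. poly (q mod ?T) t = 0}"
      by (rule card_mono) (use mod0 poly_roots_finite[OF nz] in auto)
    also have "\<dots> \<le> degree (q mod ?T)" by (rule card_poly_roots_bound[OF nz])
    also have "\<dots> < ?p" using degree_mod_less[OF T0, of q] nz degT by auto
    finally show False using card_image[OF inj] by simp
  qed
  then show ?thesis by (simp add: mod_eq_0_iff_dvd)
qed

text \<open>
  Division by \<open>x - x\<^sup>p\<close> is linear in the dividend, so that the quotient by this polynomial in the last
  variable is obtained from the quotients of the powers \<open>x\<^sup>i\<close> and depends polynomially on the other
  variables.
\<close>

lemma pfun_zero_set_divides:
  fixes f :: "(nat \<Rightarrow> 'k::alg_closed_field) \<Rightarrow> 'k"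
  assumes p: "prime CHAR('k)" and f: "f \<in> pfun (Suc n)"
    and roots: "\<And>s m. f (s(n := of_nat m)) = 0"
  shows "\<exists>g \<in> pfun (Suc n). \<forall>s. f s = g s * (s n - s n ^ CHAR('k))"
proof -
  let ?T = "[:0, 1:] - monom 1 CHAR('k) :: 'k poly"
  obtain K c where c: "\<And>i. c i \<in> pfun n" "\<And>s. f s = (\<Sum>i<K::nat. c i s * s n ^ i)"
    using pfun_last_expansion[OF f] by blast
  have csub: "c i (s(n := t)) = c i s" for i s t by (rule pfun_cong[OF c(1)]) auto
  define Q where "Q s = (\<Sum>i<K. Polynomial.smult (c i s) (monom 1 i))" for s
  have Q: "poly (Q s) t = f (s(n := t))" for s t
    by (simp add: Q_def poly_sum poly_monom c(2) csub)
  have dvd: "?T dvd Q s" for s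
    by (rule poly_dvd_of_prime_field_roots[OF p]) (simp add: Q roots)
  define g where "g s = (\<Sum>i<K. c i s * poly (monom 1 i div ?T) (s n))" for s
  have gQ: "g s = poly (Q s div ?T) (s n)" for s
    unfolding g_def Q_def
    by (induction K) (simp_all add: poly_div_add_left div_smult_left poly_sum)
  have polyfun: "(\<lambda>s. poly q (s n)) \<in> pfun (Suc n)" for q :: "'k poly"
    unfolding poly_altdef by (intro pfun_intros) auto
  show ?thesis
  proof (intro bexI allI)
    show "g \<in> pfun (Suc n)"
      unfolding g_def by (intro pfun_sum pfun.mult polyfun pfun_mono[OF c(1)]) auto
    fix s
    have "f s = poly (Q s) (s n)" using Q[of s "s n"] by simp
    also have "\<dots> = poly ((Q s div ?T) * ?T) (s n)" using dvd by simp
    also have "\<dots> = g s * (s n - s n ^ CHAR('k))" unfolding gQ by (simp add: poly_monom)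
    finally show "f s = g s * (s n - s n ^ CHAR('k))" .
  qed
qed

text \<open>
  The restriction of \<open>f\<close> to \<open>s\<^sub>n = 0\<close> vanishes by induction on the number of variables.  By periodicity
  \<open>f\<close> vanishes whenever \<open>s\<^sub>n\<close> is in the prime field, and \<open>f = g (s\<^sub>n - s\<^sub>n\<^sup>p)\<close>.  The quotient \<open>g\<close> is periodic,
  and the factor raises the lowest degree along a ray by 1 and the highest by \<open>p\<close>, so the induction on
  \<open>m\<close> applies to \<open>g\<close>.  The strict upper bound on the degrees matters: \<open>s\<^sub>n - s\<^sub>n\<^sup>p\<close> itself is periodic with
  degrees in \<open>[1, p]\<close>.
\<close>

lemma periodic_pfun_eq_zero:
  fixes f :: "(nat \<Rightarrow> 'k::alg_closed_field) \<Rightarrow> 'k"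
  assumes p: "prime CHAR('k)" and "f \<in> pfun n"
    and "\<And>j s. j < n \<Longrightarrow> f (s(j := s j + 1)) = f s"
    and "\<And>s. \<exists>q. (\<forall>t. f (\<lambda>i. t * s i) = poly q t) \<and>
            (\<forall>i. coeff q i \<noteq> 0 \<longrightarrow> m \<le> i \<and> i < CHAR('k) * m)"
  shows "f s = 0"
  using assms(2-)
proof (induction n arbitrary: f m s)
  case 0
  obtain q where q: "\<forall>t. f (\<lambda>i. t * s i) = poly q t" "\<forall>i. coeff q i \<noteq> 0 \<longrightarrow> m \<le> i \<and> i < CHAR('k) * m"
    using 0(3) by blast
  have "poly q t = poly [:f s:] t" for t using q(1) pfun_cong[OF 0(1), of s "\<lambda>i. t * s i"] by simp
  then have "q = [:f s:]" by (rule poly_eq_if_eval_eq)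
  then show ?case using q(2) by (auto dest!: spec[of _ 0])
next
  case (Suc n)
  let ?p = "CHAR('k)"
  have p2: "?p \<ge> 2" using p prime_ge_2_nat by blast
  note outer_IH = Suc.IH
  from Suc.prems show ?case
  proof (induction m arbitrary: f s)
    case 0
    obtain q where q: "\<forall>t. f (\<lambda>i. t * s i) = poly q t" "\<forall>i. coeff q i \<noteq> 0 \<longrightarrow> False"
      using 0(3) by fastforce
    then have "q = 0" by (simp add: poly_eq_iff)
    then show ?case using q(1)[rule_format, of 1] by simp
  next
    case (Suc m)
    note f = Suc.prems(1) and per = Suc.prems(2) and sc = Suc.prems(3)
    \<comment> \<open>On the hyperplane \<open>s\<^sub>n = 0\<close> the function has one variable less and the same degrees.\<close>
    have base: "f (s(n := 0)) = 0" for s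
    proof -
      show ?thesis
      proof (rule outer_IH[where f = "\<lambda>s. f (s(n := 0))" and m = "Suc m"])
        show "(\<lambda>s. f (s(n := 0))) \<in> pfun n"
          by (rule pfun_subst[OF f]) (auto simp: less_Suc_eq intro: pfun.intros)
        show "f ((s(j := s j + 1))(n := 0)) = f (s(n := 0))" if "j < n" for j s
        proof -
          have "(s(j := s j + 1))(n := 0) = (s(n := 0))(j := (s(n := 0)) j + 1)"
            using that by (auto simp: fun_eq_iff)
          then show ?thesis using per[of j "s(n := 0)"] that by (simp del: fun_upd_apply)
        qed
        show "\<exists>q. (\<forall>t. f ((\<lambda>i. t * s i)(n := 0)) = poly q t) \<and>
            (\<forall>i. coeff q i \<noteq> 0 \<longrightarrow> Suc m \<le> i \<and> i < ?p * Suc m)" for s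
        proof -
          have "(\<lambda>i. t * (s(n := 0)) i) = (\<lambda>i. t * s i)(n := 0)" for t by auto
          then show ?thesis using sc[of "s(n := 0)"] by simp
        qed
      qed
    qed
    have "f (s(n := of_nat k)) = 0" for s k
    proof (induction k)
      case 0 show ?case by (simp only: of_nat_0 base)
    next
      case (Suc k)
      have "s(n := of_nat (Suc k)) = (s(n := of_nat k))(n := (s(n := of_nat k)) n + 1)"
        by (auto simp: fun_eq_iff)
      then show ?case using per[of n "s(n := of_nat k)"] Suc by (simp del: fun_upd_apply)
    qed
    then obtain g where g: "g \<in> pfun (Suc n)" and fg: "\<And>s. f s = g s * (s n - s n ^ ?p)"
      using pfun_zero_set_divides[OF p f] by blast
    let ?t = "\<lambda>s :: nat \<Rightarrow> 'k. s n - s n ^ ?p"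
    have tp: "?t \<in> pfun (Suc n)" by (intro pfun_intros) auto
    have "[:0, 1:] - monom 1 ?p \<noteq> (0 :: 'k poly)"
    proof
      assume "[:0, 1:] - monom 1 ?p = (0 :: 'k poly)"
      then have "coeff ([:0, 1:] - monom 1 ?p) 1 = (0 :: 'k)" by simp
      then show False using p2 by simp
    qed
    then obtain a :: 'k where "poly ([:0, 1:] - monom 1 ?p) a \<noteq> 0"
      using poly_eq_if_eval_eq[of "[:0, 1:] - monom 1 ?p" "0 :: 'k poly"] by auto
    then have tnz: "?t (\<lambda>_. a) \<noteq> 0" by (simp add: poly_monom)
    have "g s = 0"
    proof (rule Suc.IH[OF g])
      fix j s assume j: "j < Suc n"
      have tshift: "?t (s(j := s j + 1)) = ?t s" for s :: "nat \<Rightarrow> 'k"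
        using freshmans_dream[of "CHAR('k)" "s n" 1] p by auto
      have g': "(\<lambda>s. g (s(j := s j + 1))) \<in> pfun (Suc n)"
        proof (rule pfun_subst[OF g])
        fix i assume "i < Suc n"
        then show "(\<lambda>s. (s(j := s j + 1)) i) \<in> pfun (Suc n)"
          by (cases "i = j") (simp_all add: pfun.intros)
      qed
      show "g (s(j := s j + 1)) = g s"
      proof (rule pfun_eq_cancel[OF g' g tp tnz])
        fix s assume nz: "?t s \<noteq> 0"
        have "g (s(j := s j + 1)) * ?t s = g s * ?t s"
          using per[OF j, of s] fg[of s] fg[of "s(j := s j + 1)"] tshift[of s]
          by (simp del: fun_upd_apply)
        then show "g (s(j := s j + 1)) = g s" using nz by simp
      qed
    next
      fix s
      obtain K c where c: "\<And>i. c i \<in> pfun (Suc n)" "\<And>s t. g (\<lambda>i. t * s i) = (\<Sum>i<K::nat. c i s * t ^ i)"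
        using pfun_scaling[OF g] by blast
      define q where "q s = (\<Sum>i<K. monom (c i s) i)" for s
      have qc: "coeff (q s) i = (if i < K then c i s else 0)" for s i
        by (simp add: q_def coeff_sum)
      have gq: "g (\<lambda>i. t * s i) = poly (q s) t" for s t
        by (simp add: c(2) q_def poly_sum poly_monom)
      have *: "m \<le> i \<and> i < ?p * m" if nz: "s n \<noteq> 0" and ci: "coeff (q s) i \<noteq> 0" for s i
      proof -
        obtain q' where q': "\<forall>t. f (\<lambda>i. t * s i) = poly q' t"
            "\<And>i. coeff q' i \<noteq> 0 \<Longrightarrow> Suc m \<le> i \<and> i < ?p * Suc m"
          using sc by blast
        let ?T = "monom (s n) 1 - monom (s n ^ ?p) ?p"
        have "poly q' t = poly (q s * ?T) t" for t
          using fg[of "\<lambda>i. t * s i"] q'(1) gq[of t s] by (simp add: poly_monom power_mult_distrib mult_ac)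
        then have q'eq: "q' = q s * ?T" by (rule poly_eq_if_eval_eq)
        have cq': "coeff q' k = (if 1 \<le> k then s n * coeff (q s) (k - 1) else 0)
            - (if ?p \<le> k then s n ^ ?p * coeff (q s) (k - ?p) else 0)" for k
          unfolding q'eq right_diff_distrib coeff_diff by (simp add: coeff_monom_mult mult.commute[of "q s"])
        \<comment> \<open>The lowest coefficient of \<open>q s\<close> reappears in \<open>q'\<close> one degree higher, the highest \<open>p\<close> degrees higher.\<close>
        define i0 where "i0 = (LEAST i. coeff (q s) i \<noteq> 0)"
        have i0: "coeff (q s) i0 \<noteq> 0" "i0 \<le> i" "\<And>k. k < i0 \<Longrightarrow> coeff (q s) k = 0"
          unfolding i0_def using LeastI[of "\<lambda>i. coeff (q s) i \<noteq> 0", OF ci]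
            Least_le[of "\<lambda>i. coeff (q s) i \<noteq> 0", OF ci] not_less_Least by blast+
        have "coeff q' (Suc i0) = s n * coeff (q s) i0"
          using cq'[of "Suc i0"] i0(3)[of "Suc i0 - ?p"] p2 by auto
        then have 1: "m \<le> i0" using q'(2)[of "Suc i0"] nz i0(1) by auto
        let ?d = "degree (q s)"
        have qnz: "q s \<noteq> 0" using ci by auto
        have "coeff q' (?d + ?p) = - (s n ^ ?p * coeff (q s) ?d)"
          using cq'[of "?d + ?p"] p2 by (simp add: coeff_eq_0)
        then have 2: "?d + ?p < ?p * Suc m" using q'(2)[of "?d + ?p"] nz qnz by auto
        have "i \<le> ?d" using ci by (rule le_degree)
        with 1 2 i0(2) show ?thesis by simp
      qed
      have "m \<le> i \<and> i < ?p * m" if "coeff (q s) i \<noteq> 0" for i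
      proof (rule ccontr)
        assume no: "\<not> (m \<le> i \<and> i < ?p * m)"
        have "c i s = 0" if "i < K"
        \<comment> \<open>The bounds on degrees hold for \<open>s\<^sub>n \<noteq> 0\<close>, so the other coefficients vanish as polynomial functions.\<close>
        proof (rule pfun_cancel[OF c(1) pfun.coord])
          show "n < Suc n" by simp
          show "(\<lambda>_. 1 :: 'k) n \<noteq> 0" by simp
          show "c i s = 0" if "s n \<noteq> 0" for s
            using *[of s i] that no \<open>i < K\<close> by (auto simp: qc)
        qed
        then show False using that by (auto simp: qc split: if_splits)
      qed
      then show "\<exists>q. (\<forall>t. g (\<lambda>i. t * s i) = poly q t) \<and>
          (\<forall>i. coeff q i \<noteq> 0 \<longrightarrow> m \<le> i \<and> i < ?p * m)"
        using gq by blast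
    qed
    then show ?case using fg by simp
  qed
qed

section \<open>Almost disjoint sets along the branches of a binary tree\<close>

text \<open>
  A triangular matrix of size \<open>d + 1\<close> with nonzero diagonal is invertible and does not factor through
  a space of dimension \<open>d\<close>.
\<close>

lemma no_long_triangular_system:
  fixes c :: "nat \<Rightarrow> nat \<Rightarrow> 'k::field" and \<beta> :: "nat \<Rightarrow> nat \<Rightarrow> 'k"
  assumes diag: "\<And>t. t \<le> d \<Longrightarrow> (\<Sum>i<d. c t i * \<beta> i t) \<noteq> 0"
    and tri: "\<And>t t'. t \<le> d \<Longrightarrow> t' < t \<Longrightarrow> (\<Sum>i<d. c t i * \<beta> i t') = 0"
  shows False
proof -
  define C where "C = mat (Suc d) (Suc d) (\<lambda>(t, i). if i < d then c t i else 0)"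
  define B where "B = mat (Suc d) (Suc d) (\<lambda>(i, t). \<beta> i t)"
  have carr: "C \<in> carrier_mat (Suc d) (Suc d)" "B \<in> carrier_mat (Suc d) (Suc d)"
    by (auto simp: C_def B_def)
  have CB: "(C * B) $$ (t, t') = (\<Sum>i<d. c t i * \<beta> i t')" if "t \<le> d" "t' \<le> d" for t t'
    using that unfolding C_def B_def
    by (auto simp: scalar_prod_def atLeast0LessThan[symmetric] intro!: sum.cong)
  have "C *\<^sub>v unit_vec (Suc d) d = 0\<^sub>v (Suc d)"
    by (rule eq_vecI) (auto simp: C_def scalar_prod_right_unit)
  moreover have "unit_vec (Suc d) d \<noteq> (0\<^sub>v (Suc d) :: 'k vec)" by simp
  ultimately have "det C = 0"
    using det_0_iff_vec_prod_zero[OF carr(1)] unit_vec_carrier by blast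
  then have "det (C * B) = 0" using det_mult[OF carr] by simp
  moreover have "upper_triangular (C * B)"
    using carr CB tri by (auto simp: upper_triangular_def less_Suc_eq_le)
  then have "det (C * B) = prod_list (diag_mat (C * B))"
    using det_upper_triangular carr by (metis mult_carrier_mat)
  ultimately have "0 \<in> set (diag_mat (C * B))" by (simp add: prod_list_zero_iff)
  then obtain t where "t < dim_row (C * B)" "(C * B) $$ (t, t) = 0" by (auto simp: diag_mat_def)
  then show False using carr CB diag by (auto simp: less_Suc_eq_le)
qed

text \<open>
  The nodes of the infinite binary tree are the positive numbers, and the node \<open>n\<close> has the children \<open>2n\<close>
  and \<open>2n + 1\<close>.
\<close>

fun ancestors :: "nat \<Rightarrow> nat set" where
  "ancestors n = (if n \<le> 1 then {} else insert (n div 2) (ancestors (n div 2)))"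

fun level :: "nat \<Rightarrow> nat" where
  "level n = (if n \<le> 1 then 0 else Suc (level (n div 2)))"

declare ancestors.simps [simp del] level.simps [simp del]

primrec branch :: "(nat \<Rightarrow> bool) \<Rightarrow> nat \<Rightarrow> nat" where
  "branch b 0 = 1"
| "branch b (Suc k) = 2 * branch b k + of_bool (b k)"

lemma branch_pos: "branch b k \<ge> 1"
  by (induction k) auto

lemma branch_Suc_div: "branch b (Suc k) div 2 = branch b k"
  by simp

lemma branch_gt1: "branch b (Suc k) > 1"
  using branch_pos[of b k] by simp

lemma level_branch: "level (branch b k) = k"
proof (induction k)
  case (Suc k)
  then show ?case using branch_gt1[of b k] branch_Suc_div[of b k]
    by (subst level.simps) (simp del: branch.simps)
qed (simp add: level.simps)

lemma ancestors_branch: "ancestors (branch b k) = branch b ` {..<k}"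
proof (induction k)
  case (Suc k)
  then show ?case using branch_gt1[of b k] branch_Suc_div[of b k]
    by (subst ancestors.simps) (simp del: branch.simps add: lessThan_Suc)
qed (simp add: ancestors.simps)

lemma ancestors_less: "m \<in> ancestors n \<Longrightarrow> m < n"
proof (induction n rule: ancestors.induct)
  case (1 n)
  show ?case
  proof (cases "n \<le> 1")
    case True
    then show ?thesis using 1(2) by (simp add: ancestors.simps[of n])
  next
    case False
    then have "m = n div 2 \<or> m \<in> ancestors (n div 2)"
      using 1(2) by (simp add: ancestors.simps[of n])
    then show ?thesis using 1(1)[OF False] False by auto
  qed
qed

lemma branch_disagree:
  assumes "b j \<noteq> b' j" and "j < k"
  shows "branch b k \<noteq> branch b' k"
  using assms(2)
proof (induction k)
  case (Suc k)
  show ?case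
  proof (cases "j = k")
    case True
    have "branch c (Suc k) mod 2 = of_bool (c k)" for c by simp
    then show ?thesis using assms(1) True by (metis of_bool_eq_iff)
  next
    case False
    then have "branch b k \<noteq> branch b' k" using Suc by simp
    then show ?thesis using branch_Suc_div by metis
  qed
qed simp

lemma prod_encode_strict_mono: "t < t' \<Longrightarrow> prod_encode (q, t) < prod_encode (q, t')"
proof -
  have "strict_mono (\<lambda>t. prod_encode (q, t))"
    unfolding strict_mono_Suc_iff by (simp add: prod_encode_def)
  then show "t < t' \<Longrightarrow> ?thesis" by (rule strict_monoD)
qed

text \<open>
  Points are attached to nodes of a binary tree, no point twice, and \<open>S b\<close> is the set of the points
  along the branch \<open>b\<close>; distinct branches have finitely many nodes in common.  The level of a node encodes
  a pair \<open>(q, t)\<close>, and the node receives a point of \<open>Y q\<close> at which some combination of the functions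
  \<open>\<beta> q i\<close> does not vanish although it vanishes at all points of \<open>Y q\<close> attached by ancestors of the same
  family \<open>q\<close>, if there is a combination of this kind with infinitely many points to choose from.  Now suppose
  that \<open>c\<close> is nonzero at infinitely many points of \<open>Y q\<close> but at none of \<open>S b\<close>.  Then \<open>c\<close> is a candidate
  at all nodes of \<open>b\<close> for \<open>q\<close>, so all these nodes receive points, and they yield a triangular
  system of unbounded length.
\<close>

lemma almost_disjoint_dense_sets:
  fixes Y :: "nat \<Rightarrow> 'x set" and \<beta> :: "nat \<Rightarrow> nat \<Rightarrow> 'x \<Rightarrow> 'k::field" and d :: "nat \<Rightarrow> nat"
  obtains S :: "(nat \<Rightarrow> bool) \<Rightarrow> 'x set" where
    "countable (\<Union>b. S b)"
    "\<forall>b b'. b \<noteq> b' \<longrightarrow> finite (S b \<inter> S b')"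
    "\<forall>b q c. infinite {y \<in> Y q. (\<Sum>i<d q. c i * \<beta> q i y) \<noteq> 0} \<longrightarrow>
        (\<exists>y\<in>S b. y \<in> Y q \<and> (\<Sum>i<d q. c i * \<beta> q i y) \<noteq> 0)"
proof -
  define ev where "ev q c y = (\<Sum>i<d q. c i * \<beta> q i y)" for q c y
  define D where "D q c = {y \<in> Y q. ev q c y \<noteq> 0}" for q c
  \<comment> \<open>The level of the node \<open>n\<close> encodes a pair \<open>(q, t)\<close>; the node works for the family \<open>q\<close>.\<close>
  define sched where "sched n = fst (prod_decode (level n))" for n
  define vanish where "vanish f n c \<longleftrightarrow>
      (\<forall>m\<in>ancestors n. \<forall>y \<in> Y (sched n). f m = Some y \<longrightarrow> ev (sched n) c y = 0)"
    for f :: "nat \<Rightarrow> 'x option" and n c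
  define P where "P f n r \<longleftrightarrow> (\<forall>y. r = Some y \<longrightarrow> Some y \<notin> f ` {..<n}) \<and>
      ((\<exists>c. vanish f n c \<and> infinite (D (sched n) c)) \<longrightarrow>
       (\<exists>c y. r = Some y \<and> vanish f n c \<and> y \<in> D (sched n) c))"
    for f :: "nat \<Rightarrow> 'x option" and n r
  have "\<exists>f. \<forall>n. P f n (f n)"
  proof (rule dependent_wf_choice)
    show "wf less_than" by simp
  next
    fix f g :: "nat \<Rightarrow> 'x option" and n r
    assume eq: "\<And>m. (m, n) \<in> less_than \<Longrightarrow> f m = g m"
    have "f ` {..<n} = g ` {..<n}" using eq by (auto simp: image_def)
    moreover have "vanish f n c = vanish g n c" for c
      proof -
      have "f m = g m" if "m \<in> ancestors n" for m using eq ancestors_less[OF that] by simp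
      then show ?thesis unfolding vanish_def by simp
    qed
    ultimately show "P f n r = P g n r" unfolding P_def by (simp only:)
  next
    fix n and f :: "nat \<Rightarrow> 'x option"
    show "\<exists>r. P f n r"
    proof (cases "\<exists>c. vanish f n c \<and> infinite (D (sched n) c)")
      case False
      then show ?thesis unfolding P_def by (intro exI[of _ None]) simp
    next
      case True
      then obtain c where c: "vanish f n c" "infinite (D (sched n) c)" by blast
      have "infinite (D (sched n) c - the ` f ` {..<n})" using c(2) by simp
      then obtain y where y: "y \<in> D (sched n) c" "y \<notin> the ` f ` {..<n}"
        by (metis Diff_iff finite.emptyI ex_in_conv)
      from y(2) have "Some y \<notin> f ` {..<n}" by (metis image_eqI option.sel)
      then have "P f n (Some y)" unfolding P_def using c(1) y(1) by blast
      then show ?thesis by blast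
    qed
  qed
  then obtain z where z: "\<And>n. P z n (z n)" by blast
  define S where "S b = {y. \<exists>k. z (branch b k) = Some y}" for b
  have zinj: "m = n" if "z m = Some y" "z n = Some y" for m n y
  proof (rule ccontr)
    assume "m \<noteq> n"
    then consider "m < n" | "n < m" by linarith
    then show False
    proof cases
      case 1
      then have "Some y \<in> z ` {..<n}" using that(1) by force
      then show False using z[of n] that(2) unfolding P_def by blast
    next
      case 2
      then have "Some y \<in> z ` {..<m}" using that(2) by force
      then show False using z[of m] that(1) unfolding P_def by blast
    qed
  qed
  have "countable (\<Union>b. S b)"
  proof -
    have "(\<Union>b. S b) \<subseteq> the ` range z"
    proof
      fix y assume "y \<in> (\<Union>b. S b)"
      then obtain b k where "z (branch b k) = Some y" by (auto simp: S_def)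
      then show "y \<in> the ` range z" by (metis option.sel rangeI image_eqI)
    qed
    then show ?thesis by (rule countable_subset) simp
  qed
  moreover have "finite (S b \<inter> S b')" if "b \<noteq> b'" for b b' :: "nat \<Rightarrow> bool"
  proof -
    from that
    obtain j where j: "b j \<noteq> b' j" by blast
    have "S b \<inter> S b' \<subseteq> (\<lambda>k. the (z (branch b k))) ` {..j}"
    proof
      fix y assume "y \<in> S b \<inter> S b'"
      then obtain k k' where k: "z (branch b k) = Some y" "z (branch b' k') = Some y"
        by (auto simp: S_def)
      then have eq: "branch b k = branch b' k'" by (rule zinj)
      then have "k = k'" by (metis level_branch)
      then have "k \<le> j" using eq branch_disagree[of b j b' k] j by (metis not_le)
      then show "y \<in> (\<lambda>k. the (z (branch b k))) ` {..j}"
        using k(1) by (intro image_eqI[of _ _ k]) auto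
    qed
    then show ?thesis by (rule finite_subset) simp
  qed
  moreover have "\<exists>y\<in>S b. y \<in> Y q \<and> (\<Sum>i<d q. c i * \<beta> q i y) \<noteq> 0"
    if inf: "infinite {y \<in> Y q. (\<Sum>i<d q. c i * \<beta> q i y) \<noteq> 0}" for b q c
    proof (rule ccontr)
      assume no: "\<not> ?thesis"
      define n where "n t = branch b (prod_encode (q, t))" for t
      have sch: "sched (n t) = q" for t by (simp add: sched_def n_def level_branch)
      have "\<exists>c y. z (n t) = Some y \<and> vanish z (n t) c \<and> y \<in> D q c" for t
      proof -
        have "vanish z (n t) c" unfolding vanish_def sch
          using no by (auto simp: n_def ancestors_branch S_def ev_def)
        moreover have "infinite (D q c)" using inf by (simp add: D_def ev_def)
        ultimately show ?thesis using z[of "n t"] unfolding P_def sch by blast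
      qed
      then obtain cc w where cw: "\<And>t. z (n t) = Some (w t)" "\<And>t. vanish z (n t) (cc t)" "\<And>t. w t \<in> D q (cc t)"
        by metis
      show False
      proof (rule no_long_triangular_system[of "d q" cc "\<lambda>i t. \<beta> q i (w t)"])
        show "(\<Sum>i<d q. cc t i * \<beta> q i (w t)) \<noteq> 0" for t
          using cw(3)[of t] by (simp add: D_def ev_def)
        show "(\<Sum>i<d q. cc t i * \<beta> q i (w t')) = 0" if "t' < t" for t t'
        proof -
          have "n t' \<in> ancestors (n t)"
            using prod_encode_strict_mono[OF that] by (auto simp: n_def ancestors_branch)
          then show ?thesis using cw(2)[of t] cw(1)[of t'] cw(3)[of t']
            unfolding vanish_def sch by (auto simp: D_def ev_def)
        qed
      qed
    qed
  ultimately show ?thesis by (intro that[of S]) auto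
qed

lemma uncountable_bool_sequences: "uncountable (UNIV :: (nat \<Rightarrow> bool) set)"
proof
  assume "countable (UNIV :: (nat \<Rightarrow> bool) set)"
  then obtain f :: "nat \<Rightarrow> nat \<Rightarrow> bool" where "range f = UNIV"
    using range_from_nat_into by blast
  then obtain m where "f m = (\<lambda>k. \<not> f k k)" by (metis surjD)
  then have "f m m = (\<not> f m m)" by (rule fun_cong)
  then show False by simp
qed

text \<open>
  If all fibres had at most two elements, the uncountable domain would be a countable union of finite
  sets.
\<close>

lemma three_in_fibre:
  fixes g :: "(nat \<Rightarrow> bool) \<Rightarrow> 'x"
  assumes "countable (range g)"
  shows "\<exists>b1 b2 b3. b1 \<noteq> b2 \<and> b1 \<noteq> b3 \<and> b2 \<noteq> b3 \<and> g b1 = g b2 \<and> g b1 = g b3"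
proof (rule ccontr)
  assume no: "\<not> ?thesis"
  have "finite (g -` {y})" for y
  proof (rule ccontr)
    assume "infinite (g -` {y})"
    then obtain A where A: "finite A" "card A = 3" "A \<subseteq> g -` {y}"
      using infinite_arbitrarily_large by blast
    then obtain b1 b2 b3 where "A = {b1, b2, b3}" "b1 \<noteq> b2" "b1 \<noteq> b3" "b2 \<noteq> b3"
      by (auto simp: card_3_iff)
    then show False using no A(3) by force
  qed
  then have "countable (\<Union>y\<in>range g. g -` {y})"
    by (intro countable_UN assms countable_finite) auto
  moreover have "(\<Union>y\<in>range g. g -` {y}) = UNIV" by auto
  ultimately show False using uncountable_bool_sequences by simp
qed

section \<open>Regular functions in affine charts\<close>

definition in_chart :: "('x, 'k::field) space_with_functions \<Rightarrow> 'x set \<Rightarrow> bool" where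
  "in_chart X W \<longleftrightarrow> (\<exists>U m \<phi>. affine_chart X U m \<phi> \<and> W \<subseteq> U)"

lemma poly_fun_minus: "f \<in> poly_fun m \<Longrightarrow> g \<in> poly_fun m \<Longrightarrow> (\<lambda>z. f z - g z) \<in> poly_fun m"
  using poly_fun.add[OF _ poly_fun.mult[OF poly_fun.const[of "-1"]]] by fastforce

lemma affine_chartE:
  assumes "affine_chart X U m \<phi>"
  obtains Z where "openin (topo X) U" "zariski_closed m Z" "Z \<subseteq> carrier_vec m" "bij_betw \<phi> U Z"
    "\<And>W. W \<subseteq> U \<Longrightarrow> openin (topo X) W \<longleftrightarrow> zariski_open_in m Z (\<phi> ` W)"
    "\<And>W f. openin (topo X) W \<Longrightarrow> W \<subseteq> U \<Longrightarrow>
       f \<in> reg X W \<longleftrightarrow> (\<exists>g. affine_regular m Z (\<phi> ` W) g \<and> (\<forall>x\<in>W. f x = g (\<phi> x)))"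
proof -
  from assms obtain Z where Z: "openin (topo X) U" "zariski_closed m Z" "bij_betw \<phi> U Z"
    "\<forall>W\<subseteq>U. openin (topo X) W \<longleftrightarrow> zariski_open_in m Z (\<phi> ` W)"
    "\<forall>W f. openin (topo X) W \<and> W \<subseteq> U \<longrightarrow>
       (f \<in> reg X W \<longleftrightarrow> (\<exists>g. affine_regular m Z (\<phi> ` W) g \<and> (\<forall>x\<in>W. f x = g (\<phi> x))))"
    unfolding affine_chart_def by (elim conjE exE) (rule that)
  have "Z \<subseteq> carrier_vec m" using Z(2) by (auto simp: zariski_closed_def)
  then show thesis
    using that[OF Z(1,2) _ Z(3)] Z(4,5) by (simp only: simp_thms)
qed

definition fraction_at :: "('x, 'k::field) space_with_functions \<Rightarrow> nat \<Rightarrow> ('x \<Rightarrow> 'k vec) \<Rightarrow> 'x set \<Rightarrow>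
    ('x \<Rightarrow> 'k) \<Rightarrow> 'x \<Rightarrow> bool" where
  "fraction_at X m \<phi> W f x \<longleftrightarrow> (\<exists>W' a b. openin (topo X) W' \<and> x \<in> W' \<and> W' \<subseteq> W \<and>
     a \<in> poly_fun m \<and> b \<in> poly_fun m \<and> (\<forall>w\<in>W'. b (\<phi> w) \<noteq> 0 \<and> f w = a (\<phi> w) / b (\<phi> w)))"

lemma fraction_atI:
  assumes "openin (topo X) W'" "x \<in> W'" "W' \<subseteq> W" "a \<in> poly_fun m" "b \<in> poly_fun m"
    "\<And>w. w \<in> W' \<Longrightarrow> b (\<phi> w) \<noteq> 0" "\<And>w. w \<in> W' \<Longrightarrow> f w = a (\<phi> w) / b (\<phi> w)"
  shows "fraction_at X m \<phi> W f x"
  unfolding fraction_at_def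
  by (rule exI[of _ W'], rule exI[of _ a], rule exI[of _ b]) (simp add: assms)

lemma fraction_atE:
  assumes "fraction_at X m \<phi> W f x"
  obtains W' a b where "openin (topo X) W'" "x \<in> W'" "W' \<subseteq> W" "a \<in> poly_fun m" "b \<in> poly_fun m"
    "\<forall>w\<in>W'. b (\<phi> w) \<noteq> 0 \<and> f w = a (\<phi> w) / b (\<phi> w)"
  using assms unfolding fraction_at_def by (elim conjE exE) (rule that)

text \<open>
  Charts are homeomorphisms onto their images, so the neighbourhoods on which a regular function is a
  fraction can be taken in \<open>X\<close> instead of affine space.
\<close>

lemma chart_reg_iff:
  assumes ch: "affine_chart X U m \<phi>" and W: "openin (topo X) W" "W \<subseteq> U"
  shows "f \<in> reg X W \<longleftrightarrow> (\<forall>x\<in>W. fraction_at X m \<phi> W f x)"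
proof -
  obtain Z where Z: "bij_betw \<phi> U Z"
      "\<And>W. W \<subseteq> U \<Longrightarrow> openin (topo X) W \<longleftrightarrow> zariski_open_in m Z (\<phi> ` W)"
      "f \<in> reg X W \<longleftrightarrow> (\<exists>g. affine_regular m Z (\<phi> ` W) g \<and> (\<forall>x\<in>W. f x = g (\<phi> x)))"
    using W by (rule_tac affine_chartE[OF ch]) auto
  have inj: "inj_on \<phi> U" using Z(1) by (simp add: bij_betw_def)
  show ?thesis
  proof
    assume "f \<in> reg X W"
    then obtain g where g: "affine_regular m Z (\<phi> ` W) g" "\<forall>x\<in>W. f x = g (\<phi> x)"
      using Z(3) by blast
    show "\<forall>x\<in>W. fraction_at X m \<phi> W f x"
    proof
      fix x assume x: "x \<in> W"
      then have "\<phi> x \<in> \<phi> ` W" by simp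
      from g(1)[unfolded affine_regular_def, rule_format, OF this] obtain W1 a b where W1: "zariski_open_in m Z W1" "\<phi> x \<in> W1" "W1 \<subseteq> \<phi> ` W"
          and ab: "a \<in> poly_fun m" "b \<in> poly_fun m" "\<forall>w\<in>W1. b w \<noteq> 0 \<and> g w = a w / b w"
        by (elim exE conjE) (rule that)
      let ?W' = "{w \<in> W. \<phi> w \<in> W1}"
      have "\<phi> ` ?W' = W1" using W1(3) by blast
      moreover have "?W' \<subseteq> U" using W(2) by blast
      ultimately have "openin (topo X) ?W'" using Z(2)[of ?W'] W1(1) by simp
      then show "fraction_at X m \<phi> W f x"
        using x W1(2) ab g(2) by (intro fraction_atI[of X ?W' x W a m b]) auto
    qed
  next
    assume R: "\<forall>x\<in>W. fraction_at X m \<phi> W f x"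
    define g where "g z = f (inv_into U \<phi> z)" for z
    have gf: "g (\<phi> x) = f x" if "x \<in> U" for x using that inj by (simp add: g_def)
    have "affine_regular m Z (\<phi> ` W) g"
      unfolding affine_regular_def
    proof
      fix z assume "z \<in> \<phi> ` W"
      then obtain x where x: "x \<in> W" "z = \<phi> x" by blast
      with R have "fraction_at X m \<phi> W f x" by simp
      then obtain W' a b where W': "openin (topo X) W'" "x \<in> W'" "W' \<subseteq> W"
          and ab: "a \<in> poly_fun m" "b \<in> poly_fun m"
          "\<forall>w\<in>W'. b (\<phi> w) \<noteq> 0 \<and> f w = a (\<phi> w) / b (\<phi> w)"
        by (rule fraction_atE)
      have "zariski_open_in m Z (\<phi> ` W')" using Z(2)[of W'] W' W(2) by simp
      moreover have "\<forall>w\<in>\<phi> ` W'. b w \<noteq> 0 \<and> g w = a w / b w"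
      proof
        fix w assume "w \<in> \<phi> ` W'"
        then obtain y where y: "y \<in> W'" "w = \<phi> y" by blast
        then have "y \<in> U" using W'(3) W(2) by blast
        then show "b w \<noteq> 0 \<and> g w = a w / b w" using y ab(3)[rule_format, OF y(1)] gf by simp
      qed
      ultimately show "\<exists>W' a b. zariski_open_in m Z W' \<and> z \<in> W' \<and> W' \<subseteq> \<phi> ` W \<and>
          a \<in> poly_fun m \<and> b \<in> poly_fun m \<and> (\<forall>w\<in>W'. b w \<noteq> 0 \<and> g w = a w / b w)"
        using W'(2,3) x(2) ab(1,2) by (intro exI[of _ "\<phi> ` W'"] exI[of _ a] exI[of _ b]) (simp add: image_mono)
    qed
    moreover have "\<forall>x\<in>W. f x = g (\<phi> x)" using gf W(2) by auto
    ultimately show "f \<in> reg X W" using Z(3) by blast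
  qed
qed

lemma in_chartE:
  assumes "in_chart X W" "openin (topo X) W"
  obtains m \<phi> where "\<forall>W' f. openin (topo X) W' \<and> W' \<subseteq> W \<longrightarrow>
    f \<in> reg X W' \<longleftrightarrow> (\<forall>x\<in>W'. fraction_at X m \<phi> W' f x)"
proof -
  obtain U m \<phi> where "affine_chart X U m \<phi>" "W \<subseteq> U" using assms(1) by (auto simp: in_chart_def)
  then show thesis using chart_reg_iff[of X U m \<phi>] by (intro that[of m \<phi>]) auto
qed

lemma chart_reg_restrict:
  assumes "in_chart X W" "openin (topo X) W" "openin (topo X) W'" "W' \<subseteq> W" "f \<in> reg X W"
  shows "f \<in> reg X W'"
proof -
  obtain m \<phi> where "\<forall>W' f. openin (topo X) W' \<and> W' \<subseteq> W \<longrightarrow>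
      f \<in> reg X W' \<longleftrightarrow> (\<forall>x\<in>W'. fraction_at X m \<phi> W' f x)"
    by (rule in_chartE[OF assms(1,2)])
  then have iff: "f \<in> reg X W' \<longleftrightarrow> (\<forall>x\<in>W'. fraction_at X m \<phi> W' f x)"
    if "openin (topo X) W'" "W' \<subseteq> W" for W' f using that by simp
  show ?thesis unfolding iff[OF assms(3,4)]
  proof
    fix x assume x: "x \<in> W'"
    have "fraction_at X m \<phi> W f x" using assms x iff[of W f, OF assms(2) subset_refl] by auto
    then show "fraction_at X m \<phi> W' f x"
      by (rule fraction_atE, rule_tac W' = "W'a \<inter> W'" and a = a and b = b in fraction_atI)
        (use x assms(3) in auto)
  qed
qed

lemma chart_reg_cong:
  assumes "in_chart X W" "openin (topo X) W" "f \<in> reg X W" "\<And>y. y \<in> W \<Longrightarrow> f y = g y"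
  shows "g \<in> reg X W"
proof -
  obtain m \<phi> where "\<forall>W' f. openin (topo X) W' \<and> W' \<subseteq> W \<longrightarrow>
      f \<in> reg X W' \<longleftrightarrow> (\<forall>x\<in>W'. fraction_at X m \<phi> W' f x)"
    by (rule in_chartE[OF assms(1,2)])
  then have iff: "f \<in> reg X W' \<longleftrightarrow> (\<forall>x\<in>W'. fraction_at X m \<phi> W' f x)"
    if "openin (topo X) W'" "W' \<subseteq> W" for W' f using that by simp
  show ?thesis unfolding iff[OF assms(2) subset_refl]
  proof
    fix x assume x: "x \<in> W"
    have "fraction_at X m \<phi> W f x" using assms x iff[of W f, OF assms(2) subset_refl] by auto
    then obtain W' a b where h: "openin (topo X) W'" "x \<in> W'" "W' \<subseteq> W" "a \<in> poly_fun m" "b \<in> poly_fun m"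
        "\<forall>w\<in>W'. b (\<phi> w) \<noteq> 0 \<and> f w = a (\<phi> w) / b (\<phi> w)"
      by (rule fraction_atE)
    show "fraction_at X m \<phi> W g x"
    proof (rule fraction_atI[OF h(1-5)])
      fix w assume w: "w \<in> W'"
      then have "f w = g w" using assms(4) h(3) by blast
      then show "b (\<phi> w) \<noteq> 0" "g w = a (\<phi> w) / b (\<phi> w)" using h(6) w by simp_all
    qed
  qed
qed

lemma chart_reg_poly:
  assumes "affine_chart X U m \<phi>" "openin (topo X) W" "W \<subseteq> U" "a \<in> poly_fun m"
  shows "(\<lambda>y. a (\<phi> y)) \<in> reg X W"
  unfolding chart_reg_iff[OF assms(1-3)]
  using assms by (intro ballI fraction_atI[of X W _ W a m "\<lambda>_. 1"]) (auto intro: poly_fun.const)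

lemma chart_reg_const:
  assumes "in_chart X W" "openin (topo X) W"
  shows "(\<lambda>_. c) \<in> reg X W"
proof -
  obtain U m \<phi> where "affine_chart X U m \<phi>" "W \<subseteq> U" using assms(1) by (auto simp: in_chart_def)
  then show ?thesis using chart_reg_poly[OF _ assms(2) _ poly_fun.const] by blast
qed

lemma chart_reg_binop:
  assumes "in_chart X W" "openin (topo X) W" "f \<in> reg X W" "g \<in> reg X W"
  shows chart_reg_add: "(\<lambda>y. f y + g y) \<in> reg X W"
    and chart_reg_mult: "(\<lambda>y. f y * g y) \<in> reg X W"
proof -
  obtain m \<phi> where "\<forall>W' f. openin (topo X) W' \<and> W' \<subseteq> W \<longrightarrow>
      f \<in> reg X W' \<longleftrightarrow> (\<forall>x\<in>W'. fraction_at X m \<phi> W' f x)"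
    by (rule in_chartE[OF assms(1,2)])
  then have iff: "f \<in> reg X W' \<longleftrightarrow> (\<forall>x\<in>W'. fraction_at X m \<phi> W' f x)"
    if "openin (topo X) W'" "W' \<subseteq> W" for W' f using that by simp
  have "fraction_at X m \<phi> W (\<lambda>y. f y + g y) x \<and> fraction_at X m \<phi> W (\<lambda>y. f y * g y) x" if x: "x \<in> W" for x
  proof -
    have "fraction_at X m \<phi> W f x" using assms x iff[of W f, OF assms(2) subset_refl] by auto
    then obtain W1 a b where 1: "openin (topo X) W1" "x \<in> W1" "W1 \<subseteq> W" "a \<in> poly_fun m" "b \<in> poly_fun m"
        "\<forall>w\<in>W1. b (\<phi> w) \<noteq> 0 \<and> f w = a (\<phi> w) / b (\<phi> w)"
      by (rule fraction_atE)
    have "fraction_at X m \<phi> W g x" using assms x iff[of W g, OF assms(2) subset_refl] by auto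
    then obtain W2 a' b' where 2: "openin (topo X) W2" "x \<in> W2" "W2 \<subseteq> W" "a' \<in> poly_fun m" "b' \<in> poly_fun m"
        "\<forall>w\<in>W2. b' (\<phi> w) \<noteq> 0 \<and> g w = a' (\<phi> w) / b' (\<phi> w)"
      by (rule fraction_atE)
    have nbhd: "openin (topo X) (W1 \<inter> W2)" "x \<in> W1 \<inter> W2" "W1 \<inter> W2 \<subseteq> W" using 1 2 by auto
    have "fraction_at X m \<phi> W (\<lambda>y. f y + g y) x"
      by (rule fraction_atI[OF nbhd, where a = "\<lambda>z. a z * b' z + a' z * b z" and b = "\<lambda>z. b z * b' z"])
        (use 1(4-6) 2(4-6) in \<open>auto intro!: poly_fun.add poly_fun.mult simp: add_frac_eq\<close>)
    moreover have "fraction_at X m \<phi> W (\<lambda>y. f y * g y) x"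
      by (rule fraction_atI[OF nbhd, where a = "\<lambda>z. a z * a' z" and b = "\<lambda>z. b z * b' z"])
        (use 1(4-6) 2(4-6) in \<open>auto intro!: poly_fun.mult\<close>)
    ultimately show ?thesis by simp
  qed
  then show "(\<lambda>y. f y + g y) \<in> reg X W" "(\<lambda>y. f y * g y) \<in> reg X W"
    unfolding iff[OF assms(2) subset_refl] by blast+
qed

lemma chart_poly_open:
  assumes "affine_chart X U m \<phi>" "F \<in> poly_fun m"
  shows "openin (topo X) {y \<in> U. F (\<phi> y) \<noteq> 0}"
proof -
  obtain Z where Z: "zariski_closed m Z" "bij_betw \<phi> U Z"
      "\<And>W. W \<subseteq> U \<Longrightarrow> openin (topo X) W \<longleftrightarrow> zariski_open_in m Z (\<phi> ` W)"
    using affine_chartE[OF assms(1)] by metis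
  have "Z \<subseteq> carrier_vec m" using Z(1) by (auto simp: zariski_closed_def)
  then have "\<phi> ` {y \<in> U. F (\<phi> y) \<noteq> 0} = Z - {z \<in> carrier_vec m. F z = 0}"
    using Z(2) by (auto simp: bij_betw_def)
  moreover have "zariski_closed m {z \<in> carrier_vec m. F z = 0}"
    unfolding zariski_closed_def using assms(2) by (intro exI[of _ "{F}"]) auto
  ultimately show ?thesis using Z(3)[of "{y \<in> U. F (\<phi> y) \<noteq> 0}"] unfolding zariski_open_in_def by auto
qed

lemma chart_basis:
  assumes "affine_chart X U m \<phi>" "openin (topo X) W" "y \<in> W" "y \<in> U"
  obtains F where "F \<in> poly_fun m" "F (\<phi> y) \<noteq> 0" "{y \<in> U. F (\<phi> y) \<noteq> 0} \<subseteq> W"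
proof -
  obtain Z where Z: "zariski_closed m Z" "bij_betw \<phi> U Z" "openin (topo X) U"
      "\<And>W. W \<subseteq> U \<Longrightarrow> openin (topo X) W \<longleftrightarrow> zariski_open_in m Z (\<phi> ` W)"
    using affine_chartE[OF assms(1)] by metis
  have Zc: "Z \<subseteq> carrier_vec m" using Z(1) by (auto simp: zariski_closed_def)
  have "zariski_open_in m Z (\<phi> ` (W \<inter> U))" using Z(4)[of "W \<inter> U"] Z(3) assms(2) by auto
  then obtain S where S: "S \<subseteq> poly_fun m" "\<phi> ` (W \<inter> U) = Z - {z \<in> carrier_vec m. \<forall>f\<in>S. f z = 0}"
    by (auto simp: zariski_open_in_def zariski_closed_def)
  have "\<phi> y \<in> \<phi> ` (W \<inter> U)" using assms by blast
  then obtain F where F: "F \<in> S" "F (\<phi> y) \<noteq> 0" using S(2) Zc by auto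
  have "y' \<in> W" if "y' \<in> U" "F (\<phi> y') \<noteq> 0" for y'
  proof -
    have "\<phi> y' \<in> \<phi> ` (W \<inter> U)" using that F Z(2) unfolding S(2) by (auto simp: bij_betw_def)
    then show ?thesis using that Z(2) by (auto simp: bij_betw_def dest: inj_onD)
  qed
  then show ?thesis using that F S(1) by blast
qed

locale algebraic_variety =
  fixes X :: "('x, 'k::alg_closed_field) space_with_functions"
  assumes variety: "variety X"
begin

lemma chart_at:
  assumes "x \<in> points X"
  obtains U m \<phi> where "affine_chart X U m \<phi>" "x \<in> U"
  using variety assms unfolding variety_def by blast

lemma openin_chart: "affine_chart X U m \<phi> \<Longrightarrow> openin (topo X) U"
  by (simp add: affine_chart_def)

lemma chart_nbhd:
  assumes "openin (topo X) W" "x \<in> W"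
  obtains W' where "openin (topo X) W'" "x \<in> W'" "W' \<subseteq> W" "in_chart X W'"
proof -
  have "x \<in> points X" using assms openin_subset by blast
  then obtain U m \<phi> where "affine_chart X U m \<phi>" "x \<in> U" by (rule chart_at)
  then show ?thesis using assms that[of "W \<inter> U"] openin_chart unfolding in_chart_def by blast
qed

lemma reg_glue:
  assumes "openin (topo X) W"
    and "\<And>x. x \<in> W \<Longrightarrow> \<exists>W'. openin (topo X) W' \<and> x \<in> W' \<and> W' \<subseteq> W \<and> f \<in> reg X W'"
  shows "f \<in> reg X W"
  using variety assms unfolding variety_def by blast

text \<open>
  Within a chart a point is the common zero set of the functions \<open>z\<^sub>i - c\<^sub>i\<close>.
\<close>

lemma open_minus_point:
  assumes "openin (topo X) W"
  shows "openin (topo X) (W - {y})"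
proof (subst openin_subopen, intro ballI)
  fix x assume x: "x \<in> W - {y}"
  then have "x \<in> points X" using assms openin_subset by blast
  then obtain U m \<phi> where ch: "affine_chart X U m \<phi>" "x \<in> U" by (rule chart_at)
  show "\<exists>T. openin (topo X) T \<and> x \<in> T \<and> T \<subseteq> W - {y}"
  proof (cases "y \<in> U")
    case False
    then show ?thesis using openin_chart[OF ch(1)] ch(2) assms x by (intro exI[of _ "W \<inter> U"]) auto
  next
    case True
    obtain Z where Z: "zariski_closed m Z" "bij_betw \<phi> U Z" using affine_chartE[OF ch(1)] by metis
    have c: "\<phi> x \<in> carrier_vec m" "\<phi> y \<in> carrier_vec m" "\<phi> x \<noteq> \<phi> y"
      using Z ch(2) True x by (auto simp: zariski_closed_def bij_betw_def dest: inj_onD)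
    then obtain i where i: "i < m" "\<phi> x $ i \<noteq> \<phi> y $ i" by (metis eq_vecI carrier_vecD)
    let ?F = "\<lambda>z :: 'k vec. z $ i - \<phi> y $ i"
    have "?F \<in> poly_fun m" using i(1) by (intro poly_fun_minus poly_fun.intros)
    from chart_poly_open[OF ch(1) this] show ?thesis
      using assms x ch(2) i(2) by (intro exI[of _ "W \<inter> {y \<in> U. ?F (\<phi> y) \<noteq> 0}"]) auto
  qed
qed

lemma open_minus_finite:
  assumes "finite A" "openin (topo X) W"
  shows "openin (topo X) (W - A)"
  using assms
proof (induction A arbitrary: W)
  case (insert y A)
  then show ?case using open_minus_point[of "W - A" y] by (metis Diff_insert)
qed simp

end

section \<open>Monomials, germs and tangent vectors\<close>

definition monomial_fun :: "nat list \<Rightarrow> 'k::comm_ring_1 vec \<Rightarrow> 'k" where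
  "monomial_fun l z = (\<Prod>i\<leftarrow>l. z $ i)"

lemma poly_fun_monomial_sum:
  assumes "F \<in> poly_fun m"
  shows "\<exists>A c. finite A \<and> (\<forall>z. F z = (\<Sum>l\<in>A. c l * monomial_fun l z))"
  using assms
proof (induction rule: poly_fun.induct)
  case (const c)
  show ?case by (rule exI[of _ "{[]}"], rule exI[of _ "\<lambda>_. c"]) (simp add: monomial_fun_def)
next
  case (coord i)
  show ?case by (rule exI[of _ "{[i]}"], rule exI[of _ "\<lambda>_. 1"]) (simp add: monomial_fun_def)
next
  case (add f g)
  then obtain A c A' c' where 1: "finite A" "\<forall>z. f z = (\<Sum>l\<in>A. c l * monomial_fun l z)" and
     2: "finite A'" "\<forall>z. g z = (\<Sum>l\<in>A'. c' l * monomial_fun l z)" by blast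
  let ?c = "\<lambda>l. (if l \<in> A then c l else 0) + (if l \<in> A' then c' l else 0)"
  have "f z + g z = (\<Sum>l\<in>A \<union> A'. ?c l * monomial_fun l z)" for z
  proof -
    have "f z = (\<Sum>l\<in>A \<union> A'. (if l \<in> A then c l else 0) * monomial_fun l z)"
      unfolding 1(2)[rule_format] using 1(1) 2(1) by (intro sum.mono_neutral_cong_left) auto
    moreover have "g z = (\<Sum>l\<in>A \<union> A'. (if l \<in> A' then c' l else 0) * monomial_fun l z)"
      unfolding 2(2)[rule_format] using 1(1) 2(1) by (intro sum.mono_neutral_cong_left) auto
    ultimately show ?thesis by (simp add: distrib_right sum.distrib)
  qed
  then show ?case using 1(1) 2(1) by (intro exI[of _ "A \<union> A'"] exI[of _ ?c]) simp
next
  case (mult f g)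
  then obtain A c A' c' where 1: "finite A" "\<forall>z. f z = (\<Sum>l\<in>A. c l * monomial_fun l z)" and
     2: "finite A'" "\<forall>z. g z = (\<Sum>l\<in>A'. c' l * monomial_fun l z)" by blast
  let ?S = "A \<times> A'" and ?h = "\<lambda>x. fst x @ snd x"
  let ?c = "\<lambda>l. \<Sum>x | x \<in> ?S \<and> ?h x = l. c (fst x) * c' (snd x)"
  have "f z * g z = (\<Sum>l\<in>?h ` ?S. ?c l * monomial_fun l z)" for z
  proof -
    have "f z * g z = (\<Sum>x\<in>?S. c (fst x) * c' (snd x) * monomial_fun (?h x) z)"
      unfolding 1(2)[rule_format] 2(2)[rule_format] sum_product sum.cartesian_product
      by (intro sum.cong refl) (auto simp: monomial_fun_def mult_ac)
    also have "\<dots> = (\<Sum>l\<in>?h ` ?S. \<Sum>x | x \<in> ?S \<and> ?h x = l. c (fst x) * c' (snd x) * monomial_fun (?h x) z)"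
      using 1(1) 2(1) by (intro sum.group[symmetric]) auto
    also have "\<dots> = (\<Sum>l\<in>?h ` ?S. ?c l * monomial_fun l z)"
      by (intro sum.cong refl) (auto simp: sum_distrib_right intro!: sum.cong)
    finally show ?thesis .
  qed
  then show ?case using 1(1) 2(1) by (intro exI[of _ "?h ` ?S"] exI[of _ ?c]) simp
qed

text \<open>
  All polynomial functions, in any number of variables, lie in the increasing union of the spaces spanned
  by the first \<open>d\<close> monomials of one enumeration.  Countably many pairs of a chart and a \<open>d\<close> thus cover
  all basic open sets of a variety.
\<close>

lemma poly_fun_enumerated_monomials:
  assumes "F \<in> poly_fun m"
  obtains d c where "\<And>z. F z = (\<Sum>i<d. c i * monomial_fun (from_nat i) z)"
proof -
  obtain A c where A: "finite A" "\<And>z. F z = (\<Sum>l\<in>A. c l * monomial_fun l z)"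
    using poly_fun_monomial_sum[OF assms] by blast
  let ?d = "Suc (Max (insert 0 (to_nat ` A)))"
  let ?c = "\<lambda>i. if i \<in> to_nat ` A then c (from_nat i) else 0"
  have lt: "to_nat ` A \<subseteq> {..<?d}" using A(1) by (auto simp: less_Suc_eq_le)
  have "F z = (\<Sum>i<?d. ?c i * monomial_fun (from_nat i) z)" for z
  proof -
    have "F z = (\<Sum>i\<in>to_nat ` A. c (from_nat i) * monomial_fun (from_nat i) z)"
      unfolding A(2) by (subst sum.reindex) (auto simp: inj_on_def)
    also have "\<dots> = (\<Sum>i<?d. ?c i * monomial_fun (from_nat i) z)"
      using lt by (intro sum.mono_neutral_cong_left) auto
    finally show ?thesis .
  qed
  then show thesis by (rule that)
qed

lemma avoid_finite:
  assumes "finite A"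
  obtains t :: "'k::alg_closed_field" where "t \<notin> A"
  using infinite_alg_closed assms by (metis UNIV_I finite_subset subsetI)

context algebraic_variety
begin

text \<open>
  Regularity on a neighbourhood inside a chart, where restriction to smaller open sets is available from
  the description by fractions.
\<close>

definition germ_reg :: "'x \<Rightarrow> ('x \<Rightarrow> 'k) \<Rightarrow> bool" where
  "germ_reg x f \<longleftrightarrow> (\<exists>W. openin (topo X) W \<and> x \<in> W \<and> in_chart X W \<and> f \<in> reg X W)"

lemma germ_reg_diff:
  assumes "germ_reg x f" "germ_reg x g"
  shows "germ_reg x (\<lambda>y. f y - g y)"
proof -
  obtain W where W: "openin (topo X) W" "x \<in> W" "in_chart X W" "f \<in> reg X W"
    using assms(1) by (auto simp: germ_reg_def)
  obtain W' where W': "openin (topo X) W'" "x \<in> W'" "in_chart X W'" "g \<in> reg X W'"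
    using assms(2) by (auto simp: germ_reg_def)
  let ?V = "W \<inter> W'"
  have V: "openin (topo X) ?V" "x \<in> ?V" "in_chart X ?V" using W W' by (auto simp: in_chart_def)
  have "f \<in> reg X ?V" "g \<in> reg X ?V"
    using chart_reg_restrict[OF W(3,1) V(1) _ W(4)] chart_reg_restrict[OF W'(3,1) V(1) _ W'(4)] by auto
  then have "(\<lambda>y. f y + (-1) * g y) \<in> reg X ?V"
    using V by (intro chart_reg_add chart_reg_mult chart_reg_const)
  then show ?thesis using V unfolding germ_reg_def by auto
qed

text \<open>
  The last of these statements recognizes regular functions by a nonzero value of a tangent vector.
\<close>

lemma tangent_add: "v \<in> tangent_space X x \<Longrightarrow> regular_at X x f \<Longrightarrow> regular_at X x g \<Longrightarrow> v (\<lambda>y. f y + g y) = v f + v g"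
  and tangent_mult: "v \<in> tangent_space X x \<Longrightarrow> regular_at X x f \<Longrightarrow> regular_at X x g \<Longrightarrow> v (\<lambda>y. f y * g y) = f x * v g + g x * v f"
  and tangent_scale: "v \<in> tangent_space X x \<Longrightarrow> regular_at X x f \<Longrightarrow> v (\<lambda>y. c * f y) = c * v f"
  and tangent_irregular: "v \<in> tangent_space X x \<Longrightarrow> v f \<noteq> 0 \<Longrightarrow> regular_at X x f"
  unfolding tangent_space_def by auto

lemma tangent_germ:
  assumes "v \<in> tangent_space X x" "openin (topo X) W" "x \<in> W" "f \<in> reg X W" "g \<in> reg X W" "\<And>y. y \<in> W \<Longrightarrow> f y = g y"
  shows "v f = v g"
proof -
  have "\<forall>f g W. openin (topo X) W \<and> x \<in> W \<and> f \<in> reg X W \<and> g \<in> reg X W \<and> (\<forall>y\<in>W. f y = g y)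
        \<longrightarrow> v f = v g"
    using assms(1) unfolding tangent_space_def by (elim CollectE conjE)
  from this[THEN spec, of f, THEN spec, of g, THEN spec, of W] show ?thesis using assms(2-) by simp
qed

lemma regular_at_const: "x \<in> points X \<Longrightarrow> regular_at X x (\<lambda>_. c)"
  using chart_nbhd[of "points X" x] chart_reg_const unfolding regular_at_def by (metis openin_topspace)

lemma tangent_const:
  assumes "x \<in> points X" "v \<in> tangent_space X x"
  shows "v (\<lambda>_. c) = 0"
proof -
  note r = regular_at_const[OF assms(1)]
  have "v (\<lambda>_. 1) + v (\<lambda>_. 1) = v (\<lambda>_. 1)"
    using tangent_mult[OF assms(2) r[of 1] r[of 1]] by (simp only: mult_1)
  then have "v (\<lambda>_. 1) = 0"
    using add_left_cancel[of "v (\<lambda>_. 1)" "v (\<lambda>_. 1)" 0] by (simp only: add_0_right simp_thms)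
  then show ?thesis using tangent_scale[OF assms(2) r[of 1], of c] by simp
qed

lemma zero_germ:
  assumes "openin (topo X) W" "x \<in> W" "\<And>y. y \<in> W \<Longrightarrow> e y = 0"
  shows zero_germ_regular: "regular_at X x e" and tangent_zero_germ: "v \<in> tangent_space X x \<Longrightarrow> v e = 0"
proof -
  obtain W' where W': "openin (topo X) W'" "x \<in> W'" "W' \<subseteq> W" "in_chart X W'"
    using chart_nbhd[OF assms(1,2)] .
  note z = chart_reg_const[OF W'(4,1), of 0]
  have e: "e \<in> reg X W'" by (rule chart_reg_cong[OF W'(4,1) z]) (use assms(3) W'(3) in auto)
  then show "regular_at X x e" using W' unfolding regular_at_def by blast
  have x: "x \<in> points X" using assms(1,2) openin_subset by blast
  assume v: "v \<in> tangent_space X x"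
  have "v e = v (\<lambda>_. 0)" by (rule tangent_germ[OF v W'(1,2) e z]) (use assms(3) W'(3) in auto)
  then show "v e = 0" using tangent_const[OF x v] by simp
qed

text \<open>
  Two functions regular at \<open>x\<close> may be regular on open sets that are not comparable, and their sum need
  not be known to be regular anywhere.  Differences of such functions are closed under addition and
  multiplication if there is a nonzero tangent vector.
\<close>

definition nearly_regular :: "'x \<Rightarrow> ('x \<Rightarrow> 'k) \<Rightarrow> bool" where
  "nearly_regular x h \<longleftrightarrow> (\<exists>g g'. regular_at X x g \<and> regular_at X x g' \<and> h = (\<lambda>y. g y - g' y))"

context
  fixes x v w
  assumes x: "x \<in> points X" and v: "v \<in> tangent_space X x" and vw: "v w \<noteq> 0"
begin

text \<open>
  Tangent vectors are additive on functions regular at \<open>x\<close>, and vanish on all that are not; so a nonzero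
  value at a sum proves that the sum is regular.  The same works for products and multiples.
\<close>

lemma regular_at_add_nonzero:
  "regular_at X x f \<Longrightarrow> regular_at X x g \<Longrightarrow> v f + v g \<noteq> 0 \<Longrightarrow> regular_at X x (\<lambda>y. f y + g y)"
  using tangent_add[OF v] tangent_irregular[OF v] by metis

lemma regular_at_mult_nonzero:
  "regular_at X x f \<Longrightarrow> regular_at X x g \<Longrightarrow> f x * v g + g x * v f \<noteq> 0 \<Longrightarrow> regular_at X x (\<lambda>y. f y * g y)"
  using tangent_mult[OF v] tangent_irregular[OF v] by metis

lemma regular_at_scale_nonzero:
  "regular_at X x f \<Longrightarrow> c * v f \<noteq> 0 \<Longrightarrow> regular_at X x (\<lambda>y. c * f y)"
  using tangent_scale[OF v] tangent_irregular[OF v] by metis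

lemma tangent_witness_regular: "regular_at X x w"
  using tangent_irregular[OF v vw] .

lemma regular_shift:
  assumes g: "regular_at X x g" and t: "t \<noteq> 0" "v g + t * v w \<noteq> 0"
  shows "regular_at X x (\<lambda>y. g y + t * w y)" "v (\<lambda>y. g y + t * w y) = v g + t * v w"
proof -
  have tw: "regular_at X x (\<lambda>y. t * w y)" "v (\<lambda>y. t * w y) = t * v w"
    using regular_at_scale_nonzero[OF tangent_witness_regular] tangent_scale[OF v tangent_witness_regular] t(1) vw by auto
  show "regular_at X x (\<lambda>y. g y + t * w y)" "v (\<lambda>y. g y + t * w y) = v g + t * v w"
    using regular_at_add_nonzero[OF g tw(1)] tangent_add[OF v g tw(1)] t tw by auto
qed

text \<open>
  Adding a common multiple of \<open>w\<close> to \<open>g\<close> and \<open>g\'\<close> does not change their difference, and only finitely many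
  multiples lead to a zero value of \<open>v\<close>.
\<close>

lemma nearly_regularE:
  assumes "nearly_regular x h"
  obtains g g' where "regular_at X x g" "regular_at X x g'" "h = (\<lambda>y. g y - g' y)" "v g \<noteq> 0" "v g' \<noteq> 0"
proof -
  obtain g g' where g: "regular_at X x g" "regular_at X x g'" "h = (\<lambda>y. g y - g' y)"
    using assms by (auto simp: nearly_regular_def)
  obtain t where "t \<notin> {0, - v g / v w, - v g' / v w}" by (rule avoid_finite[rotated], assumption, simp)
  then have t: "t \<noteq> 0" "v g + t * v w \<noteq> 0" "v g' + t * v w \<noteq> 0"
    using vw by (auto simp: field_simps eq_neg_iff_add_eq_0 add.commute)
  show thesis
    by (rule that[OF regular_shift(1)[OF g(1) t(1,2)] regular_shift(1)[OF g(2) t(1,3)]])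
      (use regular_shift(2)[OF g(1) t(1,2)] regular_shift(2)[OF g(2) t(1,3)] t g(3) in auto)
qed

lemma nearly_regular_diff:
  assumes "nearly_regular x h1" "nearly_regular x h2"
  shows "nearly_regular x (\<lambda>y. h1 y - h2 y)"
proof -
  obtain g1 g1' where 1: "regular_at X x g1" "regular_at X x g1'" "h1 = (\<lambda>y. g1 y - g1' y)"
    using assms(1) by (auto simp: nearly_regular_def)
  obtain g2 g2' where 2: "regular_at X x g2" "regular_at X x g2'" "h2 = (\<lambda>y. g2 y - g2' y)"
    using assms(2) by (auto simp: nearly_regular_def)
  obtain t where "t \<notin> {0, - v g1 / v w, - v g1' / v w, - (v g1 + v g2') / v w, - (v g1' + v g2) / v w}"
    by (rule avoid_finite[rotated], assumption, simp)
  then have t: "t \<noteq> 0" "v g1 + t * v w \<noteq> 0" "v g1' + t * v w \<noteq> 0"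
      "v g1 + t * v w + v g2' \<noteq> 0" "v g1' + t * v w + v g2 \<noteq> 0"
    using vw by (auto simp: field_simps eq_neg_iff_add_eq_0 add_ac)
  note s = regular_shift[OF 1(1) t(1,2)] and s' = regular_shift[OF 1(2) t(1,3)]
  have "regular_at X x (\<lambda>y. (g1 y + t * w y) + g2' y)" "regular_at X x (\<lambda>y. (g1' y + t * w y) + g2 y)"
    using regular_at_add_nonzero[OF s(1) 2(2)] regular_at_add_nonzero[OF s'(1) 2(1)] s(2) s'(2) t by auto
  then show ?thesis unfolding nearly_regular_def
    by (intro exI conjI) (assumption, assumption, simp add: 1(3) 2(3) algebra_simps)
qed

lemma nearly_regular_zero_germ:
  assumes "openin (topo X) W" "x \<in> W" "\<And>y. y \<in> W \<Longrightarrow> e y = 0"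
  shows "nearly_regular x e"
  unfolding nearly_regular_def
  by (intro exI[of _ e] exI[of _ "\<lambda>_. 0"]) (use zero_germ_regular[OF assms] regular_at_const[OF x] in simp)

lemma nearly_regular_add:
  assumes "nearly_regular x h1" "nearly_regular x h2"
  shows "nearly_regular x (\<lambda>y. h1 y + h2 y)"
proof -
  have "nearly_regular x (\<lambda>_. 0)" using nearly_regular_zero_germ[OF openin_topspace x] by simp
  from nearly_regular_diff[OF assms(1) nearly_regular_diff[OF this assms(2)]] show ?thesis by simp
qed

lemma nearly_regular_mult_regular:
  assumes g: "regular_at X x g1" "regular_at X x g2" "v g1 \<noteq> 0" "v g2 \<noteq> 0"
  shows "nearly_regular x (\<lambda>y. g1 y * g2 y)"
proof -
  obtain c where "c \<notin> {0, - (g1 x * v g2 + g2 x * v g1) / v g2}" by (rule avoid_finite[rotated], assumption, simp)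
  then have c: "c \<noteq> 0" "(g1 x + c) * v g2 + g2 x * v g1 \<noteq> 0"
    using g(4) by (auto simp: field_simps eq_neg_iff_add_eq_0 add_ac)
  have 1: "regular_at X x (\<lambda>y. g1 y + c)" "v (\<lambda>y. g1 y + c) = v g1"
    using regular_at_add_nonzero[OF g(1) regular_at_const[OF x]] g(3) tangent_const[OF x v]
      tangent_add[OF v g(1) regular_at_const[OF x]] by auto
  have "regular_at X x (\<lambda>y. (g1 y + c) * g2 y)"
    using regular_at_mult_nonzero[OF 1(1) g(2)] 1(2) c(2) by simp
  moreover have "regular_at X x (\<lambda>y. c * g2 y)"
    using regular_at_scale_nonzero[OF g(2)] c(1) g(4) by simp
  ultimately show ?thesis unfolding nearly_regular_def
    by (intro exI conjI) (assumption, assumption, simp add: algebra_simps)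
qed

lemma nearly_regular_mult:
  assumes "nearly_regular x h1" "nearly_regular x h2"
  shows "nearly_regular x (\<lambda>y. h1 y * h2 y)"
proof -
  obtain g1 g1' where 1: "regular_at X x g1" "regular_at X x g1'" "h1 = (\<lambda>y. g1 y - g1' y)" "v g1 \<noteq> 0" "v g1' \<noteq> 0"
    using nearly_regularE[OF assms(1)] .
  obtain g2 g2' where 2: "regular_at X x g2" "regular_at X x g2'" "h2 = (\<lambda>y. g2 y - g2' y)" "v g2 \<noteq> 0" "v g2' \<noteq> 0"
    using nearly_regularE[OF assms(2)] .
  have "nearly_regular x (\<lambda>y. (g1 y * g2 y + g1' y * g2' y) - (g1 y * g2' y + g1' y * g2 y))"
    by (intro nearly_regular_diff nearly_regular_add nearly_regular_mult_regular 1 2)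
  then show ?thesis by (simp add: 1(3) 2(3) algebra_simps)
qed

text \<open>
  Choose \<open>u\<close> regular at \<open>x\<close> with \<open>u x = 0\<close> and \<open>v u \<noteq> 0\<close> that vanishes outside \<open>W\<close>.  If \<open>h = g - g\'\<close>, then
  \<open>g u\<close> and \<open>g\' u\<close> are the same function, and by the Leibniz rule \<open>v\<close> takes the values \<open>g x * v u\<close> and
  \<open>g\' x * v u\<close> on it.
\<close>

lemma nearly_regular_isolated_value:
  assumes h: "nearly_regular x h" and W: "openin (topo X) W" "x \<in> W" "\<And>y. y \<in> W \<Longrightarrow> y \<noteq> x \<Longrightarrow> h y = 0"
  shows "h x = 0"
proof -
  obtain g g' where g: "regular_at X x g" "regular_at X x g'" "h = (\<lambda>y. g y - g' y)"
    using h by (auto simp: nearly_regular_def)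
  let ?e = "\<lambda>y. if y \<in> W then 0 else - (w y - w x)"
  have w1: "regular_at X x (\<lambda>y. w y + (- w x))" "v (\<lambda>y. w y + (- w x)) = v w"
    using regular_at_add_nonzero[OF tangent_witness_regular regular_at_const[OF x]] vw tangent_const[OF x v]
      tangent_add[OF v tangent_witness_regular regular_at_const[OF x], of "- w x"]
    by (auto simp del: add_uminus_conv_diff)
  have e: "regular_at X x ?e" "v ?e = 0"
    by (rule zero_germ_regular[OF W(1,2)], simp) (rule tangent_zero_germ[OF W(1,2) _ v], simp)
  define u where "u = (\<lambda>y. (w y + (- w x)) + ?e y)"
  have u: "regular_at X x u" "v u \<noteq> 0" "u x = 0" "\<And>y. y \<notin> W \<Longrightarrow> u y = 0"
    using regular_at_add_nonzero[OF w1(1) e(1)] tangent_add[OF v w1(1) e(1)] w1(2) e(2) vw W(2)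
    by (auto simp: u_def)
  have "(\<lambda>y. g y * u y) = (\<lambda>y. g' y * u y)"
  proof
    fix y show "g y * u y = g' y * u y"
      using W(3)[of y] u(3,4) by (cases "y \<in> W"; cases "y = x") (auto simp: g(3))
  qed
  moreover have "v (\<lambda>y. g y * u y) = g x * v u" "v (\<lambda>y. g' y * u y) = g' x * v u"
    using tangent_mult[OF v g(1) u(1)] tangent_mult[OF v g(2) u(1)] u(3) by auto
  ultimately have "g x * v u = g' x * v u" by (simp only:)
  then show ?thesis using u(2) g(3) by simp
qed

end

end

section \<open>Restriction of regular functions\<close>

locale variety_with_tangents = algebraic_variety X
  for X :: "('x, 'k::alg_closed_field) space_with_functions" +
  assumes tangents: "x \<in> points X \<Longrightarrow> \<exists>v \<in> tangent_space X x. \<exists>w. v w \<noteq> 0"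
begin

definition forbidden_value :: "('x \<Rightarrow> 'k) \<Rightarrow> 'x \<Rightarrow> 'k" where
  "forbidden_value f z = (if nearly_regular z (\<lambda>y. f y + of_bool (y = z)) then 0 else 1)"

text \<open>
  The indicator function of \<open>{z}\<close> is not nearly regular at \<open>z\<close>, so that \<open>f\<close> and the sum of \<open>f\<close> with this
  indicator function cannot both be.
\<close>

lemma forbidden_value:
  assumes z: "z \<in> points X" and W: "openin (topo X) W" "z \<in> W"
    and h: "\<And>y. y \<in> W \<Longrightarrow> h y = f y + (if y = z then forbidden_value f z else 0)"
  shows "\<not> nearly_regular z h"
proof
  assume nr: "nearly_regular z h"
  obtain v w where v: "v \<in> tangent_space X z" "v w \<noteq> 0" using tangents[OF z] by blast
  note ctx = z v
  let ?h' = "\<lambda>y. f y + (if y = z then forbidden_value f z else 0)"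
  have "nearly_regular z (\<lambda>y. ?h' y - h y)"
    by (rule nearly_regular_zero_germ[OF ctx W]) (use h in auto)
  from nearly_regular_add[OF ctx nr this] have h': "nearly_regular z ?h'" by simp
  show False
  proof (cases "nearly_regular z (\<lambda>y. f y + of_bool (y = z))")
    case True
    then have "forbidden_value f z = 0" unfolding forbidden_value_def by (rule if_P)
    then have "?h' = f" by auto
    then have "nearly_regular z f" using h' by simp
    from nearly_regular_diff[OF ctx True this] have "nearly_regular z (\<lambda>y. of_bool (y = z))" by simp
    from nearly_regular_isolated_value[OF ctx this W] show False by simp
  next
    case False
    then have "forbidden_value f z = 1" unfolding forbidden_value_def by (rule if_not_P)
    then have "?h' = (\<lambda>y. f y + of_bool (y = z))" by auto
    then show False using h' False by simp
  qed
qed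

text \<open>
  First \<open>f\<close> is changed to \<open>f\'\<close> by its forbidden values at the isolated points of \<open>Z\<close>.  For a branch \<open>b\<close> of the
  binary tree let \<open>\<phi> b\<close> be the function that takes the forbidden values of \<open>f\'\<close> at the points of \<open>S b\<close> that
  are not isolated in \<open>Z\<close>.  By assumption \<open>f\' + \<phi> b\<close> is regular at all points of a nonempty open part
  of \<open>Z\<close>; this part has no isolated points, hence is infinite near each of its points, and it meets \<open>S b\<close>.
  There are uncountably many branches and countably many points, so three branches lead to the same
  point \<open>z\<close>.  Near \<open>z\<close>, but not at \<open>z\<close>, at most one of the three functions \<open>\<phi> b\<close> is nonzero, and its values
  are 0 or 1; therefore subtracting from \<open>f\' + \<phi> b1\<close> the product of its differences with the other two
  leaves \<open>f\'\<close> changed by the forbidden value at \<open>z\<close> alone.  But the result is nearly regular at \<open>z\<close>.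
\<close>

lemma uncountable_regularity_contradiction:
  fixes Z :: "'x set" and f :: "'x \<Rightarrow> 'k"
  assumes Z: "Z \<subseteq> points X"
    and reg: "\<And>\<phi>. (\<And>y. y \<notin> Z \<Longrightarrow> \<phi> y = 0) \<Longrightarrow>
      \<exists>W. openin (topo X) W \<and> W \<inter> Z \<noteq> {} \<and> (\<forall>z\<in>W \<inter> Z. regular_at X z (\<lambda>y. f y + \<phi> y))"
  shows False
proof -
  define isolated where "isolated = {z \<in> Z. \<exists>W. openin (topo X) W \<and> W \<inter> Z = {z}}"
  define f' where "f' y = f y + (if y \<in> isolated then forbidden_value f y else 0)" for y
  obtain \<U> where \<U>: "finite \<U>" "\<Union>\<U> = points X" "\<forall>U\<in>\<U>. \<exists>m \<phi>. affine_chart X U m \<phi>"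
    using variety unfolding variety_def by blast
  then obtain mm ch where ch: "\<And>U. U \<in> \<U> \<Longrightarrow> affine_chart X U (mm U) (ch U)" by metis
  obtain Us where Us: "set Us = \<U>" using finite_list[OF \<U>(1)] by blast
  define Y where "Y q = (if fst (prod_decode q) < length Us then Us ! fst (prod_decode q) \<inter> Z else {})" for q
  define \<beta> where "\<beta> q i y = monomial_fun (from_nat i) (ch (Us ! fst (prod_decode q)) y)" for q i y
  define d where "d q = snd (prod_decode q)" for q
  obtain S :: "(nat \<Rightarrow> bool) \<Rightarrow> 'x set" where S: "countable (\<Union>b. S b)" "\<forall>b b'. b \<noteq> b' \<longrightarrow> finite (S b \<inter> S b')"
    "\<forall>b q c. infinite {y \<in> Y q. (\<Sum>i<d q. c i * \<beta> q i y) \<noteq> 0} \<longrightarrow>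
        (\<exists>y\<in>S b. y \<in> Y q \<and> (\<Sum>i<d q. c i * \<beta> q i y) \<noteq> 0)"
    by (rule almost_disjoint_dense_sets[of Y \<beta> d])
  define T where "T b = S b \<inter> (Z - isolated)" for b
  define \<phi> where "\<phi> b y = (if y \<in> T b then forbidden_value f' y else 0)" for b y
  have "\<exists>z. z \<in> T b \<and> regular_at X z (\<lambda>y. f' y + \<phi> b y)" for b
  proof -
    let ?\<phi> = "\<lambda>y. (if y \<in> isolated then forbidden_value f y else 0) + \<phi> b y"
    have "?\<phi> y = 0" if "y \<notin> Z" for y using that by (auto simp: isolated_def \<phi>_def T_def)
    from reg[OF this] obtain W where W: "openin (topo X) W" "W \<inter> Z \<noteq> {}"
        and "\<forall>z\<in>W \<inter> Z. regular_at X z (\<lambda>y. f y + ?\<phi> y)" by meson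
    then have rW: "regular_at X z (\<lambda>y. f' y + \<phi> b y)" if "z \<in> W \<inter> Z" for z
      using that by (simp add: f'_def add.assoc)
    have noiso: "z \<notin> isolated" if z: "z \<in> W" "z \<in> Z" for z
    proof
      assume iso: "z \<in> isolated"
      then obtain V where V: "openin (topo X) V" "V \<inter> Z = {z}" by (auto simp: isolated_def)
      have "nearly_regular z (\<lambda>y. f' y + \<phi> b y)"
        unfolding nearly_regular_def using rW z regular_at_const[of z 0] Z
        by (intro exI[of _ "\<lambda>y. f' y + \<phi> b y"] exI[of _ "\<lambda>_. 0"]) auto
      moreover have "\<not> nearly_regular z (\<lambda>y. f' y + \<phi> b y)"
      proof (rule forbidden_value[OF _ V(1)])
        show "z \<in> points X" "z \<in> V" using z Z V by auto
        fix y assume "y \<in> V"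
        then have "y \<in> Z \<longleftrightarrow> y = z" using V(2) by blast
        then show "f' y + \<phi> b y = f y + (if y = z then forbidden_value f z else 0)"
          using iso by (auto simp: f'_def \<phi>_def T_def isolated_def)
      qed
      ultimately show False by simp
    qed
    obtain z0 where z0: "z0 \<in> W" "z0 \<in> Z" using W(2) by blast
    then obtain U where U: "U \<in> \<U>" "z0 \<in> U" using \<U>(2) Z by blast
    then obtain c where c: "c < length Us" "Us ! c = U" using Us by (metis in_set_conv_nth)
    obtain F where F: "F \<in> poly_fun (mm U)" "F (ch U z0) \<noteq> 0" "{y \<in> U. F (ch U y) \<noteq> 0} \<subseteq> W"
      using chart_basis[OF ch[OF U(1)] W(1) z0(1) U(2)] .
    obtain dd cc where dc: "\<And>z. F z = (\<Sum>i<dd. cc i * monomial_fun (from_nat i) z)"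
      using poly_fun_enumerated_monomials[OF F(1)] by blast
    \<comment> \<open>A basic open neighbourhood inside \<open>W\<close> is given by a combination of the first \<open>dd\<close> monomials.\<close>
    let ?q = "prod_encode (c, dd)" and ?D = "{y \<in> U. F (ch U y) \<noteq> 0} \<inter> Z"
    have D: "?D = {y \<in> Y ?q. (\<Sum>i<d ?q. cc i * \<beta> ?q i y) \<noteq> 0}"
      using c by (auto simp: Y_def d_def \<beta>_def dc)
    have inf: "infinite ?D"
    proof
      assume fin: "finite ?D"
      let ?V = "{y \<in> U. F (ch U y) \<noteq> 0} - (?D - {z0})"
      have "openin (topo X) ?V"
        using chart_poly_open[OF ch[OF U(1)] F(1)] fin by (intro open_minus_finite) auto
      moreover have "?V \<inter> Z = {z0}" using z0 U F(2) by auto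
      ultimately have "z0 \<in> isolated" using z0(2) unfolding isolated_def by blast
      then show False using noiso z0 by blast
    qed
    obtain y where y: "y \<in> S b" "y \<in> Y ?q" "(\<Sum>i<d ?q. cc i * \<beta> ?q i y) \<noteq> 0"
      using S(3)[rule_format, of ?q cc b] inf unfolding D by blast
    then have "y \<in> ?D" using D by blast
    then have "y \<in> W" "y \<in> Z" using F(3) by auto
    then show ?thesis using y(1) noiso rW by (intro exI[of _ y]) (auto simp: T_def)
  qed
  then obtain g where g: "\<And>b. g b \<in> T b" "\<And>b. regular_at X (g b) (\<lambda>y. f' y + \<phi> b y)" by metis
  have "range g \<subseteq> (\<Union>b. S b)" using g(1) by (auto simp: T_def)
  then have "countable (range g)" using S(1) countable_subset by blast
  then obtain b1 b2 b3 where b: "b1 \<noteq> b2" "b1 \<noteq> b3" "b2 \<noteq> b3" "g b1 = g b2" "g b1 = g b3"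
    using three_in_fibre by metis
  define z where "z = g b1"
  have z: "z \<in> T b1" "z \<in> T b2" "z \<in> T b3" using g(1) b by (metis z_def)+
  have zX: "z \<in> points X" using z(1) Z by (auto simp: T_def)
  obtain v w where v: "v \<in> tangent_space X z" "v w \<noteq> 0" using tangents[OF zX] by blast
  note ctx = zX v
  have nr: "nearly_regular z (\<lambda>y. f' y + \<phi> b y)" if "g b = z" for b
    unfolding nearly_regular_def using g(2)[of b] that regular_at_const[OF zX, of 0]
    by (intro exI[of _ "\<lambda>y. f' y + \<phi> b y"] exI[of _ "\<lambda>_. 0"]) auto
  have n1: "nearly_regular z (\<lambda>y. f' y + \<phi> b1 y)" and n2: "nearly_regular z (\<lambda>y. f' y + \<phi> b2 y)"
    and n3: "nearly_regular z (\<lambda>y. f' y + \<phi> b3 y)" using nr b by (auto simp: z_def)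
  let ?k12 = "\<lambda>y. (f' y + \<phi> b1 y) - (f' y + \<phi> b2 y)"
  let ?k13 = "\<lambda>y. (f' y + \<phi> b1 y) - (f' y + \<phi> b3 y)"
  have nk: "nearly_regular z (\<lambda>y. (f' y + \<phi> b1 y) - ?k12 y * ?k13 y)"
    by (intro nearly_regular_diff[OF ctx] nearly_regular_mult[OF ctx] n1 n2 n3)
  \<comment> \<open>Away from this finite set and near \<open>z\<close>, the three supports are disjoint.\<close>
  let ?A = "(S b1 \<inter> S b2) \<union> (S b1 \<inter> S b3) \<union> (S b2 \<inter> S b3)"
  have W: "openin (topo X) (points X - (?A - {z}))"
    using S(2) b by (intro open_minus_finite) auto
  have "\<not> nearly_regular z (\<lambda>y. (f' y + \<phi> b1 y) - ?k12 y * ?k13 y)"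
  proof (rule forbidden_value[OF zX W])
    show "z \<in> points X - (?A - {z})" using zX by simp
    fix y assume y: "y \<in> points X - (?A - {z})"
    show "(f' y + \<phi> b1 y) - ?k12 y * ?k13 y = f' y + (if y = z then forbidden_value f' z else 0)"
    proof (cases "y = z")
      case True
      then show ?thesis using z by (simp add: \<phi>_def)
    next
      case False
      then have "\<not> (y \<in> T b1 \<and> y \<in> T b2)" "\<not> (y \<in> T b1 \<and> y \<in> T b3)" "\<not> (y \<in> T b2 \<and> y \<in> T b3)"
        using y by (auto simp: T_def)
      then show ?thesis using False by (auto simp: \<phi>_def forbidden_value_def)
    qed
  qed
  then show False using nk by simp
qed

text \<open>
  Suppose that \<open>f\<close> is regular at \<open>x\<close> but not within a chart, and that \<open>v f \<noteq> 0\<close>.  If \<open>\<phi>\<close> vanishes on a chart \<open>U\<close>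
  around \<open>x\<close>, then \<open>v (f + \<phi>) = v f \<noteq> 0\<close>, so \<open>f + \<phi>\<close> is regular on a neighbourhood of \<open>x\<close>.  It cannot lie
  in \<open>U\<close>, where \<open>f + \<phi>\<close> agrees with \<open>f\<close>, so it meets the complement of \<open>U\<close>, on which \<open>\<phi>\<close> is arbitrary.
\<close>

lemma germ_reg_if_regular_at:
  assumes "regular_at X x f"
  shows "germ_reg x f"
proof (rule ccontr)
  assume ng: "\<not> germ_reg x f"
  have x: "x \<in> points X" using assms openin_subset unfolding regular_at_def by blast
  obtain v w where v: "v \<in> tangent_space X x" "v w \<noteq> 0" using tangents[OF x] by blast
  note ctx = x v
  have w: "regular_at X x w" by (rule tangent_witness_regular[OF ctx])
  obtain f' where f': "regular_at X x f'" "\<not> germ_reg x f'" "v f' \<noteq> 0"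
  proof -
    consider "\<not> germ_reg x w" | "v f \<noteq> 0" | "germ_reg x w" "v f = 0" by blast
    then show ?thesis
    proof cases
      case 1
      then show ?thesis using that w v by blast
    next
      case 2
      then show ?thesis using that ng assms by blast
    next
      case 3
      then have "v (\<lambda>y. f y + w y) \<noteq> 0" "regular_at X x (\<lambda>y. f y + w y)"
        using tangent_add[OF v(1) assms w] regular_at_add_nonzero[OF ctx assms w] v by auto
      moreover have "\<not> germ_reg x (\<lambda>y. f y + w y)"
        using germ_reg_diff[OF _ 3(1), of "\<lambda>y. f y + w y"] ng by auto
      ultimately show ?thesis using that by blast
    qed
  qed
  obtain U m \<psi> where U: "affine_chart X U m \<psi>" "x \<in> U" using chart_at[OF x] .
  have opU: "openin (topo X) U" using U(1) openin_chart by blast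
  show False
  proof (rule uncountable_regularity_contradiction[of "points X - U" f'])
    fix \<phi> :: "'x \<Rightarrow> 'k"
    assume \<phi>: "\<And>y. y \<notin> points X - U \<Longrightarrow> \<phi> y = 0"
    then have \<phi>U: "\<And>y. y \<in> U \<Longrightarrow> \<phi> y = 0" by blast
    have r: "regular_at X x \<phi>" "v \<phi> = 0"
      by (rule zero_germ_regular[OF opU U(2) \<phi>U], assumption) (rule tangent_zero_germ[OF opU U(2) \<phi>U v(1)])
    then have "regular_at X x (\<lambda>y. f' y + \<phi> y)"
      using regular_at_add_nonzero[OF ctx f'(1)] f'(3) by simp
    then obtain W where W: "openin (topo X) W" "x \<in> W" "(\<lambda>y. f' y + \<phi> y) \<in> reg X W"
      unfolding regular_at_def by blast
    have "\<not> W \<subseteq> U"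
    proof
      assume "W \<subseteq> U"
      then have ic: "in_chart X W" using U(1) unfolding in_chart_def by blast
      have "f' \<in> reg X W" by (rule chart_reg_cong[OF ic W(1,3)]) (use \<phi>U \<open>W \<subseteq> U\<close> in auto)
      then show False using f'(2) ic W unfolding germ_reg_def by blast
    qed
    moreover have "W \<subseteq> points X" using W(1) openin_subset by blast
    ultimately show "\<exists>W. openin (topo X) W \<and> W \<inter> (points X - U) \<noteq> {} \<and>
        (\<forall>z\<in>W \<inter> (points X - U). regular_at X z (\<lambda>y. f' y + \<phi> y))"
      using W unfolding regular_at_def by (intro exI[of _ W]) auto
  qed auto
qed

theorem reg_restrict:
  assumes "openin (topo X) W" "openin (topo X) W'" "W' \<subseteq> W" "f \<in> reg X W"
  shows "f \<in> reg X W'"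
proof (rule reg_glue[OF assms(2)])
  fix x assume x: "x \<in> W'"
  then have "regular_at X x f" using assms unfolding regular_at_def by blast
  then obtain V where V: "openin (topo X) V" "x \<in> V" "in_chart X V" "f \<in> reg X V"
    using germ_reg_if_regular_at unfolding germ_reg_def by blast
  have "openin (topo X) (V \<inter> W')" using V assms by blast
  then show "\<exists>W''. openin (topo X) W'' \<and> x \<in> W'' \<and> W'' \<subseteq> W' \<and> f \<in> reg X W''"
    using chart_reg_restrict[OF V(3,1) _ _ V(4), of "V \<inter> W'"] x V(2) by (intro exI[of _ "V \<inter> W'"]) auto
qed

end

section \<open>Matrix powers and invariant subspaces\<close>

lemma pow_mat_vec_Suc:
  assumes "A \<in> carrier_mat N N" "w \<in> carrier_vec N"
  shows "(A ^\<^sub>m Suc k) *\<^sub>v w = (A ^\<^sub>m k) *\<^sub>v (A *\<^sub>v w)"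
  using assms by (simp add: assoc_mult_mat_vec[of _ N N _ N])

lemma pow_mat_vec_commute:
  assumes "A \<in> carrier_mat N N" "B \<in> carrier_mat N N" "A * B = B * A" "w \<in> carrier_vec N"
  shows "(A ^\<^sub>m k) *\<^sub>v (B *\<^sub>v w) = B *\<^sub>v ((A ^\<^sub>m k) *\<^sub>v w)"
  using assms(4)
proof (induction k arbitrary: w)
  case 0
  then show ?case using assms by simp
next
  case (Suc k)
  have "A *\<^sub>v (B *\<^sub>v w) = B *\<^sub>v (A *\<^sub>v w)"
    using assms(1-3) Suc.prems by (metis assoc_mult_mat_vec)
  then show ?case using Suc assms(1,2)
    by (simp add: pow_mat_vec_Suc[of A N] mult_mat_vec_carrier[of _ N N] del: pow_mat.simps)
qed

lemma pow_mat_vec_add: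
  assumes "A \<in> carrier_mat N N" "w \<in> carrier_vec N"
  shows "(A ^\<^sub>m (j + k)) *\<^sub>v w = (A ^\<^sub>m j) *\<^sub>v ((A ^\<^sub>m k) *\<^sub>v w)"
  using assms(2)
proof (induction k arbitrary: w)
  case 0
  then show ?case using assms(1) by simp
next
  case (Suc k)
  have "(A ^\<^sub>m (j + Suc k)) *\<^sub>v w = (A ^\<^sub>m (j + k)) *\<^sub>v (A *\<^sub>v w)"
    using pow_mat_vec_Suc[OF assms(1) Suc.prems, of "j + k"] by simp
  also have "\<dots> = (A ^\<^sub>m j) *\<^sub>v ((A ^\<^sub>m k) *\<^sub>v (A *\<^sub>v w))"
    using Suc assms(1) by (simp add: mult_mat_vec_carrier[of _ N N])
  also have "(A ^\<^sub>m k) *\<^sub>v (A *\<^sub>v w) = (A ^\<^sub>m Suc k) *\<^sub>v w"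
    using pow_mat_vec_Suc[OF assms(1) Suc.prems, of k] by simp
  finally show ?case .
qed

lemma pow_mat_vec_zero: "A \<in> carrier_mat N N \<Longrightarrow> (A ^\<^sub>m k) *\<^sub>v 0\<^sub>v N = 0\<^sub>v N"
  by (rule eq_vecI) (auto simp: scalar_prod_def)

lemma pow_mat_vec_zero_mono:
  assumes "A \<in> carrier_mat N N" "w \<in> carrier_vec N" "(A ^\<^sub>m j) *\<^sub>v w = 0\<^sub>v N" "j \<le> k"
  shows "(A ^\<^sub>m k) *\<^sub>v w = 0\<^sub>v N"
  using pow_mat_vec_add[OF assms(1,2), of "k - j" j] assms pow_mat_vec_zero[OF assms(1)] by simp

lemma vectors_dependent:
  fixes u :: "nat \<Rightarrow> 'k::field vec"
  shows "\<exists>q :: nat \<Rightarrow> 'k. (\<exists>i\<le>N. q i \<noteq> 0) \<and> (\<forall>a<N. (\<Sum>i\<le>N. q i * u i $ a) = 0)"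
proof -
  define M where "M = mat (Suc N) (Suc N) (\<lambda>(a, i). if a < N then u i $ a else 0)"
  have M: "M \<in> carrier_mat (Suc N) (Suc N)" by (simp add: M_def)
  have "transpose_mat M *\<^sub>v unit_vec (Suc N) N = 0\<^sub>v (Suc N)"
    by (rule eq_vecI) (auto simp: M_def scalar_prod_right_unit)
  moreover have "unit_vec (Suc N) N \<noteq> (0\<^sub>v (Suc N) :: 'k vec)" by simp
  ultimately have "det (transpose_mat M) = 0"
    using det_0_iff_vec_prod_zero[of "transpose_mat M" "Suc N"] M unit_vec_carrier
    by (metis transpose_carrier_mat)
  then have "det M = 0" using det_transpose[OF M] by simp
  then obtain v where v: "v \<in> carrier_vec (Suc N)" "v \<noteq> 0\<^sub>v (Suc N)" "M *\<^sub>v v = 0\<^sub>v (Suc N)"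
    using det_0_iff_vec_prod_zero[OF M] by blast
  have "\<exists>i\<le>N. v $ i \<noteq> 0"
  proof (rule ccontr)
    assume "\<not> ?thesis"
    then have "v = 0\<^sub>v (Suc N)" using v(1) by (intro eq_vecI) (auto simp: less_Suc_eq_le)
    then show False using v(2) by simp
  qed
  moreover have "(\<Sum>i\<le>N. v $ i * u i $ a) = 0" if "a < N" for a
  proof -
    have "0 = (M *\<^sub>v v) $ a" using v(3) that by simp
    also have "\<dots> = (\<Sum>i<Suc N. u i $ a * v $ i)"
      using that v(1) by (simp add: M_def scalar_prod_def atLeast0LessThan)
    finally show ?thesis by (simp add: lessThan_Suc_atMost mult.commute)
  qed
  ultimately show ?thesis by (intro exI[of _ "\<lambda>i. v $ i"]) auto
qed

definition is_subspace :: "nat \<Rightarrow> 'k::field vec set \<Rightarrow> bool" where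
  "is_subspace N E \<longleftrightarrow> E \<subseteq> carrier_vec N \<and>
     (\<forall>u\<in>E. \<forall>w\<in>E. u + w \<in> E) \<and> (\<forall>c. \<forall>w\<in>E. c \<cdot>\<^sub>v w \<in> E)"

text \<open>
  The vectors \<open>w, A w, \<dots>, A\<^sup>N w\<close> are dependent, so that a nonzero polynomial in \<open>A\<close> kills \<open>w\<close>.  When its
  linear factors are applied one after the other, the last nonzero vector is an eigenvector.
\<close>

lemma eigenvector_in_invariant_subspace:
  fixes A :: "'k::alg_closed_field mat"
  assumes A: "A \<in> carrier_mat N N" and E: "is_subspace N E" and inv: "\<And>w. w \<in> E \<Longrightarrow> A *\<^sub>v w \<in> E"
    and w: "w \<in> E" "w \<noteq> 0\<^sub>v N"
  shows "\<exists>e\<in>E. e \<noteq> 0\<^sub>v N \<and> (\<exists>\<mu>. A *\<^sub>v e = \<mu> \<cdot>\<^sub>v e)"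
proof -
  define ev where "ev q w = vec N (\<lambda>a. \<Sum>i\<le>degree q. coeff q i * ((A ^\<^sub>m i) *\<^sub>v w) $ a)" for q w
  have ev_bound: "ev q w $ a = (\<Sum>i\<le>d. coeff q i * ((A ^\<^sub>m i) *\<^sub>v w) $ a)" if "degree q \<le> d" "a < N" for q w d a
    using that unfolding ev_def by (simp, intro sum.mono_neutral_left) (auto simp: coeff_eq_0)
  have step: "ev ([:- \<mu>, 1:] * q) w = ev q (A *\<^sub>v w - \<mu> \<cdot>\<^sub>v w)" if w: "w \<in> carrier_vec N" for \<mu> q w
  proof (rule eq_vecI)
    show "dim_vec (ev ([:- \<mu>, 1:] * q) w) = dim_vec (ev q (A *\<^sub>v w - \<mu> \<cdot>\<^sub>v w))" by (simp add: ev_def)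
    fix a assume "a < dim_vec (ev q (A *\<^sub>v w - \<mu> \<cdot>\<^sub>v w))"
    then have a: "a < N" by (simp add: ev_def)
    let ?d = "degree q"
    let ?x = "\<lambda>i. ((A ^\<^sub>m i) *\<^sub>v w) $ a"
    have "degree ([:- \<mu>, 1:] * q) \<le> Suc ?d" by (rule order_trans[OF degree_mult_le]) simp
    from ev_bound[OF this a] have "ev ([:- \<mu>, 1:] * q) w $ a = (\<Sum>i\<le>Suc ?d. coeff ([:- \<mu>, 1:] * q) i * ?x i)" .
    also have "\<dots> = (\<Sum>i\<le>Suc ?d. (case i of 0 \<Rightarrow> 0 | Suc i \<Rightarrow> coeff q i * ?x (Suc i)) - \<mu> * coeff q i * ?x i)"
      by (intro sum.cong refl) (auto simp: coeff_pCons split: nat.splits simp: algebra_simps)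
    also have "\<dots> = (\<Sum>i\<le>?d. coeff q i * ?x (Suc i)) - (\<Sum>i\<le>Suc ?d. \<mu> * coeff q i * ?x i)"
      unfolding sum_subtractf by (simp add: sum.atMost_Suc_shift del: sum.atMost_Suc)
    also have "\<dots> = (\<Sum>i\<le>?d. coeff q i * (?x (Suc i) - \<mu> * ?x i))"
      by (simp add: coeff_eq_0 sum_subtractf right_diff_distrib mult_ac)
    also have "\<dots> = (\<Sum>i\<le>?d. coeff q i * ((A ^\<^sub>m i) *\<^sub>v (A *\<^sub>v w - \<mu> \<cdot>\<^sub>v w)) $ a)"
    proof (intro sum.cong refl)
      fix i
      have Ai: "A ^\<^sub>m i \<in> carrier_mat N N" and Aw: "A *\<^sub>v w \<in> carrier_vec N" "\<mu> \<cdot>\<^sub>v w \<in> carrier_vec N"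
        using A w by auto
      have "(A ^\<^sub>m i) *\<^sub>v (A *\<^sub>v w - \<mu> \<cdot>\<^sub>v w) = (A ^\<^sub>m Suc i) *\<^sub>v w - \<mu> \<cdot>\<^sub>v ((A ^\<^sub>m i) *\<^sub>v w)"
        using mult_minus_distrib_mat_vec[OF Ai Aw] mult_mat_vec[OF Ai w] pow_mat_vec_Suc[OF A w] by simp
      then show "coeff q i * (?x (Suc i) - \<mu> * ?x i) = coeff q i * ((A ^\<^sub>m i) *\<^sub>v (A *\<^sub>v w - \<mu> \<cdot>\<^sub>v w)) $ a"
        using a A w by simp
    qed
    also have "\<dots> = ev q (A *\<^sub>v w - \<mu> \<cdot>\<^sub>v w) $ a" using a by (simp add: ev_def)
    finally show "ev ([:- \<mu>, 1:] * q) w $ a = ev q (A *\<^sub>v w - \<mu> \<cdot>\<^sub>v w) $ a" .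
  qed
  have main: "w \<in> E \<Longrightarrow> w \<noteq> 0\<^sub>v N \<Longrightarrow> q \<noteq> 0 \<Longrightarrow> ev q w = 0\<^sub>v N \<Longrightarrow> ?thesis" for q w
  proof (induction "degree q" arbitrary: q w)
    case 0
    then obtain c where c: "q = [:c:]" "c \<noteq> 0" by (metis degree_eq_zeroE pCons_0_0)
    have wN: "w \<in> carrier_vec N" using 0 E by (auto simp: is_subspace_def)
    have "w = 0\<^sub>v N"
    proof (rule eq_vecI)
      fix a assume "a < dim_vec (0\<^sub>v N :: 'k vec)"
      then have "c * w $ a = ev q w $ a" using wN A c by (simp add: ev_def)
      then show "w $ a = 0\<^sub>v N $ a" using 0 c \<open>a < _\<close> by simp
    qed (use wN in simp)
    then show ?case using 0 by simp
  next
    case (Suc d)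
    then obtain \<mu> where "poly q \<mu> = 0" using alg_closed_imp_poly_has_root[of q] by auto
    then obtain q' where q': "q = [:- \<mu>, 1:] * q'" using poly_eq_0_iff_dvd by blast
    have wN: "w \<in> carrier_vec N" using Suc E by (auto simp: is_subspace_def)
    have q'0: "q' \<noteq> 0" using q' Suc by auto
    then have d: "d = degree q'" using Suc(2) q' by (simp add: degree_mult_eq del: mult_pCons_left)
    let ?w = "A *\<^sub>v w - \<mu> \<cdot>\<^sub>v w"
    have wE: "?w \<in> E"
    proof -
      have "?w = A *\<^sub>v w + (- \<mu>) \<cdot>\<^sub>v w" using wN A by (intro eq_vecI) auto
      then show ?thesis using E inv Suc(3) by (auto simp: is_subspace_def)
    qed
    show ?case
    proof (cases "?w = 0\<^sub>v N")
      case True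
      have "A *\<^sub>v w = \<mu> \<cdot>\<^sub>v w"
      proof (rule eq_vecI)
        fix a assume a: "a < dim_vec (\<mu> \<cdot>\<^sub>v w)"
        have "?w $ a = 0" using True a wN by simp
        then show "(A *\<^sub>v w) $ a = (\<mu> \<cdot>\<^sub>v w) $ a" using a wN A by simp
      qed (use wN A in simp)
      then show ?thesis using Suc by blast
    next
      case False
      have "ev q' ?w = 0\<^sub>v N" using step[OF wN, of \<mu> q'] Suc(6) q' by simp
      then show ?thesis using Suc(1)[OF d wE False q'0] by blast
    qed
  qed
  obtain q where q: "\<exists>i\<le>N. q i \<noteq> 0" "\<forall>a<N. (\<Sum>i\<le>N. q i * ((A ^\<^sub>m i) *\<^sub>v w) $ a) = 0"
    using vectors_dependent[of N "\<lambda>i. (A ^\<^sub>m i) *\<^sub>v w"] by blast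
  define Q where "Q = (\<Sum>i\<le>N. monom (q i) i)"
  have cQ: "coeff Q i = (if i \<le> N then q i else 0)" for i by (simp add: Q_def coeff_sum)
  have "degree Q \<le> N" by (rule degree_le) (simp add: cQ)
  have "ev Q w = 0\<^sub>v N"
  proof (rule eq_vecI)
    fix a assume "a < dim_vec (0\<^sub>v N :: 'k vec)"
    then show "ev Q w $ a = 0\<^sub>v N $ a" using ev_bound[OF \<open>degree Q \<le> N\<close>, of a w] q(2) by (simp add: cQ)
  qed (simp add: ev_def)
  moreover have "Q \<noteq> 0" using q(1) cQ by (metis coeff_0)
  ultimately show ?thesis using main w by blast
qed

text \<open>
  If \<open>h\<close> is the least exponent with \<open>A\<^sup>h w = 0\<close>, the vectors \<open>w, A w, \<dots>, A\<^bsup>h-1\<^esup> w\<close> are independent.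
\<close>

lemma mat_kernel_power_stable:
  fixes A :: "'k::field mat"
  assumes A: "A \<in> carrier_mat N N" and w: "w \<in> carrier_vec N" and z: "(A ^\<^sub>m k) *\<^sub>v w = 0\<^sub>v N"
  shows "(A ^\<^sub>m N) *\<^sub>v w = 0\<^sub>v N"
proof (rule ccontr)
  assume nz: "(A ^\<^sub>m N) *\<^sub>v w \<noteq> 0\<^sub>v N"
  define h where "h = (LEAST h. (A ^\<^sub>m h) *\<^sub>v w = 0\<^sub>v N)"
  have h: "(A ^\<^sub>m h) *\<^sub>v w = 0\<^sub>v N" unfolding h_def by (rule LeastI[of _ k]) (rule z)
  have hN: "N < h" using nz pow_mat_vec_zero_mono[OF A w h, of N] by (meson not_le)
  obtain q where q: "\<exists>i\<le>N. q i \<noteq> 0" "\<forall>a<N. (\<Sum>i\<le>N. q i * ((A ^\<^sub>m i) *\<^sub>v w) $ a) = 0"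
    using vectors_dependent[of N "\<lambda>i. (A ^\<^sub>m i) *\<^sub>v w"] by blast
  define i0 where "i0 = (LEAST i. q i \<noteq> 0)"
  have i0: "q i0 \<noteq> 0" "i0 \<le> N" "\<And>i. i < i0 \<Longrightarrow> q i = 0"
    using q(1) LeastI[of "\<lambda>i. q i \<noteq> 0"] Least_le[of "\<lambda>i. q i \<noteq> 0"] not_less_Least[of _ "\<lambda>i. q i \<noteq> 0"]
    unfolding i0_def by (blast, meson order_trans, blast)
  let ?j = "h - 1 - i0"
  have Aj: "A ^\<^sub>m ?j \<in> carrier_mat N N" using A by simp
  have "q i0 * ((A ^\<^sub>m (h - 1)) *\<^sub>v w) $ a = 0" if a: "a < N" for a
  proof -
    let ?B = "A ^\<^sub>m ?j"
    have "0 = (\<Sum>b<N. ?B $$ (a, b) * (\<Sum>i\<le>N. q i * ((A ^\<^sub>m i) *\<^sub>v w) $ b))"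
      using q(2) by simp
    also have "\<dots> = (\<Sum>i\<le>N. q i * (\<Sum>b<N. ?B $$ (a, b) * ((A ^\<^sub>m i) *\<^sub>v w) $ b))"
      unfolding sum_distrib_left by (subst sum.swap) (simp add: mult_ac)
    also have "\<dots> = (\<Sum>i\<le>N. q i * ((A ^\<^sub>m (?j + i)) *\<^sub>v w) $ a)"
    proof (intro sum.cong refl)
      fix i
      have "(?B *\<^sub>v ((A ^\<^sub>m i) *\<^sub>v w)) $ a = (\<Sum>b<N. ?B $$ (a, b) * ((A ^\<^sub>m i) *\<^sub>v w) $ b)"
        using a A Aj by (simp add: scalar_prod_def atLeast0LessThan)
      then show "q i * (\<Sum>b<N. ?B $$ (a, b) * ((A ^\<^sub>m i) *\<^sub>v w) $ b) = q i * ((A ^\<^sub>m (?j + i)) *\<^sub>v w) $ a"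
        by (simp add: pow_mat_vec_add[OF A w])
    qed
    also have "\<dots> = (\<Sum>i\<in>{i0}. q i * ((A ^\<^sub>m (?j + i)) *\<^sub>v w) $ a)"
    proof (rule sum.mono_neutral_right)
      show "\<forall>i\<in>{..N} - {i0}. q i * ((A ^\<^sub>m (?j + i)) *\<^sub>v w) $ a = 0"
      proof
        fix i assume "i \<in> {..N} - {i0}"
        then consider "i < i0" | "h \<le> ?j + i" using hN i0(2) by fastforce
        then show "q i * ((A ^\<^sub>m (?j + i)) *\<^sub>v w) $ a = 0"
          using i0(3) pow_mat_vec_zero_mono[OF A w h, of "?j + i"] a by cases auto
      qed
    qed (use i0 in auto)
    finally show ?thesis using hN i0(2) by simp
  qed
  then have "(A ^\<^sub>m (h - 1)) *\<^sub>v w = 0\<^sub>v N" using i0(1) A w by (intro eq_vecI) auto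
  then have "h \<le> h - 1" unfolding h_def by (rule Least_le)
  then show False using hN by simp
qed

section \<open>Dimensions of generalized eigenspaces\<close>

abbreviation subspace_dim :: "nat \<Rightarrow> 'k::field vec set \<Rightarrow> nat" where
  "subspace_dim N E \<equiv> vectorspace.dim class_ring ((module_vec TYPE('k) N)\<lparr>carrier := E\<rparr>)"

lemma mat_inverse_exists:
  fixes A :: "'k::field mat"
  assumes A: "A \<in> carrier_mat n n" and "det A \<noteq> 0"
  obtains B where "B \<in> carrier_mat n n" "A * B = 1\<^sub>m n" "B * A = 1\<^sub>m n"
  using det_non_zero_imp_unit[OF assms, of undefined] that
  by (auto simp: Units_def ring_mat_def)

lemma extend_to_invertible_matrix:
  fixes e :: "'k::field vec"
  assumes e: "e \<in> carrier_vec (Suc M)" "e \<noteq> 0\<^sub>v (Suc M)"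
  obtains P Q where "P \<in> carrier_mat (Suc M) (Suc M)" "Q \<in> carrier_mat (Suc M) (Suc M)"
    "P * Q = 1\<^sub>m (Suc M)" "Q * P = 1\<^sub>m (Suc M)" "P *\<^sub>v unit_vec (Suc M) 0 = e"
proof -
  let ?n = "Suc M"
  obtain i where i: "i < ?n" "e $ i \<noteq> 0"
  proof (rule ccontr)
    assume "\<not> thesis"
    then have "e = 0\<^sub>v ?n" using e(1) that by (intro eq_vecI) auto
    then show False using e(2) by simp
  qed
  define P where "P = mat ?n ?n (\<lambda>(a, b). if b = 0 then e $ a else if b = i then of_bool (a = 0) else of_bool (a = b))"
  have P: "P \<in> carrier_mat ?n ?n" by (simp add: P_def)
  have "det P \<noteq> 0"
  proof
    assume "det P = 0"
    then obtain x where x: "x \<in> carrier_vec ?n" "x \<noteq> 0\<^sub>v ?n" "P *\<^sub>v x = 0\<^sub>v ?n"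
      using det_0_iff_vec_prod_zero[OF P] by blast
    have Px: "(\<Sum>b<?n. P $$ (a, b) * x $ b) = 0" if "a < ?n" for a
    proof -
      have "(P *\<^sub>v x) $ a = (\<Sum>b<?n. P $$ (a, b) * x $ b)"
        using that P x(1) by (simp add: scalar_prod_def atLeast0LessThan)
      then show ?thesis using x(3) that by simp
    qed
    have "(\<Sum>b<?n. P $$ (i, b) * x $ b) = (\<Sum>b\<in>{0}. P $$ (i, b) * x $ b)"
      using i(1) by (intro sum.mono_neutral_right) (auto simp: P_def)
    then have x0: "x $ 0 = 0" using Px[OF i(1)] i by (simp add: P_def)
    have "x $ b = 0" if b: "b < ?n" for b
    proof (cases "b = 0")
      case False
      define a where "a = (if b = i then 0 else b)"
      have a: "a < ?n" using b by (simp add: a_def)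
      have "(\<Sum>c<?n. P $$ (a, c) * x $ c) = (\<Sum>c\<in>{b}. P $$ (a, c) * x $ c)"
        using b a False x0 i(1) by (intro sum.mono_neutral_right) (auto simp: P_def a_def)
      then show ?thesis using Px[OF a] b a False by (simp add: P_def a_def split: if_splits)
    qed (use x0 in simp)
    then have "x = 0\<^sub>v ?n" using x(1) by (intro eq_vecI) auto
    then show False using x(2) by simp
  qed
  then obtain Q where Q: "Q \<in> carrier_mat ?n ?n" "P * Q = 1\<^sub>m ?n" "Q * P = 1\<^sub>m ?n"
    using mat_inverse_exists[OF P] by blast
  have "P *\<^sub>v unit_vec ?n 0 = e"
    using e by (intro eq_vecI) (auto simp: P_def scalar_prod_right_unit)
  then show thesis using that P Q by blast
qed

lemma det_pow_mat:
  assumes "A \<in> carrier_mat n n"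
  shows "det (A ^\<^sub>m k) = det A ^ k"
  using assms by (induction k) (simp_all add: det_mult[of _ n] mult.commute)

text \<open>
  The \<open>k\<close>-th power sends \<open>(a, d)\<close> to \<open>(c D\<^bsup>k-1\<^esup> d, D\<^sup>k d)\<close>, and since \<open>k > M\<close> the matrices \<open>D\<^sup>k\<close> and \<open>D\<^bsup>k-1\<^esup>\<close>
  have the same kernel.
\<close>

lemma block_power_kernel:
  fixes c D :: "'k::field mat"
  assumes c: "c \<in> carrier_mat 1 M" and D: "D \<in> carrier_mat M M" and k: "Suc M \<le> k"
  shows "mat_kernel ((four_block_mat (0\<^sub>m 1 1) c (0\<^sub>m M 1) D) ^\<^sub>m k) =
    mat_kernel (four_block_mat (0\<^sub>m 1 1) (0\<^sub>m 1 M) (0\<^sub>m M 1) (D ^\<^sub>m k))"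
proof -
  let ?T = "four_block_mat (0\<^sub>m 1 1) c (0\<^sub>m M 1) D"
  let ?R = "four_block_mat (0\<^sub>m 1 1) (0\<^sub>m 1 M) (0\<^sub>m M 1) (D ^\<^sub>m k)"
  have T: "?T \<in> carrier_mat (1 + M) (1 + M)" using D by auto
  have R: "?R \<in> carrier_mat (1 + M) (1 + M)" using D by auto
  have z11: "0\<^sub>m 1 1 \<in> carrier_mat 1 1" "0\<^sub>m M 1 \<in> carrier_mat M 1" "0\<^sub>m 1 M \<in> carrier_mat 1 M" by auto
  have Tv: "?T *\<^sub>v (a @\<^sub>v d) = (c *\<^sub>v d) @\<^sub>v (D *\<^sub>v d)" if "a \<in> carrier_vec 1" "d \<in> carrier_vec M" for a d
  proof -
    have "0\<^sub>m 1 1 *\<^sub>v a = 0\<^sub>v 1" "0\<^sub>m M 1 *\<^sub>v a = 0\<^sub>v M"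
      using that(1) by (auto intro!: eq_vecI simp: scalar_prod_def)
    moreover have "c *\<^sub>v d \<in> carrier_vec 1" "D *\<^sub>v d \<in> carrier_vec M" using that c D by auto
    ultimately show ?thesis using four_block_mat_mult_vec[OF z11(1) c z11(2) D that] by simp
  qed
  have Tpow: "(?T ^\<^sub>m Suc j) *\<^sub>v (a @\<^sub>v d) = (c *\<^sub>v ((D ^\<^sub>m j) *\<^sub>v d)) @\<^sub>v ((D ^\<^sub>m Suc j) *\<^sub>v d)"
    if "a \<in> carrier_vec 1" "d \<in> carrier_vec M" for a d j
    using that
  proof (induction j arbitrary: a d)
    case 0
    then show ?case using Tv[OF 0] T c D by (simp add: left_mult_one_mat[OF T])
  next
    case (Suc j)
    have "a @\<^sub>v d \<in> carrier_vec (1 + M)" using Suc.prems by (rule append_carrier_vec)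
    from pow_mat_vec_Suc[OF T this, of "Suc j"]
    have "(?T ^\<^sub>m Suc (Suc j)) *\<^sub>v (a @\<^sub>v d) = (?T ^\<^sub>m Suc j) *\<^sub>v ((c *\<^sub>v d) @\<^sub>v (D *\<^sub>v d))"
      unfolding Tv[OF Suc.prems] .
    also have "\<dots> = (c *\<^sub>v ((D ^\<^sub>m j) *\<^sub>v (D *\<^sub>v d))) @\<^sub>v ((D ^\<^sub>m Suc j) *\<^sub>v (D *\<^sub>v d))"
      using Suc.prems c D by (intro Suc.IH) auto
    finally show ?case unfolding pow_mat_vec_Suc[OF D Suc.prems(2)] .
  qed
  have Rv: "?R *\<^sub>v (a @\<^sub>v d) = 0\<^sub>v 1 @\<^sub>v ((D ^\<^sub>m k) *\<^sub>v d)" if "a \<in> carrier_vec 1" "d \<in> carrier_vec M" for a d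
  proof -
    have "0\<^sub>m 1 1 *\<^sub>v a = 0\<^sub>v 1" "0\<^sub>m M 1 *\<^sub>v a = 0\<^sub>v M" "0\<^sub>m 1 M *\<^sub>v d = 0\<^sub>v 1"
      using that by (auto intro!: eq_vecI simp: scalar_prod_def)
    moreover have "(D ^\<^sub>m k) *\<^sub>v d \<in> carrier_vec M"
      using that(2) by (rule mult_mat_vec_carrier[OF pow_carrier_mat[OF D]])
    ultimately show ?thesis
      using four_block_mat_mult_vec[OF z11(1,3,2) pow_carrier_mat[OF D] that] by simp
  qed
  have zero: "0\<^sub>v (1 + M) = 0\<^sub>v 1 @\<^sub>v (0\<^sub>v M :: 'k vec)" by auto
  have iff: "(?T ^\<^sub>m k) *\<^sub>v w = 0\<^sub>v (1 + M) \<longleftrightarrow> ?R *\<^sub>v w = 0\<^sub>v (1 + M)" if w: "w \<in> carrier_vec (1 + M)" for w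
  proof -
    define a d where "a = vec_first w 1" and "d = vec_last w M"
    have wad: "w = a @\<^sub>v d" and ad: "a \<in> carrier_vec 1" "d \<in> carrier_vec M"
      using vec_first_last_append[OF w] by (auto simp: a_def d_def vec_first_def vec_last_def)
    obtain j where j: "k = Suc j" "M \<le> j" using k by (cases k) auto
    have cz: "c *\<^sub>v 0\<^sub>v M = 0\<^sub>v 1" using c by (intro eq_vecI) (auto simp: scalar_prod_def)
    have car: "c *\<^sub>v ((D ^\<^sub>m j) *\<^sub>v d) \<in> carrier_vec 1"
      by (rule mult_mat_vec_carrier[OF c mult_mat_vec_carrier[OF pow_carrier_mat[OF D] ad(2)]])
    have "(?T ^\<^sub>m k) *\<^sub>v w = 0\<^sub>v (1 + M) \<longleftrightarrow> c *\<^sub>v ((D ^\<^sub>m j) *\<^sub>v d) = 0\<^sub>v 1 \<and> (D ^\<^sub>m k) *\<^sub>v d = 0\<^sub>v M"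
      unfolding zero wad j(1) Tpow[OF ad] by (rule append_vec_eq[OF car zero_carrier_vec])
    also have "\<dots> \<longleftrightarrow> (D ^\<^sub>m k) *\<^sub>v d = 0\<^sub>v M"
    proof
      assume "(D ^\<^sub>m k) *\<^sub>v d = 0\<^sub>v M"
      then have "(D ^\<^sub>m j) *\<^sub>v d = 0\<^sub>v M"
        using mat_kernel_power_stable[OF D ad(2)] pow_mat_vec_zero_mono[OF D ad(2) _ j(2)] by blast
      then show "c *\<^sub>v ((D ^\<^sub>m j) *\<^sub>v d) = 0\<^sub>v 1 \<and> (D ^\<^sub>m k) *\<^sub>v d = 0\<^sub>v M"
        using cz \<open>(D ^\<^sub>m k) *\<^sub>v d = 0\<^sub>v M\<close> by simp
    qed simp
    also have "\<dots> \<longleftrightarrow> ?R *\<^sub>v w = 0\<^sub>v (1 + M)"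
      unfolding zero wad Rv[OF ad] by (subst append_vec_eq[OF zero_carrier_vec zero_carrier_vec]) simp
    finally show ?thesis .
  qed
  then show ?thesis
    using mat_kernel[OF pow_carrier_mat[OF T]] mat_kernel[OF R] by auto
qed

text \<open>
  If \<open>\<mu>\<close> is an eigenvalue, conjugation by a matrix whose first column is an eigenvector makes \<open>A\<close> block
  triangular, and splitting off this block lowers both numbers by 1.
\<close>

lemma subspace_dim_kernel_char_matrix_power:
  fixes A :: "'k::field mat"
  assumes "A \<in> carrier_mat N N" "N \<le> k"
  shows "subspace_dim N (mat_kernel (char_matrix A \<mu> ^\<^sub>m k)) = Polynomial.order \<mu> (char_poly A)"
  using assms
proof (induction N arbitrary: A k)
  case 0
  have z: "mat_kernel (char_matrix A \<mu> ^\<^sub>m k) = mat_kernel (1\<^sub>m 0)"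
    using 0(1) by (auto simp: mat_kernel[of _ 0 0] char_matrix_def intro!: eq_vecI)
  have "char_poly A = 1" using 0 by (simp add: char_poly_def char_poly_matrix_def det_dim_zero)
  then show ?case using kernel_one_mat(1)[of 0, where 'a = 'k] unfolding z by simp
next
  case (Suc M A k)
  let ?n = "Suc M"
  note A = Suc.prems(1)
  show ?case
  proof (cases "eigenvalue A \<mu>")
    case False
    then have "det (char_matrix A \<mu>) \<noteq> 0" using eigenvalue_det[OF A] by simp
    then have "det (char_matrix A \<mu> ^\<^sub>m k) \<noteq> 0"
      using A by (simp add: det_pow_mat[of _ ?n])
    then have "mat_kernel (char_matrix A \<mu> ^\<^sub>m k) = mat_kernel (1\<^sub>m ?n)"
      using det_0_iff_vec_prod_zero[of "char_matrix A \<mu> ^\<^sub>m k" ?n] A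
      by (auto simp: mat_kernel[of _ ?n ?n] pow_mat_vec_zero)
    moreover have "poly (char_poly A) \<mu> \<noteq> 0" using False eigenvalue_root_char_poly[OF A] by simp
    ultimately show ?thesis using kernel_one_mat(1)[of ?n, where 'a = 'k] by (simp add: order_0I)
  next
    case True
    then obtain e where "eigenvector A e \<mu>" unfolding eigenvalue_def by blast
    then have e: "e \<in> carrier_vec ?n" "e \<noteq> 0\<^sub>v ?n" "A *\<^sub>v e = \<mu> \<cdot>\<^sub>v e"
      using A by (auto simp: eigenvector_def)
    obtain P Q where P: "P \<in> carrier_mat ?n ?n" and Q: "Q \<in> carrier_mat ?n ?n"
      and PQ: "P * Q = 1\<^sub>m ?n" "Q * P = 1\<^sub>m ?n" and Pe: "P *\<^sub>v unit_vec ?n 0 = e"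
      using extend_to_invertible_matrix[OF e(1,2)] by blast
    define B where "B = Q * A * P"
    have B: "B \<in> carrier_mat ?n ?n" using A P Q by (simp add: B_def)
    have APBQ: "A = P * B * Q"
    proof -
      have "P * B * Q = (P * Q) * A * (P * Q)"
        unfolding B_def using A P Q by (simp add: assoc_mult_mat[of _ ?n ?n _ ?n _ ?n])
      then show ?thesis using A PQ by simp
    qed
    have wit: "similar_mat_wit A B P Q" by (rule similar_mat_witI[OF PQ APBQ A B P Q])
    have witc: "similar_mat_wit (char_matrix A \<mu>) (char_matrix B \<mu>) P Q"
      using similar_mat_wit_char_matrix[OF wit] .
    have Qe: "Q *\<^sub>v e = unit_vec ?n 0"
    proof -
      have "Q *\<^sub>v e = (Q * P) *\<^sub>v unit_vec ?n 0"
        unfolding Pe[symmetric] using Q P by (simp add: assoc_mult_mat_vec[of _ ?n ?n _ ?n])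
      then show ?thesis using PQ by simp
    qed
    have "B *\<^sub>v unit_vec ?n 0 = Q *\<^sub>v (A *\<^sub>v (P *\<^sub>v unit_vec ?n 0))"
      unfolding B_def using A P Q by (simp add: assoc_mult_mat_vec[of _ ?n ?n _ ?n])
    also have "\<dots> = \<mu> \<cdot>\<^sub>v unit_vec ?n 0"
      using Pe e mult_mat_vec[OF Q e(1), of \<mu>] Qe by simp
    finally have B0: "B *\<^sub>v unit_vec ?n 0 = \<mu> \<cdot>\<^sub>v unit_vec ?n 0" .
    have col0: "B $$ (a, 0) = (if a = 0 then \<mu> else 0)" if "a < ?n" for a
    proof -
      have "B $$ (a, 0) = (B *\<^sub>v unit_vec ?n 0) $ a" using B that by (simp add: scalar_prod_right_unit)
      then show ?thesis unfolding B0 using that by simp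
    qed
    obtain B1 B2 B3 B4 where split: "split_block B 1 1 = (B1, B2, B3, B4)" by (metis prod_cases4)
    have dims: "dim_row B = 1 + M" "dim_col B = 1 + M" using B by auto
    note sb = split_block[OF split dims]
    have B1: "B1 = \<mu> \<cdot>\<^sub>m 1\<^sub>m 1"
    proof (rule eq_matI)
      fix i j assume "i < dim_row (\<mu> \<cdot>\<^sub>m 1\<^sub>m 1 :: 'k mat)" "j < dim_col (\<mu> \<cdot>\<^sub>m 1\<^sub>m 1 :: 'k mat)"
      then show "B1 $$ (i, j) = (\<mu> \<cdot>\<^sub>m 1\<^sub>m 1) $$ (i, j)"
        using split col0[of 0] by (auto simp: split_block_def Let_def)
    qed (use sb(1) in auto)
    have B3: "B3 = 0\<^sub>m M 1"
    proof (rule eq_matI)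
      fix i j assume "i < dim_row (0\<^sub>m M 1 :: 'k mat)" "j < dim_col (0\<^sub>m M 1 :: 'k mat)"
      then show "B3 $$ (i, j) = 0\<^sub>m M 1 $$ (i, j)"
        using split col0[of "Suc i"] dims by (auto simp: split_block_def Let_def)
    qed (use sb(3) in auto)
    have Bb: "B = four_block_mat B1 B2 (0\<^sub>m M 1) B4" using sb(5) B3 by simp
    have cB: "char_matrix B \<mu> = four_block_mat (0\<^sub>m 1 1) B2 (0\<^sub>m M 1) (char_matrix B4 \<mu>)"
    proof (rule eq_matI)
      fix i j
      assume "i < dim_row (four_block_mat (0\<^sub>m 1 1) B2 (0\<^sub>m M 1) (char_matrix B4 \<mu>))"
        "j < dim_col (four_block_mat (0\<^sub>m 1 1) B2 (0\<^sub>m M 1) (char_matrix B4 \<mu>))"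
      then have ij: "i < ?n" "j < ?n" using sb(4) by (auto simp: char_matrix_def)
      have "B $$ (i, j) = four_block_mat B1 B2 (0\<^sub>m M 1) B4 $$ (i, j)" using Bb by simp
      then show "char_matrix B \<mu> $$ (i, j) = four_block_mat (0\<^sub>m 1 1) B2 (0\<^sub>m M 1) (char_matrix B4 \<mu>) $$ (i, j)"
        using ij sb B B1 by (auto simp: char_matrix_def)
    qed (use B sb(4) in \<open>auto simp: char_matrix_def\<close>)
    have cB4: "char_matrix B4 \<mu> \<in> carrier_mat M M" using sb(4) by simp
    have "subspace_dim ?n (mat_kernel (char_matrix A \<mu> ^\<^sub>m k)) = subspace_dim ?n (mat_kernel (char_matrix B \<mu> ^\<^sub>m k))"
      by (rule similar_mat_wit_kernel_dim[OF _ similar_mat_wit_pow[OF witc]]) (use A in simp)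
    also have "mat_kernel (char_matrix B \<mu> ^\<^sub>m k) = mat_kernel (four_block_mat (0\<^sub>m 1 1) (0\<^sub>m 1 M) (0\<^sub>m M 1) (char_matrix B4 \<mu> ^\<^sub>m k))"
      unfolding cB by (rule block_power_kernel[OF sb(2) cB4 Suc.prems(2)])
    also have "subspace_dim ?n \<dots> = subspace_dim (1 + M) (mat_kernel (four_block_mat (0\<^sub>m 1 1) (0\<^sub>m 1 M) (0\<^sub>m M 1) (char_matrix B4 \<mu> ^\<^sub>m k)))" by simp
    also have "\<dots> = subspace_dim 1 (mat_kernel (0\<^sub>m 1 1 :: 'k mat)) + subspace_dim M (mat_kernel (char_matrix B4 \<mu> ^\<^sub>m k))"
      by (rule kernel_four_block_0_mat[OF refl]) (use cB4 in auto)
    also have "subspace_dim M (mat_kernel (char_matrix B4 \<mu> ^\<^sub>m k)) = Polynomial.order \<mu> (char_poly B4)"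
      using Suc.IH[OF sb(4), of k] Suc.prems(2) by simp
    also have "subspace_dim 1 (mat_kernel (0\<^sub>m 1 1 :: 'k mat)) = 1"
    proof -
      have "mat_kernel (0\<^sub>m 1 1 :: 'k mat) = carrier_vec 1" by (auto simp: mat_kernel[of _ 1 1])
      moreover have "(module_vec TYPE('k) 1)\<lparr>carrier := carrier_vec 1\<rparr> = module_vec TYPE('k) 1"
        by (simp add: module_vec_def)
      ultimately show ?thesis using vec_space.dim_is_n[where 'a = 'k, of 1] by simp
    qed
    also have "1 + Polynomial.order \<mu> (char_poly B4) = Polynomial.order \<mu> (char_poly A)"
    proof -
      have "char_poly A = char_poly B" by (rule char_poly_similar) (use wit in \<open>auto simp: similar_mat_def\<close>)
      also have "\<dots> = char_poly B1 * char_poly B4"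
        unfolding Bb by (rule char_poly_four_block_zeros_col[OF sb(1,2,4)])
      also have "char_poly B1 = [:- \<mu>, 1:]"
        unfolding B1 by (subst char_poly_upper_triangular[of _ 1]) (auto simp: upper_triangular_def diag_mat_def)
      finally have "char_poly A = [:- \<mu>, 1:] * char_poly B4" .
      moreover have "char_poly B4 \<noteq> 0" using degree_monic_char_poly[OF sb(4)] by auto
      then have "[:- \<mu>, 1:] * char_poly B4 \<noteq> 0" by (simp only: mult_eq_0_iff) simp
      from order_mult[OF this, of \<mu>]
      have "Polynomial.order \<mu> ([:- \<mu>, 1:] * char_poly B4) = 1 + Polynomial.order \<mu> (char_poly B4)"
        using order_power_n_n[of \<mu> 1] by (simp only: power_one_right)
      ultimately show ?thesis by (simp only:)
    qed
    finally show ?thesis .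
  qed
qed

section \<open>Joint spectra of commuting matrices\<close>

lemma is_subspaceD:
  assumes "is_subspace N E"
  shows "w \<in> E \<Longrightarrow> w \<in> carrier_vec N" "u \<in> E \<Longrightarrow> w \<in> E \<Longrightarrow> u + w \<in> E" "w \<in> E \<Longrightarrow> c \<cdot>\<^sub>v w \<in> E"
  using assms by (auto simp: is_subspace_def)

lemma is_subspace_image:
  fixes T :: "'k::field mat"
  assumes "T \<in> carrier_mat N N" "is_subspace N E"
  shows "is_subspace N ((\<lambda>w. T *\<^sub>v w) ` E)"
  unfolding is_subspace_def
proof (intro conjI ballI allI subsetI)
  note d = is_subspaceD[OF assms(2)]
  fix u assume "u \<in> (\<lambda>w. T *\<^sub>v w) ` E"
  then obtain a where a: "a \<in> E" "u = T *\<^sub>v a" by blast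
  then show "u \<in> carrier_vec N" using assms(1) d(1) by auto
  show "c \<cdot>\<^sub>v u \<in> (\<lambda>w. T *\<^sub>v w) ` E" for c
    using a d mult_mat_vec[OF assms(1), of a c] by (intro image_eqI[of _ _ "c \<cdot>\<^sub>v a"]) auto
  fix w assume "w \<in> (\<lambda>w. T *\<^sub>v w) ` E"
  then obtain b where b: "b \<in> E" "w = T *\<^sub>v b" by blast
  show "u + w \<in> (\<lambda>w. T *\<^sub>v w) ` E"
    using a b d mult_add_distrib_mat_vec[OF assms(1), of a b] by (intro image_eqI[of _ _ "a + b"]) auto
qed

text \<open>
  Among the vectors of \<open>E\<close> on which \<open>L\<^sub>0, \<dots>, L\<^bsub>k-1\<^esub>\<close> act by given scalars, which form a subspace invariant
  under \<open>L\<^sub>k\<close>, there is an eigenvector of \<open>L\<^sub>k\<close>.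
\<close>

lemma common_eigenvector:
  fixes L :: "nat \<Rightarrow> 'k::alg_closed_field mat"
  assumes L: "commuting_pencil N r L" and E: "is_subspace N E"
    and inv: "\<And>i w. i < r \<Longrightarrow> w \<in> E \<Longrightarrow> L i *\<^sub>v w \<in> E" and w: "w \<in> E" "w \<noteq> 0\<^sub>v N"
  shows "\<exists>e\<in>E. e \<noteq> 0\<^sub>v N \<and> (\<exists>\<chi>. \<forall>i<r. L i *\<^sub>v e = \<chi> i \<cdot>\<^sub>v e)"
proof -
  have carr: "L i \<in> carrier_mat N N" if "i < r" for i using L that by (auto simp: commuting_pencil_def)
  have comm: "L i * L l = L l * L i" if "i < r" "l < r" for i l using L that by (auto simp: commuting_pencil_def)
  have "k \<le> r \<Longrightarrow> \<exists>e\<in>E. e \<noteq> 0\<^sub>v N \<and> (\<exists>\<chi>. \<forall>i<k. L i *\<^sub>v e = \<chi> i \<cdot>\<^sub>v e)" for k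
  proof (induction k)
    case 0
    then show ?case using w by auto
  next
    case (Suc k)
    then obtain e \<chi> where e: "e \<in> E" "e \<noteq> 0\<^sub>v N" "\<forall>i<k. L i *\<^sub>v e = \<chi> i \<cdot>\<^sub>v e" by auto
    define F where "F = {w \<in> E. \<forall>i<k. L i *\<^sub>v w = \<chi> i \<cdot>\<^sub>v w}"
    have Lk: "L k \<in> carrier_mat N N" using carr Suc by simp
    have "is_subspace N F"
      unfolding is_subspace_def
    proof (intro conjI ballI allI subsetI)
      note d = is_subspaceD[OF E]
      fix u assume u: "u \<in> F"
      then show uc: "u \<in> carrier_vec N" using d by (auto simp: F_def)
      show "c \<cdot>\<^sub>v u \<in> F" for c
        using u uc d(3) mult_mat_vec[OF carr, of _ u c] Suc.prems
        by (auto simp: F_def smult_smult_assoc mult.commute)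
      fix w assume w: "w \<in> F"
      then have wc: "w \<in> carrier_vec N" using d by (auto simp: F_def)
      show "u + w \<in> F"
        using u w uc wc d(2) mult_add_distrib_mat_vec[OF carr, of _ u w] Suc.prems
        by (auto simp: F_def smult_add_distrib_vec[of _ N])
    qed
    moreover have "L k *\<^sub>v w \<in> F" if "w \<in> F" for w
    proof -
      have wE: "w \<in> E" and wc: "w \<in> carrier_vec N" using that is_subspaceD[OF E] by (auto simp: F_def)
      have "L i *\<^sub>v (L k *\<^sub>v w) = \<chi> i \<cdot>\<^sub>v (L k *\<^sub>v w)" if i: "i < k" for i
      proof -
        have ir: "i < r" "k < r" using i Suc.prems by auto
        have "L i *\<^sub>v (L k *\<^sub>v w) = L k *\<^sub>v (L i *\<^sub>v w)"
          using comm[OF ir] carr[OF ir(1)] Lk wc by (metis assoc_mult_mat_vec)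
        then show ?thesis using \<open>w \<in> F\<close> i mult_mat_vec[OF Lk wc] by (simp add: F_def)
      qed
      then show ?thesis using inv[of k w] wE Suc.prems by (simp add: F_def)
    qed
    moreover have "e \<in> F" using e by (simp add: F_def)
    ultimately obtain e' \<mu> where e': "e' \<in> F" "e' \<noteq> 0\<^sub>v N" "L k *\<^sub>v e' = \<mu> \<cdot>\<^sub>v e'"
      using eigenvector_in_invariant_subspace[OF Lk _ _ _ e(2), of F] by blast
    have "\<forall>i<Suc k. L i *\<^sub>v e' = (\<chi>(k := \<mu>)) i \<cdot>\<^sub>v e'"
      using e' by (auto simp: F_def less_Suc_eq)
    then show ?case using e' unfolding F_def by blast
  qed
  from this[of r] show ?thesis by simp
qed

text \<open>
  Otherwise the image of \<open>E\<close> under \<open>T\<^sup>N\<close> is a nonzero invariant subspace and contains a joint eigenvector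
  \<open>e = T\<^sup>N a\<close>.  Then \<open>T\<^bsup>N+1\<^esup> a = T e = 0\<close>, whence \<open>T\<^sup>N a = 0\<close>.
\<close>

lemma nilpotent_on_invariant_subspace:
  fixes T :: "'k::alg_closed_field mat"
  assumes L: "commuting_pencil N r L" and E: "is_subspace N E"
    and inv: "\<And>i w. i < r \<Longrightarrow> w \<in> E \<Longrightarrow> L i *\<^sub>v w \<in> E"
    and T: "T \<in> carrier_mat N N" and invT: "\<And>w. w \<in> E \<Longrightarrow> T *\<^sub>v w \<in> E"
    and comm: "\<And>i. i < r \<Longrightarrow> T * L i = L i * T"
    and kill: "\<And>e \<chi>. e \<in> E \<Longrightarrow> e \<noteq> 0\<^sub>v N \<Longrightarrow> (\<And>i. i < r \<Longrightarrow> L i *\<^sub>v e = \<chi> i \<cdot>\<^sub>v e) \<Longrightarrow> T *\<^sub>v e = 0\<^sub>v N"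
    and w: "w \<in> E"
  shows "(T ^\<^sub>m N) *\<^sub>v w = 0\<^sub>v N"
proof (rule ccontr)
  assume nz: "(T ^\<^sub>m N) *\<^sub>v w \<noteq> 0\<^sub>v N"
  note d = is_subspaceD[OF E]
  have TN: "T ^\<^sub>m N \<in> carrier_mat N N" using T by simp
  have carr: "L i \<in> carrier_mat N N" if "i < r" for i using L that by (auto simp: commuting_pencil_def)
  let ?F = "(\<lambda>w. (T ^\<^sub>m N) *\<^sub>v w) ` E"
  have powE: "(T ^\<^sub>m k) *\<^sub>v u \<in> E" if "u \<in> E" for u k
    using that
  proof (induction k arbitrary: u)
    case 0
    then show ?case using T d(1) by simp
  next
    case (Suc k)
    then show ?case using pow_mat_vec_Suc[OF T d(1)[OF Suc.prems]] invT by simp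
  qed
  have "L i *\<^sub>v u \<in> ?F" if i: "i < r" and u: "u \<in> ?F" for i u
  proof -
    obtain a where a: "a \<in> E" "u = (T ^\<^sub>m N) *\<^sub>v a" using u by blast
    have "L i *\<^sub>v u = (T ^\<^sub>m N) *\<^sub>v (L i *\<^sub>v a)"
      unfolding a(2) using pow_mat_vec_commute[OF T carr[OF i] comm[OF i] d(1)[OF a(1)]] by simp
    then show ?thesis using inv[OF i a(1)] by blast
  qed
  then obtain e \<chi> where e: "e \<in> ?F" "e \<noteq> 0\<^sub>v N" "\<forall>i<r. L i *\<^sub>v e = \<chi> i \<cdot>\<^sub>v e"
    using common_eigenvector[OF L is_subspace_image[OF TN E] _ _ nz] w by blast
  then obtain a where a: "a \<in> E" "e = (T ^\<^sub>m N) *\<^sub>v a" by blast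
  have eE: "e \<in> E" using a powE by simp
  have "T *\<^sub>v e = 0\<^sub>v N" using kill[OF eE e(2)] e(3) by blast
  then have "(T ^\<^sub>m Suc N) *\<^sub>v a = 0\<^sub>v N"
    using pow_mat_vec_Suc[OF T d(1)[OF a(1)], of N] pow_mat_vec_commute[OF T T refl d(1)[OF a(1)], of N] a(2) by simp
  then have "e = 0\<^sub>v N" using mat_kernel_power_stable[OF T d(1)[OF a(1)]] a(2) by blast
  then show False using e(2) by simp
qed

lemma mat_lincomb_carrier [simp]: "mat_lincomb N m c M \<in> carrier_mat N N"
  by (simp add: mat_lincomb_def)

lemma mat_lincomb_mult:
  assumes "\<And>j. j < m \<Longrightarrow> M j \<in> carrier_mat N N" and "B \<in> carrier_mat N N"
  shows mat_lincomb_mult_right: "mat_lincomb N m c M * B = mat_lincomb N m c (\<lambda>j. M j * B)"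
    and mat_lincomb_mult_left: "B * mat_lincomb N m c M = mat_lincomb N m c (\<lambda>j. B * M j)"
proof -
  show "mat_lincomb N m c M * B = mat_lincomb N m c (\<lambda>j. M j * B)"
  proof (rule eq_matI)
    fix a b assume "a < dim_row (mat_lincomb N m c (\<lambda>j. M j * B))" "b < dim_col (mat_lincomb N m c (\<lambda>j. M j * B))"
    then have ab: "a < N" "b < N" by (auto simp: mat_lincomb_def)
    have "(mat_lincomb N m c M * B) $$ (a, b) = (\<Sum>d<N. (\<Sum>j<m. c j * M j $$ (a, d)) * B $$ (d, b))"
      using ab assms(2) by (simp add: mat_lincomb_def scalar_prod_def atLeast0LessThan)
    also have "\<dots> = (\<Sum>j<m. c j * (\<Sum>d<N. M j $$ (a, d) * B $$ (d, b)))"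
      unfolding sum_distrib_right sum_distrib_left by (subst sum.swap) (simp add: mult_ac)
    also have "\<dots> = (\<Sum>j<m. c j * (M j * B) $$ (a, b))"
    proof (intro sum.cong refl)
      fix j assume "j \<in> {..<m}"
      then have "M j \<in> carrier_mat N N" using assms(1) by simp
      then show "c j * (\<Sum>d<N. M j $$ (a, d) * B $$ (d, b)) = c j * (M j * B) $$ (a, b)"
        using ab assms(2) by (simp add: scalar_prod_def atLeast0LessThan)
    qed
    finally show "(mat_lincomb N m c M * B) $$ (a, b) = mat_lincomb N m c (\<lambda>j. M j * B) $$ (a, b)"
      using ab by (simp add: mat_lincomb_def)
  qed (use assms in \<open>auto simp: mat_lincomb_def\<close>)
  show "B * mat_lincomb N m c M = mat_lincomb N m c (\<lambda>j. B * M j)"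
  proof (rule eq_matI)
    fix a b assume "a < dim_row (mat_lincomb N m c (\<lambda>j. B * M j))" "b < dim_col (mat_lincomb N m c (\<lambda>j. B * M j))"
    then have ab: "a < N" "b < N" by (auto simp: mat_lincomb_def)
    have "(B * mat_lincomb N m c M) $$ (a, b) = (\<Sum>d<N. B $$ (a, d) * (\<Sum>j<m. c j * M j $$ (d, b)))"
      using ab assms(2) by (simp add: mat_lincomb_def scalar_prod_def atLeast0LessThan)
    also have "\<dots> = (\<Sum>j<m. c j * (\<Sum>d<N. B $$ (a, d) * M j $$ (d, b)))"
      unfolding sum_distrib_right sum_distrib_left by (subst sum.swap) (simp add: mult_ac)
    also have "\<dots> = (\<Sum>j<m. c j * (B * M j) $$ (a, b))"
    proof (intro sum.cong refl)
      fix j assume "j \<in> {..<m}"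
      then have "M j \<in> carrier_mat N N" using assms(1) by simp
      then show "c j * (\<Sum>d<N. B $$ (a, d) * M j $$ (d, b)) = c j * (B * M j) $$ (a, b)"
        using ab assms(2) by (simp add: scalar_prod_def atLeast0LessThan)
    qed
    finally show "(B * mat_lincomb N m c M) $$ (a, b) = mat_lincomb N m c (\<lambda>j. B * M j) $$ (a, b)"
      using ab by (simp add: mat_lincomb_def)
  qed (use assms in \<open>auto simp: mat_lincomb_def\<close>)
qed

lemma mat_lincomb_cong: "(\<And>j. j < m \<Longrightarrow> c j = c' j) \<Longrightarrow> (\<And>j. j < m \<Longrightarrow> M j = M' j) \<Longrightarrow>
    mat_lincomb N m c M = mat_lincomb N m c' M'"
  by (rule eq_matI) (auto simp: mat_lincomb_def)

lemma mat_lincomb_mult_vec: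
  assumes "\<And>j. j < m \<Longrightarrow> M j \<in> carrier_mat N N" and "w \<in> carrier_vec N" and a: "a < N"
  shows "(mat_lincomb N m c M *\<^sub>v w) $ a = (\<Sum>j<m. c j * (M j *\<^sub>v w) $ a)"
proof -
  have "(mat_lincomb N m c M *\<^sub>v w) $ a = (\<Sum>d<N. (\<Sum>j<m. c j * M j $$ (a, d)) * w $ d)"
    using a assms(2) by (simp add: mat_lincomb_def scalar_prod_def atLeast0LessThan)
  also have "\<dots> = (\<Sum>j<m. c j * (\<Sum>d<N. M j $$ (a, d) * w $ d))"
    unfolding sum_distrib_right sum_distrib_left by (subst sum.swap) (simp add: mult_ac)
  also have "\<dots> = (\<Sum>j<m. c j * (M j *\<^sub>v w) $ a)"
  proof (intro sum.cong refl)
    fix j assume "j \<in> {..<m}"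
    then have "M j \<in> carrier_mat N N" using assms(1) by simp
    then show "c j * (\<Sum>d<N. M j $$ (a, d) * w $ d) = c j * (M j *\<^sub>v w) $ a"
      using a assms(2) by (simp add: scalar_prod_def atLeast0LessThan)
  qed
  finally show ?thesis .
qed

lemma mat_lincomb_eigenvector:
  assumes "\<And>j. j < m \<Longrightarrow> M j \<in> carrier_mat N N" and "w \<in> carrier_vec N"
    and "\<And>j. j < m \<Longrightarrow> M j *\<^sub>v w = \<chi> j \<cdot>\<^sub>v w"
  shows "mat_lincomb N m c M *\<^sub>v w = (\<Sum>j<m. c j * \<chi> j) \<cdot>\<^sub>v w"
proof (rule eq_vecI)
  fix a assume "a < dim_vec ((\<Sum>j<m. c j * \<chi> j) \<cdot>\<^sub>v w)"
  then have a: "a < N" using assms(2) by simp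
  show "(mat_lincomb N m c M *\<^sub>v w) $ a = ((\<Sum>j<m. c j * \<chi> j) \<cdot>\<^sub>v w) $ a"
    using mat_lincomb_mult_vec[OF assms(1,2) a, where c = c] a assms(2,3)
    by (simp add: sum_distrib_right mult.assoc)
qed (use assms(2) in \<open>simp add: mat_lincomb_def\<close>)

lemma pencil_lincomb_commute:
  assumes "commuting_pencil N r L" "i < r"
  shows "mat_lincomb N r u L * L i = L i * mat_lincomb N r u L"
proof -
  have "L j \<in> carrier_mat N N" if "j < r" for j using assms(1) that by (auto simp: commuting_pencil_def)
  then show ?thesis
    using mat_lincomb_mult[of r L N "L i" u] assms
    by (auto simp: commuting_pencil_def intro!: mat_lincomb_cong)
qed

lemma char_matrix_mult_vec:
  fixes A :: "'k::field mat"
  assumes "A \<in> carrier_mat N N" "w \<in> carrier_vec N"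
  shows "char_matrix A \<mu> *\<^sub>v w = A *\<^sub>v w - \<mu> \<cdot>\<^sub>v w"
proof -
  have "(- \<mu> \<cdot>\<^sub>m 1\<^sub>m N) *\<^sub>v w = - \<mu> \<cdot>\<^sub>v w"
    using assms(2) by (intro eq_vecI) (simp_all add: row_smult smult_scalar_prod_distrib[of _ N])
  moreover have "char_matrix A \<mu> *\<^sub>v w = A *\<^sub>v w + (- \<mu> \<cdot>\<^sub>m 1\<^sub>m N) *\<^sub>v w"
    using assms unfolding char_matrix_def by (simp add: add_mult_distrib_mat_vec[of _ N N])
  ultimately show ?thesis using assms by (intro eq_vecI) auto
qed

lemma char_matrix_commute:
  fixes A :: "'k::field mat"
  assumes "A \<in> carrier_mat N N" "B \<in> carrier_mat N N" "A * B = B * A"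
  shows "char_matrix A \<mu> * B = B * char_matrix A \<mu>"
proof -
  have "char_matrix A \<mu> * B = A * B + (- \<mu> \<cdot>\<^sub>m 1\<^sub>m N) * B"
    using assms unfolding char_matrix_def by (simp add: add_mult_distrib_mat[of _ N N])
  also have "(- \<mu> \<cdot>\<^sub>m 1\<^sub>m N) * B = B * (- \<mu> \<cdot>\<^sub>m 1\<^sub>m N)"
    using mult_smult_distrib[OF assms(2) one_carrier_mat, of "- \<mu>"]
      mult_smult_assoc_mat[OF one_carrier_mat assms(2), of "- \<mu>"] assms(2) by simp
  also have "A * B + B * (- \<mu> \<cdot>\<^sub>m 1\<^sub>m N) = B * char_matrix A \<mu>"
    using assms unfolding char_matrix_def by (simp add: mult_add_distrib_mat[of _ N N])
  finally show ?thesis .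
qed

lemma char_matrix_altdef: "A \<in> carrier_mat N N \<Longrightarrow> A - \<mu> \<cdot>\<^sub>m 1\<^sub>m N = char_matrix (A :: 'k::field mat) \<mu>"
  by (rule eq_matI) (auto simp: char_matrix_def)

lemma mat_kernel_is_subspace:
  fixes A :: "'k::field mat"
  assumes "A \<in> carrier_mat N N"
  shows "is_subspace N (mat_kernel A)"
  unfolding is_subspace_def mat_kernel[OF assms]
  using assms by (auto simp: mult_add_distrib_mat_vec[of _ N N] mult_mat_vec[of _ N N])

lemma joint_gen_eigenspace_iff:
  assumes "commuting_pencil N r L"
  shows "w \<in> joint_gen_eigenspace N r L \<chi> \<longleftrightarrow>
    w \<in> carrier_vec N \<and> (\<forall>i<r. (char_matrix (L i) (\<chi> i) ^\<^sub>m N) *\<^sub>v w = 0\<^sub>v N)"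
  using assms by (auto simp: joint_gen_eigenspace_def commuting_pencil_def char_matrix_altdef)

lemma joint_gen_eigenspace_subspace:
  assumes L: "commuting_pencil N r L"
  shows "is_subspace N (joint_gen_eigenspace N r L \<chi>)"
proof -
  have carr: "char_matrix (L i) (\<chi> i) ^\<^sub>m N \<in> carrier_mat N N" if "i < r" for i
    using L that by (auto simp: commuting_pencil_def)
  show ?thesis
    unfolding is_subspace_def joint_gen_eigenspace_iff[OF L] Ball_def subset_iff
    using carr by (auto simp: mult_add_distrib_mat_vec[of _ N N] mult_mat_vec[of _ N N])
qed

lemma joint_gen_eigenspace_invariant:
  assumes L: "commuting_pencil N r L" and B: "B \<in> carrier_mat N N" "\<And>i. i < r \<Longrightarrow> L i * B = B * L i"
    and w: "w \<in> joint_gen_eigenspace N r L \<chi>"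
  shows "B *\<^sub>v w \<in> joint_gen_eigenspace N r L \<chi>"
  unfolding joint_gen_eigenspace_iff[OF L]
proof (intro conjI allI impI)
  have wc: "w \<in> carrier_vec N" using w by (auto simp: joint_gen_eigenspace_def)
  then show "B *\<^sub>v w \<in> carrier_vec N" using B(1) by simp
  fix i assume i: "i < r"
  have Li: "L i \<in> carrier_mat N N" using L i by (auto simp: commuting_pencil_def)
  have "(char_matrix (L i) (\<chi> i) ^\<^sub>m N) *\<^sub>v (B *\<^sub>v w) = B *\<^sub>v ((char_matrix (L i) (\<chi> i) ^\<^sub>m N) *\<^sub>v w)"
    using pow_mat_vec_commute[OF _ B(1) char_matrix_commute[OF Li B(1) B(2)[OF i]] wc] Li by simp
  also have "\<dots> = 0\<^sub>v N"
    using w i B(1) pow_mat_vec_zero[OF B(1), of 1] unfolding joint_gen_eigenspace_iff[OF L] by simp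
  finally show "(char_matrix (L i) (\<chi> i) ^\<^sub>m N) *\<^sub>v (B *\<^sub>v w) = 0\<^sub>v N" .
qed

lemma gen_eigenvector_eigenvalue:
  fixes A :: "'k::field mat"
  assumes A: "A \<in> carrier_mat N N" and e: "e \<in> carrier_vec N" "e \<noteq> 0\<^sub>v N" "A *\<^sub>v e = \<nu> \<cdot>\<^sub>v e"
    and z: "(char_matrix A \<mu> ^\<^sub>m k) *\<^sub>v e = 0\<^sub>v N"
  shows "\<nu> = \<mu>"
proof -
  have "(char_matrix A \<mu> ^\<^sub>m k) *\<^sub>v e = (\<nu> - \<mu>) ^ k \<cdot>\<^sub>v e"
  proof (induction k)
    case 0
    then show ?case using A e(1) by (simp add: char_matrix_def)
  next
    case (Suc k)
    have c: "char_matrix A \<mu> \<in> carrier_mat N N" using A by simp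
    have "char_matrix A \<mu> *\<^sub>v e = (\<nu> - \<mu>) \<cdot>\<^sub>v e"
      using char_matrix_mult_vec[OF A e(1)] e(1,3) by (intro eq_vecI) (auto simp: left_diff_distrib)
    then have "(char_matrix A \<mu> ^\<^sub>m Suc k) *\<^sub>v e = (\<nu> - \<mu>) \<cdot>\<^sub>v ((char_matrix A \<mu> ^\<^sub>m k) *\<^sub>v e)"
      using pow_mat_vec_Suc[OF c e(1), of k] mult_mat_vec[OF pow_carrier_mat[OF c] e(1)] by simp
    then show ?case using Suc e(1) by (simp add: smult_smult_assoc)
  qed
  then have "(\<nu> - \<mu>) ^ k \<cdot>\<^sub>v e = 0\<^sub>v N" using z by simp
  moreover obtain i where i: "i < N" "e $ i \<noteq> 0"
  proof (rule ccontr)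
    assume "\<not> thesis"
    then have "e = 0\<^sub>v N" using e(1) that by (intro eq_vecI) auto
    then show False using e(2) by simp
  qed
  ultimately have "((\<nu> - \<mu>) ^ k \<cdot>\<^sub>v e) $ i = 0" by simp
  then have "(\<nu> - \<mu>) ^ k = 0" using i e(1) by simp
  then show ?thesis by simp
qed

definition separates_joint_eigenvalues ::
  "nat \<Rightarrow> nat \<Rightarrow> (nat \<Rightarrow> 'k::field mat) \<Rightarrow> (nat \<Rightarrow> 'k) \<Rightarrow> (nat \<Rightarrow> 'k) \<Rightarrow> bool" where
  "separates_joint_eigenvalues N r L u \<chi> \<longleftrightarrow>
     (\<forall>e \<chi>'. e \<in> carrier_vec N \<and> e \<noteq> 0\<^sub>v N \<and> (\<forall>i<r. L i *\<^sub>v e = \<chi>' i \<cdot>\<^sub>v e) \<and>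
        (\<Sum>i<r. u i * \<chi>' i) = (\<Sum>i<r. u i * \<chi> i) \<longrightarrow> (\<forall>i<r. \<chi>' i = \<chi> i))"

text \<open>
  Each of the two spaces is invariant under the pencil, and each operator that defines one of them kills
  the joint eigenvectors in the other; so it is nilpotent there by \<open>nilpotent_on_invariant_subspace\<close>.
\<close>

lemma joint_gen_eigenspace_eq_kernel:
  fixes L :: "nat \<Rightarrow> 'k::alg_closed_field mat"
  assumes L: "commuting_pencil N r L" and sep: "separates_joint_eigenvalues N r L u \<chi>"
  shows "joint_gen_eigenspace N r L \<chi> =
    mat_kernel (char_matrix (mat_lincomb N r u L) (\<Sum>i<r. u i * \<chi> i) ^\<^sub>m N)"
proof -
  let ?A = "mat_lincomb N r u L" and ?\<mu> = "\<Sum>i<r. u i * \<chi> i"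
  let ?T = "char_matrix ?A ?\<mu>"
  have carr: "L i \<in> carrier_mat N N" if "i < r" for i using L that by (auto simp: commuting_pencil_def)
  have comm: "L i * L l = L l * L i" if "i < r" "l < r" for i l using L that by (auto simp: commuting_pencil_def)
  have T: "?T \<in> carrier_mat N N" by simp
  have TL: "?T * L i = L i * ?T" if "i < r" for i
    by (rule char_matrix_commute[OF mat_lincomb_carrier carr[OF that] pencil_lincomb_commute[OF L that]])
  note ker = mat_kernel[OF pow_carrier_mat[OF T], of N]
  show ?thesis
  proof (intro equalityI subsetI)
    fix w assume w: "w \<in> joint_gen_eigenspace N r L \<chi>"
    have "(?T ^\<^sub>m N) *\<^sub>v w = 0\<^sub>v N"
    proof (rule nilpotent_on_invariant_subspace[OF L joint_gen_eigenspace_subspace[OF L] _ T _ TL _ w])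
      show "L i *\<^sub>v w \<in> joint_gen_eigenspace N r L \<chi>" if "i < r" "w \<in> joint_gen_eigenspace N r L \<chi>" for i w
        by (rule joint_gen_eigenspace_invariant[OF L carr[OF that(1)] comm[OF _ that(1)] that(2)])
      show "?T *\<^sub>v w \<in> joint_gen_eigenspace N r L \<chi>" if "w \<in> joint_gen_eigenspace N r L \<chi>" for w
        by (rule joint_gen_eigenspace_invariant[OF L T TL[symmetric] that])
      fix e \<chi>'
      assume e: "e \<in> joint_gen_eigenspace N r L \<chi>" "e \<noteq> 0\<^sub>v N" "\<And>i. i < r \<Longrightarrow> L i *\<^sub>v e = \<chi>' i \<cdot>\<^sub>v e"
      then have ec: "e \<in> carrier_vec N" by (simp add: joint_gen_eigenspace_def)
      have "\<chi>' i = \<chi> i" if "i < r" for i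
        using gen_eigenvector_eigenvalue[OF carr[OF that] ec e(2) e(3)[OF that]] e(1) that
        unfolding joint_gen_eigenspace_iff[OF L] by blast
      then have "?A *\<^sub>v e = ?\<mu> \<cdot>\<^sub>v e" using mat_lincomb_eigenvector[OF carr ec e(3), where c = u] by simp
      then show "?T *\<^sub>v e = 0\<^sub>v N"
        using char_matrix_mult_vec[OF mat_lincomb_carrier ec] ec by simp
    qed
    then show "w \<in> mat_kernel (?T ^\<^sub>m N)" using w unfolding ker by (simp add: joint_gen_eigenspace_def)
  next
    fix w assume w: "w \<in> mat_kernel (?T ^\<^sub>m N)"
    then have wc: "w \<in> carrier_vec N" unfolding ker by simp
    have inv: "B *\<^sub>v w \<in> mat_kernel (?T ^\<^sub>m N)"
      if "w \<in> mat_kernel (?T ^\<^sub>m N)" "B \<in> carrier_mat N N" "?T * B = B * ?T" for B w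
      using that pow_mat_vec_commute[OF T that(2,3), of w N] pow_mat_vec_zero[OF that(2), of 1] unfolding ker by auto
    show "w \<in> joint_gen_eigenspace N r L \<chi>"
      unfolding joint_gen_eigenspace_iff[OF L]
    proof (intro conjI allI impI wc)
      fix i assume i: "i < r"
      let ?S = "char_matrix (L i) (\<chi> i)"
      have S: "?S \<in> carrier_mat N N" using carr[OF i] by simp
      have SL: "?S * L l = L l * ?S" if "l < r" for l
        by (rule char_matrix_commute[OF carr[OF i] carr[OF that] comm[OF i that]])
      show "(?S ^\<^sub>m N) *\<^sub>v w = 0\<^sub>v N"
      proof (rule nilpotent_on_invariant_subspace[OF L mat_kernel_is_subspace[OF pow_carrier_mat[OF T]] _ S _ SL _ w])
        show "L l *\<^sub>v w \<in> mat_kernel (?T ^\<^sub>m N)" if "l < r" "w \<in> mat_kernel (?T ^\<^sub>m N)" for l w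
          by (rule inv[OF that(2) carr[OF that(1)] TL[OF that(1)]])
        show "?S *\<^sub>v w \<in> mat_kernel (?T ^\<^sub>m N)" if "w \<in> mat_kernel (?T ^\<^sub>m N)" for w
          by (rule inv[OF that S]) (use char_matrix_commute[OF carr[OF i] T TL[OF i, symmetric]] in simp)
        fix e \<chi>'
        assume e: "e \<in> mat_kernel (?T ^\<^sub>m N)" "e \<noteq> 0\<^sub>v N" "\<And>i. i < r \<Longrightarrow> L i *\<^sub>v e = \<chi>' i \<cdot>\<^sub>v e"
        then have ec: "e \<in> carrier_vec N" unfolding ker by simp
        have "?A *\<^sub>v e = (\<Sum>i<r. u i * \<chi>' i) \<cdot>\<^sub>v e" by (rule mat_lincomb_eigenvector[OF carr ec e(3)])
        then have "(\<Sum>i<r. u i * \<chi>' i) = ?\<mu>"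
          using gen_eigenvector_eigenvalue[OF mat_lincomb_carrier ec e(2)] e(1) unfolding ker by blast
        then have "\<chi>' i = \<chi> i" using sep e(2,3) ec i unfolding separates_joint_eigenvalues_def by blast
        then show "?S *\<^sub>v e = 0\<^sub>v N"
          using char_matrix_mult_vec[OF carr[OF i] ec] e(3)[OF i] ec by simp
      qed
    qed
  qed
qed

lemma finite_joint_eigenvalues:
  fixes L :: "nat \<Rightarrow> 'k::field mat"
  assumes L: "commuting_pencil N r L"
  shows "finite {restrict \<chi> {..<r} | \<chi>. \<exists>e \<in> carrier_vec N. e \<noteq> 0\<^sub>v N \<and> (\<forall>i<r. L i *\<^sub>v e = \<chi> i \<cdot>\<^sub>v e)}"
proof (rule finite_subset)
  let ?R = "\<lambda>i. {\<mu>. poly (char_poly (L i)) \<mu> = 0}"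
  have carr: "L i \<in> carrier_mat N N" if "i < r" for i using L that by (auto simp: commuting_pencil_def)
  show "{restrict \<chi> {..<r} | \<chi>. \<exists>e \<in> carrier_vec N. e \<noteq> 0\<^sub>v N \<and> (\<forall>i<r. L i *\<^sub>v e = \<chi> i \<cdot>\<^sub>v e)}
     \<subseteq> (\<Pi>\<^sub>E i\<in>{..<r}. ?R i)"
  proof clarify
    fix \<chi> e assume e: "e \<in> carrier_vec N" "e \<noteq> 0\<^sub>v N" "\<forall>i<r. L i *\<^sub>v e = \<chi> i \<cdot>\<^sub>v e"
    have "poly (char_poly (L i)) (\<chi> i) = 0" if "i < r" for i
      using e that carr[OF that] eigenvalue_root_char_poly[OF carr[OF that]]
      by (auto simp: eigenvalue_def eigenvector_def)
    then show "restrict \<chi> {..<r} \<in> (\<Pi>\<^sub>E i\<in>{..<r}. ?R i)" by auto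
  qed
  have "char_poly (L i) \<noteq> 0" if "i < r" for i using degree_monic_char_poly[OF carr[OF that]] by auto
  then show "finite (\<Pi>\<^sub>E i\<in>{..<r}. ?R i)" by (intro finite_PiE poly_roots_finite) auto
qed

text \<open>
  With \<open>u\<^sub>i = t\<^sup>i\<close>, every pair of different tuples excludes only the roots \<open>t\<close> of one nonzero polynomial.
\<close>

lemma separating_functional:
  fixes F :: "(nat \<Rightarrow> 'k::alg_closed_field) set"
  assumes "finite F"
  shows "\<exists>u. \<forall>\<chi>\<in>F. \<forall>\<chi>'\<in>F. (\<Sum>i<r. u i * \<chi>' i) = (\<Sum>i<r. u i * \<chi> i) \<longrightarrow> (\<forall>i<r. \<chi>' i = \<chi> i)"
proof -
  define q where "q x = (\<Sum>i<r. monom (fst x i - snd x i :: 'k) i)" for x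
  have cq: "coeff (q x) i = (if i < r then fst x i - snd x i else 0)" for x i
    by (simp add: q_def coeff_sum)
  let ?B = "\<Union>x\<in>{x \<in> F \<times> F. q x \<noteq> 0}. {t. poly (q x) t = 0}"
  have "finite ?B" using assms by (auto intro: poly_roots_finite)
  then obtain t where t: "t \<notin> ?B" using ex_new_if_finite[OF infinite_alg_closed] by blast
  show ?thesis
  proof (intro exI[of _ "\<lambda>i. t ^ i"] ballI impI allI)
    fix \<chi> \<chi>' i assume h: "\<chi> \<in> F" "\<chi>' \<in> F" "(\<Sum>i<r. t ^ i * \<chi>' i) = (\<Sum>i<r. t ^ i * \<chi> i)" "i < r"
    have "poly (q (\<chi>', \<chi>)) t = (\<Sum>i<r. t ^ i * \<chi>' i) - (\<Sum>i<r. t ^ i * \<chi> i)"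
      by (simp add: q_def poly_sum poly_monom sum_subtractf[symmetric] algebra_simps)
    then have "q (\<chi>', \<chi>) = 0" using t h by auto
    then show "\<chi>' i = \<chi> i" using cq[of "(\<chi>', \<chi>)" i] h(4) by simp
  qed
qed

lemma joint_eigenvalues_separated:
  fixes F :: "(nat \<Rightarrow> 'k::alg_closed_field) set"
  assumes L: "commuting_pencil N r L" and M: "commuting_pencil N r M" and F: "finite F"
  obtains u where
    "\<forall>\<chi>\<in>F. separates_joint_eigenvalues N r L u \<chi> \<and> separates_joint_eigenvalues N r M u \<chi>"
    "\<forall>e \<chi>. e \<in> carrier_vec N \<and> e \<noteq> 0\<^sub>v N \<and> (\<forall>i<r. M i *\<^sub>v e = \<chi> i \<cdot>\<^sub>v e) \<longrightarrow>
       separates_joint_eigenvalues N r M u \<chi>"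
proof -
  define J where "J K = {restrict \<chi> {..<r} | \<chi>. \<exists>e \<in> carrier_vec N. e \<noteq> 0\<^sub>v N \<and> (\<forall>i<r. K i *\<^sub>v e = \<chi> i \<cdot>\<^sub>v e)}"
    for K :: "nat \<Rightarrow> 'k mat"
  define F' where "F' = J L \<union> J M \<union> F"
  have "finite F'"
    using finite_joint_eigenvalues[OF L] finite_joint_eigenvalues[OF M] F unfolding F'_def J_def by simp
  from separating_functional[OF this, of r] obtain u where
    u: "\<forall>\<chi>\<in>F'. \<forall>\<chi>'\<in>F'. (\<Sum>i<r. u i * \<chi>' i) = (\<Sum>i<r. u i * \<chi> i) \<longrightarrow> (\<forall>i<r. \<chi>' i = \<chi> i)" by blast
  have sep: "separates_joint_eigenvalues N r K u \<chi>"
    if K: "J K \<subseteq> F'" and \<chi>2: "\<chi>2 \<in> F'" "\<forall>i<r. \<chi>2 i = \<chi> i" for K \<chi> \<chi>2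
    unfolding separates_joint_eigenvalues_def
  proof (intro allI impI, elim conjE)
    fix e \<chi>' i
    assume h: "e \<in> carrier_vec N" "e \<noteq> 0\<^sub>v N" "\<forall>i<r. K i *\<^sub>v e = \<chi>' i \<cdot>\<^sub>v e"
      "(\<Sum>i<r. u i * \<chi>' i) = (\<Sum>i<r. u i * \<chi> i)" "i < r"
    have "restrict \<chi>' {..<r} \<in> J K" unfolding J_def using h(1-3) by blast
    then have 1: "restrict \<chi>' {..<r} \<in> F'" using K by blast
    have "(\<Sum>i<r. u i * restrict \<chi>' {..<r} i) = (\<Sum>i<r. u i * \<chi>2 i)"
      using h(4) \<chi>2(2) by simp
    then have "restrict \<chi>' {..<r} i = \<chi>2 i" using u 1 \<chi>2(1) h(5) by blast
    then show "\<chi>' i = \<chi> i" using \<chi>2(2) h(5) by simp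
  qed
  have sub: "J L \<subseteq> F'" "J M \<subseteq> F'" by (auto simp: F'_def)
  show thesis
  proof (rule that[of u])
    show "\<forall>e \<chi>. e \<in> carrier_vec N \<and> e \<noteq> 0\<^sub>v N \<and> (\<forall>i<r. M i *\<^sub>v e = \<chi> i \<cdot>\<^sub>v e) \<longrightarrow>
       separates_joint_eigenvalues N r M u \<chi>"
    proof (intro allI impI, elim conjE)
      fix e \<chi> assume e: "e \<in> carrier_vec N" "e \<noteq> 0\<^sub>v N" "\<forall>i<r. M i *\<^sub>v e = \<chi> i \<cdot>\<^sub>v e"
      have "restrict \<chi> {..<r} \<in> J M" unfolding J_def using e by blast
      then show "separates_joint_eigenvalues N r M u \<chi>" using sub(2) by (intro sep[OF sub(2)]) auto
    qed
    show "\<forall>\<chi>\<in>F. separates_joint_eigenvalues N r L u \<chi> \<and> separates_joint_eigenvalues N r M u \<chi>"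
    proof
      fix \<chi> assume "\<chi> \<in> F"
      then have "\<chi> \<in> F'" by (simp add: F'_def)
      then show "separates_joint_eigenvalues N r L u \<chi> \<and> separates_joint_eigenvalues N r M u \<chi>"
        by (auto intro: sep[OF sub(1)] sep[OF sub(2)])
    qed
  qed
qed

lemma joint_multiplicity_eq_order:
  fixes L :: "nat \<Rightarrow> 'k::alg_closed_field mat"
  assumes "commuting_pencil N r L" "separates_joint_eigenvalues N r L u \<chi>"
  shows "joint_multiplicity N r L \<chi> =
    Polynomial.order (\<Sum>i<r. u i * \<chi> i) (char_poly (mat_lincomb N r u L))"
  unfolding joint_multiplicity_def joint_gen_eigenspace_eq_kernel[OF assms]
  by (rule subspace_dim_kernel_char_matrix_power[OF mat_lincomb_carrier order_refl])

theorem isospectral_if_char_poly_eq: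
  fixes L M :: "nat \<Rightarrow> 'k::alg_closed_field mat"
  assumes L: "commuting_pencil N r L" and M: "commuting_pencil N r M"
    and eq: "\<And>u. char_poly (mat_lincomb N r u L) = char_poly (mat_lincomb N r u M)"
  shows "isospectral N r L M"
  unfolding isospectral_def
proof (intro conjI L M allI)
  fix \<chi> :: "nat \<Rightarrow> 'k"
  have "finite {\<chi>}" by simp
  then obtain u where "\<forall>\<chi>'\<in>{\<chi>}. separates_joint_eigenvalues N r L u \<chi>' \<and> separates_joint_eigenvalues N r M u \<chi>'"
    by (rule joint_eigenvalues_separated[OF L M])
  then show "joint_multiplicity N r L \<chi> = joint_multiplicity N r M \<chi>"
    using joint_multiplicity_eq_order[OF L, of u \<chi>] joint_multiplicity_eq_order[OF M, of u \<chi>] eq by simp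
qed

text \<open>
  All eigenvalues of \<open>A\<close> are 0, so \<open>A\<close> kills all eigenvectors of the pencil that consists of \<open>A\<close> alone.
\<close>

lemma nilpotent_if_char_poly_monomial:
  fixes A :: "'k::alg_closed_field mat"
  assumes A: "A \<in> carrier_mat N N" and c: "char_poly A = monom 1 N"
  shows "A ^\<^sub>m N = 0\<^sub>m N N"
proof -
  have *: "(A ^\<^sub>m N) *\<^sub>v w = 0\<^sub>v N" if w: "w \<in> carrier_vec N" for w
  proof (rule nilpotent_on_invariant_subspace[of N 1 "\<lambda>_. A" "carrier_vec N" A])
    fix e and \<chi> :: "nat \<Rightarrow> 'k"
    assume e: "e \<in> carrier_vec N" "e \<noteq> 0\<^sub>v N" "\<And>i. i < 1 \<Longrightarrow> A *\<^sub>v e = \<chi> i \<cdot>\<^sub>v e"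
    have "A *\<^sub>v e = \<chi> 0 \<cdot>\<^sub>v e" using e(3)[of 0] by simp
    then have "poly (char_poly A) (\<chi> 0) = 0"
      using eigenvalue_root_char_poly[OF A] e(1,2) A by (auto simp: eigenvalue_def eigenvector_def)
    then have "\<chi> 0 = 0" by (simp add: c poly_monom)
    then show "A *\<^sub>v e = 0\<^sub>v N" using \<open>A *\<^sub>v e = \<chi> 0 \<cdot>\<^sub>v e\<close> e(1) by simp (intro eq_vecI, auto)
  qed (use A w in \<open>auto simp: commuting_pencil_def is_subspace_def\<close>)
  show ?thesis
  proof (rule eq_matI)
    fix a b assume ab: "a < dim_row (0\<^sub>m N N :: 'k mat)" "b < dim_col (0\<^sub>m N N :: 'k mat)"
    then have "(A ^\<^sub>m N) $$ (a, b) = ((A ^\<^sub>m N) *\<^sub>v unit_vec N b) $ a"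
      using A by (simp add: scalar_prod_right_unit)
    then show "(A ^\<^sub>m N) $$ (a, b) = 0\<^sub>m N N $$ (a, b)" using *[of "unit_vec N b"] ab by simp
  qed (use A in auto)
qed

section \<open>Simple spectrum and Krylov matrices\<close>

definition cols_mat :: "nat \<Rightarrow> (nat \<Rightarrow> 'k vec) \<Rightarrow> 'k mat" where
  "cols_mat N e = mat N N (\<lambda>(a, b). e b $ a)"

lemma cols_mat_carrier [simp]: "cols_mat N e \<in> carrier_mat N N"
  by (simp add: cols_mat_def)

lemma mult_cols_mat:
  assumes "A \<in> carrier_mat N N" "\<And>b. b < N \<Longrightarrow> e b \<in> carrier_vec N"
  shows "A * cols_mat N e = cols_mat N (\<lambda>b. A *\<^sub>v e b)"
proof (rule eq_matI)
  fix a b assume "a < dim_row (cols_mat N (\<lambda>b. A *\<^sub>v e b))" "b < dim_col (cols_mat N (\<lambda>b. A *\<^sub>v e b))"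
  then have ab: "a < N" "b < N" by (auto simp: cols_mat_def)
  have "dim_vec (e b) = N" using assms(2)[OF ab(2)] by simp
  then show "(A * cols_mat N e) $$ (a, b) = cols_mat N (\<lambda>b. A *\<^sub>v e b) $$ (a, b)"
    using ab assms(1) by (simp add: cols_mat_def scalar_prod_def)
qed (use assms in \<open>simp_all add: cols_mat_def\<close>)

lemma mat_vec_entry:
  "X \<in> carrier_mat N N \<Longrightarrow> v \<in> carrier_vec N \<Longrightarrow> c < N \<Longrightarrow>
    (X *\<^sub>v v) $ c = (\<Sum>b<N. X $$ (c, b) * (v :: 'k::comm_ring_1 vec) $ b)"
  by (simp add: scalar_prod_def atLeast0LessThan)

lemma mat_vec_zero: "X \<in> carrier_mat N N \<Longrightarrow> X *\<^sub>v 0\<^sub>v N = (0\<^sub>v N :: 'k::comm_ring_1 vec)"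
  by (rule eq_vecI) (auto simp: scalar_prod_def)

lemma nonzero_entry:
  fixes e :: "'k::zero vec"
  assumes "e \<in> carrier_vec N" "e \<noteq> 0\<^sub>v N"
  obtains a where "a < N" "e $ a \<noteq> 0"
  using assms by (metis carrier_vecD eq_vecI index_zero_vec(1) index_zero_vec(2))

lemma cols_mat_mult_vec:
  assumes "c \<in> carrier_vec N" "a < N"
  shows "(cols_mat N e *\<^sub>v c) $ a = (\<Sum>b<N. e b $ a * c $ b)"
  using assms by (simp add: cols_mat_def scalar_prod_def atLeast0LessThan)

text \<open>
  The kernel of the matrix of eigenvectors is invariant under the diagonal matrix of the eigenvalues.  If
  it were nonzero, it would contain an eigenvector of the latter, which is a multiple of a unit vector;
  then one of the columns \<open>e b\<close> would be 0.
\<close>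

lemma det_eigenvectors_nonzero:
  fixes A :: "'k::alg_closed_field mat"
  assumes A: "A \<in> carrier_mat N N"
    and e: "\<And>b. b < N \<Longrightarrow> e b \<in> carrier_vec N" "\<And>b. b < N \<Longrightarrow> e b \<noteq> 0\<^sub>v N"
      "\<And>b. b < N \<Longrightarrow> A *\<^sub>v e b = \<nu> b \<cdot>\<^sub>v e b"
    and inj: "inj_on \<nu> {..<N}"
  shows "det (cols_mat N e) \<noteq> 0"
proof
  let ?P = "cols_mat N e"
  let ?D = "mat N N (\<lambda>(a, b). if a = b then \<nu> a else 0)"
  have P: "?P \<in> carrier_mat N N" and D: "?D \<in> carrier_mat N N" by simp_all
  have Dc: "(?D *\<^sub>v c) $ a = \<nu> a * c $ a" if "c \<in> carrier_vec N" "a < N" for c a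
  proof -
    have "(?D *\<^sub>v c) $ a = (\<Sum>b<N. ?D $$ (a, b) * c $ b)" by (rule mat_vec_entry[OF D that])
    also have "\<dots> = (\<Sum>b<N. if b = a then \<nu> a * c $ a else 0)" using that by (intro sum.cong) auto
    finally show ?thesis using that by simp
  qed
  have PD: "?P * ?D = A * ?P"
  proof -
    have "A * ?P = cols_mat N (\<lambda>b. A *\<^sub>v e b)" by (rule mult_cols_mat[OF A e(1)])
    also have "\<dots> = cols_mat N (\<lambda>b. \<nu> b \<cdot>\<^sub>v e b)"
      using e(3) by (intro eq_matI) (auto simp: cols_mat_def)
    also have "\<dots> = ?P * ?D"
    proof (rule eq_matI)
      fix a b assume "a < dim_row (?P * ?D)" "b < dim_col (?P * ?D)"
      then have ab: "a < N" "b < N" by (auto simp: cols_mat_def)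
      have "(?P * ?D) $$ (a, b) = (\<Sum>c<N. ?P $$ (a, c) * ?D $$ (c, b))"
        using ab by (simp add: cols_mat_def scalar_prod_def atLeast0LessThan)
      also have "\<dots> = (\<Sum>c<N. if c = b then e b $ a * \<nu> b else 0)"
        using ab by (intro sum.cong) (auto simp: cols_mat_def)
      finally have "(?P * ?D) $$ (a, b) = e b $ a * \<nu> b" using ab by simp
      moreover have "dim_vec (e b) = N" using e(1)[OF ab(2)] by simp
      ultimately show "cols_mat N (\<lambda>b. \<nu> b \<cdot>\<^sub>v e b) $$ (a, b) = (?P * ?D) $$ (a, b)"
        using ab by (simp add: cols_mat_def mult.commute)
    qed (simp_all add: cols_mat_def)
    finally show ?thesis ..
  qed
  assume "det ?P = 0"
  then obtain w where w: "w \<in> carrier_vec N" "w \<noteq> 0\<^sub>v N" "?P *\<^sub>v w = 0\<^sub>v N"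
    using det_0_iff_vec_prod_zero_field[OF P] by blast
  have "\<exists>c\<in>mat_kernel ?P. c \<noteq> 0\<^sub>v N \<and> (\<exists>\<mu>. ?D *\<^sub>v c = \<mu> \<cdot>\<^sub>v c)"
  proof (rule eigenvector_in_invariant_subspace[OF D mat_kernel_is_subspace[OF P]])
    fix c assume "c \<in> mat_kernel ?P"
    then have c: "c \<in> carrier_vec N" "?P *\<^sub>v c = 0\<^sub>v N" using mat_kernel[OF P] by auto
    have "?P *\<^sub>v (?D *\<^sub>v c) = A *\<^sub>v (?P *\<^sub>v c)"
      using assoc_mult_mat_vec[OF P D c(1)] assoc_mult_mat_vec[OF A P c(1)] PD by simp
    also have "\<dots> = 0\<^sub>v N" using mat_vec_zero[OF A] by (simp add: c(2))
    finally show "?D *\<^sub>v c \<in> mat_kernel ?P" using mult_mat_vec_carrier[OF D c(1)] mat_kernel[OF P] by blast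
  qed (use w mat_kernel[OF P] in auto)
  then obtain c \<mu> where "c \<in> mat_kernel ?P" and c0: "c \<noteq> 0\<^sub>v N" and c\<mu>: "?D *\<^sub>v c = \<mu> \<cdot>\<^sub>v c" by blast
  then have c: "c \<in> carrier_vec N" "?P *\<^sub>v c = 0\<^sub>v N" using mat_kernel[OF P] by auto
  have dv: "dim_vec c = N" using c(1) by simp
  have ev: "\<nu> b * c $ b = \<mu> * c $ b" if "b < N" for b
    using Dc[OF c(1) that] dv that unfolding c\<mu> by auto
  obtain a where a: "a < N" "c $ a \<noteq> 0"
    using c(1) c0 by (rule nonzero_entry)
  have ot: "c $ b = 0" if "b < N" "b \<noteq> a" for b
  proof (rule ccontr)
    assume "c $ b \<noteq> 0"
    then have "\<nu> b = \<nu> a" using ev[OF that(1)] ev[OF a(1)] a(2) by simp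
    then show False using inj that a(1) by (auto dest: inj_onD)
  qed
  have "e a $ d = 0" if d: "d < N" for d
  proof -
    have "0 = (\<Sum>b<N. e b $ d * c $ b)" using cols_mat_mult_vec[OF c(1) d, of e] c(2) d by simp
    also have "\<dots> = (\<Sum>b<N. if b = a then e a $ d * c $ a else 0)" using ot by (intro sum.cong) auto
    finally show ?thesis using a by simp
  qed
  then have "e a = 0\<^sub>v N" using e(1)[OF a(1)] by (intro eq_vecI) auto
  then show False using e(2)[OF a(1)] by simp
qed

text \<open>
  A vector in the kernel of the transpose consists of the coefficients of a polynomial of degree less
  than \<open>N\<close> with \<open>N\<close> roots.
\<close>

lemma det_vandermonde_nonzero:
  fixes \<nu> :: "nat \<Rightarrow> 'k::field"
  assumes inj: "inj_on \<nu> {..<N}"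
  shows "det (mat N N (\<lambda>(k, b). \<nu> b ^ k)) \<noteq> 0"
proof
  let ?V = "mat N N (\<lambda>(k, b). \<nu> b ^ k)"
  have V: "?V \<in> carrier_mat N N" by simp
  assume "det ?V = 0"
  then have "det (transpose_mat ?V) = 0" using det_transpose[OF V] by simp
  then obtain c where c: "c \<in> carrier_vec N" "c \<noteq> 0\<^sub>v N" "transpose_mat ?V *\<^sub>v c = 0\<^sub>v N"
    using det_0_iff_vec_prod_zero_field[of "transpose_mat ?V" N] by auto
  define q where "q = (\<Sum>k<N. monom (c $ k) k)"
  have cq: "coeff q k = (if k < N then c $ k else 0)" for k by (simp add: q_def coeff_sum)
  have root: "poly q (\<nu> b) = 0" if "b < N" for b
  proof -
    have "(transpose_mat ?V *\<^sub>v c) $ b = (\<Sum>k<N. \<nu> b ^ k * c $ k)"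
      using that c(1) by (simp add: scalar_prod_def atLeast0LessThan)
    then show ?thesis using c(3) that by (simp add: q_def poly_sum poly_monom mult.commute)
  qed
  have "q = 0"
  proof (rule ccontr)
    assume q: "q \<noteq> 0"
    have "degree q < N"
    proof (rule ccontr)
      assume "\<not> degree q < N"
      then have "coeff q (degree q) = 0" by (simp add: cq)
      then show False using q by simp
    qed
    moreover have "N \<le> card {z. poly q z = 0}"
    proof -
      have "\<nu> ` {..<N} \<subseteq> {z. poly q z = 0}" using root by auto
      then have "card (\<nu> ` {..<N}) \<le> card {z. poly q z = 0}" by (rule card_mono[OF poly_roots_finite[OF q]])
      then show ?thesis using card_image[OF inj] by simp
    qed
    moreover have "card {z. poly q z = 0} \<le> degree q" by (rule card_poly_roots_bound[OF q])
    ultimately show False by linarith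
  qed
  then have "c $ k = 0" if "k < N" for k using cq[of k] that by simp
  then have "c = 0\<^sub>v N" using c(1) by (intro eq_vecI) auto
  then show False using c(2) by simp
qed

text \<open>
  The rows are \<open>w\<^sup>T A\<^sup>k\<close> for \<open>k < N\<close>.
\<close>

definition krylov :: "nat \<Rightarrow> 'k::comm_ring_1 mat \<Rightarrow> 'k vec \<Rightarrow> 'k mat" where
  "krylov N A w = mat N N (\<lambda>(k, b). \<Sum>c<N. w $ c * (A ^\<^sub>m k) $$ (c, b))"

lemma krylov_carrier [simp]: "krylov N A w \<in> carrier_mat N N"
  by (simp add: krylov_def)

text \<open>
  Up to a factor the image depends on the eigenvalue alone, and no longer on \<open>A\<close>.  Krylov matrices
  of two matrices thus relate their eigenvectors for equal eigenvalues.
\<close>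

lemma krylov_eigenvector:
  fixes A :: "'k::field mat"
  assumes A: "A \<in> carrier_mat N N" and e: "e \<in> carrier_vec N" "A *\<^sub>v e = \<mu> \<cdot>\<^sub>v e"
  shows "krylov N A w *\<^sub>v e = (\<Sum>c<N. w $ c * e $ c) \<cdot>\<^sub>v vec N (\<lambda>k. \<mu> ^ k)"
proof (rule eq_vecI)
  have pw: "(A ^\<^sub>m k) *\<^sub>v e = \<mu> ^ k \<cdot>\<^sub>v e" for k
  proof (induction k)
    case 0
    then show ?case using A e(1) by simp
  next
    case (Suc k)
    have "(A ^\<^sub>m Suc k) *\<^sub>v e = \<mu> \<cdot>\<^sub>v ((A ^\<^sub>m k) *\<^sub>v e)"
      using pow_mat_vec_Suc[OF A e(1), of k] mult_mat_vec[OF pow_carrier_mat[OF A] e(1)] e(2) by simp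
    then show ?case using Suc e(1) by (simp add: smult_smult_assoc)
  qed
  fix k assume "k < dim_vec ((\<Sum>c<N. w $ c * e $ c) \<cdot>\<^sub>v vec N (\<lambda>k. \<mu> ^ k))"
  then have k: "k < N" by simp
  have "(krylov N A w *\<^sub>v e) $ k = (\<Sum>b<N. (\<Sum>c<N. w $ c * (A ^\<^sub>m k) $$ (c, b)) * e $ b)"
    using k e(1) by (simp add: krylov_def scalar_prod_def atLeast0LessThan)
  also have "\<dots> = (\<Sum>c<N. w $ c * (\<Sum>b<N. (A ^\<^sub>m k) $$ (c, b) * e $ b))"
    unfolding sum_distrib_right sum_distrib_left by (subst sum.swap) (simp add: mult.assoc)
  also have "\<dots> = (\<Sum>c<N. w $ c * (\<mu> ^ k * e $ c))"
  proof (intro sum.cong refl)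
    fix c assume "c \<in> {..<N}"
    then have c: "c < N" by simp
    have "(\<Sum>b<N. (A ^\<^sub>m k) $$ (c, b) * e $ b) = ((A ^\<^sub>m k) *\<^sub>v e) $ c"
      by (rule mat_vec_entry[OF pow_carrier_mat[OF A] e(1) c, symmetric])
    then show "w $ c * (\<Sum>b<N. (A ^\<^sub>m k) $$ (c, b) * e $ b) = w $ c * (\<mu> ^ k * e $ c)"
      using c e(1) by (simp add: pw)
  qed
  finally show "(krylov N A w *\<^sub>v e) $ k = ((\<Sum>c<N. w $ c * e $ c) \<cdot>\<^sub>v vec N (\<lambda>k. \<mu> ^ k)) $ k"
    using k by (simp add: sum_distrib_right sum_distrib_left mult_ac)
qed (simp add: krylov_def)

text \<open>
  If \<open>w \<bullet> e b = 1\<close> for all \<open>b\<close>, the product of the Krylov matrix with the matrix of eigenvectors is a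
  Vandermonde matrix.
\<close>

lemma cyclic_vector_exists:
  fixes A :: "'k::alg_closed_field mat"
  assumes A: "A \<in> carrier_mat N N"
    and e: "\<And>b. b < N \<Longrightarrow> e b \<in> carrier_vec N" "\<And>b. b < N \<Longrightarrow> e b \<noteq> 0\<^sub>v N"
      "\<And>b. b < N \<Longrightarrow> A *\<^sub>v e b = \<nu> b \<cdot>\<^sub>v e b"
    and inj: "inj_on \<nu> {..<N}"
  shows "\<exists>w. det (krylov N A w) \<noteq> 0"
proof -
  let ?P = "cols_mat N e"
  have P: "?P \<in> carrier_mat N N" by simp
  obtain Q where Q: "Q \<in> carrier_mat N N" "Q * ?P = 1\<^sub>m N"
    by (rule mat_inverse_exists[OF P det_eigenvectors_nonzero[OF A e inj]])
  \<comment> \<open>The sum of the rows of the inverse pairs to 1 with each eigenvector.\<close>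
  define w where "w = vec N (\<lambda>c. \<Sum>b<N. Q $$ (b, c))"
  have we: "(\<Sum>c<N. w $ c * e b $ c) = 1" if b: "b < N" for b
  proof -
    have "(\<Sum>c<N. w $ c * e b $ c) = (\<Sum>d<N. \<Sum>c<N. Q $$ (d, c) * e b $ c)"
      by (subst sum.swap) (simp add: w_def sum_distrib_right)
    also have "\<dots> = (\<Sum>d<N. (Q * ?P) $$ (d, b))"
      using Q(1) b by (intro sum.cong) (auto simp: cols_mat_def scalar_prod_def atLeast0LessThan)
    also have "\<dots> = (\<Sum>d<N. if d = b then 1 else 0)" unfolding Q(2) using b by (intro sum.cong) auto
    finally show ?thesis using b by simp
  qed
  let ?K = "krylov N A w"
  have "?K * ?P = cols_mat N (\<lambda>b. ?K *\<^sub>v e b)" using e(1) by (intro mult_cols_mat) auto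
  also have "\<dots> = mat N N (\<lambda>(k, b). \<nu> b ^ k)"
    using krylov_eigenvector[OF A e(1,3), of _ w] we by (intro eq_matI) (auto simp: cols_mat_def)
  finally have "det ?K * det ?P \<noteq> 0"
    using det_vandermonde_nonzero[OF inj] det_mult[OF krylov_carrier P, of A w] by simp
  then show ?thesis by auto
qed

definition joint_eigenvector ::
  "nat \<Rightarrow> nat \<Rightarrow> (nat \<Rightarrow> 'k::field mat) \<Rightarrow> 'k vec \<Rightarrow> (nat \<Rightarrow> 'k) \<Rightarrow> bool" where
  "joint_eigenvector N r L e \<chi> \<longleftrightarrow>
     e \<in> carrier_vec N \<and> e \<noteq> 0\<^sub>v N \<and> (\<forall>i<r. L i *\<^sub>v e = \<chi> i \<cdot>\<^sub>v e)"

lemma joint_eigenvector_lincomb: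
  assumes "commuting_pencil N r L" "joint_eigenvector N r L e \<chi>"
  shows "mat_lincomb N r u L *\<^sub>v e = (\<Sum>i<r. u i * \<chi> i) \<cdot>\<^sub>v e"
  using assms by (intro mat_lincomb_eigenvector) (auto simp: commuting_pencil_def joint_eigenvector_def)

lemma eigenvalue_lincomb_iff:
  fixes L :: "nat \<Rightarrow> 'k::alg_closed_field mat"
  assumes L: "commuting_pencil N r L"
  shows "poly (char_poly (mat_lincomb N r u L)) \<mu> = 0 \<longleftrightarrow>
    (\<exists>e \<chi>. joint_eigenvector N r L e \<chi> \<and> (\<Sum>i<r. u i * \<chi> i) = \<mu>)" (is "?l \<longleftrightarrow> ?r")
proof
  let ?A = "mat_lincomb N r u L"
  have A: "?A \<in> carrier_mat N N" by simp
  { assume ?l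
    then obtain v where v: "v \<in> carrier_vec N" "v \<noteq> 0\<^sub>v N" "?A *\<^sub>v v = \<mu> \<cdot>\<^sub>v v"
      unfolding eigenvalue_root_char_poly[OF A, symmetric] eigenvalue_def eigenvector_def
      carrier_matD[OF A] by blast
    define E where "E = {w \<in> carrier_vec N. ?A *\<^sub>v w = \<mu> \<cdot>\<^sub>v w}"
    have "\<exists>e\<in>E. e \<noteq> 0\<^sub>v N \<and> (\<exists>\<chi>. \<forall>i<r. L i *\<^sub>v e = \<chi> i \<cdot>\<^sub>v e)"
    proof (rule common_eigenvector[OF L])
      show "is_subspace N E"
        unfolding is_subspace_def E_def
        using A by (auto simp: mult_add_distrib_mat_vec[of _ N N] mult_mat_vec[of _ N N] smult_add_distrib_vec[of _ N]
            smult_smult_assoc mult.commute)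
      show "L i *\<^sub>v w \<in> E" if i: "i < r" and w: "w \<in> E" for i w
      proof -
        have Li: "L i \<in> carrier_mat N N" using L i by (auto simp: commuting_pencil_def)
        have wc: "w \<in> carrier_vec N" "?A *\<^sub>v w = \<mu> \<cdot>\<^sub>v w" using w by (auto simp: E_def)
        have "?A *\<^sub>v (L i *\<^sub>v w) = L i *\<^sub>v (?A *\<^sub>v w)"
          using assoc_mult_mat_vec[OF A Li wc(1)] assoc_mult_mat_vec[OF Li A wc(1)] pencil_lincomb_commute[OF L i, of u] by simp
        then show ?thesis using wc Li by (simp add: E_def mult_mat_vec[of _ N N])
      qed
    qed (use v in \<open>auto simp: E_def\<close>)
    then obtain e \<chi> where e: "e \<in> E" and j: "joint_eigenvector N r L e \<chi>"
      unfolding joint_eigenvector_def E_def by blast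
    have ec: "e \<in> carrier_vec N" "e \<noteq> 0\<^sub>v N" using j by (auto simp: joint_eigenvector_def)
    have "(\<Sum>i<r. u i * \<chi> i) \<cdot>\<^sub>v e = \<mu> \<cdot>\<^sub>v e"
      using joint_eigenvector_lincomb[OF L j, of u] e by (simp add: E_def)
    moreover obtain a where "a < N" "e $ a \<noteq> 0" using ec by (rule nonzero_entry)
    ultimately have "(\<Sum>i<r. u i * \<chi> i) * e $ a = \<mu> * e $ a" "e $ a \<noteq> 0"
      using ec(1) by (metis carrier_vecD index_smult_vec(1))+
    then have "(\<Sum>i<r. u i * \<chi> i) = \<mu>" by simp
    then show ?r using j by blast }
  { assume ?r
    then obtain e \<chi> where j: "joint_eigenvector N r L e \<chi>" "(\<Sum>i<r. u i * \<chi> i) = \<mu>" by blast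
    then show ?l
      unfolding eigenvalue_root_char_poly[OF A, symmetric] eigenvalue_def eigenvector_def
      carrier_matD[OF A] using joint_eigenvector_lincomb[OF L j(1), of u] by (auto simp: joint_eigenvector_def) }
qed

lemma joint_multiplicity_nonzero_iff:
  fixes L :: "nat \<Rightarrow> 'k::alg_closed_field mat"
  assumes L: "commuting_pencil N r L"
  shows "joint_multiplicity N r L \<chi> \<noteq> 0 \<longleftrightarrow> (\<exists>e. joint_eigenvector N r L e \<chi>)"
proof -
  have "finite {\<chi>}" by simp
  then obtain u where "\<forall>\<chi>'\<in>{\<chi>}. separates_joint_eigenvalues N r L u \<chi>' \<and> separates_joint_eigenvalues N r L u \<chi>'"
    by (rule joint_eigenvalues_separated[OF L L])
  then have sep: "separates_joint_eigenvalues N r L u \<chi>" by simp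
  let ?A = "mat_lincomb N r u L"
  have A: "?A \<in> carrier_mat N N" by simp
  have "char_poly ?A \<noteq> 0" using degree_monic_char_poly[OF A] by auto
  then have "joint_multiplicity N r L \<chi> \<noteq> 0 \<longleftrightarrow> poly (char_poly ?A) (\<Sum>i<r. u i * \<chi> i) = 0"
    unfolding joint_multiplicity_eq_order[OF L sep] by (simp add: order_root)
  also have "\<dots> \<longleftrightarrow> (\<exists>e. joint_eigenvector N r L e \<chi>)"
  proof
    assume "poly (char_poly ?A) (\<Sum>i<r. u i * \<chi> i) = 0"
    then obtain e \<chi>' where e: "joint_eigenvector N r L e \<chi>'" "(\<Sum>i<r. u i * \<chi>' i) = (\<Sum>i<r. u i * \<chi> i)"
      unfolding eigenvalue_lincomb_iff[OF L] by blast
    then have "\<forall>i<r. \<chi>' i = \<chi> i" using sep unfolding separates_joint_eigenvalues_def joint_eigenvector_def by blast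
    then have "joint_eigenvector N r L e \<chi>" using e(1) by (simp add: joint_eigenvector_def)
    then show "\<exists>e. joint_eigenvector N r L e \<chi>" ..
  qed (use eigenvalue_lincomb_iff[OF L] in blast)
  finally show ?thesis .
qed

text \<open>
  For a functional \<open>u\<close> that separates the joint eigenvalues, the roots of the characteristic polynomial
  of \<open>\<Sum>\<^sub>i u\<^sub>i M\<^sub>i\<close> have the orders of the joint eigenvalues, that is 1, so there are \<open>N\<close> of them.
\<close>

lemma simple_spectrum_eigenbasis:
  fixes M :: "nat \<Rightarrow> 'k::alg_closed_field mat"
  assumes "simple_spectrum N r M"
  obtains u :: "nat \<Rightarrow> 'k" and e \<chi> where "\<forall>b<N. joint_eigenvector N r M (e b) (\<chi> b)"
    "inj_on (\<lambda>b. \<Sum>i<r. u i * \<chi> b i) {..<N}"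
proof -
  have M: "commuting_pencil N r M" and simple: "\<And>\<chi>. joint_multiplicity N r M \<chi> \<noteq> 0 \<Longrightarrow> joint_multiplicity N r M \<chi> = 1"
    using assms by (auto simp: simple_spectrum_def)
  have "finite ({} :: (nat \<Rightarrow> 'k) set)" by simp
  then obtain u where u: "\<forall>e \<chi>. e \<in> carrier_vec N \<and> e \<noteq> 0\<^sub>v N \<and> (\<forall>i<r. M i *\<^sub>v e = \<chi> i \<cdot>\<^sub>v e) \<longrightarrow>
       separates_joint_eigenvalues N r M u \<chi>"
    by (rule joint_eigenvalues_separated[OF M M])
  let ?A = "mat_lincomb N r u M"
  have A: "?A \<in> carrier_mat N N" by simp
  let ?q = "char_poly ?A"
  have q: "degree ?q = N" "?q \<noteq> 0" using degree_monic_char_poly[OF A] by auto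
  have ord: "Polynomial.order \<mu> ?q = 1" if root: "poly ?q \<mu> = 0" for \<mu>
  proof -
    obtain e \<chi> where e: "joint_eigenvector N r M e \<chi>" "(\<Sum>i<r. u i * \<chi> i) = \<mu>"
      using root unfolding eigenvalue_lincomb_iff[OF M] by blast
    have "separates_joint_eigenvalues N r M u \<chi>" using u e(1) unfolding joint_eigenvector_def by blast
    from joint_multiplicity_eq_order[OF M this] e(2) have "joint_multiplicity N r M \<chi> = Polynomial.order \<mu> ?q" by simp
    moreover have "joint_multiplicity N r M \<chi> = 1"
      using simple joint_multiplicity_nonzero_iff[OF M] e(1) by blast
    ultimately show ?thesis by simp
  qed
  have card: "card {\<mu>. poly ?q \<mu> = 0} = N"
  proof -
    obtain S where S: "size S = degree ?q" "?q = Polynomial.smult (lead_coeff ?q) (\<Prod>x\<in>#S. [:-x, 1:])"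
      using alg_closed_imp_factorization[OF q(2)] by blast
    have "proots ?q = S"
    proof -
      have lc: "lead_coeff ?q \<noteq> 0" using q(2) by simp
      have "proots (\<Prod>x\<in>#S. [:-x, 1:]) = S"
      proof (induction S)
        case (add x S)
        have "(\<Prod>x\<in>#S. [:-x, 1:]) \<noteq> 0" by (auto simp: prod_mset_zero_iff)
        then have "proots ([:-x, 1:] * (\<Prod>x\<in>#S. [:-x, 1:])) = add_mset x S"
          using proots_mult[of "[:-x, 1:]"] proots_linear_factor[of "-x"] add by simp
        then show ?case by (simp del: mult_pCons_left)
      qed simp
      then show ?thesis using proots_smult[OF lc, of "\<Prod>x\<in>#S. [:-x, 1:]"] S(2) by metis
    qed
    then have cnt: "count S \<mu> = Polynomial.order \<mu> ?q" for \<mu> using q(2) by (metis count_proots)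
    have "set_mset S = {\<mu>. poly ?q \<mu> = 0}"
      using cnt q(2) by (auto simp: set_mset_def order_root)
    moreover have "size S = (\<Sum>\<mu>\<in>set_mset S. 1)"
      unfolding size_multiset_overloaded_eq
    proof (rule sum.cong[OF refl])
      fix \<mu> assume "\<mu> \<in> set_mset S"
      then show "count S \<mu> = 1" using calculation cnt ord by auto
    qed
    ultimately show ?thesis using S(1) q(1) by simp
  qed
  have fin: "finite {\<mu>. poly ?q \<mu> = 0}" by (rule poly_roots_finite[OF q(2)])
  obtain \<nu> where \<nu>: "bij_betw \<nu> {..<N} {\<mu>. poly ?q \<mu> = 0}"
    using ex_bij_betw_nat_finite[OF fin] card by (auto simp: atLeast0LessThan)
  have "\<forall>b. \<exists>x. b < N \<longrightarrow> joint_eigenvector N r M (fst x) (snd x) \<and> (\<Sum>i<r. u i * snd x i) = \<nu> b"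
  proof
    fix b
    show "\<exists>x. b < N \<longrightarrow> joint_eigenvector N r M (fst x) (snd x) \<and> (\<Sum>i<r. u i * snd x i) = \<nu> b"
    proof (cases "b < N")
      case True
      then have "poly ?q (\<nu> b) = 0" using \<nu> by (auto simp: bij_betw_def)
      then show ?thesis unfolding eigenvalue_lincomb_iff[OF M] by auto
    qed simp
  qed
  from choice[OF this] obtain f where f: "\<And>b. b < N \<Longrightarrow> joint_eigenvector N r M (fst (f b)) (snd (f b))"
    "\<And>b. b < N \<Longrightarrow> (\<Sum>i<r. u i * snd (f b) i) = \<nu> b" by blast
  show ?thesis
  proof (rule that)
    show "\<forall>b<N. joint_eigenvector N r M ((\<lambda>b. fst (f b)) b) ((\<lambda>b. snd (f b)) b)" using f by blast
    show "inj_on (\<lambda>b. \<Sum>i<r. u i * (\<lambda>b. snd (f b)) b i) {..<N}"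
      using \<nu> f(2) by (simp add: bij_betw_def inj_on_def)
  qed
qed

lemma isospectral_joint_eigenvector:
  fixes L M :: "nat \<Rightarrow> 'k::alg_closed_field mat"
  assumes "isospectral N r L M" "joint_eigenvector N r M e \<chi>"
  shows "\<exists>e'. joint_eigenvector N r L e' \<chi>"
  using assms joint_multiplicity_nonzero_iff[of N r L \<chi>] joint_multiplicity_nonzero_iff[of N r M \<chi>]
  unfolding isospectral_def by metis

lemma invertible_krylov_matrices:
  fixes L M :: "nat \<Rightarrow> 'k::alg_closed_field mat"
  assumes iso: "isospectral N r L M" and simple: "simple_spectrum N r M"
  obtains u w w' where "det (krylov N (mat_lincomb N r u L) w) \<noteq> 0" "det (krylov N (mat_lincomb N r u M) w') \<noteq> 0"
proof -
  have L: "commuting_pencil N r L" and M: "commuting_pencil N r M" using iso by (auto simp: isospectral_def)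
  obtain u :: "nat \<Rightarrow> 'k" and e \<chi> where e: "\<forall>b<N. joint_eigenvector N r M (e b) (\<chi> b)"
    and inj: "inj_on (\<lambda>b. \<Sum>i<r. u i * \<chi> b i) {..<N}"
    by (rule simple_spectrum_eigenbasis[OF simple])
  have cyc: "\<exists>w. det (krylov N (mat_lincomb N r u K) w) \<noteq> 0"
    if K: "commuting_pencil N r K" and e: "\<forall>b<N. joint_eigenvector N r K (e b) (\<chi> b)" for K e
  proof (rule cyclic_vector_exists[OF mat_lincomb_carrier _ _ _ inj])
    fix b assume "b < N"
    with e have j: "joint_eigenvector N r K (e b) (\<chi> b)" by blast
    then show "e b \<in> carrier_vec N" "e b \<noteq> 0\<^sub>v N" by (auto simp: joint_eigenvector_def)
    show "mat_lincomb N r u K *\<^sub>v e b = (\<Sum>i<r. u i * \<chi> b i) \<cdot>\<^sub>v e b" by (rule joint_eigenvector_lincomb[OF K j])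
  qed
  have "\<forall>b. \<exists>e'. b < N \<longrightarrow> joint_eigenvector N r L e' (\<chi> b)" using isospectral_joint_eigenvector[OF iso] e by blast
  from choice[OF this] obtain e' where "\<forall>b<N. joint_eigenvector N r L (e' b) (\<chi> b)" by blast
  then show ?thesis using that cyc[OF L] cyc[OF M e] by blast
qed

text \<open>
  By \<open>krylov_eigenvector\<close>, \<open>G\<close> maps a joint eigenvector of \<open>M\<close> to a multiple of a joint eigenvector of \<open>L\<close> for
  the same eigenvalue, so both sides agree on joint eigenvectors of \<open>M\<close>, and these form a basis.
\<close>

lemma krylov_matrices_intertwine:
  fixes L M :: "nat \<Rightarrow> 'k::alg_closed_field mat"
  assumes iso: "isospectral N r L M" and simple: "simple_spectrum N r M"
    and nz: "det (krylov N (mat_lincomb N r u L) w) \<noteq> 0"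
    and G: "G \<in> carrier_mat N N" "krylov N (mat_lincomb N r u L) w * G = krylov N (mat_lincomb N r u M) w'"
    and i: "i < r"
  shows "L i * G = G * M i"
proof -
  let ?K = "krylov N (mat_lincomb N r u L) w" and ?K' = "krylov N (mat_lincomb N r u M) w'"
  have L: "commuting_pencil N r L" and M: "commuting_pencil N r M" using iso by (auto simp: isospectral_def)
  have Li: "L i \<in> carrier_mat N N" and Mi: "M i \<in> carrier_mat N N" using L M i by (auto simp: commuting_pencil_def)
  have K: "?K \<in> carrier_mat N N" by simp
  obtain H where H: "H \<in> carrier_mat N N" "H * ?K = 1\<^sub>m N" by (rule mat_inverse_exists[OF K nz])
  have canc: "H *\<^sub>v (?K *\<^sub>v v) = v" if "v \<in> carrier_vec N" for v
    using assoc_mult_mat_vec[OF H(1) K that] H(2) that by simp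
  \<comment> \<open>Both \<open>K (G f)\<close> and \<open>K e\<close> are multiples of the vector \<open>V\<close> of powers of the common eigenvalue.\<close>
  have eig: "L i *\<^sub>v (G *\<^sub>v f) = G *\<^sub>v (M i *\<^sub>v f)" if f: "joint_eigenvector N r M f \<chi>" for f \<chi>
  proof -
    have fc: "f \<in> carrier_vec N" using f by (simp add: joint_eigenvector_def)
    obtain e where e: "joint_eigenvector N r L e \<chi>" using isospectral_joint_eigenvector[OF iso f] by blast
    have ec: "e \<in> carrier_vec N" "e \<noteq> 0\<^sub>v N" "L i *\<^sub>v e = \<chi> i \<cdot>\<^sub>v e" using e i by (auto simp: joint_eigenvector_def)
    define \<alpha> \<beta> V where "\<alpha> = (\<Sum>c<N. w $ c * e $ c)" and "\<beta> = (\<Sum>c<N. w' $ c * f $ c)"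
      and "V = vec N (\<lambda>k. (\<Sum>i<r. u i * \<chi> i) ^ k)"
    have Ke: "?K *\<^sub>v e = \<alpha> \<cdot>\<^sub>v V"
      unfolding \<alpha>_def V_def by (rule krylov_eigenvector[OF mat_lincomb_carrier ec(1) joint_eigenvector_lincomb[OF L e]])
    have Kf: "?K' *\<^sub>v f = \<beta> \<cdot>\<^sub>v V"
      unfolding \<beta>_def V_def by (rule krylov_eigenvector[OF mat_lincomb_carrier fc joint_eigenvector_lincomb[OF M f]])
    have Vc: "V \<in> carrier_vec N" by (simp add: V_def)
    have "\<alpha> \<noteq> 0"
    proof
      assume "\<alpha> = 0"
      then have "?K *\<^sub>v e = 0\<^sub>v N" unfolding Ke using Vc by (intro eq_vecI) auto
      then have "e = H *\<^sub>v 0\<^sub>v N" using canc[OF ec(1)] by simp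
      then show False using ec(2) mat_vec_zero[OF H(1)] by simp
    qed
    have "?K *\<^sub>v (G *\<^sub>v f) = \<beta> \<cdot>\<^sub>v V" using assoc_mult_mat_vec[OF K G(1) fc] G(2) Kf by simp
    also have "\<dots> = (\<beta> / \<alpha>) \<cdot>\<^sub>v (\<alpha> \<cdot>\<^sub>v V)" using \<open>\<alpha> \<noteq> 0\<close> by (simp add: smult_smult_assoc)
    also have "\<dots> = ?K *\<^sub>v ((\<beta> / \<alpha>) \<cdot>\<^sub>v e)" unfolding Ke[symmetric] using mult_mat_vec[OF K ec(1)] by simp
    finally have "H *\<^sub>v (?K *\<^sub>v (G *\<^sub>v f)) = H *\<^sub>v (?K *\<^sub>v ((\<beta> / \<alpha>) \<cdot>\<^sub>v e))" by simp
    then have Gf: "G *\<^sub>v f = (\<beta> / \<alpha>) \<cdot>\<^sub>v e"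
      using canc[of "G *\<^sub>v f"] canc[of "(\<beta> / \<alpha>) \<cdot>\<^sub>v e"] G(1) fc ec(1) by simp
    have "L i *\<^sub>v (G *\<^sub>v f) = \<chi> i \<cdot>\<^sub>v (G *\<^sub>v f)"
      unfolding Gf using mult_mat_vec[OF Li ec(1)] ec(3) by (simp add: smult_smult_assoc mult.commute)
    also have "\<dots> = G *\<^sub>v (\<chi> i \<cdot>\<^sub>v f)" using mult_mat_vec[OF G(1) fc] by simp
    also have "\<chi> i \<cdot>\<^sub>v f = M i *\<^sub>v f" using f i by (simp add: joint_eigenvector_def)
    finally show ?thesis .
  qed
  obtain u' :: "nat \<Rightarrow> 'k" and f \<chi> where f: "\<forall>b<N. joint_eigenvector N r M (f b) (\<chi> b)"
    and inj: "inj_on (\<lambda>b. \<Sum>i<r. u' i * \<chi> b i) {..<N}"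
    by (rule simple_spectrum_eigenbasis[OF simple])
  let ?Q = "cols_mat N f"
  have Q: "?Q \<in> carrier_mat N N" by simp
  have fc: "f b \<in> carrier_vec N" "f b \<noteq> 0\<^sub>v N" if "b < N" for b using f that by (auto simp: joint_eigenvector_def)
  have "det ?Q \<noteq> 0"
    by (rule det_eigenvectors_nonzero[OF mat_lincomb_carrier fc _ inj])
      (use f joint_eigenvector_lincomb[OF M] in blast)+
  then obtain R where R: "R \<in> carrier_mat N N" "?Q * R = 1\<^sub>m N" by (rule mat_inverse_exists[OF Q])
  have LG: "L i * G \<in> carrier_mat N N" and GM: "G * M i \<in> carrier_mat N N" using Li Mi G(1) by auto
  have "(L i * G) * ?Q = cols_mat N (\<lambda>b. (L i * G) *\<^sub>v f b)" by (rule mult_cols_mat[OF LG fc(1)])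
  also have "\<dots> = cols_mat N (\<lambda>b. (G * M i) *\<^sub>v f b)"
  proof -
    have "(L i * G) *\<^sub>v f b = (G * M i) *\<^sub>v f b" if "b < N" for b
      using eig[of "f b" "\<chi> b"] f that assoc_mult_mat_vec[OF Li G(1) fc(1)[OF that]]
        assoc_mult_mat_vec[OF G(1) Mi fc(1)[OF that]] by simp
    then show ?thesis by (intro eq_matI) (auto simp: cols_mat_def)
  qed
  also have "\<dots> = (G * M i) * ?Q" by (rule mult_cols_mat[OF GM fc(1), symmetric])
  finally have "(L i * G) * ?Q * R = (G * M i) * ?Q * R" by simp
  then show ?thesis
    using assoc_mult_mat[OF LG Q R(1)] assoc_mult_mat[OF GM Q R(1)] R(2) LG GM
    by (simp add: right_mult_one_mat[OF LG] right_mult_one_mat[OF GM])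
qed

section \<open>Binomial identities in prime characteristic and graded determinants\<close>

text \<open>
  The typical \<open>E k i j\<close> is the \<open>k\<close>-th derivative of a product of an \<open>i\<close>-th and a \<open>j\<close>-th derivative, and the
  recursion is the Leibniz rule.
\<close>

lemma pascal_recursion:
  fixes E :: "nat \<Rightarrow> nat \<Rightarrow> nat \<Rightarrow> 'k::comm_semiring_1"
  assumes "\<And>k i j. E (Suc k) i j = E k (Suc i) j + E k i (Suc j)"
  shows "E k i j = (\<Sum>t\<le>k. of_nat (k choose t) * E 0 (i + t) (j + (k - t)))"
proof (induction k arbitrary: i j)
  case 0
  then show ?case by simp
next
  case (Suc k)
  let ?e = "\<lambda>t. E 0 (i + t) (j + (Suc k - t))"
  have "E (Suc k) i j = (\<Sum>t\<le>k. of_nat (k choose t) * ?e (Suc t)) + (\<Sum>t\<le>k. of_nat (k choose t) * ?e t)"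
    unfolding assms Suc by (intro arg_cong2[where f = "(+)"] sum.cong refl) (auto simp: Suc_diff_le)
  also have "(\<Sum>t\<le>k. of_nat (k choose t) * ?e t) = (\<Sum>t\<le>Suc k. of_nat (k choose t) * ?e t)"
    by (simp add: binomial_eq_0)
  also have "\<dots> = ?e 0 + (\<Sum>t\<le>k. of_nat (k choose Suc t) * ?e (Suc t))"
    by (simp add: sum.atMost_Suc_shift del: sum.atMost_Suc)
  also have "(\<Sum>t\<le>k. of_nat (k choose t) * ?e (Suc t)) + (?e 0 + (\<Sum>t\<le>k. of_nat (k choose Suc t) * ?e (Suc t)))
     = ?e 0 + (\<Sum>t\<le>k. of_nat (Suc k choose Suc t) * ?e (Suc t))"
    by (simp add: sum.distrib distrib_right add_ac)
  also have "\<dots> = (\<Sum>t\<le>Suc k. of_nat (Suc k choose t) * ?e t)"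
    by (simp add: sum.atMost_Suc_shift del: sum.atMost_Suc binomial_Suc_Suc)
  finally show ?case .
qed

lemma pascal_recursion_prime_char:
  fixes E :: "nat \<Rightarrow> nat \<Rightarrow> nat \<Rightarrow> 'k::comm_ring_1"
  assumes p: "prime CHAR('k)" and "\<And>k i j. E (Suc k) i j = E k (Suc i) j + E k i (Suc j)"
  shows "E CHAR('k) 0 0 = E 0 CHAR('k) 0 + E 0 0 CHAR('k)"
proof -
  let ?p = "CHAR('k)"
  have p2: "?p \<ge> 2" using p prime_ge_2_nat by blast
  have "E ?p 0 0 = (\<Sum>t\<le>?p. of_nat (?p choose t) * E 0 t (?p - t))"
    using pascal_recursion[of E ?p 0 0, OF assms(2)] by simp
  also have "\<dots> = (\<Sum>t\<in>{0, ?p}. of_nat (?p choose t) * E 0 t (?p - t))"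
  proof (rule sum.mono_neutral_right)
    show "\<forall>t\<in>{..?p} - {0, ?p}. of_nat (?p choose t) * E 0 t (?p - t) = 0"
    proof
      fix t assume "t \<in> {..?p} - {0, ?p}"
      then have "?p dvd (?p choose t)" using p p2 by (intro dvd_choose_prime) auto
      then have "(of_nat (?p choose t) :: 'k) = 0" by (simp add: of_nat_eq_0_iff_char_dvd)
      then show "of_nat (?p choose t) * E 0 t (?p - t) = 0" by simp
    qed
  qed auto
  also have "\<dots> = E 0 ?p 0 + E 0 0 ?p" using p2 by simp
  finally show ?thesis .
qed

lemma mat_freshmans_dream:
  fixes A B :: "'k::comm_ring_1 mat"
  assumes p: "prime CHAR('k)" and A: "A \<in> carrier_mat N N" and B: "B \<in> carrier_mat N N" and comm: "A * B = B * A"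
  shows "(A + B) ^\<^sub>m CHAR('k) = A ^\<^sub>m CHAR('k) + B ^\<^sub>m CHAR('k)"
proof -
  have AB: "A + B \<in> carrier_mat N N" using A B by simp
  have pw: "A ^\<^sub>m i \<in> carrier_mat N N" "B ^\<^sub>m i \<in> carrier_mat N N" "(A + B) ^\<^sub>m i \<in> carrier_mat N N" for i
    using A B AB by auto
  have ASuc: "A * A ^\<^sub>m i = A ^\<^sub>m Suc i" if "A \<in> carrier_mat N N" for i and A :: "'k mat"
    using that by (induction i) (simp_all add: assoc_mult_mat[of _ N N _ N _ N, symmetric])
  have BA: "B * A ^\<^sub>m i = A ^\<^sub>m i * B" for i
  proof (induction i)
    case (Suc i)
    have "B * A ^\<^sub>m Suc i = (B * A ^\<^sub>m i) * A" using A B pw by (simp add: assoc_mult_mat[of _ N N _ N _ N])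
    also have "\<dots> = A ^\<^sub>m i * (B * A)" using A B pw Suc by (simp add: assoc_mult_mat[of _ N N _ N _ N])
    also have "\<dots> = A ^\<^sub>m Suc i * B" using A B pw comm by (simp add: assoc_mult_mat[of _ N N _ N _ N])
    finally show ?case .
  qed (use A B in simp)
  have step: "(A + B) ^\<^sub>m Suc k * (A ^\<^sub>m i * B ^\<^sub>m j) =
      (A + B) ^\<^sub>m k * (A ^\<^sub>m Suc i * B ^\<^sub>m j) + (A + B) ^\<^sub>m k * (A ^\<^sub>m i * B ^\<^sub>m Suc j)" for k i j
  proof -
    have c: "A ^\<^sub>m i * B ^\<^sub>m j \<in> carrier_mat N N" "A * (A ^\<^sub>m i * B ^\<^sub>m j) \<in> carrier_mat N N" "B * (A ^\<^sub>m i * B ^\<^sub>m j) \<in> carrier_mat N N"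
      using pw[of i] pw[of j] A B by auto
    have "(A + B) ^\<^sub>m Suc k * (A ^\<^sub>m i * B ^\<^sub>m j) = (A + B) ^\<^sub>m k * ((A + B) * (A ^\<^sub>m i * B ^\<^sub>m j))"
      using assoc_mult_mat[OF pw(3) AB c(1), of k] by simp
    also have "(A + B) * (A ^\<^sub>m i * B ^\<^sub>m j) = A * (A ^\<^sub>m i * B ^\<^sub>m j) + B * (A ^\<^sub>m i * B ^\<^sub>m j)"
      by (rule add_mult_distrib_mat[OF A B c(1)])
    also have "(A + B) ^\<^sub>m k * \<dots> = (A + B) ^\<^sub>m k * (A * (A ^\<^sub>m i * B ^\<^sub>m j)) + (A + B) ^\<^sub>m k * (B * (A ^\<^sub>m i * B ^\<^sub>m j))"
      by (rule mult_add_distrib_mat[OF pw(3) c(2,3)])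
    also have "A * (A ^\<^sub>m i * B ^\<^sub>m j) = A ^\<^sub>m Suc i * B ^\<^sub>m j"
      using assoc_mult_mat[OF A pw(1,2), of i j] ASuc[OF A, of i] by simp
    also have "B * (A ^\<^sub>m i * B ^\<^sub>m j) = A ^\<^sub>m i * (B * B ^\<^sub>m j)"
      using assoc_mult_mat[OF B pw(1,2), of i j] assoc_mult_mat[OF pw(1) B pw(2), of i j] BA[of i] by simp
    finally show ?thesis unfolding ASuc[OF B] .
  qed
  show ?thesis
  proof (rule eq_matI)
    fix a b assume "a < dim_row (A ^\<^sub>m CHAR('k) + B ^\<^sub>m CHAR('k))" "b < dim_col (A ^\<^sub>m CHAR('k) + B ^\<^sub>m CHAR('k))"
    then have ab: "a < N" "b < N" using pw(2)[of "CHAR('k)"] by auto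
    define E where "E k i j = ((A + B) ^\<^sub>m k * (A ^\<^sub>m i * B ^\<^sub>m j)) $$ (a, b)" for k i j
    have "E (Suc k) i j = E k (Suc i) j + E k i (Suc j)" for k i j
    proof -
      have c: "(A + B) ^\<^sub>m k * (A ^\<^sub>m i * B ^\<^sub>m Suc j) \<in> carrier_mat N N"
        using pw(1)[of i] pw(2)[of "Suc j"] pw(3)[of k] by (metis mult_carrier_mat)
      show ?thesis unfolding E_def step
        by (rule index_add_mat(1)) (simp_all only: carrier_matD[OF c] ab)
    qed
    from pascal_recursion_prime_char[of E, OF p this]
    have "E CHAR('k) 0 0 = E 0 CHAR('k) 0 + E 0 0 CHAR('k)" .
    moreover have "E k 0 0 = ((A + B) ^\<^sub>m k) $$ (a, b)" for k using A B pw[of k] by (simp add: E_def)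
    moreover have "E 0 k 0 = (A ^\<^sub>m k) $$ (a, b)" "E 0 0 k = (B ^\<^sub>m k) $$ (a, b)" for k
      using A B pw[of k] by (simp_all add: E_def)
    ultimately show "((A + B) ^\<^sub>m CHAR('k)) $$ (a, b) = (A ^\<^sub>m CHAR('k) + B ^\<^sub>m CHAR('k)) $$ (a, b)"
      by (subst index_add_mat(1)) (simp_all only: carrier_matD[OF pw(2)] ab)
  qed (use A B in auto)
qed

lemma smult_pow_mat:
  fixes A :: "'k::comm_ring_1 mat"
  assumes A: "A \<in> carrier_mat N N"
  shows "(c \<cdot>\<^sub>m A) ^\<^sub>m k = c ^ k \<cdot>\<^sub>m A ^\<^sub>m k"
proof (induction k)
  case 0
  then show ?case using A by (intro eq_matI) auto
next
  case (Suc k)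
  have "(c \<cdot>\<^sub>m A) ^\<^sub>m Suc k = (c ^ k \<cdot>\<^sub>m A ^\<^sub>m k) * (c \<cdot>\<^sub>m A)" using Suc by simp
  also have "\<dots> = c \<cdot>\<^sub>m (c ^ k \<cdot>\<^sub>m A ^\<^sub>m k * A)"
    using A by (intro mult_smult_distrib[of _ N N _ N]) auto
  also have "c ^ k \<cdot>\<^sub>m A ^\<^sub>m k * A = c ^ k \<cdot>\<^sub>m (A ^\<^sub>m k * A)"
    using A by (intro mult_smult_assoc_mat[of _ N N _ N]) auto
  finally show ?case using A by (intro eq_matI) (auto simp: mult_ac)
qed

lemma prod_graded_poly:
  fixes q :: "'i \<Rightarrow> 'k::comm_ring_1 poly"
  assumes "finite I" and "\<And>i k. i \<in> I \<Longrightarrow> coeff (q i) k \<noteq> 0 \<Longrightarrow> 1 \<le> k \<and> k \<le> p"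
  shows "(\<forall>k. coeff (\<Prod>i\<in>I. q i) k \<noteq> 0 \<longrightarrow> card I \<le> k \<and> k \<le> p * card I) \<and>
    coeff (\<Prod>i\<in>I. q i) (p * card I) = (\<Prod>i\<in>I. coeff (q i) p)"
  using assms
proof (induction I rule: finite_induct)
  case empty
  then show ?case by (auto simp: coeff_1 split: if_splits)
next
  case (insert x I)
  let ?Q = "\<Prod>i\<in>I. q i"
  have IH: "\<And>k. coeff ?Q k \<noteq> 0 \<Longrightarrow> card I \<le> k \<and> k \<le> p * card I"
    "coeff ?Q (p * card I) = (\<Prod>i\<in>I. coeff (q i) p)" using insert by auto
  have qx: "\<And>k. coeff (q x) k \<noteq> 0 \<Longrightarrow> 1 \<le> k \<and> k \<le> p" using insert.prems by auto
  have "1 + card I \<le> k \<and> k \<le> p + p * card I" if "coeff (q x * ?Q) k \<noteq> 0" for k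
  proof -
    obtain i where "i \<le> k" "coeff (q x) i * coeff ?Q (k - i) \<noteq> 0"
      using \<open>coeff (q x * ?Q) k \<noteq> 0\<close> unfolding coeff_mult by (metis (no_types, lifting) atMost_iff sum.neutral)
    then show ?thesis using qx[of i] IH(1)[of "k - i"] by force
  qed
  moreover have "coeff (q x * ?Q) (p + p * card I) = coeff (q x) p * coeff ?Q (p * card I)"
  proof -
    have "coeff (q x * ?Q) (p + p * card I) = (\<Sum>i\<in>{p}. coeff (q x) i * coeff ?Q (p + p * card I - i))"
      unfolding coeff_mult
    proof (rule sum.mono_neutral_right)
      show "\<forall>i\<in>{..p + p * card I} - {p}. coeff (q x) i * coeff ?Q (p + p * card I - i) = 0"
      proof
        fix i assume i: "i \<in> {..p + p * card I} - {p}"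
        show "coeff (q x) i * coeff ?Q (p + p * card I - i) = 0"
        proof (rule ccontr)
          assume "\<not> ?thesis"
          then have "coeff (q x) i \<noteq> 0" "coeff ?Q (p + p * card I - i) \<noteq> 0" by auto
          then have "i \<le> p" "p + p * card I - i \<le> p * card I" using qx IH(1) by blast+
          then show False using i by auto
        qed
      qed
    qed auto
    then show ?thesis by simp
  qed
  ultimately show ?case using insert.hyps IH(2) by (auto simp: algebra_simps)
qed

text \<open>
  In each term of the Leibniz expansion the degrees of \<open>N\<close> entries add up.
\<close>

lemma det_graded_poly:
  fixes Q :: "nat \<Rightarrow> nat \<Rightarrow> 'k::comm_ring_1 poly"
  assumes "\<And>a b k. a < N \<Longrightarrow> b < N \<Longrightarrow> coeff (Q a b) k \<noteq> 0 \<Longrightarrow> 1 \<le> k \<and> k \<le> p"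
  obtains q where "\<And>t. det (mat N N (\<lambda>(a, b). poly (Q a b) t)) = poly q t"
    "\<And>k. coeff q k \<noteq> 0 \<Longrightarrow> N \<le> k \<and> k \<le> p * N"
    "coeff q (p * N) = det (mat N N (\<lambda>(a, b). coeff (Q a b) p))"
proof
  let ?P = "{\<pi>. \<pi> permutes {0..<N}}"
  define q where "q = (\<Sum>\<pi>\<in>?P. signof \<pi> * (\<Prod>i\<in>{0..<N}. Q i (\<pi> i)))"
  have sg: "signof \<pi> * f = Polynomial.smult (signof \<pi>) f" for \<pi> and f :: "'k poly"
    by (simp add: sign_def)
  have lt: "\<pi> i < N" if "\<pi> permutes {0..<N}" "i < N" for \<pi> i
    using that by (metis atLeastLessThan_iff permutes_in_image zero_le)
  have pr: "(\<forall>k. coeff (\<Prod>i\<in>{0..<N}. Q i (\<pi> i)) k \<noteq> 0 \<longrightarrow> N \<le> k \<and> k \<le> p * N) \<and>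
     coeff (\<Prod>i\<in>{0..<N}. Q i (\<pi> i)) (p * N) = (\<Prod>i\<in>{0..<N}. coeff (Q i (\<pi> i)) p)" if "\<pi> \<in> ?P" for \<pi>
  proof -
    have "\<pi> i < N" if "i < N" for i using lt \<open>\<pi> \<in> ?P\<close> that by simp
    then have h: "1 \<le> k \<and> k \<le> p" if "i \<in> {0..<N}" "coeff (Q i (\<pi> i)) k \<noteq> 0" for i k
      using assms[of i "\<pi> i" k] that by simp
    show ?thesis
      using prod_graded_poly[of "{0..<N}" "\<lambda>i. Q i (\<pi> i)" p, OF finite_atLeastLessThan h] by simp
  qed
  show "det (mat N N (\<lambda>(a, b). poly (Q a b) t)) = poly q t" for t
    unfolding q_def det_def using lt
    by (auto simp: poly_sum poly_prod sg intro!: sum.cong arg_cong2[where f = "(*)"] prod.cong)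
  show "N \<le> k \<and> k \<le> p * N" if "coeff q k \<noteq> 0" for k
  proof -
    have "(\<Sum>\<pi>\<in>?P. signof \<pi> * coeff (\<Prod>i\<in>{0..<N}. Q i (\<pi> i)) k) \<noteq> 0"
      using that by (simp add: q_def coeff_sum sg)
    then obtain \<pi> where "\<pi> \<in> ?P" "coeff (\<Prod>i\<in>{0..<N}. Q i (\<pi> i)) k \<noteq> 0"
      by (metis (no_types, lifting) mult_zero_right sum.neutral)
    then show ?thesis using pr by blast
  qed
  show "coeff q (p * N) = det (mat N N (\<lambda>(a, b). coeff (Q a b) p))"
    unfolding q_def det_def using lt pr
    by (auto simp: coeff_sum sg intro!: sum.cong arg_cong2[where f = "(*)"] prod.cong)
qed

lemma pfun_det:
  assumes "\<And>a b. a < N \<Longrightarrow> b < N \<Longrightarrow> (\<lambda>s. M s a b) \<in> pfun n"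
  shows "(\<lambda>s. det (mat N N (\<lambda>(a, b). M s a b))) \<in> pfun n"
proof -
  have lt: "\<pi> i < N" if "\<pi> permutes {0..<N}" "i < N" for \<pi> i
    using that by (metis atLeastLessThan_iff permutes_in_image zero_le)
  have "det (mat N N (\<lambda>(a, b). M s a b)) =
      (\<Sum>\<pi>\<in>{\<pi>. \<pi> permutes {0..<N}}. signof \<pi> * (\<Prod>i\<in>{0..<N}. M s i (\<pi> i)))" for s
    unfolding det_def using lt by (auto intro!: sum.cong arg_cong2[where f = "(*)"] prod.cong)
  then show ?thesis using assms lt by (auto intro!: pfun_sum pfun_prod pfun.mult pfun.const)
qed

section \<open>Connections over a ring with derivations\<close>

text \<open>
  Elements of \<open>R\<close> are functions on the whole type that matter only on \<open>U\<close>, so all identities are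
  stated on \<open>U\<close>.  The intended example consists of the regular functions on the domain \<open>U\<close> of local
  coordinates and their partial derivatives.
\<close>

locale commuting_derivations =
  fixes U :: "'x set" and R :: "('x \<Rightarrow> 'k::alg_closed_field) set"
    and D :: "nat \<Rightarrow> ('x \<Rightarrow> 'k) \<Rightarrow> 'x \<Rightarrow> 'k" and r :: nat
  assumes prime_char: "prime CHAR('k)"
    and R_const: "(\<lambda>_. c) \<in> R"
    and R_add: "f \<in> R \<Longrightarrow> g \<in> R \<Longrightarrow> (\<lambda>y. f y + g y) \<in> R"
    and R_mult: "f \<in> R \<Longrightarrow> g \<in> R \<Longrightarrow> (\<lambda>y. f y * g y) \<in> R"
    and R_cong: "f \<in> R \<Longrightarrow> (\<And>y. y \<in> U \<Longrightarrow> f y = g y) \<Longrightarrow> g \<in> R"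
    and D_R: "i < r \<Longrightarrow> f \<in> R \<Longrightarrow> D i f \<in> R"
    and D_cong: "i < r \<Longrightarrow> f \<in> R \<Longrightarrow> (\<And>y. y \<in> U \<Longrightarrow> f y = g y) \<Longrightarrow> y \<in> U \<Longrightarrow> D i f y = D i g y"
    and D_add: "i < r \<Longrightarrow> f \<in> R \<Longrightarrow> g \<in> R \<Longrightarrow> y \<in> U \<Longrightarrow> D i (\<lambda>y. f y + g y) y = D i f y + D i g y"
    and D_mult: "i < r \<Longrightarrow> f \<in> R \<Longrightarrow> g \<in> R \<Longrightarrow> y \<in> U \<Longrightarrow>
      D i (\<lambda>y. f y * g y) y = f y * D i g y + g y * D i f y"
    and D_const: "i < r \<Longrightarrow> y \<in> U \<Longrightarrow> D i (\<lambda>_. c) y = 0"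
    and D_p_power: "i < r \<Longrightarrow> f \<in> R \<Longrightarrow> y \<in> U \<Longrightarrow> (D i ^^ CHAR('k)) f y = 0"
begin

lemma R_uminus: "f \<in> R \<Longrightarrow> (\<lambda>y. - f y) \<in> R"
  using R_mult[OF R_const[of "-1"]] by fastforce

lemma R_diff: "f \<in> R \<Longrightarrow> g \<in> R \<Longrightarrow> (\<lambda>y. f y - g y) \<in> R"
  using R_add[OF _ R_uminus] by fastforce

lemma R_sum: "(\<And>a. a \<in> A \<Longrightarrow> f a \<in> R) \<Longrightarrow> (\<lambda>y. \<Sum>a\<in>A. f a y) \<in> R"
  by (induction A rule: infinite_finite_induct) (auto intro: R_const R_add)

lemma R_power: "f \<in> R \<Longrightarrow> (\<lambda>y. f y ^ k) \<in> R"
  by (induction k) (auto intro: R_const R_mult)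

lemma D_scale: "i < r \<Longrightarrow> f \<in> R \<Longrightarrow> y \<in> U \<Longrightarrow> D i (\<lambda>y. c * f y) y = c * D i f y"
  using D_mult[OF _ R_const[of c], of i f y] D_const by simp

lemma D_sum: "finite A \<Longrightarrow> i < r \<Longrightarrow> (\<And>a. a \<in> A \<Longrightarrow> f a \<in> R) \<Longrightarrow> y \<in> U \<Longrightarrow>
    D i (\<lambda>y. \<Sum>a\<in>A. f a y) y = (\<Sum>a\<in>A. D i (f a) y)"
proof (induction A rule: finite_induct)
  case empty
  then show ?case using D_const by simp
next
  case (insert x A)
  have "D i (\<lambda>y. f x y + (\<Sum>a\<in>A. f a y)) y = D i (f x) y + D i (\<lambda>y. \<Sum>a\<in>A. f a y) y"
    by (rule D_add) (use insert in \<open>auto intro: R_sum\<close>)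
  then show ?case using insert by simp
qed

definition is_section :: "nat \<Rightarrow> (nat \<Rightarrow> 'x \<Rightarrow> 'k) \<Rightarrow> bool" where
  "is_section N F \<longleftrightarrow> (\<forall>a<N. F a \<in> R)"

definition is_matrix :: "nat \<Rightarrow> (nat \<Rightarrow> nat \<Rightarrow> 'x \<Rightarrow> 'k) \<Rightarrow> bool" where
  "is_matrix N M \<longleftrightarrow> (\<forall>a<N. \<forall>b<N. M a b \<in> R)"

definition section_eq :: "nat \<Rightarrow> (nat \<Rightarrow> 'x \<Rightarrow> 'k) \<Rightarrow> (nat \<Rightarrow> 'x \<Rightarrow> 'k) \<Rightarrow> bool" where
  "section_eq N F G \<longleftrightarrow> (\<forall>a<N. \<forall>y\<in>U. F a y = G a y)"

text \<open>
  The covariant derivative of the connection \<open>d - M\<close> in direction \<open>i\<close>.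
\<close>

definition cov :: "nat \<Rightarrow> nat \<Rightarrow> (nat \<Rightarrow> nat \<Rightarrow> 'x \<Rightarrow> 'k) \<Rightarrow> (nat \<Rightarrow> 'x \<Rightarrow> 'k) \<Rightarrow> nat \<Rightarrow> 'x \<Rightarrow> 'k" where
  "cov N i M F a y = D i (F a) y - (\<Sum>b<N. M a b y * F b y)"

definition mat_apply :: "nat \<Rightarrow> (nat \<Rightarrow> nat \<Rightarrow> 'x \<Rightarrow> 'k) \<Rightarrow> (nat \<Rightarrow> 'x \<Rightarrow> 'k) \<Rightarrow> nat \<Rightarrow> 'x \<Rightarrow> 'k" where
  "mat_apply N A F a y = (\<Sum>b<N. A a b y * F b y)"

definition unit_section :: "nat \<Rightarrow> nat \<Rightarrow> 'x \<Rightarrow> 'k" where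
  "unit_section b a y = of_bool (a = b)"

lemma unit_section: "is_section N (unit_section b)"
  by (auto simp: is_section_def unit_section_def[abs_def] R_const)

lemma mat_apply_section: "is_matrix N A \<Longrightarrow> is_section N F \<Longrightarrow> is_section N (mat_apply N A F)"
  by (auto simp: is_section_def is_matrix_def mat_apply_def[abs_def] intro!: R_sum R_mult)

lemma mat_apply_unit: "b < N \<Longrightarrow> mat_apply N A (unit_section b) a y = A a b y"
  by (simp add: mat_apply_def unit_section_def)

lemma section_eq_trans: "section_eq N F G \<Longrightarrow> section_eq N G H \<Longrightarrow> section_eq N F H"
  by (auto simp: section_eq_def)

lemma section_eq_sym: "section_eq N F G \<Longrightarrow> section_eq N G F"
  by (auto simp: section_eq_def)

lemma section_eq_refl: "section_eq N F F"
  by (auto simp: section_eq_def)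

context
  fixes N i :: nat and M
  assumes i: "i < r" and M: "is_matrix N M"
begin

lemma cov_section: "is_section N F \<Longrightarrow> is_section N (cov N i M F)"
  unfolding is_section_def cov_def[abs_def]
  using M i by (auto intro!: R_diff D_R R_sum R_mult simp: is_matrix_def)

lemma cov_cong: "is_section N F \<Longrightarrow> section_eq N F G \<Longrightarrow> section_eq N (cov N i M F) (cov N i M G)"
  unfolding section_eq_def
proof (intro allI impI ballI)
  fix a y assume h: "is_section N F" "\<forall>a<N. \<forall>y\<in>U. F a y = G a y" "a < N" "y \<in> U"
  have "D i (F a) y = D i (G a) y"
    by (rule D_cong[OF i]) (use h in \<open>auto simp: is_section_def\<close>)
  moreover have "(\<Sum>b<N. M a b y * F b y) = (\<Sum>b<N. M a b y * G b y)"
    using h by (intro sum.cong) auto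
  ultimately show "cov N i M F a y = cov N i M G a y" by (simp add: cov_def)
qed

lemma cov_pow_section: "is_section N F \<Longrightarrow> is_section N ((cov N i M ^^ k) F)"
  by (induction k) (auto intro: cov_section)

lemma cov_pow_cong: "is_section N F \<Longrightarrow> section_eq N F G \<Longrightarrow> section_eq N ((cov N i M ^^ k) F) ((cov N i M ^^ k) G)"
proof (induction k)
  case (Suc k)
  then show ?case using cov_cong[OF cov_pow_section] by simp
qed simp

lemma cov_add:
  assumes "is_section N F" "is_section N G"
  shows "section_eq N (cov N i M (\<lambda>a y. F a y + G a y)) (\<lambda>a y. cov N i M F a y + cov N i M G a y)"
  unfolding section_eq_def
proof (intro allI impI ballI)
  fix a y assume ay: "a < N" "y \<in> U"
  have "D i (\<lambda>y. F a y + G a y) y = D i (F a) y + D i (G a) y"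
    by (rule D_add[OF i]) (use assms ay in \<open>auto simp: is_section_def\<close>)
  then show "cov N i M (\<lambda>a y. F a y + G a y) a y = cov N i M F a y + cov N i M G a y"
    by (simp add: cov_def distrib_left sum.distrib)
qed

lemma cov_pow_add:
  assumes "is_section N F" "is_section N G"
  shows "section_eq N ((cov N i M ^^ k) (\<lambda>a y. F a y + G a y)) (\<lambda>a y. (cov N i M ^^ k) F a y + (cov N i M ^^ k) G a y)"
proof (induction k)
  case 0
  then show ?case by (simp add: section_eq_def)
next
  case (Suc k)
  have "is_section N (\<lambda>a y. F a y + G a y)" using assms by (auto simp: is_section_def intro: R_add)
  from section_eq_trans[OF cov_cong[OF cov_pow_section[OF this] Suc]
     cov_add[OF cov_pow_section[OF assms(1)] cov_pow_section[OF assms(2)]]]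
  show ?case by simp
qed

lemma cov_pow_sum:
  assumes "finite A" "\<And>c. c \<in> A \<Longrightarrow> is_section N (F c)"
  shows "section_eq N ((cov N i M ^^ k) (\<lambda>a y. \<Sum>c\<in>A. F c a y)) (\<lambda>a y. \<Sum>c\<in>A. (cov N i M ^^ k) (F c) a y)"
  using assms
proof (induction A rule: finite_induct)
  case empty
  have z: "is_section N (\<lambda>a y. 0)" by (simp add: is_section_def R_const)
  have "section_eq N ((cov N i M ^^ k) (\<lambda>a y. 0)) (\<lambda>a y. 0)"
  proof (induction k)
    case (Suc k)
    have "section_eq N (cov N i M (\<lambda>a y. 0)) (\<lambda>a y. 0)" using D_const[OF i] by (auto simp: section_eq_def cov_def)
    then show ?case using section_eq_trans[OF cov_cong[OF cov_pow_section[OF z] Suc]] by simp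
  qed (simp add: section_eq_def)
  then show ?case by simp
next
  case (insert x A)
  have s: "is_section N (F x)" "is_section N (\<lambda>a y. \<Sum>c\<in>A. F c a y)"
    using insert.prems by (auto simp: is_section_def intro: R_sum)
  have "section_eq N ((cov N i M ^^ k) (\<lambda>a y. \<Sum>c\<in>insert x A. F c a y))
      (\<lambda>a y. (cov N i M ^^ k) (F x) a y + (cov N i M ^^ k) (\<lambda>a y. \<Sum>c\<in>A. F c a y) a y)"
    using cov_pow_add[OF s, of k] insert.hyps by simp
  then show ?case using insert by (auto simp: section_eq_def)
qed

lemma D_pow_R: "f \<in> R \<Longrightarrow> (D i ^^ k) f \<in> R"
  by (induction k) (auto intro: D_R i)

lemma scaled_section: "f \<in> R \<Longrightarrow> is_section N F \<Longrightarrow> is_section N (\<lambda>a y. f y * F a y)"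
  by (auto simp: is_section_def intro: R_mult)

text \<open>
  In characteristic \<open>p\<close> the Leibniz rule for the \<open>p\<close>-th power has only two terms,
  \<open>\<nabla>\<^sup>p (f F) = D\<^sup>p f F + f \<nabla>\<^sup>p F\<close>, and \<open>D\<^sup>p = 0\<close>.
\<close>

lemma cov_p_power_scale:
  assumes f: "f \<in> R" and F: "is_section N F" and ay: "a < N" "y \<in> U"
  shows "(cov N i M ^^ CHAR('k)) (\<lambda>a y. f y * F a y) a y = f y * (cov N i M ^^ CHAR('k)) F a y"
proof -
  define E where "E k t j = (cov N i M ^^ k) (\<lambda>a y. (D i ^^ t) f y * (cov N i M ^^ j) F a y) a y" for k t j
  have "E (Suc k) t j = E k (Suc t) j + E k t (Suc j)" for k t j
  proof -
    let ?g = "(D i ^^ t) f" and ?G = "(cov N i M ^^ j) F"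
    have g: "?g \<in> R" and G: "is_section N ?G" using D_pow_R[OF f] cov_pow_section[OF F] by auto
    have s1: "is_section N (\<lambda>a y. D i ?g y * ?G a y)" and s2: "is_section N (\<lambda>a y. ?g y * cov N i M ?G a y)"
      using scaled_section[OF D_R[OF i g] G] scaled_section[OF g cov_section[OF G]] by auto
    have leibniz: "section_eq N (cov N i M (\<lambda>a y. ?g y * ?G a y)) (\<lambda>a y. D i ?g y * ?G a y + ?g y * cov N i M ?G a y)"
      unfolding section_eq_def
    proof (intro allI impI ballI)
      fix a y assume ay: "a < N" "y \<in> U"
      have "D i (\<lambda>y. ?g y * ?G a y) y = ?g y * D i (?G a) y + ?G a y * D i ?g y"
        by (rule D_mult[OF i g]) (use G ay in \<open>auto simp: is_section_def\<close>)
      then show "cov N i M (\<lambda>a y. ?g y * ?G a y) a y = D i ?g y * ?G a y + ?g y * cov N i M ?G a y"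
        by (simp add: cov_def right_diff_distrib sum_distrib_left mult_ac)
    qed
    have "section_eq N ((cov N i M ^^ k) (cov N i M (\<lambda>a y. ?g y * ?G a y)))
       ((cov N i M ^^ k) (\<lambda>a y. D i ?g y * ?G a y + ?g y * cov N i M ?G a y))"
      by (rule cov_pow_cong[OF cov_section[OF scaled_section[OF g G]] leibniz])
    from section_eq_trans[OF this cov_pow_add[OF s1 s2, of k]] show ?thesis
      using ay by (simp add: E_def section_eq_def funpow_swap1)
  qed
  from pascal_recursion_prime_char[of E, OF prime_char this]
  have "E CHAR('k) 0 0 = E 0 CHAR('k) 0 + E 0 0 CHAR('k)" .
  then show ?thesis using D_p_power[OF i f ay(2)] by (simp add: E_def)
qed

text \<open>
  The matrix of the \<open>p\<close>-curvature.
\<close>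

definition curv :: "nat \<Rightarrow> nat \<Rightarrow> 'x \<Rightarrow> 'k" where
  "curv a b = (cov N i M ^^ CHAR('k)) (unit_section b) a"

lemma curv_R: "is_matrix N curv"
  using cov_pow_section[OF unit_section] by (auto simp: is_matrix_def is_section_def curv_def)

lemma cov_p_power_eq_curv:
  assumes F: "is_section N F"
  shows "section_eq N ((cov N i M ^^ CHAR('k)) F) (mat_apply N curv F)"
proof -
  have Fc: "F c \<in> R" if "c < N" for c using F that by (simp add: is_section_def)
  have s: "is_section N (\<lambda>a y. F c y * unit_section c a y)" if "c < N" for c
    using scaled_section[OF Fc[OF that] unit_section] .
  have "section_eq N F (\<lambda>a y. \<Sum>c<N. F c y * unit_section c a y)"
    by (auto simp: section_eq_def unit_section_def)
  from cov_pow_cong[OF F this]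
  have "section_eq N ((cov N i M ^^ CHAR('k)) F) ((cov N i M ^^ CHAR('k)) (\<lambda>a y. \<Sum>c<N. F c y * unit_section c a y))" .
  from section_eq_trans[OF this cov_pow_sum] s
  have "section_eq N ((cov N i M ^^ CHAR('k)) F) (\<lambda>a y. \<Sum>c<N. (cov N i M ^^ CHAR('k)) (\<lambda>a y. F c y * unit_section c a y) a y)"
    by auto
  then show ?thesis
    using cov_p_power_scale[OF Fc unit_section]
    by (auto simp: section_eq_def mat_apply_def curv_def mult.commute intro!: sum.cong)
qed

end

lemma curv_commute:
  assumes i: "i < r" and l: "l < r" and M: "is_matrix N M" and M': "is_matrix N M'"
    and flat: "\<And>F. is_section N F \<Longrightarrow> section_eq N (cov N i M (cov N l M' F)) (cov N l M' (cov N i M F))"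
    and ab: "a < N" "b < N" and y: "y \<in> U"
  shows "(\<Sum>c<N. curv N i M a c y * curv N l M' c b y) = (\<Sum>c<N. curv N l M' a c y * curv N i M c b y)"
proof -
  have 1: "section_eq N ((cov N i M ^^ k) (cov N l M' F)) (cov N l M' ((cov N i M ^^ k) F))"
    if F: "is_section N F" for k F
  proof (induction k)
    case (Suc k)
    have "section_eq N (cov N i M ((cov N i M ^^ k) (cov N l M' F))) (cov N i M (cov N l M' ((cov N i M ^^ k) F)))"
      by (rule cov_cong[OF i M cov_pow_section[OF i M cov_section[OF l M' F]] Suc])
    from section_eq_trans[OF this flat[OF cov_pow_section[OF i M F]]] show ?case by simp
  qed (simp add: section_eq_refl)
  have 2: "section_eq N ((cov N i M ^^ CHAR('k)) ((cov N l M' ^^ k) F)) ((cov N l M' ^^ k) ((cov N i M ^^ CHAR('k)) F))"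
    if F: "is_section N F" for k F
  proof (induction k)
    case (Suc k)
    have "section_eq N (cov N l M' ((cov N i M ^^ CHAR('k)) ((cov N l M' ^^ k) F))) (cov N l M' ((cov N l M' ^^ k) ((cov N i M ^^ CHAR('k)) F)))"
      by (rule cov_cong[OF l M' cov_pow_section[OF i M cov_pow_section[OF l M' F]] Suc])
    from section_eq_trans[OF 1[OF cov_pow_section[OF l M' F]] this] show ?case by simp
  qed (simp add: section_eq_refl)
  have u: "is_section N (unit_section b)" by (rule unit_section)
  have e: "section_eq N ((cov N i M ^^ CHAR('k)) ((cov N l M' ^^ CHAR('k)) (unit_section b))) (mat_apply N (curv N i M) ((cov N l M' ^^ CHAR('k)) (unit_section b)))"
    by (rule cov_p_power_eq_curv[OF i M cov_pow_section[OF l M' u]])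
  have e': "section_eq N ((cov N l M' ^^ CHAR('k)) ((cov N i M ^^ CHAR('k)) (unit_section b))) (mat_apply N (curv N l M') ((cov N i M ^^ CHAR('k)) (unit_section b)))"
    by (rule cov_p_power_eq_curv[OF l M' cov_pow_section[OF i M u]])
  from section_eq_trans[OF section_eq_sym[OF e] section_eq_trans[OF 2[OF u, of "CHAR('k)"] e']]
  show ?thesis using ab y
    by (simp add: section_eq_def mat_apply_def curv_def[OF i M] curv_def[OF l M'])
qed

lemma curv_intertwine:
  assumes i: "i < r" and M: "is_matrix N M" and M': "is_matrix N M'" and A: "is_matrix N A"
    and int: "\<And>F. is_section N F \<Longrightarrow> section_eq N (cov N i M' (mat_apply N A F)) (mat_apply N A (cov N i M F))"
    and ab: "a < N" "b < N" and y: "y \<in> U"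
  shows "(\<Sum>c<N. curv N i M' a c y * A c b y) = (\<Sum>c<N. A a c y * curv N i M c b y)"
proof -
  have 1: "section_eq N ((cov N i M' ^^ k) (mat_apply N A F)) (mat_apply N A ((cov N i M ^^ k) F))"
    if F: "is_section N F" for k F
  proof (induction k)
    case (Suc k)
    have "section_eq N (cov N i M' ((cov N i M' ^^ k) (mat_apply N A F))) (cov N i M' (mat_apply N A ((cov N i M ^^ k) F)))"
      by (rule cov_cong[OF i M' cov_pow_section[OF i M' mat_apply_section[OF A F]] Suc])
    from section_eq_trans[OF this int[OF cov_pow_section[OF i M F]]] show ?case by simp
  qed (simp add: section_eq_refl)
  have u: "is_section N (unit_section b)" by (rule unit_section)
  have "section_eq N (mat_apply N (curv N i M') (mat_apply N A (unit_section b)))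
      (mat_apply N A ((cov N i M ^^ CHAR('k)) (unit_section b)))"
    by (rule section_eq_trans[OF section_eq_sym[OF cov_p_power_eq_curv[OF i M' mat_apply_section[OF A u]]] 1[OF u]])
  then have "mat_apply N (curv N i M') (mat_apply N A (unit_section b)) a y =
      mat_apply N A ((cov N i M ^^ CHAR('k)) (unit_section b)) a y"
    using ab y by (simp add: section_eq_def)
  then show ?thesis
    unfolding mat_apply_def[of N "curv N i M'"] mat_apply_unit[OF ab(2)]
    by (simp add: mat_apply_def curv_def[OF i M])
qed

end

section \<open>Dependence of iterated covariant derivatives on parameters\<close>

context commuting_derivations
begin

definition lin_comb :: "nat \<Rightarrow> (nat \<Rightarrow> nat \<Rightarrow> nat \<Rightarrow> 'x \<Rightarrow> 'k) \<Rightarrow> (nat \<Rightarrow> 'k) \<Rightarrow> nat \<Rightarrow> nat \<Rightarrow> 'x \<Rightarrow> 'k" where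
  "lin_comb n B s a b y = (\<Sum>j<n. s j * B j a b y)"

text \<open>
  The coefficient of \<open>t\<^sup>l\<close> in the \<open>k\<close>-th iterated covariant derivative, with respect to \<open>d - t M\<close>, of the
  \<open>b\<close>-th unit section.
\<close>

fun graded_part :: "nat \<Rightarrow> nat \<Rightarrow> (nat \<Rightarrow> nat \<Rightarrow> 'x \<Rightarrow> 'k) \<Rightarrow> nat \<Rightarrow> nat \<Rightarrow> nat \<Rightarrow> nat \<Rightarrow> 'x \<Rightarrow> 'k" where
  "graded_part N i M b 0 l a y = (if l = 0 then unit_section b a y else 0)"
| "graded_part N i M b (Suc k) l a y = D i (graded_part N i M b k l a) y -
     (case l of 0 \<Rightarrow> 0 | Suc l' \<Rightarrow> (\<Sum>c<N. M a c y * graded_part N i M b k l' c y))"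

lemma D_eq_zero: "i < r \<Longrightarrow> f \<in> R \<Longrightarrow> (\<And>y. y \<in> U \<Longrightarrow> f y = 0) \<Longrightarrow> y \<in> U \<Longrightarrow> D i f y = 0"
  using D_cong[of i f "\<lambda>_. 0" y] D_const[of i] by simp

context
  fixes N i :: nat and M
  assumes i: "i < r" and M: "is_matrix N M"
begin

lemma graded_part_R: "a < N \<Longrightarrow> graded_part N i M b k l a \<in> R"
proof (induction k arbitrary: l a)
  case 0
  have "graded_part N i M b 0 l a = (\<lambda>y. if l = 0 then of_bool (a = b) else 0)"
    by (rule ext) (simp add: unit_section_def)
  then show ?case using R_const by (cases "l = 0") auto
next
  case (Suc k)
  have "graded_part N i M b (Suc k) l a = (\<lambda>y. D i (graded_part N i M b k l a) y -
     (case l of 0 \<Rightarrow> 0 | Suc l' \<Rightarrow> (\<Sum>c<N. M a c y * graded_part N i M b k l' c y)))"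
    by (rule ext) simp
  moreover have "(\<lambda>y. case l of 0 \<Rightarrow> 0 | Suc l' \<Rightarrow> (\<Sum>c<N. M a c y * graded_part N i M b k l' c y)) \<in> R"
    using Suc M by (cases l) (auto intro!: R_const R_sum R_mult simp: is_matrix_def)
  ultimately show ?case using Suc R_diff D_R[OF i] by simp
qed

lemma graded_part_above: "a < N \<Longrightarrow> y \<in> U \<Longrightarrow> k < l \<Longrightarrow> graded_part N i M b k l a y = 0"
proof (induction k arbitrary: l a y)
  case (Suc k)
  then obtain l' where l: "l = Suc l'" "k < l'" by (cases l) auto
  have "D i (graded_part N i M b k l a) y = 0"
    by (rule D_eq_zero[OF i graded_part_R]) (use Suc l in auto)
  then show ?case using Suc l by simp
qed simp

text \<open>
  Only derivatives of a constant section contribute in degree 0.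
\<close>

lemma graded_part_below: "a < N \<Longrightarrow> y \<in> U \<Longrightarrow> graded_part N i M b (Suc k) 0 a y = 0"
proof (induction k arbitrary: a y)
  case 0
  have "graded_part N i M b 0 0 a = (\<lambda>y. of_bool (a = b))" by (rule ext) (simp add: unit_section_def)
  then show ?case using D_const[OF i 0(2)] by simp
next
  case (Suc k)
  have "D i (graded_part N i M b (Suc k) 0 a) y = 0"
    by (rule D_eq_zero[OF i graded_part_R]) (use Suc in auto)
  then show ?case by simp
qed

lemma graded_part_top:
  assumes "a < N" "b < N" "y \<in> U"
  shows "graded_part N i M b k k a y = (-1) ^ k * ((mat N N (\<lambda>(a, b). M a b y)) ^\<^sub>m k) $$ (a, b)"
  using assms(1)
proof (induction k arbitrary: a)
  case 0
  then show ?case using assms by (simp add: unit_section_def)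
next
  case (Suc k)
  let ?M = "mat N N (\<lambda>(a, b). M a b y)"
  have Mc: "?M \<in> carrier_mat N N" and Mk: "?M ^\<^sub>m k \<in> carrier_mat N N" by auto
  have "?M * ?M ^\<^sub>m k = ?M ^\<^sub>m Suc k"
    by (induction k) (simp_all add: assoc_mult_mat[of _ N N _ N _ N, symmetric])
  then have "(?M ^\<^sub>m Suc k) $$ (a, b) = (?M * ?M ^\<^sub>m k) $$ (a, b)" by (simp only:)
  also have "\<dots> = (\<Sum>c<N. M a c y * (?M ^\<^sub>m k) $$ (c, b))"
    using Suc.prems assms Mk by (simp add: scalar_prod_def atLeast0LessThan del: pow_mat.simps)
  finally have "(?M ^\<^sub>m Suc k) $$ (a, b) = (\<Sum>c<N. M a c y * (?M ^\<^sub>m k) $$ (c, b))" .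
  moreover have "D i (graded_part N i M b k (Suc k) a) y = 0"
    by (rule D_eq_zero[OF i graded_part_R]) (use Suc.prems graded_part_above assms in auto)
  moreover have "(\<Sum>c<N. M a c y * graded_part N i M b k k c y) = (\<Sum>c<N. M a c y * ((-1) ^ k * (?M ^\<^sub>m k) $$ (c, b)))"
    using Suc.IH by (intro sum.cong) auto
  ultimately show ?case by (simp add: sum_distrib_left sum_negf mult_ac del: pow_mat.simps)
qed

end

lemma cov_pow_scaled:
  assumes i: "i < r" and M: "is_matrix N M" and ay: "a < N" "y \<in> U"
  shows "(cov N i (\<lambda>a b y. t * M a b y) ^^ k) (unit_section b) a y = (\<Sum>l\<le>k. graded_part N i M b k l a y * t ^ l)"
proof -
  have "section_eq N ((cov N i (\<lambda>a b y. t * M a b y) ^^ k) (unit_section b)) (\<lambda>a y. \<Sum>l\<le>k. graded_part N i M b k l a y * t ^ l)"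
  proof (induction k)
    case 0
    then show ?case by (simp add: section_eq_def)
  next
    case (Suc k)
    let ?tM = "\<lambda>a b y. t * M a b y" and ?G = "graded_part N i M b"
    have tM: "is_matrix N ?tM" using M by (auto simp: is_matrix_def intro: R_mult R_const)
    have GR: "?G k l a \<in> R" if "a < N" for k l a using graded_part_R[OF i M that] .
    let ?S = "\<lambda>a y. \<Sum>l\<le>k. ?G k l a y * t ^ l"
    have "section_eq N (cov N i ?tM ?S) (\<lambda>a y. \<Sum>l\<le>Suc k. ?G (Suc k) l a y * t ^ l)"
      unfolding section_eq_def
    proof (intro allI impI ballI)
      fix a y assume ay: "a < N" "y \<in> U"
      have "D i (?S a) y = (\<Sum>l\<le>k. D i (\<lambda>y. ?G k l a y * t ^ l) y)"
        by (rule D_sum[OF _ i _ ay(2)]) (auto intro!: R_mult R_const GR ay)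
      also have "\<dots> = (\<Sum>l\<le>k. D i (?G k l a) y * t ^ l)"
        using D_scale[OF i GR[OF ay(1)] ay(2)] by (intro sum.cong) (simp_all add: mult.commute)
      also have "\<dots> = (\<Sum>l\<le>Suc k. D i (?G k l a) y * t ^ l)"
      proof -
        have "D i (?G k (Suc k) a) y = 0"
          by (rule D_eq_zero[OF i GR]) (use ay graded_part_above[OF i M] in auto)
        then show ?thesis by simp
      qed
      finally have 1: "D i (?S a) y = (\<Sum>l\<le>Suc k. D i (?G k l a) y * t ^ l)" .
      have "(\<Sum>c<N. ?tM a c y * ?S c y) = (\<Sum>l\<le>k. (\<Sum>c<N. M a c y * ?G k l c y) * t ^ Suc l)"
        unfolding sum_distrib_left sum_distrib_right by (subst sum.swap) (simp add: mult_ac)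
      also have "\<dots> = (\<Sum>l\<le>Suc k. (case l of 0 \<Rightarrow> 0 | Suc l' \<Rightarrow> (\<Sum>c<N. M a c y * ?G k l' c y)) * t ^ l)"
        by (simp add: sum.atMost_Suc_shift del: sum.atMost_Suc)
      finally show "cov N i ?tM ?S a y = (\<Sum>l\<le>Suc k. ?G (Suc k) l a y * t ^ l)"
        unfolding cov_def 1 by (simp add: sum_subtractf[symmetric] left_diff_distrib del: sum.atMost_Suc)
    qed
    from section_eq_trans[OF cov_cong[OF i tM cov_pow_section[OF i tM unit_section] Suc] this]
    show ?case by simp
  qed
  then show ?thesis using ay by (simp add: section_eq_def)
qed

text \<open>
  Families of elements of \<open>R\<close> that depend polynomially on a parameter; they are generated by products of
  polynomial functions with fixed elements of \<open>R\<close>, and are stable under derivations for this reason.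
\<close>

inductive_set pfun_family :: "nat \<Rightarrow> ((nat \<Rightarrow> 'k) \<Rightarrow> 'x \<Rightarrow> 'k) set" for n where
  base: "g \<in> pfun n \<Longrightarrow> f \<in> R \<Longrightarrow> (\<lambda>s y. g s * f y) \<in> pfun_family n"
| add: "\<Phi> \<in> pfun_family n \<Longrightarrow> \<Psi> \<in> pfun_family n \<Longrightarrow> (\<lambda>s y. \<Phi> s y + \<Psi> s y) \<in> pfun_family n"
| eq_on: "\<Phi> \<in> pfun_family n \<Longrightarrow> (\<And>s y. y \<in> U \<Longrightarrow> \<Psi> s y = \<Phi> s y) \<Longrightarrow> \<Psi> \<in> pfun_family n"

lemma pfun_family_R: "\<Phi> \<in> pfun_family n \<Longrightarrow> \<Phi> s \<in> R"
proof (induction rule: pfun_family.induct)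
  case (eq_on \<Phi> \<Psi>)
  then show ?case using R_cong[of "\<Phi> s" "\<Psi> s"] by simp
qed (auto intro: R_mult R_add R_const)

lemma pfun_family_eval: "\<Phi> \<in> pfun_family n \<Longrightarrow> y \<in> U \<Longrightarrow> (\<lambda>s. \<Phi> s y) \<in> pfun n"
  by (induction rule: pfun_family.induct) (auto intro: pfun.intros)

lemma pfun_family_const: "f \<in> R \<Longrightarrow> (\<lambda>s. f) \<in> pfun_family n"
  using pfun_family.base[OF pfun.const[of 1]] by simp

lemma pfun_family_mult_base:
  assumes "\<Phi> \<in> pfun_family n" "g \<in> pfun n" "f \<in> R"
  shows "(\<lambda>s y. g s * f y * \<Phi> s y) \<in> pfun_family n"
  using assms(1)
proof (induction rule: pfun_family.induct)
  case (base g' f')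
  have "(\<lambda>s y. (g s * g' s) * (f y * f' y)) \<in> pfun_family n"
    by (intro pfun_family.base pfun.mult R_mult assms base)
  then show ?case by (simp add: mult_ac)
next
  case (add \<Phi> \<Psi>)
  from pfun_family.add[OF add.IH] show ?case by (simp add: distrib_left)
next
  case (eq_on \<Phi> \<Psi>)
  from eq_on.IH show ?case by (rule pfun_family.eq_on) (simp add: eq_on.hyps)
qed

lemma pfun_family_mult:
  assumes "\<Phi> \<in> pfun_family n" "\<Psi> \<in> pfun_family n"
  shows "(\<lambda>s y. \<Phi> s y * \<Psi> s y) \<in> pfun_family n"
  using assms(1)
proof (induction rule: pfun_family.induct)
  case (base g f)
  then show ?case using pfun_family_mult_base[OF assms(2)] by simp
next
  case (add \<Phi>1 \<Phi>2)
  from pfun_family.add[OF add.IH] show ?case by (simp add: distrib_right)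
next
  case (eq_on \<Phi>1 \<Phi>2)
  from eq_on.IH show ?case by (rule pfun_family.eq_on) (simp add: eq_on.hyps)
qed

lemma pfun_family_sum:
  "(\<And>a. a \<in> A \<Longrightarrow> \<Phi> a \<in> pfun_family n) \<Longrightarrow> (\<lambda>s y. \<Sum>a\<in>A. \<Phi> a s y) \<in> pfun_family n"
proof (induction A rule: infinite_finite_induct)
  case (insert x A)
  then show ?case using pfun_family.add[of "\<Phi> x" n "\<lambda>s y. \<Sum>a\<in>A. \<Phi> a s y"] by simp
qed (auto intro: pfun_family_const R_const)

lemma pfun_family_D:
  assumes "\<Phi> \<in> pfun_family n" and i: "i < r"
  shows "(\<lambda>s y. D i (\<Phi> s) y) \<in> pfun_family n"
  using assms(1)
proof (induction rule: pfun_family.induct)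
  case (base g f)
  have "(\<lambda>s y. g s * D i f y) \<in> pfun_family n" using base D_R[OF i] by (intro pfun_family.base)
  then show ?case by (rule pfun_family.eq_on) (simp add: D_scale[OF i base(2)])
next
  case (add \<Phi> \<Psi>)
  from pfun_family.add[OF add.IH] show ?case
    by (rule pfun_family.eq_on) (simp add: D_add[OF i pfun_family_R[OF add.hyps(1)] pfun_family_R[OF add.hyps(2)]])
next
  case (eq_on \<Phi> \<Psi>)
  from eq_on.IH show ?case
    by (rule pfun_family.eq_on) (rule D_cong[OF i pfun_family_R[OF eq_on.hyps(1)], symmetric], auto simp: eq_on.hyps)
qed

lemma cov_pow_pfun_family:
  assumes i: "i < r" and M: "\<And>a b. a < N \<Longrightarrow> b < N \<Longrightarrow> (\<lambda>s. M s a b) \<in> pfun_family n" and a: "a < N"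
  shows "(\<lambda>s. (cov N i (M s) ^^ k) (unit_section b) a) \<in> pfun_family n"
  using a
proof (induction k arbitrary: a)
  case 0
  have "unit_section b a \<in> R" using unit_section[of "Suc a" b] by (simp add: is_section_def)
  then show ?case using pfun_family_const by simp
next
  case (Suc k)
  let ?F = "\<lambda>s c. (cov N i (M s) ^^ k) (unit_section b) c"
  have "(\<lambda>s y. D i (?F s a) y + (\<Sum>c<N. (-1) * (M s a c y * ?F s c y))) \<in> pfun_family n"
    using Suc by (intro pfun_family.add pfun_family_D i pfun_family_sum
        pfun_family_mult[OF pfun_family_const[OF R_const]] pfun_family_mult M) auto
  then show ?case by (simp add: cov_def[abs_def] sum_negf)
qed

lemma lin_comb_pfun_family:
  assumes "\<And>j. j < n \<Longrightarrow> B j a b \<in> R"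
  shows "(\<lambda>s. lin_comb n B s a b) \<in> pfun_family n"
  unfolding lin_comb_def[abs_def]
  by (intro pfun_family_sum pfun_family.base pfun.coord) (auto intro: assms)

end

section \<open>Flat periodic pencils\<close>

lemma poly_char_poly_eq_det:
  fixes X :: "'k::field mat"
  assumes X: "X \<in> carrier_mat N N"
  shows "poly (char_poly X) z = det (mat N N (\<lambda>(a, b). of_bool (a = b) * z - X $$ (a, b)))"
proof -
  have "- char_matrix X z = mat N N (\<lambda>(a, b). of_bool (a = b) * z - X $$ (a, b))"
    using X by (intro eq_matI) (auto simp: char_matrix_def)
  then show ?thesis using char_poly_matrix[OF X, of z] by simp
qed

lemma frobenius_comm_ring_hom:
  assumes "prime CHAR('k::comm_ring_1)"
  shows "comm_ring_hom (\<lambda>x :: 'k. x ^ CHAR('k))"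
proof
  have "CHAR('k) > 0" using assms prime_gt_0_nat by blast
  then show "(0 :: 'k) ^ CHAR('k) = 0" by (rule zero_power)
  show "(x + y) ^ CHAR('k) = x ^ CHAR('k) + y ^ CHAR('k)" for x y :: 'k
    by (rule freshmans_dream[OF assms refl])
qed (simp_all add: power_mult_distrib)

lemma frobenius_sum:
  assumes "prime CHAR('k::comm_ring_1)"
  shows "(\<Sum>a\<in>A. f a :: 'k) ^ CHAR('k) = (\<Sum>a\<in>A. f a ^ CHAR('k))"
  by (rule freshmans_dream_sum[OF assms refl])

lemma frobenius_diff:
  assumes "prime CHAR('k::comm_ring_1)"
  shows "(x - y :: 'k) ^ CHAR('k) = x ^ CHAR('k) - y ^ CHAR('k)"
  using freshmans_dream[OF assms refl, of x "- y"] minus_power_prime_CHAR[OF refl assms, of y] by simp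

lemma mat_lincomb_Suc:
  assumes "\<And>j. j < Suc m \<Longrightarrow> M j \<in> carrier_mat N N"
  shows "mat_lincomb N (Suc m) c M = mat_lincomb N m c M + c m \<cdot>\<^sub>m M m"
  using assms[of m] by (intro eq_matI) (auto simp: mat_lincomb_def)

lemma mat_lincomb_frobenius_power:
  fixes L :: "nat \<Rightarrow> 'k::field mat"
  assumes p: "prime CHAR('k)" and L: "commuting_pencil N r L"
  shows "mat_lincomb N r w L ^\<^sub>m CHAR('k) = mat_lincomb N r (\<lambda>i. w i ^ CHAR('k)) (\<lambda>i. L i ^\<^sub>m CHAR('k))"
  using L
proof (induction r)
  case 0
  have "CHAR('k) > 0" using p prime_gt_0_nat by blast
  have z: "mat_lincomb N 0 c M = 0\<^sub>m N N" for c and M :: "nat \<Rightarrow> 'k mat" by (rule eq_matI) (auto simp: mat_lincomb_def)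
  have "(0\<^sub>m N N :: 'k mat) ^\<^sub>m Suc k = 0\<^sub>m N N" for k
    using right_mult_zero_mat[of "0\<^sub>m N N ^\<^sub>m k :: 'k mat" N N N] by simp
  then show ?case using \<open>CHAR('k) > 0\<close> unfolding z by (metis gr0_conv_Suc)
next
  case (Suc r)
  have carr: "L i \<in> carrier_mat N N" if "i < Suc r" for i using Suc.prems that by (auto simp: commuting_pencil_def)
  have Lr: "commuting_pencil N r L" using Suc.prems by (auto simp: commuting_pencil_def)
  let ?S = "mat_lincomb N r w L"
  have Sc: "?S \<in> carrier_mat N N" by simp
  have Lc: "L r \<in> carrier_mat N N" using carr by simp
  have "?S * L r = mat_lincomb N r w (\<lambda>i. L i * L r)"
    using carr by (intro mat_lincomb_mult_right) auto
  also have "\<dots> = mat_lincomb N r w (\<lambda>i. L r * L i)"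
    using Suc.prems by (intro mat_lincomb_cong) (auto simp: commuting_pencil_def)
  also have "\<dots> = L r * ?S" using carr by (intro mat_lincomb_mult_left[symmetric]) auto
  finally have comm: "?S * L r = L r * ?S" .
  then have comm': "?S * (w r \<cdot>\<^sub>m L r) = (w r \<cdot>\<^sub>m L r) * ?S"
    using mult_smult_distrib[OF Sc Lc] mult_smult_assoc_mat[OF Lc Sc] by simp
  have "mat_lincomb N (Suc r) w L ^\<^sub>m CHAR('k) = (?S + w r \<cdot>\<^sub>m L r) ^\<^sub>m CHAR('k)"
    using mat_lincomb_Suc[OF carr] by simp
  also have "\<dots> = ?S ^\<^sub>m CHAR('k) + (w r \<cdot>\<^sub>m L r) ^\<^sub>m CHAR('k)"
    by (rule mat_freshmans_dream[OF p Sc _ comm']) (use Lc in simp)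
  also have "\<dots> = mat_lincomb N r (\<lambda>i. w i ^ CHAR('k)) (\<lambda>i. L i ^\<^sub>m CHAR('k)) + w r ^ CHAR('k) \<cdot>\<^sub>m L r ^\<^sub>m CHAR('k)"
    using Suc.IH[OF Lr] smult_pow_mat[OF Lc] by simp
  also have "\<dots> = mat_lincomb N (Suc r) (\<lambda>i. w i ^ CHAR('k)) (\<lambda>i. L i ^\<^sub>m CHAR('k))"
    using carr by (intro mat_lincomb_Suc[symmetric]) auto
  finally show ?case .
qed

text \<open>
  The indices of \<open>B i j a b\<close> are the direction \<open>i\<close>, the parameter \<open>j\<close>, the row \<open>a\<close> and the column \<open>b\<close>.  In the
  periodicity assumption \<open>A\<close> and \<open>A\'\<close> are the values at \<open>s\<close> of a shift operator and its inverse, and \<open>q\<close> is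
  their common denominator.
\<close>

locale flat_periodic_pencil = commuting_derivations U R D r
  for U :: "'x set" and R :: "('x \<Rightarrow> 'k::alg_closed_field) set" and D r +
  fixes N n :: nat and B :: "nat \<Rightarrow> nat \<Rightarrow> nat \<Rightarrow> nat \<Rightarrow> 'x \<Rightarrow> 'k"
  assumes B: "i < r \<Longrightarrow> j < n \<Longrightarrow> is_matrix N (B i j)"
    and flat: "i < r \<Longrightarrow> l < r \<Longrightarrow> is_section N F \<Longrightarrow>
      section_eq N (cov N i (lin_comb n (B i) s) (cov N l (lin_comb n (B l) s) F))
        (cov N l (lin_comb n (B l) s) (cov N i (lin_comb n (B i) s) F))"
    and periodic: "j < n \<Longrightarrow> \<exists>q\<in>pfun n. (\<exists>s. q s \<noteq> 0) \<and> (\<forall>s. q s \<noteq> 0 \<longrightarrow> (\<exists>A A'.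
      is_matrix N A \<and> (\<forall>y\<in>U. \<forall>a<N. \<forall>b<N. (\<Sum>c<N. A a c y * A' c b y) = of_bool (a = b)) \<and>
      (\<forall>i<r. \<forall>F. is_section N F \<longrightarrow>
        section_eq N (cov N i (lin_comb n (B i) (s(j := s j + 1))) (mat_apply N A F))
          (mat_apply N A (cov N i (lin_comb n (B i) s) F)))))"
begin

definition conn_mat where "conn_mat s y i = mat N N (\<lambda>(a, b). lin_comb n (B i) s a b y)"

definition curv_mat where "curv_mat s y i = mat N N (\<lambda>(a, b). curv N i (lin_comb n (B i) s) a b y)"

definition twisted_mat where
  "twisted_mat s y i = mat N N (\<lambda>(a, b). \<Sum>j<n. (s j - s j ^ CHAR('k)) * B i j a b y ^ CHAR('k))"

lemma lin_comb_matrix: "i < r \<Longrightarrow> is_matrix N (lin_comb n (B i) s)"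
  unfolding is_matrix_def
proof (intro allI impI)
  fix a b assume i: "i < r" and ab: "a < N" "b < N"
  have "lin_comb n (B i) s a b = (\<lambda>y. \<Sum>j<n. s j * B i j a b y)" by (rule ext) (simp add: lin_comb_def)
  then show "lin_comb n (B i) s a b \<in> R"
    using B i ab by (auto simp: is_matrix_def intro!: R_sum R_mult R_const)
qed

lemma lin_comb_scaled: "lin_comb n (B i) (\<lambda>j. t * s j) = (\<lambda>a b y. t * lin_comb n (B i) s a b y)"
  by (intro ext) (simp add: lin_comb_def sum_distrib_left mult.assoc)

lemma lin_comb_cong: "(\<And>j. j < n \<Longrightarrow> s j = s' j) \<Longrightarrow> lin_comb n (B i) s = lin_comb n (B i) s'"
  by (intro ext) (simp add: lin_comb_def)

lemma conn_mat_carrier [simp]: "conn_mat s y i \<in> carrier_mat N N" by (simp add: conn_mat_def)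
lemma curv_mat_carrier [simp]: "curv_mat s y i \<in> carrier_mat N N" by (simp add: curv_mat_def)
lemma twisted_mat_carrier [simp]: "twisted_mat s y i \<in> carrier_mat N N" by (simp add: twisted_mat_def)

lemma curv_mat_commuting:
  assumes y: "y \<in> U"
  shows "commuting_pencil N r (curv_mat s y)"
  unfolding commuting_pencil_def
proof (intro conjI allI impI)
  fix i l assume il: "i < r" "l < r"
  show "curv_mat s y i * curv_mat s y l = curv_mat s y l * curv_mat s y i"
  proof (rule eq_matI)
    fix a b assume "a < dim_row (curv_mat s y l * curv_mat s y i)" "b < dim_col (curv_mat s y l * curv_mat s y i)"
    then have ab: "a < N" "b < N" by (auto simp: curv_mat_def)
    from curv_commute[OF il lin_comb_matrix[OF il(1), of s] lin_comb_matrix[OF il(2), of s] flat[OF il, where s = s] ab y]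
    show "(curv_mat s y i * curv_mat s y l) $$ (a, b) = (curv_mat s y l * curv_mat s y i) $$ (a, b)"
      using ab by (simp add: curv_mat_def scalar_prod_def atLeast0LessThan)
  qed (simp_all add: curv_mat_def)
qed simp

text \<open>
  Flatness at \<open>t s\<close> has a part \<open>X\<close> linear in \<open>t\<close> and a quadratic one, the commutator \<open>Y\<close>.  From \<open>X + Y = 0\<close> and
  \<open>t X + t\<^sup>2 Y = 0\<close> with \<open>t\<close> different from 0 and 1 one gets \<open>Y = 0\<close>.
\<close>

lemma conn_mat_commuting:
  assumes y: "y \<in> U"
  shows "commuting_pencil N r (conn_mat s y)"
  unfolding commuting_pencil_def
proof (intro conjI allI impI)
  fix i l assume il: "i < r" "l < r"
  have second: "cov N i (lin_comb n (B i) s) (cov N l (lin_comb n (B l) s) (unit_section b)) a y =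
      - D i (lin_comb n (B l) s a b) y + (\<Sum>c<N. lin_comb n (B i) s a c y * lin_comb n (B l) s c b y)"
    if il: "i < r" "l < r" and ab: "a < N" "b < N" for i l a b s
  proof -
    have first: "cov N l (lin_comb n (B l) s) (unit_section b) c y = - lin_comb n (B l) s c b y"
      if "c < N" "y \<in> U" for c y
    proof -
      have "unit_section b c = (\<lambda>y. of_bool (c = b))" by (rule ext) (simp add: unit_section_def)
      then show ?thesis using mat_apply_unit[OF ab(2), of "lin_comb n (B l) s" c y] D_const[OF il(2) that(2)]
        by (simp add: cov_def mat_apply_def)
    qed
    have R: "lin_comb n (B l) s a b \<in> R" using lin_comb_matrix[OF il(2)] ab by (simp add: is_matrix_def)
    have "D i (cov N l (lin_comb n (B l) s) (unit_section b) a) y = D i (\<lambda>y. (-1) * lin_comb n (B l) s a b y) y"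
      by (rule D_cong[OF il(1) _ _ y])
        (use cov_section[OF il(2) lin_comb_matrix[OF il(2)] unit_section] ab first in \<open>auto simp: is_section_def\<close>)
    also have "\<dots> = - D i (lin_comb n (B l) s a b) y" using D_scale[OF il(1) R y, of "-1"] by simp
    finally have 1: "D i (cov N l (lin_comb n (B l) s) (unit_section b) a) y = - D i (lin_comb n (B l) s a b) y" .
    have 2: "(\<Sum>c<N. lin_comb n (B i) s a c y * cov N l (lin_comb n (B l) s) (unit_section b) c y) =
        - (\<Sum>c<N. lin_comb n (B i) s a c y * lin_comb n (B l) s c b y)"
      unfolding sum_negf[symmetric] using first y by (intro sum.cong) auto
    show ?thesis unfolding cov_def[of N i] 1 2 by simp
  qed
  have flat': "- D i (lin_comb n (B l) s a b) y + (\<Sum>c<N. lin_comb n (B i) s a c y * lin_comb n (B l) s c b y) =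
      - D l (lin_comb n (B i) s a b) y + (\<Sum>c<N. lin_comb n (B l) s a c y * lin_comb n (B i) s c b y)"
    if ab: "a < N" "b < N" for a b s
  proof -
    have "cov N i (lin_comb n (B i) s) (cov N l (lin_comb n (B l) s) (unit_section b)) a y =
        cov N l (lin_comb n (B l) s) (cov N i (lin_comb n (B i) s) (unit_section b)) a y"
      using flat[OF il unit_section[of N b], of s] ab y unfolding section_eq_def by blast
    then show ?thesis unfolding second[OF il ab] second[OF il(2,1) ab] .
  qed
  show "conn_mat s y i * conn_mat s y l = conn_mat s y l * conn_mat s y i"
  proof (rule eq_matI)
    fix a b assume "a < dim_row (conn_mat s y l * conn_mat s y i)" "b < dim_col (conn_mat s y l * conn_mat s y i)"
    then have ab: "a < N" "b < N" by (auto simp: conn_mat_def)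
    obtain t :: 'k where t: "t \<notin> {0, 1}" using ex_new_if_finite[OF infinite_alg_closed, of "{0,1}"] by auto
    define X Y where "X = - D i (lin_comb n (B l) s a b) y + D l (lin_comb n (B i) s a b) y"
      and "Y = (\<Sum>c<N. lin_comb n (B i) s a c y * lin_comb n (B l) s c b y) -
         (\<Sum>c<N. lin_comb n (B l) s a c y * lin_comb n (B i) s c b y)"
    have 1: "X + Y = 0" using flat'[OF ab, of s] by (simp add: X_def Y_def algebra_simps)
    have R: "lin_comb n (B l) s a b \<in> R" if "l < r" for l using lin_comb_matrix[OF that] ab by (simp add: is_matrix_def)
    have "t * X + t * t * Y = 0"
      using flat'[OF ab, of "\<lambda>j. t * s j"] D_scale[OF il(1) R[OF il(2)] y, of t] D_scale[OF il(2) R[OF il(1)] y, of t]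
      unfolding lin_comb_scaled
      by (simp add: X_def Y_def algebra_simps sum_distrib_left mult_ac)
    then have "t * (t - 1) * Y = 0" using 1 by (simp add: algebra_simps add_eq_0_iff)
    then have "Y = 0" using t by auto
    then show "(conn_mat s y i * conn_mat s y l) $$ (a, b) = (conn_mat s y l * conn_mat s y i) $$ (a, b)"
      using ab by (simp add: conn_mat_def scalar_prod_def atLeast0LessThan Y_def)
  qed (simp_all add: conn_mat_def)
qed simp

text \<open>
  The twisted pencil inherits commutativity from the connection matrices at \<open>\<sigma>\<close>, because the entrywise
  Frobenius map is multiplicative.
\<close>

lemma twisted_mat_eq_frobenius:
  assumes "\<And>j. j < n \<Longrightarrow> \<sigma> j ^ CHAR('k) = s j - s j ^ CHAR('k)"
  shows "twisted_mat s y i = map_mat (\<lambda>c. c ^ CHAR('k)) (conn_mat \<sigma> y i)"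
  using assms by (intro eq_matI)
    (auto simp: twisted_mat_def conn_mat_def lin_comb_def frobenius_sum[OF prime_char] power_mult_distrib)

lemma p_th_root: "\<exists>w :: 'k. w ^ CHAR('k) = x"
  using nth_root_exists[of "CHAR('k)" x] prime_char prime_gt_0_nat by auto

lemma twisted_mat_commuting:
  assumes y: "y \<in> U"
  shows "commuting_pencil N r (twisted_mat s y)"
proof -
  have "\<forall>j. \<exists>w. w ^ CHAR('k) = s j - s j ^ CHAR('k)" using p_th_root by blast
  from choice[OF this] obtain \<sigma> where \<sigma>: "\<And>j. \<sigma> j ^ CHAR('k) = s j - s j ^ CHAR('k)" by blast
  interpret frob: comm_ring_hom "\<lambda>x :: 'k. x ^ CHAR('k)" by (rule frobenius_comm_ring_hom[OF prime_char])
  note eq = twisted_mat_eq_frobenius[of \<sigma> s, OF \<sigma>]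
  show ?thesis
    using conn_mat_commuting[OF y, of \<sigma>] unfolding commuting_pencil_def eq
    by (simp add: frob.mat_hom_mult[OF conn_mat_carrier conn_mat_carrier, symmetric])
qed

end

section \<open>The characteristic polynomial of the p-curvature\<close>

lemma pow_one_mat: "(1\<^sub>m N :: 'k::comm_ring_1 mat) ^\<^sub>m k = 1\<^sub>m N"
  by (induction k) auto

lemma char_poly_mat_lincomb_intertwined:
  fixes L L' :: "nat \<Rightarrow> 'k::field mat"
  assumes P: "P \<in> carrier_mat N N" and Q: "Q \<in> carrier_mat N N" and PQ: "P * Q = 1\<^sub>m N"
    and L: "\<And>i. i < r \<Longrightarrow> L i \<in> carrier_mat N N" and L': "\<And>i. i < r \<Longrightarrow> L' i \<in> carrier_mat N N"
    and int: "\<And>i. i < r \<Longrightarrow> L' i * P = P * L i"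
  shows "char_poly (mat_lincomb N r u L') = char_poly (mat_lincomb N r u L)"
proof -
  have QP: "Q * P = 1\<^sub>m N" by (rule mat_mult_left_right_inverse[OF P Q PQ])
  let ?A = "mat_lincomb N r u L'" and ?B = "mat_lincomb N r u L"
  have AB: "?A \<in> carrier_mat N N" "?B \<in> carrier_mat N N" by simp_all
  have "?A * P = mat_lincomb N r u (\<lambda>i. L' i * P)" using L' P by (intro mat_lincomb_mult_right) auto
  also have "\<dots> = mat_lincomb N r u (\<lambda>i. P * L i)" using int by (intro mat_lincomb_cong) auto
  also have "\<dots> = P * ?B" using L P by (intro mat_lincomb_mult_left[symmetric]) auto
  finally have "?A * P * Q = P * ?B * Q" by simp
  moreover have "?A * P * Q = ?A" using assoc_mult_mat[OF AB(1) P Q] PQ right_mult_one_mat[OF AB(1)] by simp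
  ultimately have "similar_mat_wit ?A ?B P Q"
    using P Q PQ QP by (intro similar_mat_witI[of _ _ N]) auto
  then have "similar_mat ?A ?B" unfolding similar_mat_def by blast
  then show ?thesis by (rule char_poly_similar)
qed

context flat_periodic_pencil
begin

text \<open>
  The spectral parameter is the variable \<open>s\<^sub>n\<close>, and enters as \<open>s\<^sub>n - s\<^sub>n\<^sup>p\<close> in order to be periodic and to have
  the same degrees along rays as the other variables.
\<close>

definition curv_char :: "(nat \<Rightarrow> 'k) \<Rightarrow> 'x \<Rightarrow> (nat \<Rightarrow> 'k) \<Rightarrow> 'k" where
  "curv_char u y s = poly (char_poly (mat_lincomb N r u (curv_mat s y))) (s n - s n ^ CHAR('k))"

definition twisted_char :: "(nat \<Rightarrow> 'k) \<Rightarrow> 'x \<Rightarrow> (nat \<Rightarrow> 'k) \<Rightarrow> 'k" where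
  "twisted_char u y s = poly (char_poly (mat_lincomb N r u (twisted_mat s y))) (s n - s n ^ CHAR('k))"

lemma curv_char_det: "curv_char u y s = det (mat N N (\<lambda>(a, b). of_bool (a = b) * (s n - s n ^ CHAR('k)) -
    (\<Sum>i<r. u i * curv N i (lin_comb n (B i) s) a b y)))"
  unfolding curv_char_def poly_char_poly_eq_det[OF mat_lincomb_carrier]
  by (intro arg_cong[of _ _ det] eq_matI) (simp_all add: mat_lincomb_def curv_mat_def)

lemma twisted_char_det: "twisted_char u y s = det (mat N N (\<lambda>(a, b). of_bool (a = b) * (s n - s n ^ CHAR('k)) -
    (\<Sum>i<r. u i * (\<Sum>j<n. (s j - s j ^ CHAR('k)) * B i j a b y ^ CHAR('k)))))"
  unfolding twisted_char_def poly_char_poly_eq_det[OF mat_lincomb_carrier]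
  by (intro arg_cong[of _ _ det] eq_matI) (simp_all add: mat_lincomb_def twisted_mat_def)

lemma curv_char_pfun:
  assumes y: "y \<in> U"
  shows "curv_char u y \<in> pfun (Suc n)"
proof -
  have "(\<lambda>s. curv N i (lin_comb n (B i) s) a b y) \<in> pfun (Suc n)" if "i < r" "a < N" "b < N" for i a b
  proof -
    have lc: "(\<lambda>s. lin_comb n (B i) s a b) \<in> pfun_family n" if "a < N" "b < N" for a b
      using B \<open>i < r\<close> that by (intro lin_comb_pfun_family) (auto simp: is_matrix_def)
    have "(\<lambda>s. (cov N i (lin_comb n (B i) s) ^^ CHAR('k)) (unit_section b) a) \<in> pfun_family n"
      by (rule cov_pow_pfun_family[OF \<open>i < r\<close> lc \<open>a < N\<close>])
    from pfun_family_eval[OF this y] show ?thesis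
      unfolding curv_def[OF \<open>i < r\<close> lin_comb_matrix[OF \<open>i < r\<close>]] by (rule pfun_mono) simp
  qed
  then show ?thesis unfolding curv_char_det[abs_def]
    by (intro pfun_det pfun_intros) auto
qed

lemma twisted_char_pfun: "twisted_char u y \<in> pfun (Suc n)"
  unfolding twisted_char_det[abs_def] by (intro pfun_det pfun_intros) auto

lemma artin_schreier_shift: "(x + 1) - (x + 1) ^ CHAR('k) = x - x ^ CHAR('k)" for x :: 'k
  using freshmans_dream[OF prime_char refl, of x 1] by simp

lemma twisted_char_periodic: "j < Suc n \<Longrightarrow> twisted_char u y (s(j := s j + 1)) = twisted_char u y s"
proof -
  have "(s(j := s j + 1)) k - (s(j := s j + 1)) k ^ CHAR('k) = s k - s k ^ CHAR('k)" for k
    using artin_schreier_shift[of "s j"] by (cases "k = j") auto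
  then show ?thesis unfolding twisted_char_det by simp
qed

text \<open>
  In the directions \<open>j < n\<close> the shift operator conjugates the two \<open>p\<close>-curvatures wherever its denominator
  does not vanish, and an identity of polynomial functions can be checked there.  In direction \<open>n\<close> only
  the spectral parameter is affected.
\<close>

lemma curv_char_periodic:
  assumes y: "y \<in> U" and j: "j < Suc n"
  shows "curv_char u y (s(j := s j + 1)) = curv_char u y s"
proof (cases "j = n")
  case True
  have "lin_comb n (B i) (s(n := s n + 1)) = lin_comb n (B i) s" for i by (rule lin_comb_cong) simp
  then have "curv_mat (s(n := s n + 1)) y = curv_mat s y" by (intro ext) (simp add: curv_mat_def del: fun_upd_apply)
  then show ?thesis unfolding curv_char_def True fun_upd_same artin_schreier_shift by simp
next
  case False
  with j have jn: "j < n" by simp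
  from periodic[OF jn] obtain q :: "(nat \<Rightarrow> 'k) \<Rightarrow> 'k" and s0 where q: "q \<in> pfun n" "q s0 \<noteq> 0"
    and A: "\<forall>s. q s \<noteq> 0 \<longrightarrow> (\<exists>A A'. is_matrix N A \<and>
      (\<forall>y\<in>U. \<forall>a<N. \<forall>b<N. (\<Sum>c<N. A a c y * A' c b y) = of_bool (a = b)) \<and>
      (\<forall>i<r. \<forall>F. is_section N F \<longrightarrow>
        section_eq N (cov N i (lin_comb n (B i) (s(j := s j + 1))) (mat_apply N A F))
          (mat_apply N A (cov N i (lin_comb n (B i) s) F))))"
    by blast
  have "(\<lambda>s. curv_char u y (s(j := s j + 1))) \<in> pfun (Suc n)"
  proof (rule pfun_subst[OF curv_char_pfun[OF y]])
    show "(\<lambda>s. (s(j := s j + 1)) i) \<in> pfun (Suc n)" if "i < Suc n" for i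
      using j that by (cases "i = j") (auto intro: pfun_intros)
  qed
  moreover have "q \<in> pfun (Suc n)" using q by (auto intro: pfun_mono)
  moreover have "curv_char u y (s(j := s j + 1)) = curv_char u y s" if "q s \<noteq> 0" for s
  proof -
    from A that obtain A A' where A1: "is_matrix N A"
      and A2: "\<forall>y\<in>U. \<forall>a<N. \<forall>b<N. (\<Sum>c<N. A a c y * A' c b y) = of_bool (a = b)"
      and A3: "\<forall>i<r. \<forall>F. is_section N F \<longrightarrow>
        section_eq N (cov N i (lin_comb n (B i) (s(j := s j + 1))) (mat_apply N A F))
          (mat_apply N A (cov N i (lin_comb n (B i) s) F))" by blast
    let ?s = "s(j := s j + 1)"
    let ?P = "mat N N (\<lambda>(a, b). A a b y)" and ?Q = "mat N N (\<lambda>(a, b). A' a b y)"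
    have "char_poly (mat_lincomb N r u (curv_mat ?s y)) = char_poly (mat_lincomb N r u (curv_mat s y))"
    proof (rule char_poly_mat_lincomb_intertwined[of ?P N ?Q])
      show "?P * ?Q = 1\<^sub>m N"
        using A2 y by (intro eq_matI) (auto simp: scalar_prod_def atLeast0LessThan)
      show "curv_mat ?s y i * ?P = ?P * curv_mat s y i" if i: "i < r" for i
      proof (rule eq_matI)
        fix a b assume "a < dim_row (?P * curv_mat s y i)" "b < dim_col (?P * curv_mat s y i)"
        then have ab: "a < N" "b < N" by (auto simp: curv_mat_def)
        have "(\<Sum>c<N. curv N i (lin_comb n (B i) ?s) a c y * A c b y) =
            (\<Sum>c<N. A a c y * curv N i (lin_comb n (B i) s) c b y)"
          by (rule curv_intertwine[OF i lin_comb_matrix[OF i] lin_comb_matrix[OF i] A1 _ ab y])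
            (rule A3[rule_format, OF i])
        then show "(curv_mat ?s y i * ?P) $$ (a, b) = (?P * curv_mat s y i) $$ (a, b)"
          using ab by (simp add: curv_mat_def scalar_prod_def atLeast0LessThan del: fun_upd_apply)
      qed (simp_all add: curv_mat_def)
    qed simp_all
    then show ?thesis using jn by (simp add: curv_char_def)
  qed
  ultimately show ?thesis
    using pfun_eq_cancel[of "\<lambda>s. curv_char u y (s(j := s j + 1))" "Suc n" "curv_char u y" q s0 s]
      curv_char_pfun[OF y] q(2) by blast
qed

text \<open>
  The entries of the \<open>p\<close>-curvature have parts of degrees \<open>1, \<dots>, p\<close> in \<open>s\<close>, and the part of degree \<open>p\<close> is that
  of \<open>(-M)\<^sup>p = -M\<^sup>p\<close> for the connection matrix \<open>M\<close>.
\<close>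

lemma curv_char_scaled:
  assumes y: "y \<in> U"
  obtains q where "\<forall>t. curv_char u y (\<lambda>i. t * s i) = poly q t"
    "\<forall>k. coeff q k \<noteq> 0 \<longrightarrow> N \<le> k \<and> k \<le> CHAR('k) * N"
    "coeff q (CHAR('k) * N) = det (mat N N (\<lambda>(a, b).
       - (of_bool (a = b) * s n ^ CHAR('k) - (\<Sum>i<r. u i * (conn_mat s y i ^\<^sub>m CHAR('k)) $$ (a, b)))))"
proof -
  let ?p = "CHAR('k)"
  have p1: "?p > 1" using prime_char prime_gt_1_nat by blast
  define Q where "Q a b = (if a = b then monom (s n) 1 - monom (s n ^ ?p) ?p else 0) -
    (\<Sum>i<r. Polynomial.smult (u i) (\<Sum>l\<le>?p. monom (graded_part N i (lin_comb n (B i) s) b ?p l a y) l))" for a b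
  have cQ: "coeff (Q a b) k = (if a = b then (if k = 1 then s n else 0) - (if k = ?p then s n ^ ?p else 0) else 0) -
    (\<Sum>i<r. u i * (if k \<le> ?p then graded_part N i (lin_comb n (B i) s) b ?p k a y else 0))" for a b k
    unfolding Q_def using p1 by (simp add: coeff_sum coeff_monom if_distrib cong: if_cong)
  have bound: "1 \<le> k \<and> k \<le> ?p" if ab: "a < N" "b < N" and nz: "coeff (Q a b) k \<noteq> 0" for a b k
  proof (rule ccontr)
    assume *: "\<not> (1 \<le> k \<and> k \<le> ?p)"
    have "(if k \<le> ?p then graded_part N i (lin_comb n (B i) s) b ?p k a y else 0) = 0" if i: "i < r" for i
    proof (cases "k \<le> ?p")
      case True
      then have "k = 0" using * by simp
      obtain p' where "?p = Suc p'" using p1 by (cases ?p) auto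
      then show ?thesis using graded_part_below[OF i lin_comb_matrix[OF i] ab(1) y, of s b p'] \<open>k = 0\<close> by simp
    qed simp
    then have "coeff (Q a b) k = 0" unfolding cQ using * p1 by auto
    with nz show False by simp
  qed
  obtain q where q: "\<And>t. det (mat N N (\<lambda>(a, b). poly (Q a b) t)) = poly q t"
    "\<And>k. coeff q k \<noteq> 0 \<Longrightarrow> N \<le> k \<and> k \<le> ?p * N"
    "coeff q (?p * N) = det (mat N N (\<lambda>(a, b). coeff (Q a b) ?p))"
    by (rule det_graded_poly[of N Q ?p]) (use bound in blast)+
  have ev: "poly (Q a b) t = of_bool (a = b) * (t * s n - (t * s n) ^ ?p) -
      (\<Sum>i<r. u i * curv N i (lin_comb n (B i) (\<lambda>j. t * s j)) a b y)" if ab: "a < N" "b < N" for a b t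
  proof -
    have "curv N i (lin_comb n (B i) (\<lambda>j. t * s j)) a b y =
        (\<Sum>l\<le>?p. graded_part N i (lin_comb n (B i) s) b ?p l a y * t ^ l)" if i: "i < r" for i
      unfolding curv_def[OF i lin_comb_matrix[OF i]] unfolding lin_comb_scaled
      by (rule cov_pow_scaled[OF i lin_comb_matrix[OF i] ab(1) y])
    then show ?thesis unfolding Q_def
      by (simp add: poly_sum poly_monom power_mult_distrib mult.commute[of t])
  qed
  have top: "coeff (Q a b) ?p = - (of_bool (a = b) * s n ^ ?p - (\<Sum>i<r. u i * (conn_mat s y i ^\<^sub>m ?p) $$ (a, b)))"
    if ab: "a < N" "b < N" for a b
  proof -
    have "graded_part N i (lin_comb n (B i) s) b ?p ?p a y = - (conn_mat s y i ^\<^sub>m ?p) $$ (a, b)" if i: "i < r" for i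
      using graded_part_top[OF i lin_comb_matrix[OF i] ab y, of s ?p] minus_power_prime_CHAR[OF refl prime_char, of "1::'k"]
      by (simp add: conn_mat_def)
    then show ?thesis unfolding cQ using p1 by (simp add: sum_negf)
  qed
  show ?thesis
  proof (rule that)
    show "\<forall>t. curv_char u y (\<lambda>i. t * s i) = poly q t"
      unfolding curv_char_det q(1)[symmetric]
      by (intro allI arg_cong[of _ _ det] eq_matI) (simp_all add: ev)
    show "\<forall>k. coeff q k \<noteq> 0 \<longrightarrow> N \<le> k \<and> k \<le> ?p * N" using q(2) by blast
    show "coeff q (?p * N) = det (mat N N (\<lambda>(a, b).
       - (of_bool (a = b) * s n ^ CHAR('k) - (\<Sum>i<r. u i * (conn_mat s y i ^\<^sub>m CHAR('k)) $$ (a, b)))))"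
      unfolding q(3) by (intro arg_cong[of _ _ det] eq_matI) (simp_all add: top)
  qed
qed

lemma twisted_char_scaled:
  obtains q where "\<forall>t. twisted_char u y (\<lambda>i. t * s i) = poly q t"
    "\<forall>k. coeff q k \<noteq> 0 \<longrightarrow> N \<le> k \<and> k \<le> CHAR('k) * N"
    "coeff q (CHAR('k) * N) = det (mat N N (\<lambda>(a, b).
       - (of_bool (a = b) * s n ^ CHAR('k) - (\<Sum>i<r. u i * conn_mat s y i $$ (a, b) ^ CHAR('k)))))"
proof -
  let ?p = "CHAR('k)"
  have p1: "?p > 1" using prime_char prime_gt_1_nat by blast
  define AS where "AS c = monom c 1 - monom (c ^ ?p) ?p" for c :: 'k
  have cAS: "coeff (AS c) k = (if k = 1 then c else 0) - (if k = ?p then c ^ ?p else 0)" for c k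
    using p1 by (auto simp: AS_def coeff_monom)
  have pAS: "poly (AS c) t = t * c - (t * c) ^ ?p" for c t
    by (simp add: AS_def poly_monom power_mult_distrib mult.commute)
  define Q where "Q a b = (if a = b then AS (s n) else 0) -
    (\<Sum>i<r. Polynomial.smult (u i) (\<Sum>j<n. Polynomial.smult (B i j a b y ^ ?p) (AS (s j))))" for a b
  have cQ: "coeff (Q a b) k = (if a = b then coeff (AS (s n)) k else 0) -
    (\<Sum>i<r. u i * (\<Sum>j<n. B i j a b y ^ ?p * coeff (AS (s j)) k))" for a b k
    unfolding Q_def by (simp add: coeff_sum)
  have bound: "1 \<le> k \<and> k \<le> ?p" if nz: "coeff (Q a b) k \<noteq> 0" for a b k
  proof (rule ccontr)
    assume "\<not> (1 \<le> k \<and> k \<le> ?p)"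
    then have "coeff (AS c) k = 0" for c using p1 by (auto simp: cAS)
    then show False using nz by (cases "a = b") (simp_all add: cQ)
  qed
  obtain q where q: "\<And>t. det (mat N N (\<lambda>(a, b). poly (Q a b) t)) = poly q t"
    "\<And>k. coeff q k \<noteq> 0 \<Longrightarrow> N \<le> k \<and> k \<le> ?p * N"
    "coeff q (?p * N) = det (mat N N (\<lambda>(a, b). coeff (Q a b) ?p))"
    by (rule det_graded_poly[of N Q ?p]) (use bound in blast)+
  have ev: "poly (Q a b) t = of_bool (a = b) * (t * s n - (t * s n) ^ ?p) -
      (\<Sum>i<r. u i * (\<Sum>j<n. (t * s j - (t * s j) ^ ?p) * B i j a b y ^ ?p))" for a b t
    unfolding Q_def by (simp add: poly_sum pAS mult.commute[of "_ ^ ?p"])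
  have top: "coeff (Q a b) ?p = - (of_bool (a = b) * s n ^ ?p - (\<Sum>i<r. u i * conn_mat s y i $$ (a, b) ^ ?p))"
    if ab: "a < N" "b < N" for a b
  proof -
    have "(\<Sum>j<n. B i j a b y ^ ?p * coeff (AS (s j)) ?p) = - (conn_mat s y i $$ (a, b) ^ ?p)" for i
      using ab p1 by (simp add: conn_mat_def lin_comb_def frobenius_sum[OF prime_char] cAS power_mult_distrib
          sum_negf mult.commute)
    then show ?thesis unfolding cQ cAS using p1 by (simp add: sum_negf)
  qed
  show ?thesis
  proof (rule that)
    show "\<forall>t. twisted_char u y (\<lambda>i. t * s i) = poly q t"
      unfolding twisted_char_det q(1)[symmetric]
      by (intro allI arg_cong[of _ _ det] eq_matI) (simp_all add: ev)
    show "\<forall>k. coeff q k \<noteq> 0 \<longrightarrow> N \<le> k \<and> k \<le> ?p * N" using q(2) by blast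
    show "coeff q (?p * N) = det (mat N N (\<lambda>(a, b).
       - (of_bool (a = b) * s n ^ CHAR('k) - (\<Sum>i<r. u i * conn_mat s y i $$ (a, b) ^ CHAR('k)))))"
      unfolding q(3) by (intro arg_cong[of _ _ det] eq_matI) (simp_all add: top)
  qed
qed

text \<open>
  Take \<open>w\<^sub>i\<^sup>p = u\<^sub>i\<close> and \<open>P = \<zeta> - \<Sum>\<^sub>i w\<^sub>i M\<^sub>i\<close> with the commuting connection matrices \<open>M\<^sub>i\<close>.  The matrix on the left is
  \<open>-P\<^sup>p\<close>, and the one on the right has as entries the negatives of the \<open>p\<close>-th powers of those of \<open>P\<close>.  Both
  determinants are the same multiple of \<open>det(P)\<^sup>p\<close>.
\<close>

lemma leading_coefficients_eq:
  assumes y: "y \<in> U"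
  shows "det (mat N N (\<lambda>(a, b). - (of_bool (a = b) * \<zeta> ^ CHAR('k) - (\<Sum>i<r. u i * (conn_mat s y i ^\<^sub>m CHAR('k)) $$ (a, b))))) =
    det (mat N N (\<lambda>(a, b). - (of_bool (a = b) * \<zeta> ^ CHAR('k) - (\<Sum>i<r. u i * conn_mat s y i $$ (a, b) ^ CHAR('k)))))"
proof -
  let ?p = "CHAR('k)"
  have p0: "?p > 0" using prime_char prime_gt_0_nat by blast
  have "\<forall>i. \<exists>w. w ^ ?p = u i" using p_th_root by blast
  from choice[OF this] obtain w where w: "\<And>i. w i ^ ?p = u i" by blast
  interpret frob: comm_ring_hom "\<lambda>x :: 'k. x ^ ?p" by (rule frobenius_comm_ring_hom[OF prime_char])
  \<comment> \<open>The scalar \<open>\<zeta>\<close> is included as one more member of the pencil, so that \<open>P = mat_lincomb N (Suc r) c L\<close>.\<close>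
  define L where "L i = (if i < r then conn_mat s y i else 1\<^sub>m N)" for i
  define c where "c i = (if i < r then - w i else \<zeta>)" for i
  have neg: "(- x) ^ ?p = - (x ^ ?p)" for x :: 'k by (rule minus_power_prime_CHAR[OF refl prime_char])
  have Lc: "L i \<in> carrier_mat N N" for i by (simp add: L_def)
  have L: "commuting_pencil N (Suc r) L"
    using conn_mat_commuting[OF y, of s] unfolding commuting_pencil_def
    by (auto simp: L_def less_Suc_eq right_mult_one_mat[OF conn_mat_carrier] left_mult_one_mat[OF conn_mat_carrier])
  let ?P = "mat_lincomb N (Suc r) c L"
  have Pc: "?P \<in> carrier_mat N N" by simp
  have pw: "?P ^\<^sub>m ?p = mat_lincomb N (Suc r) (\<lambda>i. c i ^ ?p) (\<lambda>i. L i ^\<^sub>m ?p)"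
    by (rule mat_lincomb_frobenius_power[OF prime_char L])
  have 1: "mat N N (\<lambda>(a, b). - (of_bool (a = b) * \<zeta> ^ ?p - (\<Sum>i<r. u i * (conn_mat s y i ^\<^sub>m ?p) $$ (a, b)))) =
      (-1) \<cdot>\<^sub>m (?P ^\<^sub>m ?p)"
    unfolding pw by (intro eq_matI) (auto simp: mat_lincomb_def L_def c_def pow_one_mat neg w sum_negf)
  have 2: "mat N N (\<lambda>(a, b). - (of_bool (a = b) * \<zeta> ^ ?p - (\<Sum>i<r. u i * conn_mat s y i $$ (a, b) ^ ?p))) =
      (-1) \<cdot>\<^sub>m (map_mat (\<lambda>x. x ^ ?p) ?P)"
    using p0 by (intro eq_matI) (auto simp: mat_lincomb_def L_def c_def neg w sum_negf power_mult_distrib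
        frobenius_sum[OF prime_char] freshmans_dream[OF prime_char refl] frobenius_diff[OF prime_char])
  show ?thesis unfolding 1 2 using p0 Pc det_pow_mat[OF Pc, of ?p] by (simp add: det_smult frob.hom_det)
qed

lemma curv_char_eq_twisted_char:
  assumes y: "y \<in> U"
  shows "curv_char u y s = twisted_char u y s"
proof -
  have "curv_char u y s - twisted_char u y s = 0"
  proof (rule periodic_pfun_eq_zero[OF prime_char pfun_diff[OF curv_char_pfun[OF y] twisted_char_pfun]])
    show "curv_char u y (s(j := s j + 1)) - twisted_char u y (s(j := s j + 1)) = curv_char u y s - twisted_char u y s"
      if "j < Suc n" for j s
      unfolding curv_char_periodic[OF y that] twisted_char_periodic[OF that] ..
    fix s
    obtain q1 where q1: "\<forall>t. curv_char u y (\<lambda>i. t * s i) = poly q1 t"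
      "\<forall>k. coeff q1 k \<noteq> 0 \<longrightarrow> N \<le> k \<and> k \<le> CHAR('k) * N"
      "coeff q1 (CHAR('k) * N) = det (mat N N (\<lambda>(a, b).
         - (of_bool (a = b) * s n ^ CHAR('k) - (\<Sum>i<r. u i * (conn_mat s y i ^\<^sub>m CHAR('k)) $$ (a, b)))))"
      by (rule curv_char_scaled[OF y])
    obtain q2 where q2: "\<forall>t. twisted_char u y (\<lambda>i. t * s i) = poly q2 t"
      "\<forall>k. coeff q2 k \<noteq> 0 \<longrightarrow> N \<le> k \<and> k \<le> CHAR('k) * N"
      "coeff q2 (CHAR('k) * N) = det (mat N N (\<lambda>(a, b).
         - (of_bool (a = b) * s n ^ CHAR('k) - (\<Sum>i<r. u i * conn_mat s y i $$ (a, b) ^ CHAR('k)))))"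
      by (rule twisted_char_scaled)
    have top: "coeff q1 (CHAR('k) * N) = coeff q2 (CHAR('k) * N)"
      unfolding q1(3) q2(3) by (rule leading_coefficients_eq[OF y])
    show "\<exists>q. (\<forall>t. curv_char u y (\<lambda>i. t * s i) - twisted_char u y (\<lambda>i. t * s i) = poly q t) \<and>
        (\<forall>i. coeff q i \<noteq> 0 \<longrightarrow> N \<le> i \<and> i < CHAR('k) * N)"
    proof (intro exI[of _ "q1 - q2"] conjI allI impI)
      fix i assume nz: "coeff (q1 - q2) i \<noteq> 0"
      then have "coeff q1 i \<noteq> 0 \<or> coeff q2 i \<noteq> 0" by auto
      then have "N \<le> i \<and> i \<le> CHAR('k) * N" using q1(2) q2(2) by blast
      moreover have "i \<noteq> CHAR('k) * N" using nz top by auto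
      ultimately show "N \<le> i" "i < CHAR('k) * N" by auto
    qed (simp add: q1(1) q2(1))
  qed
  then show ?thesis by simp
qed

lemma artin_schreier_surjective: "\<exists>\<zeta> :: 'k. \<zeta> - \<zeta> ^ CHAR('k) = z"
proof -
  let ?q = "[:-z, 1:] - monom 1 CHAR('k) :: 'k poly"
  have p1: "CHAR('k) > 1" using prime_char prime_gt_1_nat by blast
  have "coeff ?q CHAR('k) = -1" using p1 by (simp add: coeff_pCons split: nat.splits)
  then have "degree ?q > 0" using p1 le_degree[of ?q "CHAR('k)"] by simp
  then obtain \<zeta> where "poly ?q \<zeta> = 0" using alg_closed_imp_poly_has_root by blast
  then show ?thesis by (intro exI[of _ \<zeta>]) (simp add: poly_monom algebra_simps)
qed

text \<open>
  Every \<open>z\<close> has the form \<open>\<zeta> - \<zeta>\<^sup>p\<close>, and the matrices depend on \<open>s\<^sub>0, \<dots>, s\<^bsub>n-1\<^esub>\<close> only.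
\<close>

theorem char_poly_curv_eq_twisted:
  assumes y: "y \<in> U"
  shows "char_poly (mat_lincomb N r u (curv_mat s y)) = char_poly (mat_lincomb N r u (twisted_mat s y))"
proof (rule poly_eq_if_eval_eq)
  fix z :: 'k
  obtain \<zeta> where \<zeta>: "\<zeta> - \<zeta> ^ CHAR('k) = z" using artin_schreier_surjective by blast
  have "lin_comb n (B i) (s(n := \<zeta>)) = lin_comb n (B i) s" for i by (rule lin_comb_cong) simp
  then have 1: "curv_mat (s(n := \<zeta>)) y = curv_mat s y" by (intro ext) (simp add: curv_mat_def del: fun_upd_apply)
  have 2: "twisted_mat (s(n := \<zeta>)) y = twisted_mat s y" by (intro ext) (simp add: twisted_mat_def)
  show "poly (char_poly (mat_lincomb N r u (curv_mat s y))) z = poly (char_poly (mat_lincomb N r u (twisted_mat s y))) z"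
    using curv_char_eq_twisted_char[OF y, of u "s(n := \<zeta>)"] unfolding curv_char_def twisted_char_def 1 2
    by (simp add: \<zeta>)
qed

theorem isospectral_curv_twisted:
  assumes y: "y \<in> U"
  shows "isospectral N r (curv_mat s y) (twisted_mat s y)"
  by (rule isospectral_if_char_poly_eq[OF curv_mat_commuting[OF y] twisted_mat_commuting[OF y]
        char_poly_curv_eq_twisted[OF y]])

text \<open>
  Elements of the prime field satisfy \<open>s\<^sub>j = s\<^sub>j\<^sup>p\<close>, so the twisted pencil is 0.
\<close>

lemma nilpotent_curv:
  assumes y: "y \<in> U" and i: "i < r" and s: "\<And>j. j < n \<Longrightarrow> s j \<in> range (of_int :: int \<Rightarrow> 'k)"
  shows "curv_mat s y i ^\<^sub>m N = 0\<^sub>m N N"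
proof (rule nilpotent_if_char_poly_monomial)
  have fermat: "s j ^ CHAR('k) = s j" if jn: "j < n" for j
  proof -
    have nat: "(of_nat m :: 'k) ^ CHAR('k) = of_nat m" for m
    proof (induction m)
      case 0
      show ?case using prime_char prime_gt_0_nat by auto
    next
      case (Suc m)
      then show ?case using freshmans_dream[OF prime_char refl, of 1 "of_nat m :: 'k"] by simp
    qed
    obtain z where z: "s j = of_int z" using s[OF jn] by blast
    show ?thesis
    proof (cases z)
      case (nonneg m)
      then show ?thesis using z nat by simp
    next
      case (neg m)
      then have "s j = - of_nat (Suc m)" using z by simp
      then show ?thesis using nat[of "Suc m"] minus_power_prime_CHAR[OF refl prime_char, of "of_nat (Suc m) :: 'k"] by simp
    qed
  qed
  let ?u = "\<lambda>l. of_bool (l = i) :: 'k"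
  have pick: "mat_lincomb N r ?u L = L i" if "L i \<in> carrier_mat N N" for L
    using that i by (intro eq_matI) (auto simp: mat_lincomb_def)
  have z: "twisted_mat s y i = 0\<^sub>m N N" by (intro eq_matI) (auto simp: twisted_mat_def fermat)
  have "char_poly (curv_mat s y i) = char_poly (0\<^sub>m N N)"
    using char_poly_curv_eq_twisted[OF y, of ?u s] unfolding pick[OF curv_mat_carrier] pick[OF twisted_mat_carrier] z .
  also have "\<dots> = monom 1 N"
  proof (rule poly_eq_if_eval_eq)
    fix c :: 'k
    have "mat N N (\<lambda>(a, b). of_bool (a = b) * c - 0\<^sub>m N N $$ (a, b)) = c \<cdot>\<^sub>m 1\<^sub>m N" by (intro eq_matI) auto
    then show "poly (char_poly (0\<^sub>m N N :: 'k mat)) c = poly (monom 1 N) c"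
      using poly_char_poly_eq_det[of "0\<^sub>m N N" N c] by (simp add: det_smult poly_monom)
  qed
  finally show "char_poly (curv_mat s y i) = monom 1 N" .
qed simp

end

section \<open>The ring of regular functions\<close>

lemma (in algebraic_variety) reg_const:
  assumes "openin (topo X) W"
  shows "(\<lambda>_. c) \<in> reg X W"
proof (rule reg_glue[OF assms])
  fix y assume "y \<in> W"
  obtain W' where W': "openin (topo X) W'" "y \<in> W'" "W' \<subseteq> W" "in_chart X W'"
    using assms \<open>y \<in> W\<close> by (rule chart_nbhd)
  then show "\<exists>W'. openin (topo X) W' \<and> y \<in> W' \<and> W' \<subseteq> W \<and> (\<lambda>_. c) \<in> reg X W'"
    using chart_reg_const[OF W'(4,1)] by (intro exI[of _ W'] conjI)
qed

context variety_with_tangents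
begin

lemma reg_chart_nbhd:
  assumes "openin (topo X) W" "y \<in> W" "f \<in> reg X W" "g \<in> reg X W"
  obtains W' where "openin (topo X) W'" "y \<in> W'" "W' \<subseteq> W" "in_chart X W'" "f \<in> reg X W'" "g \<in> reg X W'"
proof -
  obtain W' where W': "openin (topo X) W'" "y \<in> W'" "W' \<subseteq> W" "in_chart X W'"
    using assms(1,2) by (rule chart_nbhd)
  show ?thesis
    by (rule that[OF W']) (use reg_restrict[OF assms(1) W'(1,3)] assms(3,4) in auto)
qed

lemma reg_binop:
  assumes "openin (topo X) W" "f \<in> reg X W" "g \<in> reg X W"
  shows reg_add: "(\<lambda>y. f y + g y) \<in> reg X W" and reg_mult: "(\<lambda>y. f y * g y) \<in> reg X W"
proof -
  show "(\<lambda>y. f y + g y) \<in> reg X W"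
  proof (rule reg_glue[OF assms(1)])
    fix y assume "y \<in> W"
    obtain W' where W': "openin (topo X) W'" "y \<in> W'" "W' \<subseteq> W" "in_chart X W'" "f \<in> reg X W'" "g \<in> reg X W'"
      by (rule reg_chart_nbhd[OF assms(1) \<open>y \<in> W\<close> assms(2,3)])
    show "\<exists>W'. openin (topo X) W' \<and> y \<in> W' \<and> W' \<subseteq> W \<and> (\<lambda>y. f y + g y) \<in> reg X W'"
      by (intro exI[of _ W'] conjI W' chart_reg_add)
  qed
  show "(\<lambda>y. f y * g y) \<in> reg X W"
  proof (rule reg_glue[OF assms(1)])
    fix y assume "y \<in> W"
    obtain W' where W': "openin (topo X) W'" "y \<in> W'" "W' \<subseteq> W" "in_chart X W'" "f \<in> reg X W'" "g \<in> reg X W'"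
      by (rule reg_chart_nbhd[OF assms(1) \<open>y \<in> W\<close> assms(2,3)])
    show "\<exists>W'. openin (topo X) W' \<and> y \<in> W' \<and> W' \<subseteq> W \<and> (\<lambda>y. f y * g y) \<in> reg X W'"
      by (intro exI[of _ W'] conjI W' chart_reg_mult)
  qed
qed

lemma reg_cong:
  assumes "openin (topo X) W" "f \<in> reg X W" "\<And>y. y \<in> W \<Longrightarrow> f y = g y"
  shows "g \<in> reg X W"
proof (rule reg_glue[OF assms(1)])
  fix y assume "y \<in> W"
  obtain W' where W': "openin (topo X) W'" "y \<in> W'" "W' \<subseteq> W" "in_chart X W'" "f \<in> reg X W'"
    by (rule reg_chart_nbhd[OF assms(1) \<open>y \<in> W\<close> assms(2,2)])
  have "g \<in> reg X W'" by (rule chart_reg_cong[OF W'(4,1,5)]) (use assms(3) W'(3) in auto)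
  then show "\<exists>W'. openin (topo X) W' \<and> y \<in> W' \<and> W' \<subseteq> W \<and> g \<in> reg X W'" using W' by blast
qed

lemma reg_sum:
  assumes "openin (topo X) W"
  shows "(\<And>a. a \<in> A \<Longrightarrow> f a \<in> reg X W) \<Longrightarrow> (\<lambda>y. \<Sum>a\<in>A. f a y) \<in> reg X W"
  by (induction A rule: infinite_finite_induct) (auto intro: reg_const reg_add assms)

lemma reg_prod:
  assumes "openin (topo X) W"
  shows "(\<And>a. a \<in> A \<Longrightarrow> f a \<in> reg X W) \<Longrightarrow> (\<lambda>y. \<Prod>a\<in>A. f a y) \<in> reg X W"
  by (induction A rule: infinite_finite_induct) (auto intro: reg_const reg_mult assms)

lemma reg_invertible_locus:
  assumes W: "openin (topo X) W" "f \<in> reg X W"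
  shows "openin (topo X) {y \<in> W. f y \<noteq> 0}" and "(\<lambda>y. inverse (f y)) \<in> reg X {y \<in> W. f y \<noteq> 0}"
proof -
  let ?V = "{y \<in> W. f y \<noteq> 0}"
  have local: "\<exists>W'. openin (topo X) W' \<and> y \<in> W' \<and> W' \<subseteq> ?V \<and> (\<lambda>y. inverse (f y)) \<in> reg X W'" if y: "y \<in> ?V" for y
  proof -
    have yW: "y \<in> W" using y by simp
    have "y \<in> points X" using W(1) yW openin_subset by blast
    then obtain U0 m \<phi> where ch: "affine_chart X U0 m \<phi>" "y \<in> U0" by (rule chart_at)
    let ?W = "W \<inter> U0"
    have Wo: "openin (topo X) ?W" using W(1) openin_chart[OF ch(1)] by blast
    have "f \<in> reg X ?W" by (rule reg_restrict[OF W(1) Wo _ W(2)]) simp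
    then have "fraction_at X m \<phi> ?W f y" using chart_reg_iff[OF ch(1) Wo] yW ch(2) by blast
    then obtain W' a b where W': "openin (topo X) W'" "y \<in> W'" "W' \<subseteq> ?W" "a \<in> poly_fun m" "b \<in> poly_fun m"
      "\<forall>w\<in>W'. b (\<phi> w) \<noteq> 0 \<and> f w = a (\<phi> w) / b (\<phi> w)"
      by (rule fraction_atE)
    let ?V' = "W' \<inter> {w \<in> U0. a (\<phi> w) \<noteq> 0}"
    have V': "openin (topo X) ?V'" using W'(1) chart_poly_open[OF ch(1) W'(4)] by blast
    have sub: "?V' \<subseteq> U0" by blast
    have "(\<lambda>y. inverse (f y)) \<in> reg X ?V'"
      unfolding chart_reg_iff[OF ch(1) V' sub]
    proof
      fix z assume z: "z \<in> ?V'"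
      show "fraction_at X m \<phi> ?V' (\<lambda>y. inverse (f y)) z"
        by (rule fraction_atI[OF V' z subset_refl W'(5,4)]) (use W'(6) in \<open>auto simp: field_simps\<close>)
    qed
    moreover have "y \<in> ?V'" using y W'(2,6) ch(2) by auto
    moreover have "?V' \<subseteq> ?V" using W'(3,6) by auto
    ultimately show ?thesis using V' by blast
  qed
  show V: "openin (topo X) ?V"
  proof (subst openin_subopen, intro ballI)
    fix y assume "y \<in> ?V"
    from local[OF this] show "\<exists>T. openin (topo X) T \<and> y \<in> T \<and> T \<subseteq> ?V" by (elim exE conjE) (intro exI conjI)
  qed
  show "(\<lambda>y. inverse (f y)) \<in> reg X ?V" by (rule reg_glue[OF V local])
qed

end

section \<open>Derivatives in local coordinates\<close>

locale coordinate_system = variety_with_tangents X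
  for X :: "('x, 'k::alg_closed_field) space_with_functions" +
  fixes U :: "'x set" and r :: nat and x :: "nat \<Rightarrow> 'x \<Rightarrow> 'k"
  assumes coords: "local_coordinates X U r x"
begin

lemma openin_U: "openin (topo X) U" and coord_reg: "i < r \<Longrightarrow> x i \<in> reg X U"
  using coords by (auto simp: local_coordinates_def)

lemma differential_generated:
  assumes "openin (topo X) W" "W \<subseteq> U" "one_form_on X W \<omega>"
  shows "\<exists>g. (\<forall>i<r. g i \<in> reg X W) \<and> (\<forall>y\<in>W. \<forall>v\<in>tangent_space X y. \<omega> y v = (\<Sum>i<r. g i y * v (x i)))"
  by (rule coords[unfolded local_coordinates_def, THEN conjunct2, THEN conjunct2, THEN spec[of _ W], THEN mp, OF assms(2),
        THEN mp, OF assms(1), THEN conjunct1, THEN spec, THEN mp, OF assms(3)])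

lemma differential_free:
  assumes "openin (topo X) W" "W \<subseteq> U" "\<And>i. i < r \<Longrightarrow> f i \<in> reg X W"
    "\<And>y v. y \<in> W \<Longrightarrow> v \<in> tangent_space X y \<Longrightarrow> (\<Sum>i<r. f i y * v (x i)) = 0"
    and "i < r" "y \<in> W"
  shows "f i y = 0"
proof -
  have "\<forall>i<r. \<forall>y\<in>W. f i y = 0"
    by (rule coords[unfolded local_coordinates_def, THEN conjunct2, THEN conjunct2, THEN spec[of _ W], THEN mp, OF assms(2),
          THEN mp, OF assms(1), THEN conjunct2, THEN spec, THEN mp]) (intro conjI allI impI ballI; rule assms; assumption)
  then show ?thesis using assms(5,6) by simp
qed

definition expands :: "'x set \<Rightarrow> ('x \<Rightarrow> 'k) \<Rightarrow> (nat \<Rightarrow> 'x \<Rightarrow> 'k) \<Rightarrow> bool" where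
  "expands W f g \<longleftrightarrow> openin (topo X) W \<and> W \<subseteq> U \<and> f \<in> reg X W \<and> (\<forall>i<r. g i \<in> reg X W) \<and>
     (\<forall>y\<in>W. \<forall>v\<in>tangent_space X y. v f = (\<Sum>i<r. g i y * v (x i)))"

lemma expandsD:
  assumes "expands W f g"
  shows "openin (topo X) W" "W \<subseteq> U" "f \<in> reg X W" "i < r \<Longrightarrow> g i \<in> reg X W"
    "y \<in> W \<Longrightarrow> v \<in> tangent_space X y \<Longrightarrow> v f = (\<Sum>i<r. g i y * v (x i))"
  using assms unfolding expands_def by blast+

lemma expands_restrict:
  assumes "expands W f g" "openin (topo X) W'" "W' \<subseteq> W"
  shows "expands W' f g"
proof -
  note e = expandsD[OF assms(1)] and res = reg_restrict[OF expandsD(1)[OF assms(1)] assms(2,3)]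
  show ?thesis unfolding expands_def
  proof (intro conjI allI impI ballI)
    show "v f = (\<Sum>i<r. g i y * v (x i))" if "y \<in> W'" "v \<in> tangent_space X y" for y v
      using e(5) that assms(3) by blast
  qed (use assms(2,3) e(2) res[OF e(3)] res[OF e(4)] in auto)
qed

lemma expansion_exists:
  assumes "openin (topo X) W" "W \<subseteq> U" "f \<in> reg X W"
  obtains g where "expands W f g"
proof -
  have "one_form_on X W (\<lambda>y v. v f)"
    unfolding one_form_on_def
  proof
    fix y assume "y \<in> W"
    show "\<exists>W' (m::nat) f' g. openin (topo X) W' \<and> y \<in> W' \<and> W' \<subseteq> W \<and>
        (\<forall>l<m. f' l \<in> reg X W' \<and> g l \<in> reg X W') \<and>
        (\<forall>y\<in>W'. \<forall>v\<in>tangent_space X y. v f = (\<Sum>l<m. f' l y * v (g l)))"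
      by (rule exI[of _ W], rule exI[of _ 1], rule exI[of _ "\<lambda>_ _. 1"], rule exI[of _ "\<lambda>_. f"])
        (simp add: assms \<open>y \<in> W\<close> reg_const[OF assms(1)])
  qed
  from differential_generated[OF assms(1,2) this] obtain g where "\<forall>i<r. g i \<in> reg X W"
    "\<forall>y\<in>W. \<forall>v\<in>tangent_space X y. v f = (\<Sum>i<r. g i y * v (x i))" by (elim exE conjE)
  then have "expands W f g" using assms unfolding expands_def by (intro conjI)
  then show ?thesis by (rule that)
qed

lemma expansion_unique:
  assumes "expands W f g" "expands W' f g'" "y \<in> W" "y \<in> W'" "i < r"
  shows "g i y = g' i y"
proof -
  let ?V = "W \<inter> W'"
  have V: "openin (topo X) ?V" using expandsD(1)[OF assms(1)] expandsD(1)[OF assms(2)] by blast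
  have 1: "expands ?V f g" and 2: "expands ?V f g'"
    using expands_restrict[OF assms(1) V] expands_restrict[OF assms(2) V] by auto
  have "(\<lambda>i y. g i y + (-1) * g' i y) i y = 0"
  proof (rule differential_free[OF V])
    show "?V \<subseteq> U" by (rule expandsD(2)[OF 1])
    show "(\<lambda>y. g i y + (-1) * g' i y) \<in> reg X ?V" if "i < r" for i
      by (intro reg_add reg_mult reg_const V expandsD(4)[OF 1] expandsD(4)[OF 2] that)
    show "(\<Sum>i<r. (g i y + (-1) * g' i y) * v (x i)) = 0" if "y \<in> ?V" "v \<in> tangent_space X y" for y v
      using expandsD(5)[OF 1 that] expandsD(5)[OF 2 that]
      by (simp add: algebra_simps sum_subtractf)
  qed (use assms in auto)
  then show ?thesis by simp
qed

text \<open>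
  The coefficient of \<open>dx\<^sub>i\<close> in \<open>df\<close>, from an arbitrary expansion of \<open>df\<close> near \<open>y\<close>.
\<close>

definition partial_at :: "nat \<Rightarrow> 'x \<Rightarrow> ('x \<Rightarrow> 'k) \<Rightarrow> 'k" where
  "partial_at i y f = (if regular_at X y f then (SOME c. \<exists>W g. expands W f g \<and> y \<in> W \<and> c = g i y) else 0)"

lemma partial_at_eq:
  assumes "expands W f g" "y \<in> W" "i < r"
  shows "partial_at i y f = g i y"
proof -
  have "regular_at X y f" using expandsD(1,3)[OF assms(1)] assms(2) by (auto simp: regular_at_def)
  moreover have "(SOME c. \<exists>W g. expands W f g \<and> y \<in> W \<and> c = g i y) = g i y"
  proof (rule some_equality)
    show "\<exists>W g'. expands W f g' \<and> y \<in> W \<and> g i y = g' i y" using assms(1,2) by blast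
    show "c = g i y" if "\<exists>W g'. expands W f g' \<and> y \<in> W \<and> c = g' i y" for c
      using that expansion_unique[OF _ assms(1) _ assms(2,3)] by blast
  qed
  ultimately show ?thesis by (simp add: partial_at_def)
qed

lemma regular_at_U:
  assumes "y \<in> U" "regular_at X y f"
  obtains W where "openin (topo X) W" "y \<in> W" "W \<subseteq> U" "f \<in> reg X W"
proof -
  obtain W where W: "openin (topo X) W" "y \<in> W" "f \<in> reg X W" using assms(2) by (auto simp: regular_at_def)
  have o: "openin (topo X) (W \<inter> U)" using W(1) openin_U by blast
  show ?thesis by (rule that[OF o]) (use reg_restrict[OF W(1) o _ W(3)] W(2) assms(1) in auto)
qed

text \<open>
  Functions regular at \<open>y\<close> are regular on a common neighbourhood inside \<open>U\<close>, so the rules for derivations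
  need to be verified only there.
\<close>

lemma tangent_spaceI:
  assumes y: "y \<in> U"
    and add: "\<And>W f g. openin (topo X) W \<Longrightarrow> y \<in> W \<Longrightarrow> W \<subseteq> U \<Longrightarrow> f \<in> reg X W \<Longrightarrow> g \<in> reg X W \<Longrightarrow>
      T (\<lambda>y. f y + g y) = T f + T g"
    and mult: "\<And>W f g. openin (topo X) W \<Longrightarrow> y \<in> W \<Longrightarrow> W \<subseteq> U \<Longrightarrow> f \<in> reg X W \<Longrightarrow> g \<in> reg X W \<Longrightarrow>
      T (\<lambda>y. f y * g y) = f y * T g + g y * T f"
    and const: "\<And>c. T (\<lambda>_. c) = 0"
    and germ: "\<And>W f g. openin (topo X) W \<Longrightarrow> y \<in> W \<Longrightarrow> W \<subseteq> U \<Longrightarrow> f \<in> reg X W \<Longrightarrow> g \<in> reg X W \<Longrightarrow>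
      (\<And>z. z \<in> W \<Longrightarrow> f z = g z) \<Longrightarrow> T f = T g"
  shows "(\<lambda>f. if regular_at X y f then T f else 0) \<in> tangent_space X y"
proof -
  have rI: "regular_at X y f" if "openin (topo X) W" "y \<in> W" "f \<in> reg X W" for W f
    using that by (auto simp: regular_at_def)
  have common: "\<exists>W. openin (topo X) W \<and> y \<in> W \<and> W \<subseteq> U \<and> f \<in> reg X W \<and> g \<in> reg X W"
    if fr: "regular_at X y f" and gr: "regular_at X y g" for f g
  proof -
    obtain W where W: "openin (topo X) W" "y \<in> W" "W \<subseteq> U" "f \<in> reg X W" by (rule regular_at_U[OF y fr])
    obtain W' where W': "openin (topo X) W'" "y \<in> W'" "W' \<subseteq> U" "g \<in> reg X W'" by (rule regular_at_U[OF y gr])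
    have o: "openin (topo X) (W \<inter> W')" using W W' by blast
    have "f \<in> reg X (W \<inter> W')" "g \<in> reg X (W \<inter> W')"
      using reg_restrict[OF W(1) o _ W(4)] reg_restrict[OF W'(1) o _ W'(4)] by auto
    then show ?thesis using o W W' by (intro exI[of _ "W \<inter> W'"]) auto
  qed
  show ?thesis unfolding tangent_space_def
  proof (intro CollectI conjI allI impI)
    fix f g assume fg: "regular_at X y f \<and> regular_at X y g"
    then obtain W where W: "openin (topo X) W" "y \<in> W" "W \<subseteq> U" "f \<in> reg X W" "g \<in> reg X W" using common by blast
    have "regular_at X y (\<lambda>y. f y + g y)" "regular_at X y (\<lambda>y. f y * g y)"
      using rI[OF W(1,2)] reg_add[OF W(1,4,5)] reg_mult[OF W(1,4,5)] by auto
    then show "(if regular_at X y (\<lambda>y. f y + g y) then T (\<lambda>y. f y + g y) else 0) =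
        (if regular_at X y f then T f else 0) + (if regular_at X y g then T g else 0)"
      "(if regular_at X y (\<lambda>y. f y * g y) then T (\<lambda>y. f y * g y) else 0) =
        f y * (if regular_at X y g then T g else 0) + g y * (if regular_at X y f then T f else 0)"
      using fg add[OF W] mult[OF W] by auto
  next
    fix c f assume f: "regular_at X y f"
    then obtain W where W: "openin (topo X) W" "y \<in> W" "W \<subseteq> U" "f \<in> reg X W" using common by blast
    have "regular_at X y (\<lambda>y. c * f y)" using rI[OF W(1,2)] reg_mult[OF W(1) reg_const[OF W(1)] W(4)] by auto
    then show "(if regular_at X y (\<lambda>y. c * f y) then T (\<lambda>y. c * f y) else 0) = c * (if regular_at X y f then T f else 0)"
      using f mult[OF W(1-3) reg_const[OF W(1)] W(4), of c] const[of c] by simp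
  next
    fix f g W assume h: "openin (topo X) W \<and> y \<in> W \<and> f \<in> reg X W \<and> g \<in> reg X W \<and> (\<forall>y\<in>W. f y = g y)"
    then have o: "openin (topo X) (W \<inter> U)" using openin_U by blast
    have "f \<in> reg X (W \<inter> U)" "g \<in> reg X (W \<inter> U)" using h reg_restrict[OF _ o] by auto
    then have "T f = T g" using h y by (intro germ[OF o]) auto
    moreover have "regular_at X y f" "regular_at X y g" using h rI by auto
    ultimately show "(if regular_at X y f then T f else 0) = (if regular_at X y g then T g else 0)" by simp
  qed simp
qed

text \<open>
  Near \<open>y\<close> the differential of a function is a combination of the \<open>dx\<^sub>i\<close>.
\<close>

lemma tangent_eqI:
  assumes y: "y \<in> U" and v: "v \<in> tangent_space X y" "v' \<in> tangent_space X y"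
    and eq: "\<And>i. i < r \<Longrightarrow> v (x i) = v' (x i)"
  shows "v = v'"
proof
  fix f
  show "v f = v' f"
  proof (cases "regular_at X y f")
    case False
    then have "v f = 0" "v' f = 0" using tangent_irregular[OF v(1), of f] tangent_irregular[OF v(2), of f] by blast+
    then show ?thesis by simp
  next
    case True
    obtain W where W: "openin (topo X) W" "y \<in> W" "W \<subseteq> U" "f \<in> reg X W" by (rule regular_at_U[OF y True])
    obtain g where g: "expands W f g" by (rule expansion_exists[OF W(1,3,4)])
    show ?thesis unfolding expandsD(5)[OF g W(2) v(1)] expandsD(5)[OF g W(2) v(2)] using eq by simp
  qed
qed

text \<open>
  The expansions of \<open>d(f + g)\<close> and \<open>d(f g)\<close> come from those of \<open>df\<close> and \<open>dg\<close>, and expansions are unique.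
\<close>

lemma partial_at_tangent:
  assumes y: "y \<in> U" and i: "i < r"
  shows "partial_at i y \<in> tangent_space X y"
proof -
  have c: "partial_at i y (\<lambda>_. c) = 0" for c
  proof -
    have "expands U (\<lambda>_. c) (\<lambda>_ _. 0)"
      unfolding expands_def
    proof (intro conjI ballI allI impI openin_U subset_refl reg_const)
      fix z v assume "z \<in> U" "v \<in> tangent_space X z"
      then show "v (\<lambda>_. c) = (\<Sum>i<r. 0 * v (x i))"
        using tangent_const[of z v c] openin_subset[OF openin_U] by auto
    qed
    from partial_at_eq[OF this y i] show ?thesis .
  qed
  have "(\<lambda>f. if regular_at X y f then partial_at i y f else 0) \<in> tangent_space X y"
  proof (rule tangent_spaceI[where T = "partial_at i y", OF y _ _ c])
    fix W f g assume W: "openin (topo X) W" "y \<in> W" "W \<subseteq> U" "f \<in> reg X W" "g \<in> reg X W"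
    have rg: "regular_at X z f" "regular_at X z g" if "z \<in> W" for z using W that by (auto simp: regular_at_def)
    obtain f' where f': "expands W f f'" by (rule expansion_exists[OF W(1,3,4)])
    obtain g' where g': "expands W g g'" by (rule expansion_exists[OF W(1,3,5)])
    have "expands W (\<lambda>y. f y + g y) (\<lambda>i y. f' i y + g' i y)"
      unfolding expands_def
    proof (intro conjI allI impI ballI)
      show "(\<lambda>y. f' i y + g' i y) \<in> reg X W" if "i < r" for i
        by (intro reg_add W expandsD(4)[OF f' that] expandsD(4)[OF g' that])
      show "v (\<lambda>y. f y + g y) = (\<Sum>i<r. (f' i z + g' i z) * v (x i))"
        if z: "z \<in> W" "v \<in> tangent_space X z" for z v
        unfolding tangent_add[OF z(2) rg[OF z(1)]] expandsD(5)[OF f' z] expandsD(5)[OF g' z]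
        by (simp add: algebra_simps sum.distrib)
    qed (use W reg_add in auto)
    from partial_at_eq[OF this W(2) i] show "partial_at i y (\<lambda>y. f y + g y) = partial_at i y f + partial_at i y g"
      unfolding partial_at_eq[OF f' W(2) i] partial_at_eq[OF g' W(2) i] .
    have "expands W (\<lambda>y. f y * g y) (\<lambda>i y. f y * g' i y + g y * f' i y)"
      unfolding expands_def
    proof (intro conjI allI impI ballI)
      show "(\<lambda>y. f y * g' i y + g y * f' i y) \<in> reg X W" if "i < r" for i
        by (intro reg_add reg_mult W expandsD(4)[OF f' that] expandsD(4)[OF g' that])
      show "v (\<lambda>y. f y * g y) = (\<Sum>i<r. (f z * g' i z + g z * f' i z) * v (x i))"
        if z: "z \<in> W" "v \<in> tangent_space X z" for z v
        unfolding tangent_mult[OF z(2) rg[OF z(1)]] expandsD(5)[OF f' z] expandsD(5)[OF g' z]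
        by (simp add: algebra_simps sum.distrib sum_distrib_left)
    qed (use W reg_mult in auto)
    from partial_at_eq[OF this W(2) i] show "partial_at i y (\<lambda>y. f y * g y) = f y * partial_at i y g + g y * partial_at i y f"
      unfolding partial_at_eq[OF f' W(2) i] partial_at_eq[OF g' W(2) i] .
    show "partial_at i y f = partial_at i y g" if eq: "\<And>z. z \<in> W \<Longrightarrow> f z = g z"
    proof -
      have "v f = v g" if "z \<in> W" "v \<in> tangent_space X z" for z v
        by (rule tangent_germ[OF that(2) W(1) that(1) W(4,5) eq])
      then have "expands W f g'"
        using W(1,3,4) expandsD(4,5)[OF g'] unfolding expands_def by simp
      from partial_at_eq[OF this W(2) i] show ?thesis unfolding partial_at_eq[OF g' W(2) i] .
    qed
  qed
  moreover have "(\<lambda>f. if regular_at X y f then partial_at i y f else 0) = partial_at i y" by (rule ext) (simp add: partial_at_def)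
  ultimately show ?thesis by simp
qed

lemma partial_at_coord:
  assumes "y \<in> U" "i < r" "l < r"
  shows "partial_at i y (x l) = (if l = i then 1 else 0)"
proof -
  have "expands U (x l) (\<lambda>j _. if l = j then 1 else 0)"
    unfolding expands_def using openin_U coord_reg[OF assms(3)] reg_const[OF openin_U] assms(3)
    by (auto simp: if_distrib[of "\<lambda>c. c * _"] cong: if_cong)
  from partial_at_eq[OF this assms(1,2)] show ?thesis .
qed

lemma coord_field_eq_partial_at:
  assumes "y \<in> U" "i < r"
  shows "coord_field X r x i y = partial_at i y"
  unfolding coord_field_def
  using partial_at_tangent[OF assms] partial_at_coord[OF assms] tangent_eqI[OF assms(1)]
  by (intro the_equality) auto

definition D :: "nat \<Rightarrow> ('x \<Rightarrow> 'k) \<Rightarrow> 'x \<Rightarrow> 'k" where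
  "D i f y = coord_field X r x i y f"

lemma D_tangent: "y \<in> U \<Longrightarrow> i < r \<Longrightarrow> coord_field X r x i y \<in> tangent_space X y"
  by (simp add: coord_field_eq_partial_at partial_at_tangent)

lemma D_coord: "y \<in> U \<Longrightarrow> i < r \<Longrightarrow> l < r \<Longrightarrow> D i (x l) y = (if l = i then 1 else 0)"
  by (simp add: D_def coord_field_eq_partial_at partial_at_coord)

context
  fixes W assumes W: "openin (topo X) W" "W \<subseteq> U"
begin

lemma D_reg:
  assumes "i < r" "f \<in> reg X W"
  shows "D i f \<in> reg X W"
proof -
  obtain g where g: "expands W f g" by (rule expansion_exists[OF W assms(2)])
  show ?thesis
  proof (rule reg_cong[OF W(1) expandsD(4)[OF g assms(1)]])
    fix y assume "y \<in> W"
    then show "g i y = D i f y"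
      using W(2) coord_field_eq_partial_at[of y i] partial_at_eq[OF g _ assms(1)] assms(1) by (auto simp: D_def)
  qed
qed

lemma D_pow_reg: "i < r \<Longrightarrow> f \<in> reg X W \<Longrightarrow> (D i ^^ k) f \<in> reg X W"
  by (induction k) (auto intro: D_reg)

context
  fixes i y assumes iy: "i < r" "y \<in> W"
begin

lemma D_facts:
  assumes "f \<in> reg X W" "g \<in> reg X W"
  shows D_plus: "D i (\<lambda>y. f y + g y) y = D i f y + D i g y"
    and D_times: "D i (\<lambda>y. f y * g y) y = f y * D i g y + g y * D i f y"
    and D_eq: "(\<And>z. z \<in> W \<Longrightarrow> f z = g z) \<Longrightarrow> D i f y = D i g y"
proof -
  have t: "coord_field X r x i y \<in> tangent_space X y" using D_tangent iy W(2) by blast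
  have r: "regular_at X y f" "regular_at X y g" using assms W iy by (auto simp: regular_at_def)
  show "D i (\<lambda>y. f y + g y) y = D i f y + D i g y" unfolding D_def by (rule tangent_add[OF t r])
  show "D i (\<lambda>y. f y * g y) y = f y * D i g y + g y * D i f y" unfolding D_def by (rule tangent_mult[OF t r])
  show "(\<And>z. z \<in> W \<Longrightarrow> f z = g z) \<Longrightarrow> D i f y = D i g y" unfolding D_def
    by (rule tangent_germ[OF t W(1) iy(2) assms])
qed

lemma D_constant: "D i (\<lambda>_. c) y = 0"
  unfolding D_def by (rule tangent_const[OF _ D_tangent]) (use iy W openin_subset in blast)+

end

end

text \<open>
  Commutators and \<open>p\<close>-th powers of coordinate fields are derivations; to prove that they are 0 it suffices
  to evaluate them at the coordinates.
\<close>

lemma derivation_eq_zero: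
  assumes y: "y \<in> U"
    and add: "\<And>W f g. openin (topo X) W \<Longrightarrow> y \<in> W \<Longrightarrow> W \<subseteq> U \<Longrightarrow> f \<in> reg X W \<Longrightarrow> g \<in> reg X W \<Longrightarrow>
      T (\<lambda>y. f y + g y) = T f + T g"
    and mult: "\<And>W f g. openin (topo X) W \<Longrightarrow> y \<in> W \<Longrightarrow> W \<subseteq> U \<Longrightarrow> f \<in> reg X W \<Longrightarrow> g \<in> reg X W \<Longrightarrow>
      T (\<lambda>y. f y * g y) = f y * T g + g y * T f"
    and const: "\<And>c. T (\<lambda>_. c) = 0"
    and germ: "\<And>W f g. openin (topo X) W \<Longrightarrow> y \<in> W \<Longrightarrow> W \<subseteq> U \<Longrightarrow> f \<in> reg X W \<Longrightarrow> g \<in> reg X W \<Longrightarrow>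
      (\<And>z. z \<in> W \<Longrightarrow> f z = g z) \<Longrightarrow> T f = T g"
    and coord: "\<And>i. i < r \<Longrightarrow> T (x i) = 0"
    and f: "regular_at X y f"
  shows "T f = 0"
proof -
  let ?v = "\<lambda>f. if regular_at X y f then T f else 0"
  have 1: "?v \<in> tangent_space X y" by (rule tangent_spaceI[where T = T, OF y]) (fact add mult const germ)+
  have 2: "(\<lambda>_. 0) \<in> tangent_space X y" by (simp add: tangent_space_def)
  have "?v = (\<lambda>_. 0)" by (rule tangent_eqI[OF y 1 2]) (use coord in simp)
  from fun_cong[OF this, of f] show ?thesis using f by simp
qed

lemma D_commute:
  assumes "openin (topo X) W" "W \<subseteq> U" "i < r" "l < r" "f \<in> reg X W" "y \<in> W"
  shows "D i (D l f) y = D l (D i f) y"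
proof -
  let ?T = "\<lambda>f. D i (D l f) y - D l (D i f) y"
  have y: "y \<in> U" using assms by blast
  have "?T f = 0"
  proof (rule derivation_eq_zero[OF y, where T = ?T])
    fix W f g assume W: "openin (topo X) W" "y \<in> W" "W \<subseteq> U" "f \<in> reg X W" "g \<in> reg X W"
    note R = D_reg[OF W(1,3)]
    have plus: "D a (D b (\<lambda>y. f y + g y)) y = D a (D b f) y + D a (D b g) y" if "a < r" "b < r" for a b
    proof -
      have "D a (D b (\<lambda>y. f y + g y)) y = D a (\<lambda>y. D b f y + D b g y) y"
        by (rule D_eq[OF W(1,3) that(1) W(2)])
          (use that R reg_add[OF W(1)] W(4,5) D_plus[OF W(1,3) that(2)] in auto)
      then show ?thesis using D_plus[OF W(1,3) that(1) W(2) R[OF that(2) W(4)] R[OF that(2) W(5)]] by simp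
    qed
    then show "?T (\<lambda>y. f y + g y) = ?T f + ?T g" using assms by simp
    have times: "D a (D b (\<lambda>y. f y * g y)) y =
        f y * D a (D b g) y + D b g y * D a f y + (g y * D a (D b f) y + D b f y * D a g y)" if "a < r" "b < r" for a b
    proof -
      have "D a (D b (\<lambda>y. f y * g y)) y = D a (\<lambda>y. f y * D b g y + g y * D b f y) y"
        by (rule D_eq[OF W(1,3) that(1) W(2)])
          (use that R reg_add[OF W(1)] reg_mult[OF W(1)] W(4,5) D_times[OF W(1,3) that(2)] in auto)
      also have "\<dots> = D a (\<lambda>y. f y * D b g y) y + D a (\<lambda>y. g y * D b f y) y"
        by (rule D_plus[OF W(1,3) that(1) W(2)]) (use that R reg_mult[OF W(1)] W(4,5) in auto)
      finally show ?thesis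
        using D_times[OF W(1,3) that(1) W(2) W(4) R[OF that(2) W(5)]] D_times[OF W(1,3) that(1) W(2) W(5) R[OF that(2) W(4)]]
        by simp
    qed
    show "?T (\<lambda>y. f y * g y) = f y * ?T g + g y * ?T f" unfolding times[OF assms(3,4)] times[OF assms(4,3)]
      by (simp add: algebra_simps)
    show "?T f = ?T g" if eq: "\<And>z. z \<in> W \<Longrightarrow> f z = g z"
    proof -
      have "D a (D b f) y = D a (D b g) y" if "a < r" "b < r" for a b
        by (rule D_eq[OF W(1,3) that(1) W(2) R[OF that(2) W(4)] R[OF that(2) W(5)]])
          (rule D_eq[OF W(1,3) that(2) _ W(4,5) eq])
      then show ?thesis using assms by simp
    qed
  next
    have *: "D a (D b g) y = 0" if "a < r" "b < r" "g \<in> reg X U" "\<And>z. z \<in> U \<Longrightarrow> D b g z = c" for a b g c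
      using D_eq[OF openin_U subset_refl that(1) y D_reg[OF openin_U subset_refl that(2,3)] reg_const[OF openin_U], of c]
        that(4) D_constant[OF openin_U subset_refl that(1) y, of c] by auto
    show "?T (\<lambda>_. c) = 0" for c
      using *[OF assms(3,4) reg_const[OF openin_U] D_constant[OF openin_U subset_refl assms(4)]]
        *[OF assms(4,3) reg_const[OF openin_U] D_constant[OF openin_U subset_refl assms(3)]] by simp
    show "?T (x j) = 0" if j: "j < r" for j
      using *[OF assms(3,4) coord_reg[OF j] D_coord[OF _ assms(4) j]]
        *[OF assms(4,3) coord_reg[OF j] D_coord[OF _ assms(3) j]] by simp
    show "regular_at X y f" using assms by (auto simp: regular_at_def)
  qed
  then show ?thesis by simp
qed

lemma D_pow_cong:
  assumes W: "openin (topo X) W" "W \<subseteq> U" and i: "i < r" and fg: "f \<in> reg X W" "g \<in> reg X W"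
    "\<And>z. z \<in> W \<Longrightarrow> f z = g z" and y: "y \<in> W"
  shows "(D i ^^ k) f y = (D i ^^ k) g y"
  using y
proof (induction k arbitrary: y)
  case (Suc k)
  have "D i ((D i ^^ k) f) y = D i ((D i ^^ k) g) y"
    by (rule D_eq[OF W i Suc.prems D_pow_reg[OF W i fg(1)] D_pow_reg[OF W i fg(2)] Suc.IH])
  then show ?case by simp
qed (use fg in simp)

lemma D_pow_add:
  assumes W: "openin (topo X) W" "W \<subseteq> U" and i: "i < r" and fg: "f \<in> reg X W" "g \<in> reg X W" and y: "y \<in> W"
  shows "(D i ^^ k) (\<lambda>y. f y + g y) y = (D i ^^ k) f y + (D i ^^ k) g y"
  using y
proof (induction k arbitrary: y)
  case (Suc k)
  note R = D_pow_reg[OF W i fg(1)] D_pow_reg[OF W i fg(2)]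
  have "D i ((D i ^^ k) (\<lambda>y. f y + g y)) y = D i (\<lambda>y. (D i ^^ k) f y + (D i ^^ k) g y) y"
    by (rule D_eq[OF W i Suc.prems D_pow_reg[OF W i reg_add[OF W(1) fg]] reg_add[OF W(1) R] Suc.IH])
  also have "\<dots> = D i ((D i ^^ k) f) y + D i ((D i ^^ k) g) y" by (rule D_plus[OF W i Suc.prems R])
  finally show ?case by simp
qed simp

lemma D_pow_const:
  assumes i: "i < r" and f: "f \<in> reg X U" "\<And>z. z \<in> U \<Longrightarrow> f z = c" and y: "y \<in> U"
  shows "(D i ^^ Suc k) f y = 0"
proof -
  have zero: "(D i ^^ k) (\<lambda>_. 0) z = 0" if "z \<in> U" for z
    using that
  proof (induction k arbitrary: z)
    case (Suc k)
    have "D i ((D i ^^ k) (\<lambda>_. 0)) z = D i (\<lambda>_. 0) z"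
      by (rule D_eq[OF openin_U subset_refl i Suc.prems D_pow_reg[OF openin_U subset_refl i reg_const[OF openin_U]]
            reg_const[OF openin_U] Suc.IH])
    then show ?case using D_constant[OF openin_U subset_refl i Suc.prems] by simp
  qed simp
  have "D i f z = 0" if "z \<in> U" for z
    using D_eq[OF openin_U subset_refl i that f(1) reg_const[OF openin_U] f(2)]
      D_constant[OF openin_U subset_refl i that] by simp
  then have "(D i ^^ k) (D i f) y = (D i ^^ k) (\<lambda>_. 0) y"
    by (rule D_pow_cong[OF openin_U subset_refl i D_reg[OF openin_U subset_refl i f(1)] reg_const[OF openin_U] _ y])
  then show ?thesis using zero[OF y] by (simp only: funpow_Suc_right comp_def)
qed

text \<open>
  The \<open>p\<close>-th power of a derivation is a derivation in characteristic \<open>p\<close>, and it kills the coordinates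
  because already their second derivatives vanish.
\<close>

lemma D_pow_CHAR:
  assumes p: "prime CHAR('k)" and i: "i < r" and f: "f \<in> reg X U" and y: "y \<in> U"
  shows "(D i ^^ CHAR('k)) f y = 0"
proof -
  obtain p' where p': "CHAR('k) = Suc (Suc p')"
    using prime_ge_2_nat[OF p] by (metis add_2_eq_Suc le_Suc_ex)
  show ?thesis
  proof (rule derivation_eq_zero[OF y, where T = "\<lambda>f. (D i ^^ CHAR('k)) f y"])
    fix W f g assume W: "openin (topo X) W" "y \<in> W" "W \<subseteq> U" "f \<in> reg X W" "g \<in> reg X W"
    show "(D i ^^ CHAR('k)) (\<lambda>y. f y + g y) y = (D i ^^ CHAR('k)) f y + (D i ^^ CHAR('k)) g y"
      by (rule D_pow_add[OF W(1,3) i W(4,5,2)])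
    define E where "E k t j = (D i ^^ k) (\<lambda>y. (D i ^^ t) f y * (D i ^^ j) g y) y" for k t j
    have "E (Suc k) t j = E k (Suc t) j + E k t (Suc j)" for k t j
    proof -
      note R = D_pow_reg[OF W(1,3) i W(4)] D_pow_reg[OF W(1,3) i W(5)]
      have "E (Suc k) t j = (D i ^^ k) (D i (\<lambda>y. (D i ^^ t) f y * (D i ^^ j) g y)) y"
        by (simp only: E_def funpow_Suc_right comp_def)
      also have "\<dots> = (D i ^^ k) (\<lambda>y. (D i ^^ Suc t) f y * (D i ^^ j) g y + (D i ^^ t) f y * (D i ^^ Suc j) g y) y"
      proof (rule D_pow_cong[OF W(1,3) i D_reg[OF W(1,3) i reg_mult[OF W(1) R]] _ _ W(2)])
        show "(\<lambda>y. (D i ^^ Suc t) f y * (D i ^^ j) g y + (D i ^^ t) f y * (D i ^^ Suc j) g y) \<in> reg X W"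
          by (intro reg_add reg_mult R W(1))
        show "D i (\<lambda>y. (D i ^^ t) f y * (D i ^^ j) g y) z =
            (D i ^^ Suc t) f z * (D i ^^ j) g z + (D i ^^ t) f z * (D i ^^ Suc j) g z" if "z \<in> W" for z
          unfolding D_times[OF W(1,3) i that R] by simp
      qed
      also have "\<dots> = E k (Suc t) j + E k t (Suc j)"
        unfolding E_def by (rule D_pow_add[OF W(1,3) i reg_mult[OF W(1) R] reg_mult[OF W(1) R] W(2)])
      finally show ?thesis .
    qed
    from pascal_recursion_prime_char[of E, OF p this]
    show "(D i ^^ CHAR('k)) (\<lambda>y. f y * g y) y = f y * (D i ^^ CHAR('k)) g y + g y * (D i ^^ CHAR('k)) f y"
      by (simp add: E_def algebra_simps)
    show "(D i ^^ CHAR('k)) f y = (D i ^^ CHAR('k)) g y" if "\<And>z. z \<in> W \<Longrightarrow> f z = g z"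
      by (rule D_pow_cong[OF W(1,3) i W(4,5) that W(2)])
  next
    show "(D i ^^ CHAR('k)) (\<lambda>_. c) y = 0" for c
      unfolding p' by (rule D_pow_const[OF i reg_const[OF openin_U] refl y])
    show "(D i ^^ CHAR('k)) (x l) y = 0" if l: "l < r" for l
    proof -
      have "(D i ^^ Suc p') (D i (x l)) y = 0"
        by (rule D_pow_const[OF i D_reg[OF openin_U subset_refl i coord_reg[OF l]] D_coord[OF _ i l] y])
      then show ?thesis unfolding p' by (simp only: funpow_Suc_right comp_def)
    qed
    show "regular_at X y f" using openin_U f y by (auto simp: regular_at_def)
  qed
qed

lemma coord_field_vector_field: "i < r \<Longrightarrow> vector_field_on X U (coord_field X r x i)"
  unfolding vector_field_on_def using D_tangent D_reg unfolding D_def[abs_def] by auto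

lemma coord_fields_commute:
  assumes "i < r" "l < r" "y \<in> U"
  shows "lie_bracket X (coord_field X r x i) (coord_field X r x l) y = (\<lambda>_. 0)"
proof
  fix f
  show "lie_bracket X (coord_field X r x i) (coord_field X r x l) y f = 0"
  proof (cases "regular_at X y f")
    case True
    obtain W where W: "openin (topo X) W" "y \<in> W" "W \<subseteq> U" "f \<in> reg X W" by (rule regular_at_U[OF assms(3) True])
    show ?thesis using D_commute[OF W(1,3) assms(1,2) W(4,2)] unfolding D_def[abs_def] by (simp add: lie_bracket_def)
  qed (simp add: lie_bracket_def)
qed

lemma commuting_derivations:
  assumes p: "prime CHAR('k)"
  shows "commuting_derivations U (reg X U) D r"
proof unfold_locales
  show "prime CHAR('k)" by (rule p)
  note U = openin_U subset_refl
  show "(\<lambda>_. c) \<in> reg X U" for c by (rule reg_const[OF openin_U])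
  show "f \<in> reg X U \<Longrightarrow> g \<in> reg X U \<Longrightarrow> (\<lambda>y. f y + g y) \<in> reg X U" for f g by (rule reg_add[OF openin_U])
  show "f \<in> reg X U \<Longrightarrow> g \<in> reg X U \<Longrightarrow> (\<lambda>y. f y * g y) \<in> reg X U" for f g by (rule reg_mult[OF openin_U])
  show "f \<in> reg X U \<Longrightarrow> (\<And>y. y \<in> U \<Longrightarrow> f y = g y) \<Longrightarrow> g \<in> reg X U" for f g by (rule reg_cong[OF openin_U])
  show "i < r \<Longrightarrow> f \<in> reg X U \<Longrightarrow> D i f \<in> reg X U" for i f by (rule D_reg[OF U])
  show "D i f y = D i g y" if "i < r" "f \<in> reg X U" "\<And>y. y \<in> U \<Longrightarrow> f y = g y" "y \<in> U" for i f g y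
    by (rule D_eq[OF U that(1,4,2) reg_cong[OF openin_U that(2,3)] that(3)])
  show "i < r \<Longrightarrow> f \<in> reg X U \<Longrightarrow> g \<in> reg X U \<Longrightarrow> y \<in> U \<Longrightarrow> D i (\<lambda>y. f y + g y) y = D i f y + D i g y" for i f g y
    by (rule D_plus[OF U])
  show "i < r \<Longrightarrow> f \<in> reg X U \<Longrightarrow> g \<in> reg X U \<Longrightarrow> y \<in> U \<Longrightarrow>
      D i (\<lambda>y. f y * g y) y = f y * D i g y + g y * D i f y" for i f g y
    by (rule D_times[OF U])
  show "i < r \<Longrightarrow> y \<in> U \<Longrightarrow> D i (\<lambda>_. c) y = 0" for i y c by (rule D_constant[OF U])
  show "i < r \<Longrightarrow> f \<in> reg X U \<Longrightarrow> y \<in> U \<Longrightarrow> (D i ^^ CHAR('k)) f y = 0" for i f y by (rule D_pow_CHAR[OF p])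
qed

end

section \<open>Matrices of regular functions\<close>

lemma poly_fun_imp_pfun: "q \<in> poly_fun n \<Longrightarrow> (\<lambda>s. q (vec n s)) \<in> pfun n"
proof (induction rule: poly_fun.induct)
  case (coord i)
  then show ?case using pfun.coord[OF coord] by simp
qed (auto intro: pfun.intros)

lemma matrix_quotient_inverse:
  fixes K K' :: "'k::field mat"
  assumes K: "K \<in> carrier_mat N N" "det K \<noteq> 0" and K': "K' \<in> carrier_mat N N" "det K' \<noteq> 0"
    and G: "G \<in> carrier_mat N N" "K * G = K'" and H: "H \<in> carrier_mat N N" "K' * H = K"
  shows "G * H = 1\<^sub>m N \<and> H * G = 1\<^sub>m N"
proof -
  have cancel: "G * H = 1\<^sub>m N" if K: "K \<in> carrier_mat N N" "det K \<noteq> 0" and G: "G \<in> carrier_mat N N" "K * G = K'"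
    and H: "H \<in> carrier_mat N N" "K' * H = K" for K K' G H :: "'k mat"
  proof -
    obtain J where J: "J \<in> carrier_mat N N" "J * K = 1\<^sub>m N" by (rule mat_inverse_exists[OF K])
    have GH: "G * H \<in> carrier_mat N N" using G H by simp
    have "K * (G * H) = K" using assoc_mult_mat[OF K(1) G(1) H(1)] G(2) H(2) by simp
    then have "J * (K * (G * H)) = 1\<^sub>m N" using J(2) by simp
    then show ?thesis using assoc_mult_mat[OF J(1) K(1) GH] J(2) left_mult_one_mat[OF GH] by simp
  qed
  show ?thesis using cancel[OF K G H] cancel[OF K' H G] by simp
qed

context variety_with_tangents
begin

context
  fixes W and N :: nat assumes W: "openin (topo X) W"
begin

lemma matrix_function_mult:
  assumes "matrix_function_on X N W A" "matrix_function_on X N W B"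
  shows "matrix_function_on X N W (\<lambda>y. A y * B y)"
  unfolding matrix_function_on_def
proof (intro conjI ballI allI impI)
  fix a b assume ab: "a < N" "b < N"
  have "(\<lambda>y. \<Sum>c<N. A y $$ (a, c) * B y $$ (c, b)) \<in> reg X W"
    using assms ab by (intro reg_sum reg_mult W) (auto simp: matrix_function_on_def)
  then show "(\<lambda>y. (A y * B y) $$ (a, b)) \<in> reg X W"
  proof (rule reg_cong[OF W])
    fix y assume "y \<in> W"
    then have "A y \<in> carrier_mat N N" "B y \<in> carrier_mat N N" using assms by (auto simp: matrix_function_on_def)
    then show "(\<Sum>c<N. A y $$ (a, c) * B y $$ (c, b)) = (A y * B y) $$ (a, b)"
      using ab by (simp add: scalar_prod_def atLeast0LessThan)
  qed
qed (use assms in \<open>auto simp: matrix_function_on_def\<close>)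

lemma matrix_function_one: "matrix_function_on X N W (\<lambda>_. 1\<^sub>m N)"
  unfolding matrix_function_on_def by (auto intro: reg_const W)

lemma matrix_function_cong:
  assumes "matrix_function_on X N W A" "\<And>y. y \<in> W \<Longrightarrow> A y = B y"
  shows "matrix_function_on X N W B"
  unfolding matrix_function_on_def
proof (intro conjI ballI allI impI)
  fix a b assume ab: "a < N" "b < N"
  have "(\<lambda>y. A y $$ (a, b)) \<in> reg X W" using assms(1) ab by (auto simp: matrix_function_on_def)
  then show "(\<lambda>y. B y $$ (a, b)) \<in> reg X W" by (rule reg_cong[OF W]) (use assms(2) in simp)
next
  fix y assume "y \<in> W"
  then show "B y \<in> carrier_mat N N" using assms by (auto simp: matrix_function_on_def)
qed

lemma matrix_function_pow:
  assumes "matrix_function_on X N W A"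
  shows "matrix_function_on X N W (\<lambda>y. A y ^\<^sub>m k)"
proof (induction k)
  case 0
  show ?case by (rule matrix_function_cong[OF matrix_function_one]) (use assms in \<open>auto simp: matrix_function_on_def\<close>)
next
  case (Suc k)
  show ?case using matrix_function_mult[OF Suc assms] by simp
qed

lemma matrix_function_smult:
  assumes "c \<in> reg X W" "matrix_function_on X N W A"
  shows "matrix_function_on X N W (\<lambda>y. c y \<cdot>\<^sub>m A y)"
  unfolding matrix_function_on_def
proof (intro conjI ballI allI impI)
  fix a b assume ab: "a < N" "b < N"
  have "(\<lambda>y. c y * A y $$ (a, b)) \<in> reg X W"
    using assms ab by (intro reg_mult W) (auto simp: matrix_function_on_def)
  then show "(\<lambda>y. (c y \<cdot>\<^sub>m A y) $$ (a, b)) \<in> reg X W"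
  proof (rule reg_cong[OF W])
    fix y assume "y \<in> W"
    then have "A y \<in> carrier_mat N N" using assms by (auto simp: matrix_function_on_def)
    then show "c y * A y $$ (a, b) = (c y \<cdot>\<^sub>m A y) $$ (a, b)" using ab by simp
  qed
qed (use assms in \<open>auto simp: matrix_function_on_def\<close>)

lemma matrix_function_lincomb:
  assumes "\<And>j. j < m \<Longrightarrow> matrix_function_on X N W (A j)"
  shows "matrix_function_on X N W (\<lambda>y. mat_lincomb N m c (\<lambda>j. A j y))"
  unfolding matrix_function_on_def
proof (intro conjI ballI allI impI)
  fix a b assume ab: "a < N" "b < N"
  have "(\<lambda>y. \<Sum>j<m. c j * A j y $$ (a, b)) \<in> reg X W"
    using assms ab by (intro reg_sum reg_mult reg_const W) (auto simp: matrix_function_on_def)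
  then show "(\<lambda>y. mat_lincomb N m c (\<lambda>j. A j y) $$ (a, b)) \<in> reg X W" using ab by (simp add: mat_lincomb_def)
qed simp

lemma matrix_function_det:
  assumes "matrix_function_on X N W A"
  shows "(\<lambda>y. det (A y)) \<in> reg X W"
proof -
  have lt: "\<pi> i < N" if "\<pi> permutes {0..<N}" "i < N" for \<pi> i
    using that by (metis atLeastLessThan_iff permutes_in_image zero_le)
  have "(\<lambda>y. \<Sum>\<pi>\<in>{\<pi>. \<pi> permutes {0..<N}}. signof \<pi> * (\<Prod>i\<in>{0..<N}. A y $$ (i, \<pi> i))) \<in> reg X W"
    using assms lt by (intro reg_sum reg_prod reg_mult reg_const W) (auto simp: matrix_function_on_def)
  then show ?thesis
    by (rule reg_cong[OF W]) (use assms in \<open>auto simp: matrix_function_on_def det_def'\<close>)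
qed

lemma matrix_function_krylov:
  assumes "matrix_function_on X N W A"
  shows "matrix_function_on X N W (\<lambda>y. krylov N (A y) w)"
  unfolding matrix_function_on_def
proof (intro conjI ballI allI impI)
  fix a b assume ab: "a < N" "b < N"
  have "(\<lambda>y. (A y ^\<^sub>m a) $$ (c, b)) \<in> reg X W" if "c < N" for c
    using matrix_function_pow[OF assms, of a] ab that by (auto simp: matrix_function_on_def)
  then have "(\<lambda>y. \<Sum>c<N. w $ c * (A y ^\<^sub>m a) $$ (c, b)) \<in> reg X W"
    by (intro reg_sum reg_mult reg_const W) auto
  then show "(\<lambda>y. krylov N (A y) w $$ (a, b)) \<in> reg X W" using ab by (simp add: krylov_def)
qed simp

lemma matrix_function_restrict:
  assumes "matrix_function_on X N W A" "openin (topo X) W'" "W' \<subseteq> W"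
  shows "matrix_function_on X N W' A"
  using assms reg_restrict[OF W assms(2,3)] unfolding matrix_function_on_def by auto

end

lemma matrix_function_adj:
  assumes W: "openin (topo X) W" and A: "matrix_function_on X N W A"
  shows "matrix_function_on X N W (\<lambda>y. adj_mat (A y))"
  unfolding matrix_function_on_def
proof (intro conjI ballI allI impI)
  fix y assume "y \<in> W"
  then have "A y \<in> carrier_mat N N" using A by (auto simp: matrix_function_on_def)
  then show "adj_mat (A y) \<in> carrier_mat N N" by (rule adj_mat)
next
  fix a b assume ab: "a < N" "b < N"
  have "matrix_function_on X (N - 1) W (\<lambda>y. mat_delete (A y) b a)"
    unfolding matrix_function_on_def
  proof (intro conjI ballI allI impI)
    fix y assume "y \<in> W"
    then have "A y \<in> carrier_mat N N" using A by (auto simp: matrix_function_on_def)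
    then show "mat_delete (A y) b a \<in> carrier_mat (N - 1) (N - 1)" by (rule mat_delete_carrier)
  next
    fix i l assume il: "i < N - 1" "l < N - 1"
    let ?i = "if i < b then i else Suc i" and ?l = "if l < a then l else Suc l"
    have "(\<lambda>y. A y $$ (?i, ?l)) \<in> reg X W" using A il by (auto simp: matrix_function_on_def)
    then show "(\<lambda>y. mat_delete (A y) b a $$ (i, l)) \<in> reg X W"
    proof (rule reg_cong[OF W])
      fix y assume "y \<in> W"
      then have "A y \<in> carrier_mat N N" using A by (auto simp: matrix_function_on_def)
      then show "A y $$ (?i, ?l) = mat_delete (A y) b a $$ (i, l)" using il by (simp add: mat_delete_def)
    qed
  qed
  from matrix_function_det[OF W this]
  have "(\<lambda>y. (-1) ^ (b + a) * det (mat_delete (A y) b a)) \<in> reg X W" by (intro reg_mult reg_const W)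
  then show "(\<lambda>y. adj_mat (A y) $$ (a, b)) \<in> reg X W"
  proof (rule reg_cong[OF W])
    fix y assume "y \<in> W"
    then have "A y \<in> carrier_mat N N" using A by (auto simp: matrix_function_on_def)
    then show "(-1) ^ (b + a) * det (mat_delete (A y) b a) = adj_mat (A y) $$ (a, b)"
      using ab by (simp add: adj_mat_def cofactor_def)
  qed
qed

text \<open>
  The vectors \<open>u\<close>, \<open>w\<close>, \<open>w\'\<close> are constant and chosen so that the Krylov matrices \<open>K\<close>, \<open>K\'\<close> of the two pencils are
  invertible at one point.  They are invertible near this point, and \<open>K\<^sup>-\<^sup>1 K\'\<close> conjugates the pencils.
  Adjugates express the inverses through regular functions.
\<close>

theorem isospectral_simple_imp_conjugate:
  assumes U: "openin (topo X) U"
    and L: "\<And>i. i < r \<Longrightarrow> matrix_function_on X N U (L i)" and M: "\<And>i. i < r \<Longrightarrow> matrix_function_on X N U (M i)"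
    and iso: "\<And>y. y \<in> U \<Longrightarrow> isospectral N r (\<lambda>i. L i y) (\<lambda>i. M i y)"
    and simple: "generically_simple_spectrum X N U r M"
  shows "conjugate_over_function_field X N U r L M"
proof -
  obtain W0 where W0: "W0 \<subseteq> U" "openin (topo X) W0" "W0 \<noteq> {}" "\<And>y. y \<in> W0 \<Longrightarrow> simple_spectrum N r (\<lambda>i. M i y)"
    using simple unfolding generically_simple_spectrum_def by blast
  obtain y0 where y0: "y0 \<in> W0" using W0(3) by blast
  obtain u w w' where nz: "det (krylov N (mat_lincomb N r u (\<lambda>i. L i y0)) w) \<noteq> 0"
    "det (krylov N (mat_lincomb N r u (\<lambda>i. M i y0)) w') \<noteq> 0"
    by (rule invertible_krylov_matrices[OF iso W0(4)[OF y0]]) (use y0 W0(1) in auto)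
  define K where "K y = krylov N (mat_lincomb N r u (\<lambda>i. L i y)) w" for y
  define K' where "K' y = krylov N (mat_lincomb N r u (\<lambda>i. M i y)) w'" for y
  have KU: "matrix_function_on X N U K" "matrix_function_on X N U K'"
    unfolding K_def K'_def by (intro matrix_function_krylov matrix_function_lincomb U L M; assumption)+
  have K: "matrix_function_on X N W0 K" "matrix_function_on X N W0 K'"
    using matrix_function_restrict[OF U KU(1) W0(2,1)] matrix_function_restrict[OF U KU(2) W0(2,1)] by auto
  define \<delta> where "\<delta> y = det (K y) * det (K' y)" for y
  have \<delta>: "\<delta> \<in> reg X W0" unfolding \<delta>_def[abs_def]
    by (intro reg_mult W0 matrix_function_det[OF W0(2) K(1)] matrix_function_det[OF W0(2) K(2)])
  define W where "W = {y \<in> W0. \<delta> y \<noteq> 0}"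
  have Wo: "openin (topo X) W" and inv: "(\<lambda>y. inverse (\<delta> y)) \<in> reg X W"
    unfolding W_def using reg_invertible_locus[OF W0(2) \<delta>] by auto
  have W: "W \<subseteq> W0" "W \<noteq> {}" using nz y0 by (auto simp: W_def \<delta>_def K_def K'_def)
  have KW: "matrix_function_on X N W K" "matrix_function_on X N W K'"
    using matrix_function_restrict[OF W0(2) K(1) Wo W(1)] matrix_function_restrict[OF W0(2) K(2) Wo W(1)] by auto
  define Q where "Q A A' y = (inverse (\<delta> y) * det (A' y)) \<cdot>\<^sub>m (adj_mat (A y) * A' y)" for A A' :: "'x \<Rightarrow> 'k mat" and y
  have Q: "matrix_function_on X N W (Q A A')"
    if "matrix_function_on X N W A" "matrix_function_on X N W A'" for A A'
    unfolding Q_def[abs_def]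
    by (rule matrix_function_smult[OF Wo reg_mult[OF Wo inv matrix_function_det[OF Wo that(2)]]
          matrix_function_mult[OF Wo matrix_function_adj[OF Wo that(1)] that(2)]])
  have solve: "A y * Q A A' y = A' y"
    if y: "A y \<in> carrier_mat N N" "A' y \<in> carrier_mat N N" and d: "\<delta> y = det (A y) * det (A' y)" "\<delta> y \<noteq> 0" for A A' y
  proof -
    have adj: "adj_mat (A y) \<in> carrier_mat N N" by (rule adj_mat[OF y(1)])
    have "A y * Q A A' y = (inverse (\<delta> y) * det (A' y)) \<cdot>\<^sub>m (A y * (adj_mat (A y) * A' y))"
      unfolding Q_def by (rule mult_smult_distrib[OF y(1)]) (use adj y in auto)
    also have "A y * (adj_mat (A y) * A' y) = (A y * adj_mat (A y)) * A' y" by (rule assoc_mult_mat[OF y(1) adj y(2), symmetric])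
    also have "\<dots> = det (A y) \<cdot>\<^sub>m A' y"
      unfolding adj_mat(2)[OF y(1)] using mult_smult_assoc_mat[OF one_carrier_mat y(2), of "det (A y)"] y(2) by simp
    finally show ?thesis using d y by (intro eq_matI) (auto simp: field_simps)
  qed
  show ?thesis unfolding conjugate_over_function_field_def
  proof (rule exI[of _ W], rule exI[of _ "Q K K'"], rule exI[of _ "Q K' K"], intro conjI ballI allI impI)
    show "W \<subseteq> U" using W W0 by blast
    show "openin (topo X) W" by (rule Wo)
    show "W \<noteq> {}" by (rule W(2))
    show "matrix_function_on X N W (Q K K')" by (rule Q[OF KW])
    show "matrix_function_on X N W (Q K' K)" by (rule Q[OF KW(2,1)])
    fix y assume y: "y \<in> W"
    then have yW0: "y \<in> W0" and yU: "y \<in> U" using W W0 by auto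
    have c: "K y \<in> carrier_mat N N" "K' y \<in> carrier_mat N N" by (simp_all add: K_def K'_def)
    have d: "\<delta> y \<noteq> 0" "det (K y) \<noteq> 0" "det (K' y) \<noteq> 0" using y by (auto simp: W_def \<delta>_def)
    have G: "Q K K' y \<in> carrier_mat N N" "K y * Q K K' y = K' y"
      using Q[OF KW] y solve[of K y K'] c d \<delta>_def by (auto simp: matrix_function_on_def)
    have H: "Q K' K y \<in> carrier_mat N N" "K' y * Q K' K y = K y"
      using Q[OF KW(2,1)] y solve[of K' y K] c d \<delta>_def by (auto simp: matrix_function_on_def mult.commute)
    have GH: "Q K K' y * Q K' K y = 1\<^sub>m N \<and> Q K' K y * Q K K' y = 1\<^sub>m N"
      by (rule matrix_quotient_inverse[OF c(1) d(2) c(2) d(3) G H])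
    then show "Q K K' y * Q K' K y = 1\<^sub>m N" "Q K' K y * Q K K' y = 1\<^sub>m N" by auto
    fix i assume i: "i < r"
    have Li: "L i y \<in> carrier_mat N N" and Mi: "M i y \<in> carrier_mat N N"
      using L[OF i] M[OF i] yU by (auto simp: matrix_function_on_def)
    define g where "g = Q K K' y"
    have "L i y * g = g * M i y"
      by (rule krylov_matrices_intertwine[OF iso[OF yU] W0(4)[OF yW0] d(2)[unfolded K_def] G(1)[folded g_def]
            G(2)[folded g_def, unfolded K_def K'_def] i])
    then have "L i y * Q K K' y = Q K K' y * M i y" unfolding g_def .
    then have "L i y * Q K K' y * Q K' K y = Q K K' y * M i y * Q K' K y" by simp
    then show "L i y = Q K K' y * M i y * Q K' K y"
      using assoc_mult_mat[OF Li G(1) H(1)] GH Li by simp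
  qed
qed

end

section \<open>Periodic pencils in local coordinates\<close>

lemma isospectral_cong:
  assumes "isospectral N r L M" and eq: "\<And>i. i < r \<Longrightarrow> L i = L' i" "\<And>i. i < r \<Longrightarrow> M i = M' i"
  shows "isospectral N r L' M'"
proof -
  have commuting: "commuting_pencil N r L \<longleftrightarrow> commuting_pencil N r L'"
    and multiplicity: "joint_multiplicity N r L = joint_multiplicity N r L'"
    if eq: "\<And>i. i < r \<Longrightarrow> L i = L' i" for L L' :: "nat \<Rightarrow> 'a mat"
  proof -
    show "commuting_pencil N r L \<longleftrightarrow> commuting_pencil N r L'" by (simp add: commuting_pencil_def eq)
    have "joint_gen_eigenspace N r L = joint_gen_eigenspace N r L'"
      by (rule ext) (simp add: joint_gen_eigenspace_def eq)
    then show "joint_multiplicity N r L = joint_multiplicity N r L'"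
      by (intro ext) (simp only: joint_multiplicity_def)
  qed
  have "commuting_pencil N r L = commuting_pencil N r L'" "joint_multiplicity N r L = joint_multiplicity N r L'"
    by (rule commuting multiplicity, erule eq)+
  moreover have "commuting_pencil N r M = commuting_pencil N r M'" "joint_multiplicity N r M = joint_multiplicity N r M'"
    by (rule commuting multiplicity, erule eq)+
  ultimately show ?thesis using assms(1) by (simp add: isospectral_def)
qed

locale pencil_in_coordinates = coordinate_system X U r x
  for X :: "('x, 'k::alg_closed_field) space_with_functions" and U r x +
  fixes N n :: nat and B :: "nat \<Rightarrow> ('x, 'k) matrix_form" and Bc :: "nat \<Rightarrow> nat \<Rightarrow> 'x \<Rightarrow> 'k mat"
  assumes prime: "prime CHAR('k)"
    and periodic_pencil: "periodic_pencil X N n B"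
    and expansion: "coordinate_expansion X N U r x n B Bc"
begin

sublocale commuting_derivations U "reg X U" D r
  by (rule commuting_derivations[OF prime])

abbreviation entries :: "nat \<Rightarrow> nat \<Rightarrow> nat \<Rightarrow> nat \<Rightarrow> 'x \<Rightarrow> 'k" where
  "entries i j a b y \<equiv> Bc i j y $$ (a, b)"

abbreviation conn :: "nat \<Rightarrow> (nat \<Rightarrow> 'k) \<Rightarrow> nat \<Rightarrow> nat \<Rightarrow> 'x \<Rightarrow> 'k" where
  "conn i s \<equiv> lin_comb n (entries i) s"

lemma coefficient_matrix: "i < r \<Longrightarrow> j < n \<Longrightarrow> is_matrix N (entries i j)"
  using expansion by (auto simp: coordinate_expansion_def matrix_function_on_def is_matrix_def)

lemma conn_matrix: "i < r \<Longrightarrow> is_matrix N (conn i s)"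
  using coefficient_matrix unfolding is_matrix_def lin_comb_def[abs_def]
  by (auto intro!: R_sum R_mult R_const)

lemma connection_form_entry:
  assumes y: "y \<in> U" and i: "i < r" and ab: "a < N" "b < N"
  shows "pencil_form N n B s y (coord_field X r x i y) $$ (a, b) = conn i (\<lambda>j. s $ j) a b y"
proof -
  let ?v = "coord_field X r x i y"
  have v: "?v \<in> tangent_space X y" by (rule D_tangent[OF y i])
  have vx: "?v (x l) = (if l = i then 1 else 0)" if "l < r" for l
    using D_coord[OF y i that] by (simp add: D_def)
  have "B j y ?v $$ (a, b) = Bc i j y $$ (a, b)" if j: "j < n" for j
  proof -
    have "B j y ?v = mat_lincomb N r (\<lambda>i. ?v (x i)) (\<lambda>i. Bc i j y)"
      using expansion y v j unfolding coordinate_expansion_def by blast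
    then have "B j y ?v $$ (a, b) = (\<Sum>l<r. (if l = i then 1 else 0) * Bc l j y $$ (a, b))"
      using ab vx by (simp add: mat_lincomb_def)
    also have "\<dots> = (\<Sum>l<r. if l = i then Bc i j y $$ (a, b) else 0)" by (intro sum.cong) auto
    finally show ?thesis using i by simp
  qed
  then show ?thesis using ab by (simp add: pencil_form_def mat_lincomb_def lin_comb_def)
qed

lemma covariant_derivative_entry:
  assumes y: "y \<in> U" and i: "i < r" and F: "F y \<in> carrier_vec N" and a: "a < N"
  shows "nabla N (pencil_form N n B s) F y (coord_field X r x i y) $ a =
    cov N i (conn i (\<lambda>j. s $ j)) (\<lambda>a y. F y $ a) a y"
proof -
  let ?A = "pencil_form N n B s y (coord_field X r x i y)"
  have A: "?A \<in> carrier_mat N N" by (simp add: pencil_form_def)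
  have "(?A *\<^sub>v F y) $ a = (\<Sum>b<N. conn i (\<lambda>j. s $ j) a b y * F y $ b)"
    unfolding mat_vec_entry[OF A F a] using connection_form_entry[OF y i a] by (intro sum.cong) auto
  moreover have "dim_row ?A = N" using A by simp
  ultimately show ?thesis using a by (simp add: nabla_def cov_def D_def)
qed

lemma nabla_carrier: "nabla N (pencil_form N n B s) F y v \<in> carrier_vec N"
  by (rule carrier_vecI) (simp add: nabla_def pencil_form_def mat_lincomb_def)

lemma iterated_covariant_derivative:
  assumes i: "i < r" and F: "section_on X N U F" and ay: "a < N" "y \<in> U"
  shows "((covariant_derivative N (pencil_form N n B s) (coord_field X r x i) ^^ k) F) y $ a =
    (cov N i (conn i (\<lambda>j. s $ j)) ^^ k) (\<lambda>a y. F y $ a) a y"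
proof -
  let ?cd = "covariant_derivative N (pencil_form N n B s) (coord_field X r x i)"
  let ?M = "conn i (\<lambda>j. s $ j)" and ?F = "\<lambda>a y. F y $ a"
  have Fs: "is_section N ?F" using F by (auto simp: section_on_def is_section_def)
  have carr: "(?cd ^^ k) F z \<in> carrier_vec N" if "z \<in> U" for k z
    using F that by (cases k) (auto simp: section_on_def covariant_derivative_def nabla_carrier)
  have "section_eq N (\<lambda>a y. (?cd ^^ k) F y $ a) ((cov N i ?M ^^ k) ?F)"
  proof (induction k)
    case 0
    show ?case by (simp add: section_eq_refl)
  next
    case (Suc k)
    have 1: "section_eq N (cov N i ?M ((cov N i ?M ^^ k) ?F)) (cov N i ?M (\<lambda>a y. (?cd ^^ k) F y $ a))"
      by (rule cov_cong[OF i conn_matrix[OF i] cov_pow_section[OF i conn_matrix[OF i] Fs] section_eq_sym[OF Suc]])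
    have 2: "section_eq N (\<lambda>a y. (?cd ^^ Suc k) F y $ a) (cov N i ?M (\<lambda>a y. (?cd ^^ k) F y $ a))"
      unfolding section_eq_def
    proof (intro allI impI ballI)
      fix a z assume "a < N" and z: "z \<in> U"
      from covariant_derivative_entry[where F = "(?cd ^^ k) F", OF z i carr[OF z] this(1)]
      show "(?cd ^^ Suc k) F z $ a = cov N i ?M (\<lambda>a y. (?cd ^^ k) F y $ a) a z"
        by (simp add: covariant_derivative_def)
    qed
    show ?case using section_eq_trans[OF 2 section_eq_sym[OF 1]] by (simp only: funpow.simps comp_def)
  qed
  then show ?thesis using ay by (simp add: section_eq_def)
qed

text \<open>
  The Lie bracket of two coordinate fields is 0, so flatness says that covariant derivatives along
  coordinates commute.
\<close>

lemma flat_along_coordinates: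
  assumes il: "i < r" "l < r" and F: "is_section N F"
  shows "section_eq N (cov N i (conn i s) (cov N l (conn l s) F)) (cov N l (conn l s) (cov N i (conn i s) F))"
  unfolding section_eq_def
proof (intro allI impI ballI)
  fix a y assume ay: "a < N" "y \<in> U"
  define Fv where "Fv = (\<lambda>y. vec N (\<lambda>a. F a y))"
  let ?A = "pencil_form N n B (vec n s)"
  let ?cd = "\<lambda>i. covariant_derivative N ?A (coord_field X r x i)"
  have Fv: "section_on X N U Fv" using F by (simp add: section_on_def Fv_def is_section_def)
  have s: "conn i (\<lambda>j. vec n s $ j) = conn i s" for i by (intro ext) (simp add: lin_comb_def)
  have FF: "section_eq N (\<lambda>a y. Fv y $ a) F" by (simp add: section_eq_def Fv_def)
  have two: "?cd i (?cd l Fv) y $ a = cov N i (conn i s) (cov N l (conn l s) F) a y" if il: "i < r" "l < r" for i l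
  proof -
    note M = conn_matrix[OF il(1), of s] and M' = conn_matrix[OF il(2), of s]
    have Fs: "is_section N (\<lambda>a y. Fv y $ a)" using Fv by (auto simp: section_on_def is_section_def)
    have 1: "section_eq N (cov N l (conn l s) F) (\<lambda>a y. ?cd l Fv y $ a)"
    proof (rule section_eq_trans[OF cov_cong[OF il(2) M' F section_eq_sym[OF FF]]])
      show "section_eq N (cov N l (conn l s) (\<lambda>a y. Fv y $ a)) (\<lambda>a y. ?cd l Fv y $ a)"
        unfolding section_eq_def
      proof (intro allI impI ballI)
        fix a y assume "a < N" "y \<in> U"
        then show "cov N l (conn l s) (\<lambda>a y. Fv y $ a) a y = ?cd l Fv y $ a"
          using covariant_derivative_entry[OF _ il(2), of y Fv a "vec n s"] unfolding s
          by (simp add: covariant_derivative_def Fv_def)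
      qed
    qed
    have "section_eq N (cov N i (conn i s) (cov N l (conn l s) F)) (cov N i (conn i s) (\<lambda>a y. ?cd l Fv y $ a))"
      by (rule cov_cong[OF il(1) M cov_section[OF il(2) M' F] 1])
    then have "cov N i (conn i s) (cov N l (conn l s) F) a y = cov N i (conn i s) (\<lambda>a y. ?cd l Fv y $ a) a y"
      using ay by (simp add: section_eq_def)
    also have "\<dots> = ?cd i (?cd l Fv) y $ a"
      using covariant_derivative_entry[OF ay(2) il(1) _ ay(1), of "?cd l Fv" "vec n s"] nabla_carrier unfolding s
      by (simp add: covariant_derivative_def)
    finally show ?thesis ..
  qed
  have flat: "flat X N ?A" using periodic_pencil by (simp add: periodic_pencil_def flat_pencil_def)
  have "?cd i (?cd l Fv) y - ?cd l (?cd i Fv) y =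
      covariant_derivative N ?A (lie_bracket X (coord_field X r x i) (coord_field X r x l)) Fv y"
    by (rule flat[unfolded flat_def, THEN spec, THEN spec, THEN spec, THEN spec, THEN mp,
          OF conjI[OF openin_U conjI[OF coord_field_vector_field[OF il(1)] conjI[OF coord_field_vector_field[OF il(2)] Fv]]],
          THEN bspec, OF ay(2)])
  also have "\<dots> = 0\<^sub>v N"
  proof -
    have z: "(\<lambda>_. 0) \<in> tangent_space X y" by (simp add: tangent_space_def)
    have "B j y (\<lambda>_. 0) = mat_lincomb N r (\<lambda>i. 0) (\<lambda>i. Bc i j y)" if "j < n" for j
      using expansion ay(2) z that unfolding coordinate_expansion_def by blast
    then have "?A y (\<lambda>_. 0) = 0\<^sub>m N N"
      by (intro eq_matI) (auto simp: pencil_form_def mat_lincomb_def)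
    moreover have "Fv y \<in> carrier_vec N" by (simp add: Fv_def)
    ultimately show ?thesis
      unfolding covariant_derivative_def coord_fields_commute[OF il ay(2)] nabla_def by (intro eq_vecI) auto
  qed
  finally have "(?cd i (?cd l Fv) y - ?cd l (?cd i Fv) y) $ a = 0" using ay by simp
  moreover have "dim_vec (?cd l (?cd i Fv) y) = N" using nabla_carrier by (simp add: covariant_derivative_def)
  ultimately have "?cd i (?cd l Fv) y $ a = ?cd l (?cd i Fv) y $ a" using ay by simp
  then show "cov N i (conn i s) (cov N l (conn l s) F) a y = cov N l (conn l s) (cov N i (conn i s) F) a y"
    unfolding two[OF il] two[OF il(2,1)] .
qed

lemma shift_along_coordinates:
  assumes j: "j < n"
  shows "\<exists>q\<in>pfun n. (\<exists>s. q s \<noteq> 0) \<and> (\<forall>s. q s \<noteq> 0 \<longrightarrow> (\<exists>A A'.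
      is_matrix N A \<and> (\<forall>y\<in>U. \<forall>a<N. \<forall>b<N. (\<Sum>c<N. A a c y * A' c b y) = of_bool (a = b)) \<and>
      (\<forall>i<r. \<forall>F. is_section N F \<longrightarrow>
        section_eq N (cov N i (conn i (s(j := s j + 1))) (mat_apply N A F))
          (mat_apply N A (cov N i (conn i s) F)))))"
proof -
  obtain A where "shift_operator X N n B j A" using periodic_pencil j by (auto simp: periodic_pencil_def)
  then obtain q A' where shift: "q \<in> poly_fun n \<and> (\<exists>s\<in>carrier_vec n. q s \<noteq> 0) \<and>
        rational_matrix_family X N n q A \<and> rational_matrix_family X N n q A' \<and>
        (\<forall>s\<in>carrier_vec n. q s \<noteq> 0 \<longrightarrow>
           (\<forall>x\<in>points X. A s x * A' s x = 1\<^sub>m N \<and> A' s x * A s x = 1\<^sub>m N) \<and>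
           (\<forall>W F. openin (topo X) W \<and> section_on X N W F \<longrightarrow>
              (\<forall>x\<in>W. \<forall>v\<in>tangent_space X x.
                 nabla N (pencil_form N n B (s + unit_vec n j)) (\<lambda>y. A s y *\<^sub>v F y) x v
                 = A s x *\<^sub>v nabla N (pencil_form N n B s) F x v)))"
    unfolding shift_operator_def by (elim exE) (rule that)
  note q = shift[THEN conjunct1] and q0 = shift[THEN conjunct2, THEN conjunct1]
    and rat = shift[THEN conjunct2, THEN conjunct2, THEN conjunct1]
      shift[THEN conjunct2, THEN conjunct2, THEN conjunct2, THEN conjunct1]
    and inv = shift[THEN conjunct2, THEN conjunct2, THEN conjunct2, THEN conjunct2]
  obtain s0 where s0: "s0 \<in> carrier_vec n" "q s0 \<noteq> 0" using q0 by blast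
  have pU: "z \<in> points X" if "z \<in> U" for z using openin_subset[OF openin_U] that by blast
  show ?thesis
  proof (intro bexI[of _ "\<lambda>s. q (vec n s)"] conjI allI impI)
    show "(\<lambda>s. q (vec n s)) \<in> pfun n" by (rule poly_fun_imp_pfun[OF q])
    have "vec n (\<lambda>j. s0 $ j) = s0" using s0(1) by auto
    then show "\<exists>s. q (vec n s) \<noteq> 0" using s0(2) by (intro exI[of _ "\<lambda>j. s0 $ j"]) simp
    fix s :: "nat \<Rightarrow> 'k" assume qs: "q (vec n s) \<noteq> 0"
    let ?s = "vec n s"
    have sc: "?s \<in> carrier_vec n" by simp
    have Ac: "A ?s y \<in> carrier_mat N N" "A' ?s y \<in> carrier_mat N N" if "y \<in> points X" for y
      using rat qs sc that unfolding rational_matrix_family_def by blast+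
    have AA: "A ?s y * A' ?s y = 1\<^sub>m N" if "y \<in> points X" for y
      by (rule inv[THEN bspec, OF sc, THEN mp, OF qs, THEN conjunct1, THEN bspec, OF that, THEN conjunct1])
    let ?A = "\<lambda>a b y. A ?s y $$ (a, b)" and ?A' = "\<lambda>a b y. A' ?s y $$ (a, b)"
    have Am: "is_matrix N ?A"
      unfolding is_matrix_def
    proof (intro allI impI)
      fix a b assume ab: "a < N" "b < N"
      then have "rational_family X n q (\<lambda>s x. A s x $$ (a, b))" using rat(1) by (simp add: rational_matrix_family_def)
      then obtain m g f where gf: "\<forall>l<(m::nat). g l \<in> poly_fun n \<and> f l \<in> reg X (points X)"
        "\<forall>s\<in>carrier_vec n. q s \<noteq> 0 \<longrightarrow> (\<forall>x\<in>points X. A s x $$ (a, b) = (\<Sum>l<m. g l s / q s * f l x))"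
        unfolding rational_family_def by (elim exE conjE) (rule that)
      have "(\<lambda>y. \<Sum>l<m. g l ?s / q ?s * f l y) \<in> reg X U"
        using gf(1) reg_restrict[OF openin_topspace openin_U openin_subset[OF openin_U]]
        by (intro reg_sum reg_mult reg_const openin_U) auto
      then show "?A a b \<in> reg X U" by (rule reg_cong[OF openin_U]) (use gf(2) sc qs pU in simp)
    qed
    show "\<exists>A A'. is_matrix N A \<and> (\<forall>y\<in>U. \<forall>a<N. \<forall>b<N. (\<Sum>c<N. A a c y * A' c b y) = of_bool (a = b)) \<and>
      (\<forall>i<r. \<forall>F. is_section N F \<longrightarrow>
        section_eq N (cov N i (conn i (s(j := s j + 1))) (mat_apply N A F))
          (mat_apply N A (cov N i (conn i s) F)))"
    proof (rule exI[of _ ?A], rule exI[of _ ?A'], intro conjI ballI allI impI)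
      show "is_matrix N ?A" by (rule Am)
      fix y a b assume y: "y \<in> U" and ab: "a < N" "b < N"
      have "(\<Sum>c<N. ?A a c y * ?A' c b y) = (A ?s y * A' ?s y) $$ (a, b)"
        using ab Ac[OF pU[OF y]] by (simp add: scalar_prod_def atLeast0LessThan)
      then show "(\<Sum>c<N. ?A a c y * ?A' c b y) = of_bool (a = b)" using AA[OF pU[OF y]] ab by simp
    next
      fix i F assume i: "i < r" and F: "is_section N F"
      show "section_eq N (cov N i (conn i (s(j := s j + 1))) (mat_apply N ?A F)) (mat_apply N ?A (cov N i (conn i s) F))"
        unfolding section_eq_def
      proof (intro allI impI ballI)
        fix a y assume a: "a < N" and y: "y \<in> U"
        define Fv where "Fv = (\<lambda>y. vec N (\<lambda>a. F a y))"
        have Fv: "section_on X N U Fv" using F by (simp add: section_on_def Fv_def is_section_def)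
        have Fc: "Fv z \<in> carrier_vec N" for z by (simp add: Fv_def)
        let ?v = "coord_field X r x i y"
        let ?AF = "\<lambda>y. A ?s y *\<^sub>v Fv y"
        have AFe: "?AF z $ a = mat_apply N ?A F a z" if "a < N" "z \<in> U" for a z
          unfolding mat_vec_entry[OF Ac(1)[OF pU[OF that(2)]] Fc that(1)] by (simp add: mat_apply_def Fv_def)
        have c1: "conn i (\<lambda>l. (?s + unit_vec n j) $ l) = conn i (s(j := s j + 1))"
          by (intro ext) (auto simp: lin_comb_def unit_vec_def intro!: sum.cong)
        have c2: "conn i (\<lambda>l. ?s $ l) = conn i s" by (intro ext) (simp add: lin_comb_def)
        have AFs: "is_section N (mat_apply N ?A F)" by (rule mat_apply_section[OF Am F])
        have eqn: "nabla N (pencil_form N n B (?s + unit_vec n j)) ?AF y ?v =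
            A ?s y *\<^sub>v nabla N (pencil_form N n B ?s) Fv y ?v"
          by (rule inv[THEN bspec, OF sc, THEN mp, OF qs, THEN conjunct2, THEN spec, THEN spec, THEN mp, OF conjI,
                OF openin_U Fv, THEN bspec, OF y, THEN bspec, OF D_tangent[OF y i]])
        have "section_eq N (cov N i (conn i (s(j := s j + 1))) (mat_apply N ?A F))
            (cov N i (conn i (s(j := s j + 1))) (\<lambda>a y. ?AF y $ a))"
          by (rule cov_cong[OF i conn_matrix[OF i] AFs]) (use AFe in \<open>simp add: section_eq_def\<close>)
        then have "cov N i (conn i (s(j := s j + 1))) (mat_apply N ?A F) a y =
            cov N i (conn i (s(j := s j + 1))) (\<lambda>a y. ?AF y $ a) a y" using a y unfolding section_eq_def by blast
        also have "\<dots> = nabla N (pencil_form N n B (?s + unit_vec n j)) ?AF y ?v $ a"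
          using covariant_derivative_entry[OF y i _ a, of ?AF "?s + unit_vec n j"] mult_mat_vec_carrier[OF Ac(1)[OF pU[OF y]] Fc]
          unfolding c1 by simp
        also have "\<dots> = (\<Sum>b<N. ?A a b y * nabla N (pencil_form N n B ?s) Fv y ?v $ b)"
          unfolding eqn by (rule mat_vec_entry[OF Ac(1)[OF pU[OF y]] nabla_carrier a])
        also have "\<dots> = (\<Sum>b<N. ?A a b y * cov N i (conn i s) F b y)"
        proof (intro sum.cong refl)
          fix b assume "b \<in> {..<N}"
          then have b: "b < N" by simp
          have FF: "section_eq N F (\<lambda>a y. Fv y $ a)" by (simp add: section_eq_def Fv_def)
          have "cov N i (conn i s) F b y = cov N i (conn i s) (\<lambda>a y. Fv y $ a) b y"
            using cov_cong[OF i conn_matrix[OF i] F FF] b y unfolding section_eq_def by blast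
          then show "?A a b y * nabla N (pencil_form N n B ?s) Fv y ?v $ b = ?A a b y * cov N i (conn i s) F b y"
            using covariant_derivative_entry[OF y i Fc b, of ?s] unfolding c2 by simp
        qed
        finally show "cov N i (conn i (s(j := s j + 1))) (mat_apply N ?A F) a y = mat_apply N ?A (cov N i (conn i s) F) a y"
          by (simp add: mat_apply_def)
      qed
    qed
  qed
qed

sublocale flat_periodic_pencil U "reg X U" D r N n entries
proof unfold_locales
  show "is_matrix N (entries i j)" if "i < r" "j < n" for i j by (rule coefficient_matrix[OF that])
  show "section_eq N (cov N i (conn i s) (cov N l (conn l s) F)) (cov N l (conn l s) (cov N i (conn i s) F))"
    if "i < r" "l < r" "is_section N F" for i l F s by (rule flat_along_coordinates[OF that])
  show "\<exists>q\<in>pfun n. (\<exists>s. q s \<noteq> 0) \<and> (\<forall>s. q s \<noteq> 0 \<longrightarrow> (\<exists>A A'.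
      is_matrix N A \<and> (\<forall>y\<in>U. \<forall>a<N. \<forall>b<N. (\<Sum>c<N. A a c y * A' c b y) = of_bool (a = b)) \<and>
      (\<forall>i<r. \<forall>F. is_section N F \<longrightarrow>
        section_eq N (cov N i (conn i (s(j := s j + 1))) (mat_apply N A F))
          (mat_apply N A (cov N i (conn i s) F)))))" if "j < n" for j by (rule shift_along_coordinates[OF that])
qed

lemma p_curvature_eq:
  assumes y: "y \<in> U" and i: "i < r"
  shows "p_curvature X N r x (pencil_form N n B s) i y = curv_mat (\<lambda>j. s $ j) y i"
proof (rule eq_matI)
  fix a b assume "a < dim_row (curv_mat (\<lambda>j. s $ j) y i)" "b < dim_col (curv_mat (\<lambda>j. s $ j) y i)"
  then have ab: "a < N" "b < N" by (auto simp: curv_mat_def)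
  let ?M = "conn i (\<lambda>j. s $ j)"
  have sec: "section_on X N U (\<lambda>_. unit_vec N b)"
    unfolding section_on_def using reg_const[OF openin_U] by auto
  have "((covariant_derivative N (pencil_form N n B s) (coord_field X r x i) ^^ CHAR('k)) (\<lambda>_. unit_vec N b)) y $ a =
      (cov N i ?M ^^ CHAR('k)) (\<lambda>a y. unit_vec N b $ a) a y"
    by (rule iterated_covariant_derivative[OF i sec ab(1) y])
  also have "\<dots> = (cov N i ?M ^^ CHAR('k)) (unit_section b) a y"
  proof -
    have e: "section_eq N (unit_section b) (\<lambda>a y. unit_vec N b $ a)"
      by (simp add: section_eq_def unit_section_def ab)
    show ?thesis
      using cov_pow_cong[OF i conn_matrix[OF i] unit_section e] ab y unfolding section_eq_def by simp
  qed
  finally show "p_curvature X N r x (pencil_form N n B s) i y $$ (a, b) = curv_mat (\<lambda>j. s $ j) y i $$ (a, b)"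
    using ab by (simp add: p_curvature_def curv_mat_def curv_def[OF i conn_matrix[OF i]])
qed (simp_all add: p_curvature_def curv_mat_def)

lemma coefficient_carrier: "i < r \<Longrightarrow> j < n \<Longrightarrow> y \<in> U \<Longrightarrow> Bc i j y \<in> carrier_mat N N"
  using expansion by (auto simp: coordinate_expansion_def matrix_function_on_def)

lemma twisted_pencil_eq:
  assumes y: "y \<in> U" and i: "i < r"
  shows "twisted_pencil N n Bc s i y = twisted_mat (\<lambda>j. s $ j) y i"
proof (rule eq_matI)
  fix a b assume "a < dim_row (twisted_mat (\<lambda>j. s $ j) y i)" "b < dim_col (twisted_mat (\<lambda>j. s $ j) y i)"
  then have ab: "a < N" "b < N" by (auto simp: twisted_mat_def)
  have "frobenius_twist (Bc i j y) $$ (a, b) = Bc i j y $$ (a, b) ^ CHAR('k)" if "j < n" for j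
    using ab coefficient_carrier[OF i that y] by (simp add: frobenius_twist_def)
  then show "twisted_pencil N n Bc s i y $$ (a, b) = twisted_mat (\<lambda>j. s $ j) y i $$ (a, b)"
    using ab by (simp add: twisted_pencil_def twisted_mat_def mat_lincomb_def)
qed (simp_all add: twisted_pencil_def twisted_mat_def mat_lincomb_def)

lemma isospectral_p_curvature:
  assumes y: "y \<in> U"
  shows "isospectral N r (\<lambda>i. p_curvature X N r x (pencil_form N n B s) i y) (\<lambda>i. twisted_pencil N n Bc s i y)"
  by (rule isospectral_cong[OF isospectral_curv_twisted[OF y, of "\<lambda>j. s $ j"]])
    (simp_all add: p_curvature_eq[OF y] twisted_pencil_eq[OF y])

lemma nilpotent_p_curvature:
  fixes s :: "'k vec"
  assumes "y \<in> U" "i < r" "\<And>j. j < n \<Longrightarrow> s $ j \<in> range (of_int :: int \<Rightarrow> 'k)"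
  shows "p_curvature X N r x (pencil_form N n B s) i y ^\<^sub>m N = 0\<^sub>m N N"
  unfolding p_curvature_eq[OF assms(1,2)] by (rule nilpotent_curv[OF assms])

lemma conjugate_p_curvature:
  assumes "generically_simple_spectrum X N U r (twisted_pencil N n Bc s)"
  shows "conjugate_over_function_field X N U r (p_curvature X N r x (pencil_form N n B s)) (twisted_pencil N n Bc s)"
proof (rule isospectral_simple_imp_conjugate[OF openin_U])
  show "isospectral N r (\<lambda>i. p_curvature X N r x (pencil_form N n B s) i y) (\<lambda>i. twisted_pencil N n Bc s i y)"
    if "y \<in> U" for y by (rule isospectral_p_curvature[OF that])
  show "generically_simple_spectrum X N U r (twisted_pencil N n Bc s)" by (rule assms)
  fix i assume i: "i < r"
  have "matrix_function_on X N U (\<lambda>y. curv_mat (\<lambda>j. s $ j) y i)"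
    using curv_R[OF i conn_matrix[OF i]] by (auto simp: matrix_function_on_def curv_mat_def is_matrix_def)
  then show "matrix_function_on X N U (p_curvature X N r x (pencil_form N n B s) i)"
    by (rule matrix_function_cong[OF openin_U]) (simp add: p_curvature_eq i)
  have "matrix_function_on X N U (\<lambda>y. twisted_mat (\<lambda>j. s $ j) y i)"
    using coefficient_matrix[OF i]
    by (auto simp: matrix_function_on_def twisted_mat_def is_matrix_def intro!: R_sum R_mult R_const R_power)
  then show "matrix_function_on X N U (twisted_pencil N n Bc s i)"
    by (rule matrix_function_cong[OF openin_U]) (simp add: twisted_pencil_eq i)
qed

end

section \<open>Empty pencils and nonzero tangent vectors\<close>

lemma isospectral_empty_pencil: "isospectral N 0 L M"
  by (simp add: isospectral_def commuting_pencil_def joint_multiplicity_def joint_gen_eigenspace_def)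

context algebraic_variety
begin

lemma conjugate_empty_pencil:
  assumes "generically_simple_spectrum X N U 0 M"
  shows "conjugate_over_function_field X N U 0 L M"
proof -
  obtain W where W: "W \<subseteq> U" "openin (topo X) W" "W \<noteq> {}" using assms by (auto simp: generically_simple_spectrum_def)
  have "matrix_function_on X N W (\<lambda>_. 1\<^sub>m N)" using reg_const[OF W(2)] by (auto simp: matrix_function_on_def)
  then show ?thesis unfolding conjugate_over_function_field_def
    using W by (intro exI[of _ W] exI[of _ "\<lambda>_. 1\<^sub>m N"]) auto
qed

text \<open>
  As the \<open>dx\<^sub>i\<close> are independent, \<open>\<Sum>\<^sub>i dx\<^sub>i\<close> does not vanish on all of \<open>U\<close>.  So some tangent space is nonzero,
  and all of them have the same dimension.
\<close>

lemma nonzero_tangent_vectors: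
  assumes dim: "\<And>y. y \<in> points X \<Longrightarrow> tangent_space_dim X y d"
    and coords: "local_coordinates X U r x" and r: "r > 0" and U: "U \<noteq> {}"
    and z: "z \<in> points X"
  shows "\<exists>v\<in>tangent_space X z. \<exists>w. v w \<noteq> 0"
proof -
  have Uo: "openin (topo X) U" using coords by (simp add: local_coordinates_def)
  obtain y v where y: "y \<in> U" "v \<in> tangent_space X y" and nz: "(\<Sum>i<r. 1 * v (x i)) \<noteq> 0"
  proof (rule ccontr)
    assume none: "\<not> thesis"
    have "\<forall>i<r. \<forall>y\<in>U. (\<lambda>_ _. 1 :: 'k) i y = 0"
      by (rule coords[unfolded local_coordinates_def, THEN conjunct2, THEN conjunct2, THEN spec[of _ U], THEN mp, OF subset_refl,
            THEN mp, OF Uo, THEN conjunct2, THEN spec, THEN mp]) (use none that reg_const[OF Uo] in blast)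
    then show False using r U by auto
  qed
  have "d \<noteq> 0"
  proof
    assume "d = 0"
    have "y \<in> points X" using y(1) openin_subset[OF Uo] by blast
    from dim[OF this] obtain e where "\<exists>!c. c \<in> carrier_vec d \<and> v = (\<lambda>f. \<Sum>l<d. c $ l * e l f)"
      unfolding tangent_space_dim_def using y(2) by blast
    then have "v = (\<lambda>_. 0)" using \<open>d = 0\<close> by auto
    then show False using nz by simp
  qed
  obtain e where e: "\<forall>l<d. e l \<in> tangent_space X z"
    and uniq: "\<forall>v\<in>tangent_space X z. \<exists>!c. c \<in> carrier_vec d \<and> v = (\<lambda>f. \<Sum>l<d. c $ l * e l f)"
    using dim[OF z] unfolding tangent_space_dim_def by blast
  have "\<exists>w. e 0 w \<noteq> 0"
  proof (rule ccontr)
    assume none: "\<not> (\<exists>w. e 0 w \<noteq> 0)"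
    have "(\<lambda>_. 0) \<in> tangent_space X z" by (simp add: tangent_space_def)
    with uniq have ex1: "\<exists>!c. c \<in> carrier_vec d \<and> (\<lambda>_. 0) = (\<lambda>f. \<Sum>l<d. c $ l * e l f)" by blast
    have "(\<Sum>l<d. (unit_vec d 0 :: 'k vec) $ l * e l f) = 0" for f
      by (rule sum.neutral) (use none in \<open>auto simp: unit_vec_def\<close>)
    then have "unit_vec d 0 \<in> carrier_vec d \<and> (\<lambda>_. 0) = (\<lambda>f. \<Sum>l<d. (unit_vec d 0 :: 'k vec) $ l * e l f)" by simp
    moreover have "(0\<^sub>v d :: 'k vec) \<in> carrier_vec d \<and> (\<lambda>_. 0) = (\<lambda>f. \<Sum>l<d. (0\<^sub>v d :: 'k vec) $ l * e l f)" by simp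
    ultimately have "unit_vec d 0 = (0\<^sub>v d :: 'k vec)" using ex1 by blast
    then have "(unit_vec d 0 :: 'k vec) $ 0 = 0\<^sub>v d $ 0" by simp
    then show False using \<open>d \<noteq> 0\<close> by simp
  qed
  then show ?thesis using e \<open>d \<noteq> 0\<close> by blast
qed

end

theorem theorem3p3:
  fixes X :: "('x, 'k::alg_closed_field) space_with_functions"
    and N n r :: nat
    and B :: "nat \<Rightarrow> ('x, 'k) matrix_form"
    and U :: "'x set"
    and x :: "nat \<Rightarrow> 'x \<Rightarrow> 'k"
    and Bc :: "nat \<Rightarrow> nat \<Rightarrow> 'x \<Rightarrow> 'k mat"
  defines "C \<equiv> \<lambda>s. p_curvature X N r x (pencil_form N n B s)"
    and "BB \<equiv> \<lambda>s. twisted_pencil N n Bc s"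
  assumes char: "CHAR('k) > 0"
    and X: "smooth_irreducible_variety X"
    and B: "periodic_pencil X N n B"
    and U: "openin (topo X) U" "(topo X) closure_of U = points X"
    and x: "local_coordinates X U r x"
    and Bc: "coordinate_expansion X N U r x n B Bc"
  shows "(\<forall>s\<in>carrier_vec n. \<forall>y\<in>U. isospectral N r (\<lambda>i. C s i y) (\<lambda>i. BB s i y)) \<and>
    (\<forall>s\<in>carrier_vec n. (\<forall>j<n. s $ j \<in> range (of_int :: int \<Rightarrow> 'k)) \<longrightarrow>
       (\<forall>i<r. \<exists>m. \<forall>y\<in>U. C s i y ^\<^sub>m m = 0\<^sub>m N N)) \<and>
    (\<forall>s\<in>carrier_vec n. generically_simple_spectrum X N U r (BB s) \<longrightarrow>
       conjugate_over_function_field X N U r (C s) (BB s))"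
proof -
  from X have v: "variety X" and irr: "points X \<noteq> {}"
    by (auto simp: smooth_irreducible_variety_def irreducible_in_def)
  interpret algebraic_variety X by unfold_locales (rule v)
  show ?thesis
  \<comment> \<open>Tangent spaces may be 0 if there are no coordinates; then there is nothing to conjugate.\<close>
  proof (cases "r = 0")
    case True
    show ?thesis unfolding C_def BB_def True
      by (intro conjI ballI allI impI isospectral_empty_pencil conjugate_empty_pencil) simp_all
  next
    case False
    then have r: "r > 0" by simp
    obtain d where d: "\<forall>y\<in>points X. tangent_space_dim X y d" using X by (auto simp: smooth_irreducible_variety_def)
    have "U \<noteq> {}"
    proof
      assume "U = {}"
      then have "points X = {}" using U(2) by simp
      with irr show False by contradiction
    qed
    interpret pencil_in_coordinates X U r x N n B Bc
    proof unfold_locales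
      show "\<exists>v\<in>tangent_space X z. \<exists>w. v w \<noteq> 0" if "z \<in> points X" for z
        by (rule nonzero_tangent_vectors[OF _ x r \<open>U \<noteq> {}\<close> that]) (use d in blast)
      show "local_coordinates X U r x" by (rule x)
      show "prime CHAR('k)" by (rule prime_CHAR_semidom[OF char])
      show "periodic_pencil X N n B" by (rule B)
      show "coordinate_expansion X N U r x n B Bc" by (rule Bc)
    qed
    show ?thesis unfolding C_def BB_def
      by (intro conjI ballI allI impI exI[of _ N] isospectral_p_curvature nilpotent_p_curvature conjugate_p_curvature) auto
  qed
qed

end
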